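(* Let $\Omega\subset\mathbb{R}^n$ be a bounded connected domain with smooth boundary, let $\eta\in C^2(\mathbb{R}^n)$ be real-valued, let $T$ be a symmetric positive definite $(1,1)$-tensor on $\mathbb{R}^n$, let $\varepsilon,\delta>0$ satisfy $\varepsilon I\le T\le\delta I$ on $\Omega$, and let $\alpha\ge 0$ be a constant. Let $0<\sigma_1\le\sigma_2\le\cdots\to\infty$ be the eigenvalues, repeated according to multiplicity, of the problem $\mathscr{L}\mathbf{u}+\alpha\nabla(\mathrm{div}_\eta\mathbf{u})=-\sigma\mathbf{u}$ in $\Omega$, $\mathbf{u}=0$ on $\partial\Omega$, for vector-valued functions $\mathbf{u}:\Omega\to\mathbb{R}^n$, and let $\mathbf{u}_i$ be a normalized eigenfunction corresponding to $\sigma_i$, the $\mathbf{u}_i$ being chosen orthonormal: $\int_\Omega\mathbf{u}_i\cdot\mathbf{u}_j\,dm=\delta_{ij}$ (Kronecker delta). For a positive integer $k$ put $$D_0=-\alpha\min_{j=1,\dots,k}\|\mathrm{div}_\eta\mathbf{u}_j\|^2+\frac{T_0^2+4C_0}{4\delta},$$ where $$C_0=\sup_\Omega\Big\{\frac12\,\mathrm{div}\Big(T\big(T(\nabla\eta)-\mathrm{tr}(\nabla T)\big)\Big)-\frac14|T(\nabla\eta)|^2\Big\},\qquad T_0=\sup_\Omega|\mathrm{tr}(\nabla T)|.$$ Then $$\sum_{i=1}^k(\sigma_{k+1}-\sigma_i)^2\le\frac{4\delta(n\delta+\alpha)}{n^2\varepsilon^2}\sum_{i=1}^k(\sigma_{k+1}-\sigma_i)(\sigma_i+D_0),$$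 and consequently $$\sigma_{k+1}+D_0\le\Big(1+\frac{2\delta(n\delta+\alpha)}{\varepsilon^2n^2}\Big)\frac1k\sum_{i=1}^k(\sigma_i+D_0)+\Big[\Big(\frac{2\delta(n\delta+\alpha)}{\varepsilon^2n^2}\frac1k\sum_{i=1}^k(\sigma_i+D_0)\Big)^2-\Big(1+\frac{4\delta(n\delta+\alpha)}{\varepsilon^2n^2}\Big)\frac1k\sum_{j=1}^k\Big(\sigma_j-\frac1k\sum_{i=1}^k\sigma_i\Big)^2\Big]^{\frac12}$$ and $$\sigma_{k+1}-\sigma_k\le2\Big[\Big(\frac{2\delta(n\delta+\alpha)}{\varepsilon^2n^2}\frac1k\sum_{i=1}^k(\sigma_i+D_0)\Big)^2-\Big(1+\frac{4\delta(n\delta+\alpha)}{\varepsilon^2n^2}\Big)\frac1k\sum_{j=1}^k\Big(\sigma_j-\frac1k\sum_{i=1}^k\sigma_i\Big)^2\Big]^{\frac12}.$$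
   Context: $\mathbb{R}^n$ carries its canonical metric; tensor fields are smooth, and $I$ is the identity $(1,1)$-tensor. For a vector field $X$, $\mathrm{div}_\eta X=\mathrm{div}X-\langle\nabla\eta,X\rangle$. For a real-valued function $f$, $\mathscr{L}f=\mathrm{div}_\eta(T(\nabla f))=\mathrm{div}(T(\nabla f))-\langle\nabla\eta,T(\nabla f)\rangle$. For $\mathbf{u}=(u^1,\dots,u^n):\Omega\to\mathbb{R}^n$, $\mathscr{L}\mathbf{u}=(\mathscr{L}u^1,\dots,\mathscr{L}u^n)$, and $\mathrm{div}_\eta\mathbf{u}$ is computed regarding $\mathbf{u}$ as a vector field. The measure is $dm=e^{-\eta}d\Omega$, with $d\Omega$ the Lebesgue measure; $\|f\|^2=\int_\Omega f^2\,dm$ for real-valued $f$, and $\|\mathbf{u}\|^2=\int_\Omega|\mathbf{u}|^2\,dm$; normalized means $\|\mathbf{u}_i\|=1$. The vector field $\mathrm{tr}(\nabla T)$ is $\sum_{j}(\nabla_{e_j}T)(e_j)$ for a local orthonormal frame $\{e_j\}$. The operator $\mathscr{L}+\alpha\nabla\mathrm{div}_\eta$ with the Dirichlet condition is formally self-adjoint in the space of vector-valued $L^2(\Omega,dm)$ functions vanishing on $\partial\Omega$ in the trace sense, and its spectrum is real and discrete. *)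

theory Defs
  imports "HOL-Analysis.Analysis"
begin

section \<open>Smoothness and domains\<close>

text \<open>\<open>C_k k f S\<close> is meant for open \<open>S\<close>. Having directional derivatives of class \<open>C^k\<close> in
  every fixed direction is, in finite dimension, the same as the Frechet derivative being
  of class \<open>C^k\<close>.\<close>

primrec C_k :: "nat \<Rightarrow> ('a::euclidean_space \<Rightarrow> 'b::real_normed_vector) \<Rightarrow> 'a set \<Rightarrow> bool" where
  "C_k 0 f S \<longleftrightarrow> continuous_on S f"
| "C_k (Suc k) f S \<longleftrightarrow>
     (\<forall>x\<in>S. f differentiable (at x)) \<and> (\<forall>v. C_k k (\<lambda>x. frechet_derivative f (at x) v) S)"

definition smooth_on :: "('a::euclidean_space \<Rightarrow> 'b::real_normed_vector) \<Rightarrow> 'a set \<Rightarrow> bool" where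
  "smooth_on f S \<longleftrightarrow> (\<forall>k. C_k k f S)"

text \<open>Classical gradient, divergence and \<open>tr(\<nabla>T)\<close> in Cartesian coordinates. A \<open>(1,1)\<close>-tensor
  field is a matrix field \<open>T\<close>, and \<open>T(X)\<close> is \<open>\<lambda>x. T x *v X x\<close>. For constant frames the
  covariant derivative of \<open>T\<close> is the ordinary directional derivative of its matrix.\<close>

definition grad :: "(real^'n \<Rightarrow> real) \<Rightarrow> real^'n \<Rightarrow> real^'n" where
  "grad f x = (\<chi> i. frechet_derivative f (at x) (axis i 1))"

definition divergence :: "(real^'n \<Rightarrow> real^'n) \<Rightarrow> real^'n \<Rightarrow> real" where
  "divergence X x = (\<Sum>i\<in>UNIV. frechet_derivative X (at x) (axis i 1) $ i)"

definition tr_nabla :: "(real^'n \<Rightarrow> real^'n^'n) \<Rightarrow> real^'n \<Rightarrow> real^'n" where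
  "tr_nabla T x = (\<Sum>j\<in>UNIV. frechet_derivative T (at x) (axis j 1) *v axis j 1)"

text \<open>Near each boundary point, the domain is a strict sublevel set of a smooth function
  without critical points.\<close>

definition smooth_boundary :: "(real^'n) set \<Rightarrow> bool" where
  "smooth_boundary \<Omega> \<longleftrightarrow>
     (\<forall>p\<in>frontier \<Omega>. \<exists>U \<rho>. open U \<and> p \<in> U \<and> smooth_on \<rho> U \<and> (\<forall>x\<in>U. grad \<rho> x \<noteq> 0) \<and>
        \<Omega> \<inter> U = {x\<in>U. \<rho> x < 0} \<and> frontier \<Omega> \<inter> U = {x\<in>U. \<rho> x = 0})"

definition smooth_bounded_domain :: "(real^'n) set \<Rightarrow> bool" where
  "smooth_bounded_domain \<Omega> \<longleftrightarrow>
     \<Omega> \<noteq> {} \<and> open \<Omega> \<and> connected \<Omega> \<and> bounded \<Omega> \<and> smooth_boundary \<Omega>"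

definition sym_pos_def_tensor :: "(real^'n \<Rightarrow> real^'n^'n) \<Rightarrow> bool" where
  "sym_pos_def_tensor T \<longleftrightarrow>
     smooth_on T UNIV \<and> (\<forall>x. transpose (T x) = T x) \<and> (\<forall>x v. v \<noteq> 0 \<longrightarrow> (T x *v v) \<bullet> v > 0)"

section \<open>The space \<open>H^1_0\<close>\<close>

definition test_functions :: "(real^'n) set \<Rightarrow> (real^'n \<Rightarrow> real) set" where
  "test_functions \<Omega> =
     {\<phi>. smooth_on \<phi> UNIV \<and> (\<exists>K. compact K \<and> K \<subseteq> \<Omega> \<and> (\<forall>x. x \<notin> K \<longrightarrow> \<phi> x = 0))}"

definition square_integrable ::
    "(real^'n) set \<Rightarrow> (real^'n \<Rightarrow> 'b::{second_countable_topology,real_normed_vector}) \<Rightarrow> bool" where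
  "square_integrable \<Omega> f \<longleftrightarrow>
     f \<in> borel_measurable (lebesgue_on \<Omega>) \<and> integrable (lebesgue_on \<Omega>) (\<lambda>x. (norm (f x))\<^sup>2)"

definition has_weak_grad ::
    "(real^'n) set \<Rightarrow> (real^'n \<Rightarrow> real) \<Rightarrow> (real^'n \<Rightarrow> real^'n) \<Rightarrow> bool" where
  "has_weak_grad \<Omega> f g \<longleftrightarrow> square_integrable \<Omega> f \<and> square_integrable \<Omega> g \<and>
     (\<forall>\<phi>\<in>test_functions \<Omega>. \<forall>i. (LINT x|lebesgue_on \<Omega>. f x * grad \<phi> x $ i)
                               = - (LINT x|lebesgue_on \<Omega>. g x $ i * \<phi> x))"

text \<open>A representative; the weak gradient is unique only almost everywhere in \<open>\<Omega>\<close>, so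
  \<open>weak_grad\<close> may only be used under integrals over \<open>\<Omega>\<close>.\<close>

definition weak_grad :: "(real^'n) set \<Rightarrow> (real^'n \<Rightarrow> real) \<Rightarrow> real^'n \<Rightarrow> real^'n" where
  "weak_grad \<Omega> f = (SOME g. has_weak_grad \<Omega> f g)"

text \<open>The functions of \<open>H^1(\<Omega>)\<close> that vanish on the boundary in the trace sense, as the closure of
  the test functions in the \<open>H^1\<close>-norm. The Lebesgue measure may be used here in place of
  \<open>e^{-\<eta>} d\<Omega>\<close>: for continuous \<open>\<eta>\<close> and bounded \<open>\<Omega>\<close> the two norms are equivalent.\<close>

definition H1_0 :: "(real^'n) set \<Rightarrow> (real^'n \<Rightarrow> real) set" where
  "H1_0 \<Omega> = {f. (\<exists>g. has_weak_grad \<Omega> f g) \<and>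
     (\<exists>\<phi>. (\<forall>m. \<phi> m \<in> test_functions \<Omega>) \<and>
        (\<lambda>m::nat. LINT x|lebesgue_on \<Omega>.
            (\<phi> m x - f x)\<^sup>2 + (norm (grad (\<phi> m) x - weak_grad \<Omega> f x))\<^sup>2) \<longlonglongrightarrow> 0)}"

section \<open>The weighted measure and the operators\<close>

definition weighted_measure :: "(real^'n) set \<Rightarrow> (real^'n \<Rightarrow> real) \<Rightarrow> (real^'n) measure" where
  "weighted_measure \<Omega> \<eta> = density (lebesgue_on \<Omega>) (\<lambda>x. ennreal (exp (- \<eta> x)))"

definition weak_div_eta ::
    "(real^'n) set \<Rightarrow> (real^'n \<Rightarrow> real) \<Rightarrow> (real^'n \<Rightarrow> real^'n) \<Rightarrow> real^'n \<Rightarrow> real" where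
  "weak_div_eta \<Omega> \<eta> u x = (\<Sum>i\<in>UNIV. weak_grad \<Omega> (\<lambda>y. u y $ i) x $ i) - grad \<eta> x \<bullet> u x"

text \<open>Since \<open>\<eta>\<close> is only \<open>C^2\<close>, eigenfunctions need not have classical second derivatives, so the
  differential equation is understood in the sense of distributions on \<open>\<Omega>\<close>. A distribution
  is represented as a functional on test functions.\<close>

type_synonym 'n distr = "(real^'n \<Rightarrow> real) \<Rightarrow> real"

definition distr_of :: "(real^'n) set \<Rightarrow> (real^'n \<Rightarrow> real) \<Rightarrow> 'n distr" where
  "distr_of \<Omega> f \<phi> = (LINT x|lebesgue_on \<Omega>. f x * \<phi> x)"

definition distr_partial :: "(real^'n) set \<Rightarrow> 'n \<Rightarrow> (real^'n \<Rightarrow> real) \<Rightarrow> 'n distr" where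
  "distr_partial \<Omega> i f \<phi> = - (LINT x|lebesgue_on \<Omega>. f x * grad \<phi> x $ i)"

definition distr_div :: "(real^'n) set \<Rightarrow> (real^'n \<Rightarrow> real^'n) \<Rightarrow> 'n distr" where
  "distr_div \<Omega> X \<phi> = - (LINT x|lebesgue_on \<Omega>. X x \<bullet> grad \<phi> x)"

definition distr_div_eta ::
    "(real^'n) set \<Rightarrow> (real^'n \<Rightarrow> real) \<Rightarrow> (real^'n \<Rightarrow> real^'n) \<Rightarrow> 'n distr" where
  "distr_div_eta \<Omega> \<eta> X \<phi> = distr_div \<Omega> X \<phi> - distr_of \<Omega> (\<lambda>x. grad \<eta> x \<bullet> X x) \<phi>"

definition L_op ::
    "(real^'n) set \<Rightarrow> (real^'n \<Rightarrow> real^'n^'n) \<Rightarrow> (real^'n \<Rightarrow> real) \<Rightarrow> (real^'n \<Rightarrow> real) \<Rightarrow> 'n distr" where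
  "L_op \<Omega> T \<eta> f = distr_div_eta \<Omega> \<eta> (\<lambda>x. T x *v weak_grad \<Omega> f x)"

section \<open>The eigenvalue problem\<close>

text \<open>All solutions, including \<open>0\<close>, of \<open>L u + \<alpha> \<nabla>(div_eta u) = - s u\<close> in \<open>\<Omega>\<close>, \<open>u = 0\<close> on the
  boundary.\<close>

definition eigenspace ::
    "(real^'n) set \<Rightarrow> (real^'n \<Rightarrow> real^'n^'n) \<Rightarrow> (real^'n \<Rightarrow> real) \<Rightarrow> real \<Rightarrow> real
      \<Rightarrow> (real^'n \<Rightarrow> real^'n) set" where
  "eigenspace \<Omega> T \<eta> \<alpha> s = {u. (\<forall>i. (\<lambda>x. u x $ i) \<in> H1_0 \<Omega>) \<and>
     (\<forall>i. \<forall>\<phi>\<in>test_functions \<Omega>.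
        L_op \<Omega> T \<eta> (\<lambda>x. u x $ i) \<phi> + \<alpha> * distr_partial \<Omega> i (weak_div_eta \<Omega> \<eta> u) \<phi>
        = - s * distr_of \<Omega> (\<lambda>x. u x $ i) \<phi>)}"

text \<open>The dimension of the eigenspace, modulo equality almost everywhere, is \<open>m\<close>; \<open>m = 0\<close> says
  that \<open>s\<close> is not an eigenvalue.\<close>

definition has_multiplicity ::
    "(real^'n) set \<Rightarrow> (real^'n \<Rightarrow> real^'n^'n) \<Rightarrow> (real^'n \<Rightarrow> real) \<Rightarrow> real \<Rightarrow> real \<Rightarrow> nat \<Rightarrow> bool" where
  "has_multiplicity \<Omega> T \<eta> \<alpha> s m \<longleftrightarrow>
     (\<exists>v::nat \<Rightarrow> real^'n \<Rightarrow> real^'n. (\<forall>j<m. v j \<in> eigenspace \<Omega> T \<eta> \<alpha> s) \<and>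
        (\<forall>c. (AE x in lebesgue_on \<Omega>. (\<Sum>j<m. c j *\<^sub>R v j x) = 0) \<longrightarrow> (\<forall>j<m. c j = (0::real))) \<and>
        (\<forall>w\<in>eigenspace \<Omega> T \<eta> \<alpha> s. \<exists>c. AE x in lebesgue_on \<Omega>. w x = (\<Sum>j<m. c j *\<^sub>R v j x)))"

text \<open>The sequence is indexed from 1; \<open>\<sigma> 0\<close> is irrelevant.\<close>

definition eigenvalue_sequence ::
    "(real^'n) set \<Rightarrow> (real^'n \<Rightarrow> real^'n^'n) \<Rightarrow> (real^'n \<Rightarrow> real) \<Rightarrow> real \<Rightarrow> (nat \<Rightarrow> real) \<Rightarrow> bool" where
  "eigenvalue_sequence \<Omega> T \<eta> \<alpha> \<sigma> \<longleftrightarrow>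
     0 < \<sigma> 1 \<and> (\<forall>i\<ge>1. \<sigma> i \<le> \<sigma> (Suc i)) \<and> filterlim \<sigma> at_top sequentially \<and>
     (\<forall>s. has_multiplicity \<Omega> T \<eta> \<alpha> s (card {i. 1 \<le> i \<and> \<sigma> i = s}))"

section \<open>The constants\<close>

definition C0_const ::
    "(real^'n) set \<Rightarrow> (real^'n \<Rightarrow> real^'n^'n) \<Rightarrow> (real^'n \<Rightarrow> real) \<Rightarrow> real" where
  "C0_const \<Omega> T \<eta> = (SUP x\<in>\<Omega>.
     1/2 * divergence (\<lambda>y. T y *v (T y *v grad \<eta> y - tr_nabla T y)) x
     - 1/4 * (norm (T x *v grad \<eta> x))\<^sup>2)"

definition T0_const :: "(real^'n) set \<Rightarrow> (real^'n \<Rightarrow> real^'n^'n) \<Rightarrow> real" where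
  "T0_const \<Omega> T = (SUP x\<in>\<Omega>. norm (tr_nabla T x))"

definition D0_const ::
    "(real^'n) set \<Rightarrow> (real^'n \<Rightarrow> real^'n^'n) \<Rightarrow> (real^'n \<Rightarrow> real) \<Rightarrow> real \<Rightarrow> real
      \<Rightarrow> (nat \<Rightarrow> real^'n \<Rightarrow> real^'n) \<Rightarrow> nat \<Rightarrow> real" where
  "D0_const \<Omega> T \<eta> \<alpha> \<delta> u k =
     - \<alpha> * Min ((\<lambda>j. LINT x|weighted_measure \<Omega> \<eta>. (weak_div_eta \<Omega> \<eta> (u j) x)\<^sup>2) ` {1..k})
     + ((T0_const \<Omega> T)\<^sup>2 + 4 * C0_const \<Omega> T \<eta>) / (4 * \<delta>)"

end

theory Submission
  imports Defs "HOL-Library.Function_Algebras"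
begin

text \<open>Fix a coordinate \<open>x\<^sub>h\<close> and take as trial fields for \<open>\<sigma>\<^sub>k\<^sub>+\<^sub>1\<close> the products \<open>x\<^sub>h u\<^sub>i\<close>, made
  orthogonal to \<open>u\<^sub>1, \<dots>, u\<^sub>k\<close>. The variational characterisation of \<open>\<sigma>\<^sub>k\<^sub>+\<^sub>1\<close> comes from minimising the
  Rayleigh quotient on the orthogonal complement: by Rellich's theorem the minimum is attained at an
  eigenfield, and the multiplicities leave no eigenvalue below \<open>\<sigma>\<^sub>k\<^sub>+\<^sub>1\<close> there. The operator
  \<open>Z\<^sub>h = T e\<^sub>h \<sqdot> \<nabla> + 1/2 div\<^sub>\<eta> (T e\<^sub>h)\<close> is skew-adjoint with \<open>[Z\<^sub>h, x\<^sub>h] = T\<^sub>h\<^sub>h\<close>, whereas the double commutator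
  of the elliptic operator with \<open>x\<^sub>h\<close> contributes \<open>T\<^sub>h\<^sub>h |u|^2 + \<alpha> (u^h)^2\<close>. The Cauchy-Schwarz inequality,
  with skewness cancelling the terms antisymmetric in \<open>i, j\<close>, bounds the former by the latter and by
  \<open>\<parallel>Z\<^sub>h u\<^sub>i\<parallel>^2\<close>. After summation over \<open>h\<close>, integration by parts gives
  \<open>\<Sum>\<^sub>h \<parallel>Z\<^sub>h u\<^sub>i\<parallel>^2 \<le> \<delta> (\<sigma>\<^sub>i + D\<^sub>0)\<close>. The last two estimates follow because the resulting quadratic
  inequality has both \<open>\<sigma>\<^sub>k\<^sub>+\<^sub>1\<close> and, when used with \<open>k - 1\<close> in place of \<open>k\<close>, also \<open>\<sigma>\<^sub>k\<close> as solutions.\<close>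

text \<open>Since \<eta> is only C^2, an eigenfield need not have classical second derivatives.
  Everything is therefore done with jets, pairs (u, grad u) in the L2-closure of the jets of test
  functions: the operator becomes the form \<open>q\<close>, multiplication by a coordinate becomes
  the Leibniz rule, and commutators become pointwise algebraic identities between jets. Integration
  by parts is checked for test functions and carried over by density. The weight exp(-\<eta>) is not
  smooth either, so products with C^1 functions must be shown to stay in the space. The variational
  characterisation is not among the hypotheses. They say only that the number of repetitions of each
  listed value is the dimension of its eigenspace, so an eigenvector orthogonal to the matching
  \<open>u i\<close> contradicts a count of dimensions. In D_0 the terms with C_0 and T_0 are what
  remains of |Y|^2/4, Y = tr(grad T) - T(grad \<eta>), once the cross term between Y and the
  gradient has been integrated by parts. The term with \<alpha> subtracts the divergence part of the
  energy, since only the part with T enters the estimate of Z_h u.\<close>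

text \<open>Lets \<open>subspace\<close>, \<open>linear\<close> and finite linear combinations be
  used for sets of fields. A field is a function here, not a class modulo null sets.\<close>

instantiation "fun" :: (type, real_vector) real_vector
begin

definition scaleR_fun :: "real \<Rightarrow> ('a \<Rightarrow> 'b) \<Rightarrow> 'a \<Rightarrow> 'b" where
  "scaleR_fun c f = (\<lambda>x. c *\<^sub>R f x)"

instance
  by standard (auto simp: scaleR_fun_def plus_fun_def scaleR_add_right scaleR_add_left)

end

lemma scaleR_fun_apply [simp]: "(c *\<^sub>R f) x = c *\<^sub>R f x"
  for f :: "'a \<Rightarrow> 'b::real_vector"
  by (simp add: scaleR_fun_def)

lemma sum_fun_apply: "(\<Sum>j\<in>A. f j) x = (\<Sum>j\<in>A. f j x)"
  for f :: "'i \<Rightarrow> 'a \<Rightarrow> 'b::ab_group_add"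
  by (induction A rule: infinite_finite_induct) auto

section \<open>Square integrable functions\<close>

definition L2 :: "'a measure \<Rightarrow> ('a \<Rightarrow> 'b::euclidean_space) set" where
  "L2 M = {f \<in> borel_measurable M. integrable M (\<lambda>x. (norm (f x))\<^sup>2)}"

definition sqn :: "'a measure \<Rightarrow> ('a \<Rightarrow> 'b::euclidean_space) \<Rightarrow> real" where
  "sqn M f = (LINT x|M. (norm (f x))\<^sup>2)"

lemma L2D: "f \<in> L2 M \<Longrightarrow> f \<in> borel_measurable M" "f \<in> L2 M \<Longrightarrow> integrable M (\<lambda>x. (norm (f x))\<^sup>2)"
  by (auto simp: L2_def)

lemma L2I_bound:
  assumes "f \<in> borel_measurable M" "g \<in> L2 M" "\<And>x. x \<in> space M \<Longrightarrow> norm (f x) \<le> C * norm (g x)"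
  shows "f \<in> L2 M"
proof -
  have "integrable M (\<lambda>x. (norm (f x))\<^sup>2)"
  proof (rule Bochner_Integration.integrable_bound)
    show "integrable M (\<lambda>x. C\<^sup>2 * (norm (g x))\<^sup>2)"
      using L2D(2)[OF assms(2)] by simp
    show "AE x in M. norm ((norm (f x))\<^sup>2) \<le> norm (C\<^sup>2 * (norm (g x))\<^sup>2)"
      using assms(3) power_mono[OF assms(3) norm_ge_zero, of _ 2] by (auto simp: power_mult_distrib)
  qed (use assms(1) in measurable)
  with assms(1) show ?thesis by (simp add: L2_def)
qed

lemma sqn_nonneg [simp]: "0 \<le> sqn M f"
  by (simp add: sqn_def)

lemma norm_add_sq_le: "(norm (a + b))\<^sup>2 \<le> 2 * (norm a)\<^sup>2 + 2 * (norm b)\<^sup>2"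
  for a b :: "'a::real_normed_vector"
proof -
  have "(norm (a + b))\<^sup>2 \<le> (norm a + norm b)\<^sup>2"
    by (simp add: norm_triangle_ineq power_mono)
  also have "\<dots> \<le> 2 * (norm a)\<^sup>2 + 2 * (norm b)\<^sup>2"
    using sum_squares_bound[of "norm a" "norm b"] by (simp add: power2_sum)
  finally show ?thesis .
qed

lemma L2_add: "f \<in> L2 M \<Longrightarrow> g \<in> L2 M \<Longrightarrow> f + g \<in> L2 M"
  unfolding L2_def
proof safe
  assume [measurable]: "f \<in> borel_measurable M" "g \<in> borel_measurable M"
    and i: "integrable M (\<lambda>x. (norm (f x))\<^sup>2)" "integrable M (\<lambda>x. (norm (g x))\<^sup>2)"
  show "f + g \<in> borel_measurable M"
    unfolding plus_fun_def by measurable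
  have "integrable M (\<lambda>x. 2 * (norm (f x))\<^sup>2 + 2 * (norm (g x))\<^sup>2)"
    using i by simp
  then show "integrable M (\<lambda>x. (norm ((f + g) x))\<^sup>2)"
    by (rule Bochner_Integration.integrable_bound)
       (auto simp: norm_add_sq_le intro!: order_trans[OF norm_add_sq_le])
qed

lemma L2_scaleR: "f \<in> L2 M \<Longrightarrow> c *\<^sub>R f \<in> L2 M"
  by (rule L2I_bound[of _ _ f "\<bar>c\<bar>"]) (auto simp: scaleR_fun_def dest: L2D)

lemma subspace_L2: "subspace (L2 M :: ('a \<Rightarrow> 'b::euclidean_space) set)"
proof (rule subspaceI)
  show "(0 :: 'a \<Rightarrow> 'b) \<in> L2 M"
    by (simp add: L2_def zero_fun_def)
qed (auto intro: L2_add L2_scaleR)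

lemmas L2_diff = subspace_diff[OF subspace_L2]
lemmas L2_sum = subspace_sum[OF subspace_L2]

lemma integrable_norm_mult:
  assumes "f \<in> L2 M" "g \<in> L2 M"
  shows "integrable M (\<lambda>x. norm (f x) * norm (g x))"
proof (rule Bochner_Integration.integrable_bound)
  show "integrable M (\<lambda>x. (norm (f x))\<^sup>2 + (norm (g x))\<^sup>2)"
    using assms by (auto dest: L2D)
  have [measurable]: "f \<in> borel_measurable M" "g \<in> borel_measurable M"
    using assms by (auto dest: L2D)
  show "(\<lambda>x. norm (f x) * norm (g x)) \<in> borel_measurable M" by measurable
  have "a * b \<le> a\<^sup>2 + b\<^sup>2" if "a \<ge> 0" "b \<ge> 0" for a b :: real
    using sum_squares_bound[of a b] mult_nonneg_nonneg[OF that] by linarith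
  then show "AE x in M. norm (norm (f x) * norm (g x)) \<le> norm ((norm (f x))\<^sup>2 + (norm (g x))\<^sup>2)"
    by auto
qed

text \<open>The optimal parameter is t = C / B. The case C = 0 is excluded by t = B / (A + 1), which
  would give 2 B <= B.\<close>

lemma sq_le_if_young:
  fixes A B C :: real
  assumes "0 \<le> A" "0 \<le> C" and young: "\<And>t. 0 < t \<Longrightarrow> 2 * B \<le> t * A + C / t" and "0 \<le> B"
  shows "B\<^sup>2 \<le> A * C"
proof (cases "B = 0")
  case False
  with assms have B: "B > 0" by simp
  have "C > 0"
  proof (rule ccontr)
    assume "\<not> 0 < C"
    with assms have "C = 0" by simp
    have "2 * B \<le> (B / (A + 1)) * A"
      using young[of "B / (A + 1)"] B assms \<open>C = 0\<close> by simp
    also have "\<dots> \<le> B"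
      using assms(1) B by (simp add: field_simps)
    finally show False using B by simp
  qed
  have "2 * B \<le> C / B * A + B"
    using young[of "C / B"] B \<open>C > 0\<close> by simp
  then have "B * B \<le> C * A"
    using B by (simp add: field_simps)
  then show ?thesis by (simp add: power2_eq_square mult.commute)
qed (use assms in simp)

lemma Cauchy_Schwarz_L2:
  assumes "f \<in> L2 M" "g \<in> L2 M"
  shows "(LINT x|M. norm (f x) * norm (g x))\<^sup>2 \<le> sqn M f * sqn M g"
proof (rule sq_le_if_young)
  fix t :: real assume t: "0 < t"
  have "2 * (LINT x|M. norm (f x) * norm (g x)) = (LINT x|M. 2 * (norm (f x) * norm (g x)))"
    by simp
  also have "\<dots> \<le> (LINT x|M. t * (norm (f x))\<^sup>2 + (norm (g x))\<^sup>2 / t)"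
  proof (rule integral_mono)
    fix x
    have "0 \<le> (t * norm (f x) - norm (g x))\<^sup>2 / t" using t by simp
    then show "2 * (norm (f x) * norm (g x)) \<le> t * (norm (f x))\<^sup>2 + (norm (g x))\<^sup>2 / t"
      using t by (simp add: field_simps power2_eq_square)
  qed (use integrable_norm_mult[OF assms] L2D(2)[OF assms(1)] L2D(2)[OF assms(2)] in auto)
  also have "\<dots> = t * sqn M f + sqn M g / t"
    using assms by (simp add: sqn_def L2D)
  finally show "2 * (LINT x|M. norm (f x) * norm (g x)) \<le> t * sqn M f + sqn M g / t" .
qed auto

lemma sqn_add_le:
  assumes "f \<in> L2 M" "g \<in> L2 M"
  shows "sqn M (f + g) \<le> 2 * sqn M f + 2 * sqn M g"
proof -
  have "sqn M (f + g) \<le> (LINT x|M. 2 * (norm (f x))\<^sup>2 + 2 * (norm (g x))\<^sup>2)"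
    unfolding sqn_def
    by (rule integral_mono) (use L2D(2)[OF L2_add[OF assms]] L2D(2)[OF assms(1)] L2D(2)[OF assms(2)] in
        \<open>auto intro: norm_add_sq_le\<close>)
  also have "\<dots> = 2 * sqn M f + 2 * sqn M g"
    using assms by (simp add: sqn_def L2D)
  finally show ?thesis .
qed

lemma sqn_scaleR: "sqn M (c *\<^sub>R f) = c\<^sup>2 * sqn M f"
  by (simp add: sqn_def power_mult_distrib)

lemma sqn_le_bound:
  assumes "f \<in> L2 M" "g \<in> L2 M" "\<And>x. x \<in> space M \<Longrightarrow> norm (f x) \<le> C * norm (g x)"
  shows "sqn M f \<le> C\<^sup>2 * sqn M g"
proof -
  have "sqn M f \<le> (LINT x|M. C\<^sup>2 * (norm (g x))\<^sup>2)"
    unfolding sqn_def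
  proof (rule integral_mono)
    fix x assume "x \<in> space M"
    then show "(norm (f x))\<^sup>2 \<le> C\<^sup>2 * (norm (g x))\<^sup>2"
      using power_mono[OF assms(3) norm_ge_zero, of x 2] by (simp add: power_mult_distrib)
  qed (use assms in \<open>auto dest: L2D\<close>)
  then show ?thesis by (simp add: sqn_def)
qed

text \<open>\<open>L\<^sup>1\<close>-Cauchy subsequences converge almost everywhere, and Fatou's lemma upgrades this to
  convergence in \<open>L\<^sup>2\<close>.\<close>

lemma L2_complete:
  fixes F :: "nat \<Rightarrow> 'a \<Rightarrow> 'b::euclidean_space"
  assumes fin: "finite_measure M"
    and F: "\<And>m. F m \<in> L2 M"
    and cauchy: "\<And>e. 0 < e \<Longrightarrow> \<exists>N. \<forall>i\<ge>N. \<forall>j\<ge>N. sqn M (F i - F j) < e"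
  obtains f where "f \<in> L2 M" "(\<lambda>m. sqn M (F m - f)) \<longlonglongrightarrow> 0"
proof -
  interpret finite_measure M by fact
  have one: "(\<lambda>_. 1::real) \<in> L2 M"
    by (simp add: L2_def)
  have meas [measurable]: "F m \<in> borel_measurable M" for m
    using F by (rule L2D)
  have int: "integrable M (F m)" for m
    using integrable_norm_mult[OF F one, of m] by (simp add: integrable_norm_iff)
  have L1: "\<exists>N. \<forall>i\<ge>N. \<forall>j\<ge>N. (LINT x|M. norm (F i x - F j x)) < e" if e: "0 < e" for e
  proof -
    \<comment> \<open>One more than the total mass, so that division is safe even if the space is a
      null set.\<close>
    define c where "c = measure M (space M) + 1"
    have c: "c > 0" by (simp add: c_def add_nonneg_pos)
    obtain N where N: "\<And>i j. i \<ge> N \<Longrightarrow> j \<ge> N \<Longrightarrow> sqn M (F i - F j) < e\<^sup>2 / c"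
      using cauchy[OF divide_pos_pos[OF zero_less_power[OF e] c]] by blast
    have "(LINT x|M. norm (F i x - F j x)) < e" if "i \<ge> N" "j \<ge> N" for i j
    proof -
      have "(LINT x|M. norm (F i x - F j x))\<^sup>2 \<le> sqn M (F i - F j) * sqn M (\<lambda>_. 1::real)"
        using Cauchy_Schwarz_L2[OF L2_diff[OF F F] one, of i j] by (simp add: )
      also have "\<dots> \<le> sqn M (F i - F j) * c"
        by (rule mult_left_mono) (auto simp: sqn_def c_def)
      also have "\<dots> < e\<^sup>2"
        using N[OF that] c by (simp add: field_simps)
      finally show ?thesis
        using \<open>0 < e\<close> by (metis less_imp_le power2_less_imp_less)
    qed
    then show ?thesis by auto
  qed
  obtain r where r: "strict_mono r" "AE x in M. Cauchy (\<lambda>i. F (r i) x)"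
    using cauchy_L1_AE_cauchy_subseq[of M F, OF int L1] by blast
  define f where "f x = lim (\<lambda>i. F (r i) x)" for x
  have f[measurable]: "f \<in> borel_measurable M"
    unfolding f_def by (rule borel_measurable_lim_metric) (rule meas)
  have conv: "AE x in M. (\<lambda>i. F (r i) x) \<longlonglongrightarrow> f x"
    using r(2) by eventually_elim (simp add: f_def Cauchy_convergent_iff convergent_LIMSEQ_iff)
  have key: "integrable M (\<lambda>x. (norm ((F m - f) x))\<^sup>2) \<and> sqn M (F m - f) \<le> e"
    if e: "0 < e" and N: "\<forall>i\<ge>N. \<forall>j\<ge>N. sqn M (F i - F j) < e" and m: "m \<ge> N" for m N e
  proof -
    have "(\<integral>\<^sup>+x. ennreal ((norm ((F m - f) x))\<^sup>2) \<partial>M)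
        = (\<integral>\<^sup>+x. liminf (\<lambda>i. ennreal ((norm (F m x - F (r i) x))\<^sup>2)) \<partial>M)"
    proof (rule nn_integral_cong_AE, use conv in eventually_elim)
      fix x assume "(\<lambda>i. F (r i) x) \<longlonglongrightarrow> f x"
      then have "(\<lambda>i. ennreal ((norm (F m x - F (r i) x))\<^sup>2)) \<longlonglongrightarrow> ennreal ((norm (F m x - f x))\<^sup>2)"
        by (intro tendsto_intros tendsto_ennrealI)
      then show "ennreal ((norm ((F m - f) x))\<^sup>2) = liminf (\<lambda>i. ennreal ((norm (F m x - F (r i) x))\<^sup>2))"
        using lim_imp_Liminf[OF sequentially_bot] by (metis (mono_tags) fun_diff_def)
    qed
    also have "\<dots> \<le> liminf (\<lambda>i. \<integral>\<^sup>+x. ennreal ((norm (F m x - F (r i) x))\<^sup>2) \<partial>M)"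
      by (rule nn_integral_liminf) measurable
    also have "\<dots> = liminf (\<lambda>i. ennreal (sqn M (F m - F (r i))))"
    proof -
      have "(\<integral>\<^sup>+x. ennreal ((norm (F m x - F (r i) x))\<^sup>2) \<partial>M) = ennreal (sqn M (F m - F (r i)))" for i
        unfolding sqn_def using L2D(2)[OF L2_diff[OF F F], of m "r i"]
        by (subst nn_integral_eq_integral[symmetric]) (auto)
      then show ?thesis by simp
    qed
    also have "\<dots> \<le> limsup (\<lambda>i. ennreal (sqn M (F m - F (r i))))"
      by (rule Liminf_le_Limsup) simp
    also have "\<dots> \<le> ennreal e"
    proof (rule Limsup_bounded)
      show "\<forall>\<^sub>F i in sequentially. ennreal (sqn M (F m - F (r i))) \<le> ennreal e"
        using eventually_ge_at_top[of N]
      proof eventually_elim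
        case (elim i)
        then have "r i \<ge> N" using seq_suble[OF r(1), of i] by simp
        then show ?case using N m by (intro ennreal_leI) (auto intro: less_imp_le)
      qed
    qed
    finally have le: "(\<integral>\<^sup>+x. ennreal ((norm ((F m - f) x))\<^sup>2) \<partial>M) \<le> ennreal e" .
    have i: "integrable M (\<lambda>x. (norm ((F m - f) x))\<^sup>2)"
      by (rule integrableI_bounded) (use le in \<open>auto simp: top.extremum_unique fun_diff_def less_top[symmetric]
            intro!: le_less_trans[OF le]\<close>)
    moreover have "ennreal (sqn M (F m - f)) \<le> ennreal e"
      unfolding sqn_def using le i by (subst nn_integral_eq_integral[symmetric]) auto
    ultimately show ?thesis using e by simp
  qed
  \<comment> \<open>One index suffices for square integrability of \<open>f\<close>, which differs
    from \<open>F N1\<close> by a square integrable function.\<close>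
  obtain N1 where N1: "\<forall>i\<ge>N1. \<forall>j\<ge>N1. sqn M (F i - F j) < 1"
    using cauchy[of 1] by auto
  have "F N1 - f \<in> L2 M"
    using key[of 1 N1 N1] N1 by (auto simp: L2_def fun_diff_def)
  then have "F N1 - (F N1 - f) \<in> L2 M"
    by (rule L2_diff[OF F])
  moreover have "F N1 - (F N1 - f) = f"
    by (simp add: fun_eq_iff)
  ultimately have "f \<in> L2 M" by simp
  moreover have "(\<lambda>m. sqn M (F m - f)) \<longlonglongrightarrow> 0"
  proof (rule LIMSEQ_I)
    fix e :: real assume "0 < e"
    then obtain N where "\<forall>i\<ge>N. \<forall>j\<ge>N. sqn M (F i - F j) < e / 2"
      using cauchy[of "e / 2"] by auto
    then have "sqn M (F m - f) \<le> e / 2" if "m \<ge> N" for m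
      using key[of "e / 2" N m] \<open>0 < e\<close> that by auto
    then show "\<exists>N. \<forall>m\<ge>N. norm (sqn M (F m - f) - 0) < e"
      using \<open>0 < e\<close> by (intro exI[of _ N]) fastforce
  qed
  ultimately show ?thesis using that by blast
qed

section \<open>Closures and bounded forms\<close>

definition L2_closure :: "'a measure \<Rightarrow> ('a \<Rightarrow> 'b::euclidean_space) set \<Rightarrow> ('a \<Rightarrow> 'b) set" where
  "L2_closure M S = {f \<in> L2 M. \<exists>F. (\<forall>m. F m \<in> S) \<and> (\<lambda>m. sqn M (F m - f)) \<longlonglongrightarrow> 0}"

lemma tendsto_0_le:
  fixes a b :: "nat \<Rightarrow> real"
  assumes "b \<longlonglongrightarrow> 0" "\<And>m. 0 \<le> a m" "\<And>m. a m \<le> b m"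
  shows "a \<longlonglongrightarrow> 0"
  by (rule tendsto_sandwich[OF _ _ tendsto_const assms(1)]) (use assms in auto)

lemma L2_closure_L2: "f \<in> L2_closure M S \<Longrightarrow> f \<in> L2 M"
  by (simp add: L2_closure_def)

lemma L2_closureE:
  assumes "f \<in> L2_closure M S"
  obtains F where "\<And>m. F m \<in> S" "(\<lambda>m. sqn M (F m - f)) \<longlonglongrightarrow> 0"
  using assms by (auto simp: L2_closure_def)

lemma L2_closureI:
  assumes "f \<in> L2 M" "\<And>m. F m \<in> S" "(\<lambda>m. sqn M (F m - f)) \<longlonglongrightarrow> 0"
  shows "f \<in> L2_closure M S"
  using assms by (auto simp: L2_closure_def)

lemma L2_closure_iff:
  assumes "f \<in> L2 M"
  shows "f \<in> L2_closure M S \<longleftrightarrow> (\<forall>e>0. \<exists>g\<in>S. sqn M (g - f) < e)"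
proof
  assume "f \<in> L2_closure M S"
  then obtain F where F: "\<And>m. F m \<in> S" "(\<lambda>m. sqn M (F m - f)) \<longlonglongrightarrow> 0"
    by (rule L2_closureE) auto
  show "\<forall>e>0. \<exists>g\<in>S. sqn M (g - f) < e"
  proof safe
    fix e :: real assume "0 < e"
    then have "\<forall>\<^sub>F m in sequentially. sqn M (F m - f) < e"
      by (intro order_tendstoD(2)[OF F(2)])
    then show "\<exists>g\<in>S. sqn M (g - f) < e"
      using F(1) by (meson eventually_happens' sequentially_bot)
  qed
next
  assume *: "\<forall>e>0. \<exists>g\<in>S. sqn M (g - f) < e"
  have "\<forall>m. \<exists>g. g \<in> S \<and> sqn M (g - f) < inverse (real (Suc m))"
    using * by (metis inverse_positive_iff_positive of_nat_0_less_iff zero_less_Suc)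
  then obtain F where F: "\<And>m. F m \<in> S" "\<And>m. sqn M (F m - f) < inverse (real (Suc m))"
    by metis
  have "(\<lambda>m. sqn M (F m - f)) \<longlonglongrightarrow> 0"
    by (rule tendsto_sandwich[OF _ _ tendsto_const LIMSEQ_inverse_real_of_nat])
       (use F(2) in \<open>auto intro!: always_eventually less_imp_le\<close>)
  then show "f \<in> L2_closure M S"
    using F(1) assms by (intro L2_closureI)
qed

lemma L2_closure_incl: "S \<subseteq> L2 M \<Longrightarrow> S \<subseteq> L2_closure M S"
proof
  fix f assume "S \<subseteq> L2 M" "f \<in> S"
  then show "f \<in> L2_closure M S"
    by (intro L2_closureI[where F="\<lambda>_. f"]) (auto simp: sqn_def)
qed

lemma L2_closure_closed:
  assumes S: "S \<subseteq> L2 M" and f: "f \<in> L2 M" and F: "\<And>m. F m \<in> L2_closure M S"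
    and conv: "(\<lambda>m. sqn M (F m - f)) \<longlonglongrightarrow> 0"
  shows "f \<in> L2_closure M S"
  unfolding L2_closure_iff[OF f]
proof safe
  fix e :: real assume e: "0 < e"
  then have "\<forall>\<^sub>F m in sequentially. sqn M (F m - f) < e / 4"
    by (intro order_tendstoD(2)[OF conv]) simp
  then obtain m where m: "sqn M (F m - f) < e / 4"
    by (meson eventually_happens' sequentially_bot)
  have Fm: "F m \<in> L2 M" using F by (rule L2_closure_L2)
  obtain g where g: "g \<in> S" "sqn M (g - F m) < e / 4"
    using F[of m] e unfolding L2_closure_iff[OF Fm] by (meson divide_pos_pos zero_less_numeral)
  have "sqn M (g - f) = sqn M ((g - F m) + (F m - f))"
    by simp
  also have "\<dots> \<le> 2 * sqn M (g - F m) + 2 * sqn M (F m - f)"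
    using g S Fm f by (intro sqn_add_le L2_diff) auto
  also have "\<dots> < e" using g m by simp
  finally show "\<exists>g\<in>S. sqn M (g - f) < e" using g by auto
qed

lemma subspace_L2_closure:
  assumes S: "S \<subseteq> L2 M" and sub: "subspace S"
  shows "subspace (L2_closure M S)"
proof (rule subspaceI)
  show "0 \<in> L2_closure M S"
    using L2_closure_incl[OF S] subspace_0[OF sub] by auto
next
  fix f g assume f: "f \<in> L2_closure M S" and g: "g \<in> L2_closure M S"
  obtain F where F: "\<And>m. F m \<in> S" "(\<lambda>m. sqn M (F m - f)) \<longlonglongrightarrow> 0"
    using f by (rule L2_closureE) auto
  obtain G where G: "\<And>m. G m \<in> S" "(\<lambda>m. sqn M (G m - g)) \<longlonglongrightarrow> 0"
    using g by (rule L2_closureE) auto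
  show "f + g \<in> L2_closure M S"
  proof (rule L2_closureI)
    show "f + g \<in> L2 M"
      using f g by (intro L2_add L2_closure_L2)
    show "F m + G m \<in> S" for m
      using F G by (intro subspace_add[OF sub])
    have le: "sqn M (F m + G m - (f + g)) \<le> 2 * sqn M (F m - f) + 2 * sqn M (G m - g)" for m
    proof -
      have eq: "F m + G m - (f + g) = (F m - f) + (G m - g)"
        by (simp add: fun_eq_iff)
      show ?thesis
        unfolding eq using F G S L2_closure_L2[OF f] L2_closure_L2[OF g]
        by (intro sqn_add_le L2_diff) auto
    qed
    have "(\<lambda>m. 2 * sqn M (F m - f) + 2 * sqn M (G m - g)) \<longlonglongrightarrow> 2 * 0 + 2 * 0"
      by (intro tendsto_intros F G)
    then show "(\<lambda>m. sqn M (F m + G m - (f + g))) \<longlonglongrightarrow> 0"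
      by (intro tendsto_0_le[OF _ sqn_nonneg le]) simp
  qed
next
  fix c f assume f: "f \<in> L2_closure M S"
  obtain F where F: "\<And>m. F m \<in> S" "(\<lambda>m. sqn M (F m - f)) \<longlonglongrightarrow> 0"
    using f by (rule L2_closureE) auto
  show "c *\<^sub>R f \<in> L2_closure M S"
  proof (rule L2_closureI)
    show "c *\<^sub>R f \<in> L2 M"
      using f by (intro L2_scaleR L2_closure_L2)
    show "c *\<^sub>R F m \<in> S" for m
      using F by (intro subspace_scale[OF sub])
    have "(\<lambda>m. c\<^sup>2 * sqn M (F m - f)) \<longlonglongrightarrow> c\<^sup>2 * 0"
      by (intro tendsto_intros F)
    moreover have "c *\<^sub>R F m - c *\<^sub>R f = c *\<^sub>R (F m - f)" for m
      by (simp add: fun_eq_iff scaleR_right_diff_distrib)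
    ultimately show "(\<lambda>m. sqn M (c *\<^sub>R F m - c *\<^sub>R f)) \<longlonglongrightarrow> 0"
      by (simp add: sqn_scaleR)
  qed
qed

section \<open>Bilinear forms acting pointwise on fields\<close>

definition bform :: "'a measure \<Rightarrow> ('a \<Rightarrow> 'b \<Rightarrow> 'c \<Rightarrow> real) \<Rightarrow> ('a \<Rightarrow> 'b) \<Rightarrow> ('a \<Rightarrow> 'c) \<Rightarrow> real" where
  "bform M q f g = (LINT x|M. q x (f x) (g x))"

text \<open>Derivatives enter only through the jets, so all integral expressions of the proof have
  this shape. Measurability is required after insertion of fields because \<open>q\<close> varies
  with the point; with the uniform bound it makes \<open>bform\<close> continuous in both
  arguments.\<close>

definition bounded_form ::
    "'a measure \<Rightarrow> ('a \<Rightarrow> 'b::euclidean_space \<Rightarrow> 'c::euclidean_space \<Rightarrow> real) \<Rightarrow> bool" where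
  "bounded_form M q \<longleftrightarrow> (\<forall>x. bilinear (q x)) \<and>
     (\<forall>f g. f \<in> borel_measurable M \<longrightarrow> g \<in> borel_measurable M
        \<longrightarrow> (\<lambda>x. q x (f x) (g x)) \<in> borel_measurable M) \<and>
     (\<exists>C\<ge>0. \<forall>x\<in>space M. \<forall>p r. \<bar>q x p r\<bar> \<le> C * (norm p * norm r))"

context
  fixes M :: "'a measure" and q :: "'a \<Rightarrow> 'b::euclidean_space \<Rightarrow> 'c::euclidean_space \<Rightarrow> real"
  assumes q: "bounded_form M q"
begin

lemma bform_integrable:
  assumes "f \<in> L2 M" "g \<in> L2 M"
  shows "integrable M (\<lambda>x. q x (f x) (g x))"
proof -
  obtain C where C: "C \<ge> 0" "\<And>x p r. x \<in> space M \<Longrightarrow> \<bar>q x p r\<bar> \<le> C * (norm p * norm r)"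
    using q by (auto simp: bounded_form_def)
  show ?thesis
  proof (rule Bochner_Integration.integrable_bound)
    show "integrable M (\<lambda>x. C * (norm (f x) * norm (g x)))"
      using integrable_norm_mult[OF assms] by simp
    show "(\<lambda>x. q x (f x) (g x)) \<in> borel_measurable M"
      using q assms by (auto simp: bounded_form_def L2_def)
    show "AE x in M. norm (q x (f x) (g x)) \<le> norm (C * (norm (f x) * norm (g x)))"
      using C by (auto intro!: AE_I2)
  qed
qed

lemma bform_bound:
  obtains C where "C \<ge> 0"
    "\<And>f g. f \<in> L2 M \<Longrightarrow> g \<in> L2 M \<Longrightarrow> \<bar>bform M q f g\<bar> \<le> C * (sqrt (sqn M f) * sqrt (sqn M g))"
proof -
  obtain C where C: "C \<ge> 0" "\<And>x p r. x \<in> space M \<Longrightarrow> \<bar>q x p r\<bar> \<le> C * (norm p * norm r)"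
    using q by (auto simp: bounded_form_def)
  have "\<bar>bform M q f g\<bar> \<le> C * (sqrt (sqn M f) * sqrt (sqn M g))" if "f \<in> L2 M" "g \<in> L2 M" for f g
  proof -
    have "\<bar>bform M q f g\<bar> \<le> (LINT x|M. \<bar>q x (f x) (g x)\<bar>)"
      unfolding bform_def by (rule integral_abs_bound)
    also have "\<dots> \<le> (LINT x|M. C * (norm (f x) * norm (g x)))"
      using C bform_integrable[OF that] integrable_norm_mult[OF that]
      by (intro integral_mono) auto
    also have "\<dots> = C * (LINT x|M. norm (f x) * norm (g x))" by simp
    also have "\<dots> \<le> C * sqrt (sqn M f * sqn M g)"
      using Cauchy_Schwarz_L2[OF that] C(1) by (intro mult_left_mono real_le_rsqrt) auto
    finally show ?thesis by (simp add: real_sqrt_mult)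
  qed
  with C(1) that show ?thesis by blast
qed

lemma bform_add_left: "f \<in> L2 M \<Longrightarrow> f' \<in> L2 M \<Longrightarrow> g \<in> L2 M \<Longrightarrow>
    bform M q (f + f') g = bform M q f g + bform M q f' g"
  using q bform_integrable[of f g] bform_integrable[of f' g]
  by (simp add: bform_def bounded_form_def bilinear_ladd)

lemma bform_add_right: "f \<in> L2 M \<Longrightarrow> g \<in> L2 M \<Longrightarrow> g' \<in> L2 M \<Longrightarrow>
    bform M q f (g + g') = bform M q f g + bform M q f g'"
  using q bform_integrable[of f g] bform_integrable[of f g']
  by (simp add: bform_def bounded_form_def bilinear_radd)

lemma bform_scale_left: "bform M q (c *\<^sub>R f) g = c * bform M q f g"
  using q by (simp add: bform_def bounded_form_def bilinear_lmul)

lemma bform_diff_left: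
  assumes "f \<in> L2 M" "f' \<in> L2 M" "g \<in> L2 M"
  shows "bform M q (f - f') g = bform M q f g - bform M q f' g"
  using bform_add_left[of "f - f'" f' g] L2_diff[of f M f'] assms by simp

lemma bform_diff_right:
  assumes "f \<in> L2 M" "g \<in> L2 M" "g' \<in> L2 M"
  shows "bform M q f (g - g') = bform M q f g - bform M q f g'"
  using bform_add_right[of f "g - g'" g'] L2_diff[of g M g'] assms by simp

lemma bform_tendsto:
  assumes F: "\<And>m. F m \<in> L2 M" "f \<in> L2 M" "(\<lambda>m. sqn M (F m - f)) \<longlonglongrightarrow> 0"
    and G: "\<And>m. G m \<in> L2 M" "g \<in> L2 M" "(\<lambda>m. sqn M (G m - g)) \<longlonglongrightarrow> 0"
  shows "(\<lambda>m. bform M q (F m) (G m)) \<longlonglongrightarrow> bform M q f g"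
proof -
  obtain C where C: "C \<ge> 0"
    "\<And>f g. f \<in> L2 M \<Longrightarrow> g \<in> L2 M \<Longrightarrow> \<bar>bform M q f g\<bar> \<le> C * (sqrt (sqn M f) * sqrt (sqn M g))"
    by (rule bform_bound) auto
  define e where "e m = C * (sqrt (sqn M (F m - f)) * sqrt (sqn M (G m - g))) +
      C * (sqrt (sqn M (F m - f)) * sqrt (sqn M g)) + C * (sqrt (sqn M f) * sqrt (sqn M (G m - g)))" for m
  have "e \<longlonglongrightarrow> C * (sqrt 0 * sqrt 0) + C * (sqrt 0 * sqrt (sqn M g)) + C * (sqrt (sqn M f) * sqrt 0)"
    unfolding e_def by (intro tendsto_intros F G)
  then have e0: "e \<longlonglongrightarrow> 0" by simp
  have "norm (bform M q (F m) (G m) - bform M q f g) \<le> e m" for m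
  proof -
    have d: "F m - f \<in> L2 M" "G m - g \<in> L2 M"
      using F G by (auto intro: L2_diff)
    have "bform M q (F m) (G m) - bform M q f g
        = bform M q (F m - f) (G m - g) + bform M q (F m - f) g + bform M q f (G m - g)"
      using F G by (simp add: bform_diff_left bform_diff_right d)
    then show ?thesis
      unfolding e_def real_norm_def
      using C(2)[OF d] C(2)[OF d(1) G(2)] C(2)[OF F(2) d(2)] by linarith
  qed
  then have "(\<lambda>m. bform M q (F m) (G m) - bform M q f g) \<longlonglongrightarrow> 0"
    by (rule Lim_null_comparison[OF always_eventually[OF allI] e0])
  then show ?thesis
    by (rule LIM_zero_cancel)
qed

text \<open>Density principle: an integral identity checked on test functions passes to their
  closures because the form is continuous along the approximating sequences.\<close>

lemma bform_zero_closure: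
  assumes "S \<subseteq> L2 M" "S' \<subseteq> L2 M" "\<And>f g. f \<in> S \<Longrightarrow> g \<in> S' \<Longrightarrow> bform M q f g = 0"
    and f: "f \<in> L2_closure M S" and g: "g \<in> L2_closure M S'"
  shows "bform M q f g = 0"
proof -
  obtain F where F: "\<And>m. F m \<in> S" "(\<lambda>m. sqn M (F m - f)) \<longlonglongrightarrow> 0"
    using f by (rule L2_closureE) auto
  obtain G where G: "\<And>m. G m \<in> S'" "(\<lambda>m. sqn M (G m - g)) \<longlonglongrightarrow> 0"
    using g by (rule L2_closureE) auto
  have "(\<lambda>m. bform M q (F m) (G m)) \<longlonglongrightarrow> bform M q f g"
    using F G assms by (intro bform_tendsto) (auto intro: L2_closure_L2)
  moreover have "bform M q (F m) (G m) = 0" for m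
    using assms(3)[OF F(1) G(1)] .
  ultimately have "(\<lambda>_. 0) \<longlonglongrightarrow> bform M q f g" by simp
  then show ?thesis
    using LIMSEQ_unique tendsto_const by blast
qed

end

section \<open>Linear operators acting pointwise on fields\<close>

definition bounded_op ::
    "'a measure \<Rightarrow> ('a \<Rightarrow> 'b::euclidean_space \<Rightarrow> 'c::euclidean_space) \<Rightarrow> bool" where
  "bounded_op M A \<longleftrightarrow> (\<forall>x. linear (A x)) \<and>
     (\<forall>f. f \<in> borel_measurable M \<longrightarrow> (\<lambda>x. A x (f x)) \<in> borel_measurable M) \<and>
     (\<exists>C\<ge>0. \<forall>x\<in>space M. \<forall>p. norm (A x p) \<le> C * norm p)"

lemma bounded_op_linear: "bounded_op M A \<Longrightarrow> linear (A x)"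
  unfolding bounded_op_def by (drule conjunct1) (erule spec)

lemma bounded_op_measurable:
  assumes "bounded_op M A" "f \<in> borel_measurable M"
  shows "(\<lambda>x. A x (f x)) \<in> borel_measurable M"
  by (rule assms(1)[unfolded bounded_op_def, THEN conjunct2, THEN conjunct1, THEN spec, THEN mp,
        OF assms(2)])

lemma bounded_op_bound:
  "bounded_op M A \<Longrightarrow> \<exists>C\<ge>0. \<forall>x\<in>space M. \<forall>p. norm (A x p) \<le> C * norm p"
  unfolding bounded_op_def by (drule conjunct2, erule conjunct2)

lemma bounded_op_L2:
  assumes A: "bounded_op M A" and f: "f \<in> L2 M"
  shows "(\<lambda>x. A x (f x)) \<in> L2 M"
proof -
  obtain C where C: "\<forall>x\<in>space M. \<forall>p. norm (A x p) \<le> C * norm p"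
    using bounded_op_bound[OF A] by (elim exE conjE)
  show ?thesis
    by (rule L2I_bound[where C=C, OF bounded_op_measurable[OF A L2D(1)[OF f]] f]) (use C in simp)
qed

lemma bounded_op_tendsto:
  assumes A: "bounded_op M A" and F: "\<And>m. F m \<in> L2 M" "f \<in> L2 M" "(\<lambda>m. sqn M (F m - f)) \<longlonglongrightarrow> 0"
  shows "(\<lambda>m. sqn M ((\<lambda>x. A x (F m x)) - (\<lambda>x. A x (f x)))) \<longlonglongrightarrow> 0"
proof -
  obtain C where C: "\<forall>x\<in>space M. \<forall>p. norm (A x p) \<le> C * norm p"
    using bounded_op_bound[OF A] by (elim exE conjE)
  have le: "sqn M ((\<lambda>x. A x (F m x)) - (\<lambda>x. A x (f x))) \<le> C\<^sup>2 * sqn M (F m - f)" for m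
  proof (rule sqn_le_bound)
    show "(\<lambda>x. A x (F m x)) - (\<lambda>x. A x (f x)) \<in> L2 M"
      by (rule L2_diff[OF bounded_op_L2[OF A F(1)] bounded_op_L2[OF A F(2)]])
    show "norm (((\<lambda>x. A x (F m x)) - (\<lambda>x. A x (f x))) x) \<le> C * norm ((F m - f) x)"
      if "x \<in> space M" for x
      using C[rule_format, OF that, of "F m x - f x"] by (simp add: linear_diff[OF bounded_op_linear[OF A]])
  qed (rule L2_diff[OF F(1) F(2)])
  have "(\<lambda>m. C\<^sup>2 * sqn M (F m - f)) \<longlonglongrightarrow> C\<^sup>2 * 0"
    by (intro tendsto_intros F)
  then show ?thesis
    by (intro tendsto_0_le[OF _ sqn_nonneg le]) simp
qed

text \<open>The images of the generators need only lie in the closure of \<open>S'\<close>: a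
  coefficient of class C^1 turns the jet of a test function into a mere limit of such jets.\<close>

lemma bounded_op_closure:
  assumes A: "bounded_op M A" and S: "S \<subseteq> L2 M" and S': "S' \<subseteq> L2 M"
    and AS: "\<And>f. f \<in> S \<Longrightarrow> (\<lambda>x. A x (f x)) \<in> L2_closure M S'"
    and f: "f \<in> L2_closure M S"
  shows "(\<lambda>x. A x (f x)) \<in> L2_closure M S'"
proof -
  obtain F where F: "\<And>m. F m \<in> S" "(\<lambda>m. sqn M (F m - f)) \<longlonglongrightarrow> 0"
    using f by (rule L2_closureE) auto
  show ?thesis
  proof (rule L2_closure_closed[OF S'])
    show "(\<lambda>x. A x (f x)) \<in> L2 M"
      by (rule bounded_op_L2[OF A L2_closure_L2[OF f]])
    show "(\<lambda>x. A x (F m x)) \<in> L2_closure M S'" for m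
      using F AS by auto
    show "(\<lambda>m. sqn M ((\<lambda>x. A x (F m x)) - (\<lambda>x. A x (f x)))) \<longlonglongrightarrow> 0"
      using F(1) S by (intro bounded_op_tendsto[OF A _ L2_closure_L2[OF f] F(2)]) blast
  qed
qed

text \<open>By bilinearity a bound on unit vectors is enough, and there it comes from compactness of
  the closure of \<Omega> times two unit spheres. The coefficients are continuous on the whole
  space, hence on that closure.\<close>

lemma bounded_form_continuous:
  fixes q :: "'a::euclidean_space \<Rightarrow> 'b::euclidean_space \<Rightarrow> 'c::euclidean_space \<Rightarrow> real"
  assumes bil: "\<And>x. bilinear (q x)" and cont: "continuous_on UNIV (\<lambda>(x, p, r). q x p r)"
    and "bounded \<Omega>" "\<Omega> \<in> sets lebesgue"
  shows "bounded_form (lebesgue_on \<Omega>) q"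
  unfolding bounded_form_def
proof (intro conjI allI impI)
  fix f :: "'a \<Rightarrow> 'b" and g :: "'a \<Rightarrow> 'c"
  assume [measurable]: "f \<in> borel_measurable (lebesgue_on \<Omega>)" "g \<in> borel_measurable (lebesgue_on \<Omega>)"
  have id[measurable]: "(\<lambda>x. x) \<in> borel_measurable (lebesgue_on \<Omega>)"
    by (rule measurable_restrict_space1) (auto intro: measurable_completion)
  have "(\<lambda>x. (x, f x, g x)) \<in> borel_measurable (lebesgue_on \<Omega>)"
    unfolding borel_prod[symmetric] by measurable
  moreover have "(\<lambda>(x, p, r). q x p r) \<in> borel_measurable borel"
    using cont by (rule borel_measurable_continuous_onI)
  ultimately show "(\<lambda>x. q x (f x) (g x)) \<in> borel_measurable (lebesgue_on \<Omega>)"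
    using measurable_compose[of "\<lambda>x. (x, f x, g x)" "lebesgue_on \<Omega>" borel "\<lambda>(x, p, r). q x p r" borel]
    by simp
next
  let ?K = "closure \<Omega> \<times> sphere (0::'b) 1 \<times> sphere (0::'c) 1"
  have "compact ((\<lambda>(x, p, r). q x p r) ` ?K)"
    using assms by (intro compact_continuous_image continuous_on_subset[OF cont] compact_Times) auto
  then obtain C where C: "C > 0" "\<And>y. y \<in> (\<lambda>(x, p, r). q x p r) ` ?K \<Longrightarrow> norm y \<le> C"
    using compact_imp_bounded bounded_pos by metis
  have "\<bar>q x p r\<bar> \<le> C * (norm p * norm r)" if "x \<in> space (lebesgue_on \<Omega>)" for x p r
  proof (cases "p = 0 \<or> r = 0")
    case True
    then show ?thesis
      using bil[of x] by (auto simp: bilinear_lzero bilinear_rzero)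
  next
    case False
    have "x \<in> closure \<Omega>"
      using that closure_subset[of \<Omega>] by auto
    then have "(x, p /\<^sub>R norm p, r /\<^sub>R norm r) \<in> ?K"
      using False by simp
    then have "\<bar>q x (p /\<^sub>R norm p) (r /\<^sub>R norm r)\<bar> \<le> C"
      using C(2)[OF imageI] by fastforce
    then show ?thesis
      using False bil[of x] by (simp add: bilinear_lmul bilinear_rmul abs_mult field_simps)
  qed
  then show "\<exists>C\<ge>0. \<forall>x\<in>space (lebesgue_on \<Omega>). \<forall>p r. \<bar>q x p r\<bar> \<le> C * (norm p * norm r)"
    using less_imp_le[OF C(1)] by blast
qed (use bil in auto)

lemma bounded_op_continuous:
  fixes A :: "'a::euclidean_space \<Rightarrow> 'b::euclidean_space \<Rightarrow> 'c::euclidean_space"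
  assumes lin: "\<And>x. linear (A x)" and cont: "continuous_on UNIV (\<lambda>(x, p). A x p)"
    and "bounded \<Omega>" "\<Omega> \<in> sets lebesgue"
  shows "bounded_op (lebesgue_on \<Omega>) A"
  unfolding bounded_op_def
proof (intro conjI allI impI)
  fix f :: "'a \<Rightarrow> 'b"
  assume [measurable]: "f \<in> borel_measurable (lebesgue_on \<Omega>)"
  have id[measurable]: "(\<lambda>x. x) \<in> borel_measurable (lebesgue_on \<Omega>)"
    by (rule measurable_restrict_space1) (auto intro: measurable_completion)
  have "(\<lambda>x. (x, f x)) \<in> borel_measurable (lebesgue_on \<Omega>)"
    unfolding borel_prod[symmetric] by measurable
  moreover have "(\<lambda>(x, p). A x p) \<in> borel_measurable borel"
    using cont by (rule borel_measurable_continuous_onI)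
  ultimately show "(\<lambda>x. A x (f x)) \<in> borel_measurable (lebesgue_on \<Omega>)"
    using measurable_compose[of "\<lambda>x. (x, f x)" "lebesgue_on \<Omega>" borel "\<lambda>(x, p). A x p" borel]
    by simp
next
  let ?K = "closure \<Omega> \<times> sphere (0::'b) 1"
  have "compact ((\<lambda>(x, p). A x p) ` ?K)"
    using assms by (intro compact_continuous_image continuous_on_subset[OF cont] compact_Times) auto
  then obtain C where C: "C > 0" "\<And>y. y \<in> (\<lambda>(x, p). A x p) ` ?K \<Longrightarrow> norm y \<le> C"
    using compact_imp_bounded bounded_pos by metis
  have "norm (A x p) \<le> C * norm p" if "x \<in> space (lebesgue_on \<Omega>)" for x p
  proof (cases "p = 0")
    case True
    then show ?thesis
      using lin[of x] by (simp add: linear_0)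
  next
    case False
    have "x \<in> closure \<Omega>"
      using that closure_subset[of \<Omega>] by auto
    then have "(x, p /\<^sub>R norm p) \<in> ?K"
      using False by simp
    then have "norm (A x (p /\<^sub>R norm p)) \<le> C"
      using C(2)[OF imageI] by fastforce
    then show ?thesis
      using False lin[of x] by (simp add: linear_scale field_simps)
  qed
  then show "\<exists>C\<ge>0. \<forall>x\<in>space (lebesgue_on \<Omega>). \<forall>p. norm (A x p) \<le> C * norm p"
    using less_imp_le[OF C(1)] by blast
qed (use lin in auto)

section \<open>Functions of class \<open>C^k\<close> on the whole space\<close>

lemma C_k_Suc_imp: "C_k (Suc k) f S \<Longrightarrow> C_k k f S"
proof (induction k arbitrary: f)
  case 0
  have "f differentiable (at x within S)" if "x \<in> S" for x
    by (rule differentiable_at_withinI) (use 0 that in simp)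
  then show ?case
    by (simp add: differentiable_imp_continuous_on differentiable_on_def)
qed auto

lemma C_k_le: "C_k k f S \<Longrightarrow> j \<le> k \<Longrightarrow> C_k j f S"
  by (induction k) (auto simp: le_Suc_eq simp del: C_k.simps dest: C_k_Suc_imp)

lemma C_k_imp_continuous: "C_k k f S \<Longrightarrow> continuous_on S f"
  using C_k_le[of k f S 0] by simp

lemma C_k_SucI:
  assumes "\<And>x. (f has_derivative (D x)) (at x)" "\<And>v. C_k k (\<lambda>x. D x v) UNIV"
  shows "C_k (Suc k) f UNIV"
proof -
  have "frechet_derivative f (at x) = D x" for x
    using frechet_derivative_at[OF assms(1)] by simp
  with assms show ?thesis by (auto simp: differentiable_def)
qed

lemma C_k_Suc_has_derivative:
  "C_k (Suc k) f UNIV \<Longrightarrow> (f has_derivative frechet_derivative f (at x)) (at x)"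
  by (simp flip: frechet_derivative_works)

lemma C_k_Suc_derivative: "C_k (Suc k) f UNIV \<Longrightarrow> C_k k (\<lambda>x. frechet_derivative f (at x) v) UNIV"
  by simp

lemma C_k_const: "C_k k (\<lambda>_. c) UNIV"
proof (induction k arbitrary: c)
  case (Suc k)
  show ?case by (rule C_k_SucI[OF has_derivative_const Suc])
qed simp

lemma C_k_add: "C_k k f UNIV \<Longrightarrow> C_k k g UNIV \<Longrightarrow> C_k k (\<lambda>x. f x + g x) UNIV"
proof (induction k arbitrary: f g)
  case (Suc k)
  show ?case
    by (rule C_k_SucI[OF has_derivative_add[OF Suc.prems[THEN C_k_Suc_has_derivative]]])
       (use Suc in auto)
qed (auto intro: continuous_intros)

lemma C_k_bounded_linear: "bounded_linear l \<Longrightarrow> C_k k f UNIV \<Longrightarrow> C_k k (\<lambda>x. l (f x)) UNIV"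
proof (induction k arbitrary: f)
  case (Suc k)
  show ?case
    by (rule C_k_SucI[OF bounded_linear.has_derivative[OF Suc.prems(1) C_k_Suc_has_derivative[OF Suc.prems(2)]]])
       (use Suc in auto)
qed (auto intro: bounded_linear.continuous_on)

lemma C_k_linear: "bounded_linear l \<Longrightarrow> C_k k l UNIV"
proof (induction k)
  case (Suc k)
  show ?case
    by (rule C_k_SucI[OF bounded_linear_imp_has_derivative[OF Suc.prems] C_k_const])
qed (auto intro: linear_continuous_on)

lemma C_k_bilinear:
  assumes "bounded_bilinear B"
  shows "C_k k f UNIV \<Longrightarrow> C_k k g UNIV \<Longrightarrow> C_k k (\<lambda>x. B (f x) (g x)) UNIV"
proof (induction k arbitrary: f g)
  case 0
  then show ?case using assms by (auto intro: bounded_bilinear.continuous_on)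
next
  case (Suc k)
  show ?case
    by (rule C_k_SucI[OF bounded_bilinear.FDERIV[OF assms Suc.prems[THEN C_k_Suc_has_derivative]]])
       (use Suc C_k_Suc_imp[of k f] C_k_Suc_imp[of k g] in \<open>auto intro!: C_k_add\<close>)
qed

lemmas C_k_mult = C_k_bilinear[OF bounded_bilinear_mult]
lemmas C_k_scaleR = C_k_bilinear[OF bounded_bilinear_scaleR]

lemma C_k_uminus: "C_k k f UNIV \<Longrightarrow> C_k k (\<lambda>x. - f x) UNIV"
  by (rule C_k_bounded_linear[OF bounded_linear_minus[OF bounded_linear_ident]])

lemma C_k_diff: "C_k k f UNIV \<Longrightarrow> C_k k g UNIV \<Longrightarrow> C_k k (\<lambda>x. f x - g x) UNIV"
  using C_k_add[OF _ C_k_uminus, of k f g] by simp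

lemma C_k_sum: "(\<And>i. i \<in> I \<Longrightarrow> C_k k (f i) UNIV) \<Longrightarrow> C_k k (\<lambda>x. \<Sum>i\<in>I. f i x) UNIV"
  by (induction I rule: infinite_finite_induct) (auto intro: C_k_const C_k_add)

lemma C_k_prod: "(\<And>i. i \<in> I \<Longrightarrow> C_k k (f i) UNIV) \<Longrightarrow> C_k k (\<lambda>x. \<Prod>i\<in>I. f i x :: real) UNIV"
  by (induction I rule: infinite_finite_induct) (auto intro: C_k_const C_k_mult)

lemma C_k_compose_real:
  fixes g :: "real \<Rightarrow> real"
  shows "C_k k g UNIV \<Longrightarrow> C_k k f UNIV \<Longrightarrow> C_k k (\<lambda>x. g (f x)) UNIV"
proof (induction k arbitrary: g f)
  case 0
  then show ?case by (auto intro: continuous_on_compose2)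
next
  case (Suc k)
  let ?g' = "\<lambda>t. frechet_derivative g (at t) 1"
  have lin: "frechet_derivative g (at t) s = ?g' t * s" for s t
    using linear_scale[OF has_derivative_linear[OF C_k_Suc_has_derivative[OF Suc.prems(1)]], of t s 1]
    by simp
  show ?case
  proof (rule C_k_SucI)
    show "((\<lambda>x. g (f x)) has_derivative (\<lambda>v. ?g' (f x) * frechet_derivative f (at x) v)) (at x)" for x
      using diff_chain_at[OF C_k_Suc_has_derivative[OF Suc.prems(2), of x]
          C_k_Suc_has_derivative[OF Suc.prems(1)]] lin[abs_def]
      by (simp add: o_def)
    show "C_k k (\<lambda>x. ?g' (f x) * frechet_derivative f (at x) v) UNIV" for v
      by (intro C_k_mult Suc.IH[OF C_k_Suc_derivative[OF Suc.prems(1)] C_k_Suc_imp[OF Suc.prems(2)]]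
          C_k_Suc_derivative Suc.prems)
  qed
qed

lemma C_k_exp: "C_k k (exp :: real \<Rightarrow> real) UNIV"
proof (induction k)
  case (Suc k)
  have "((exp :: real \<Rightarrow> real) has_derivative (\<lambda>v. exp x * v)) (at x)" for x
    using DERIV_exp[of x] by (simp add: has_field_derivative_def mult_commute_abs)
  then show ?case
    by (rule C_k_SucI) (intro C_k_mult Suc C_k_const)
qed (auto intro: continuous_intros)

lemma smooth_on_imp_C_k: "smooth_on f UNIV \<Longrightarrow> C_k k f UNIV"
  by (simp add: smooth_on_def)

section \<open>Gradients\<close>

lemma frechet_eq_grad:
  fixes f :: "real^'n \<Rightarrow> real"
  assumes "f differentiable (at x)"
  shows "frechet_derivative f (at x) v = grad f x \<bullet> v"
proof -
  have lin: "linear (frechet_derivative f (at x))"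
    using assms by (simp add: frechet_derivative_works has_derivative_linear)
  have "frechet_derivative f (at x) v = frechet_derivative f (at x) (\<Sum>i\<in>UNIV. v $ i *\<^sub>R axis i 1)"
    using basis_expansion[of v] by (simp add: scalar_mult_eq_scaleR)
  also have "\<dots> = grad f x \<bullet> v"
    using lin by (simp add: linear_sum linear_scale grad_def inner_vec_def mult.commute)
  finally show ?thesis .
qed

lemma has_derivative_grad:
  fixes f :: "real^'n \<Rightarrow> real"
  assumes "f differentiable (at x)"
  shows "(f has_derivative (\<lambda>v. grad f x \<bullet> v)) (at x)"
  using assms frechet_eq_grad[OF assms, abs_def] by (metis (no_types) frechet_derivative_works ext)

lemma grad_eqI:
  fixes f :: "real^'n \<Rightarrow> real"
  assumes "(f has_derivative (\<lambda>v. d \<bullet> v)) (at x)"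
  shows "grad f x = d"
  unfolding grad_def frechet_derivative_at[OF assms, symmetric]
  by (simp add: vec_eq_iff inner_axis)

lemma C_k_differentiable: "C_k (Suc k) f UNIV \<Longrightarrow> f differentiable (at x)"
  by simp

lemma grad_add:
  fixes f g :: "real^'n \<Rightarrow> real"
  assumes "f differentiable (at x)" "g differentiable (at x)"
  shows "grad (\<lambda>x. f x + g x) x = grad f x + grad g x"
  by (rule grad_eqI)
     (use has_derivative_add[OF assms[THEN has_derivative_grad]] in \<open>simp add: inner_add_left\<close>)

lemma grad_mult:
  fixes f g :: "real^'n \<Rightarrow> real"
  assumes "f differentiable (at x)" "g differentiable (at x)"
  shows "grad (\<lambda>x. f x * g x) x = f x *\<^sub>R grad g x + g x *\<^sub>R grad f x"
  by (rule grad_eqI)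
     (use has_derivative_mult[OF assms[THEN has_derivative_grad]]
      in \<open>simp add: inner_add_left mult.commute\<close>)

lemma grad_cmult:
  fixes f :: "real^'n \<Rightarrow> real"
  assumes "f differentiable (at x)"
  shows "grad (\<lambda>x. c * f x) x = c *\<^sub>R grad f x"
  by (rule grad_eqI)
     (use has_derivative_mult_right[OF has_derivative_grad[OF assms]] in simp)

lemma continuous_grad:
  fixes f :: "real^'n \<Rightarrow> real"
  assumes "C_k (Suc k) f UNIV"
  shows "continuous_on UNIV (grad f)"
  unfolding grad_def[abs_def]
  by (intro continuous_on_vec_lambda C_k_imp_continuous[of k] C_k_Suc_derivative assms)

lemma grad_nth_C_k:
  fixes f :: "real^'n \<Rightarrow> real"
  assumes "C_k (Suc k) f UNIV"
  shows "C_k k (\<lambda>x. grad f x $ i) UNIV"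
  using assms by (simp add: grad_def)

lemma C_k_vec:
  fixes F :: "'a::euclidean_space \<Rightarrow> real^'n"
  assumes "\<And>i. C_k k (\<lambda>x. F x $ i) UNIV"
  shows "C_k k F UNIV"
proof -
  have "C_k k (\<lambda>x. \<Sum>i\<in>UNIV. (F x $ i) *\<^sub>R (axis i 1 :: real^'n)) UNIV"
    by (intro C_k_sum C_k_scaleR C_k_const assms)
  moreover have "(\<Sum>i\<in>UNIV. (F x $ i) *\<^sub>R (axis i 1 :: real^'n)) = F x" for x
    using basis_expansion[of "F x"] by (simp add: scalar_mult_eq_scaleR)
  ultimately show ?thesis by simp
qed

lemma grad_eq_0_outside:
  fixes f :: "real^'n \<Rightarrow> real"
  assumes "closed K" "\<And>y. y \<notin> K \<Longrightarrow> f y = 0" "x \<notin> K"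
  shows "grad f x = 0"
proof (rule grad_eqI)
  have "((\<lambda>_. 0 :: real) has_derivative (\<lambda>v. 0 \<bullet> v)) (at x)"
    by simp
  then show "(f has_derivative (\<lambda>v. 0 \<bullet> v)) (at x)"
    by (rule has_derivative_transform_within_open[where s="- K"]) (use assms in auto)
qed

section \<open>Test functions\<close>

text \<open>The classical flat function exp(-1/t), extended by zero, times powers of 1/t. With the
  powers included, derivatives are linear combinations of members of the family, so that smoothness
  follows by one induction for all \<open>j\<close> at once.\<close>

definition flat_fun :: "nat \<Rightarrow> real \<Rightarrow> real" where
  "flat_fun j t = (if 0 < t then inverse t ^ j * exp (- inverse t) else 0)"

lemma flat_fun_tendsto_0: "(flat_fun j \<longlongrightarrow> 0) (at 0)"
proof (rule filterlim_split_at)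
  show "(flat_fun j \<longlongrightarrow> 0) (at_left 0)"
    by (rule tendsto_eventually) (auto simp: flat_fun_def eventually_at_filter)
  have "((\<lambda>t. inverse t ^ j / exp (inverse t)) \<longlongrightarrow> (0::real)) (at_right 0)"
    by (rule filterlim_compose[OF tendsto_power_div_exp_0 filterlim_inverse_at_top_right])
  then show "(flat_fun j \<longlongrightarrow> 0) (at_right 0)"
    by (rule Lim_transform_eventually)
       (auto simp: flat_fun_def eventually_at_filter exp_minus divide_inverse)
qed

lemma flat_fun_has_derivative:
  "(flat_fun j has_field_derivative (- real j * flat_fun (j + 1) t + flat_fun (j + 2) t)) (at t)"
proof (cases t "0::real" rule: linorder_cases)
  case less
  have "((\<lambda>_. 0) has_field_derivative 0) (at t)" by simp
  then have "(flat_fun j has_field_derivative 0) (at t)"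
    by (rule has_field_derivative_transform_within_open[where S="{..<0}"]) (use less in \<open>auto simp: flat_fun_def\<close>)
  then show ?thesis using less by (simp add: flat_fun_def)
next
  case equal
  \<comment> \<open>The difference quotient of \<open>flat_fun j\<close> at 0 is
    \<open>flat_fun (j + 1)\<close>, whose limit is known.\<close>
  have "((\<lambda>h. (flat_fun j (0 + h) - flat_fun j 0) / h) \<longlongrightarrow> 0) (at 0)"
    by (rule Lim_transform_eventually[OF flat_fun_tendsto_0[of "j + 1"]])
       (auto simp: flat_fun_def eventually_at_filter field_simps)
  then show ?thesis
    using equal by (simp add: DERIV_def flat_fun_def)
next
  case greater
  have "((\<lambda>t. inverse t ^ j * exp (- inverse t)) has_field_derivative
      (- real j * flat_fun (j + 1) t + flat_fun (j + 2) t)) (at t)"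
  proof (cases j)
    case (Suc m)
    \<comment> \<open>Truncated subtraction in the power rule: the two exponents can disagree only
      for \<open>m = 0\<close>.\<close>
    have "inverse t ^ m \<noteq> inverse t * inverse t ^ (m - Suc 0) \<Longrightarrow> m = 0"
      by (cases m) auto
    with Suc show ?thesis
      using greater
      by (auto intro!: derivative_eq_intros simp: flat_fun_def power2_eq_square algebra_simps)
  qed (use greater in \<open>auto intro!: derivative_eq_intros simp: flat_fun_def power2_eq_square\<close>)
  then show ?thesis
    by (rule has_field_derivative_transform_within_open[where S="{0<..}"]) (use greater in \<open>auto simp: flat_fun_def\<close>)
qed

lemma C_k_flat_fun: "C_k k (flat_fun j) UNIV"
proof (induction k arbitrary: j)
  case 0
  have "isCont (flat_fun j) t" for t
    using flat_fun_has_derivative by (rule DERIV_isCont)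
  then show ?case by (simp add: continuous_at_imp_continuous_on)
next
  case (Suc k)
  show ?case
  proof (rule C_k_SucI)
    show "(flat_fun j has_derivative (*) (- real j * flat_fun (j + 1) t + flat_fun (j + 2) t)) (at t)" for t
      using flat_fun_has_derivative by (simp add: has_field_derivative_def)
    show "C_k k (\<lambda>t. (- real j * flat_fun (j + 1) t + flat_fun (j + 2) t) * v) UNIV" for v
      by (intro C_k_mult C_k_add C_k_const Suc)
  qed
qed

definition box_bump :: "real^'n \<Rightarrow> real^'n \<Rightarrow> real^'n \<Rightarrow> real" where
  "box_bump a b x = (\<Prod>i\<in>UNIV. flat_fun 0 (x $ i - a $ i) * flat_fun 0 (b $ i - x $ i))"

lemma box_bump_nonneg: "0 \<le> box_bump a b x"
  by (auto simp: box_bump_def flat_fun_def intro!: prod_nonneg)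

lemma box_bump_pos: "x \<in> box a b \<Longrightarrow> 0 < box_bump a b x"
  by (auto simp: box_bump_def flat_fun_def mem_box_cart intro!: prod_pos)

lemma box_bump_eq_0:
  assumes "x \<notin> box a b"
  shows "box_bump a b x = 0"
proof -
  obtain i where "\<not> (a $ i < x $ i \<and> x $ i < b $ i)"
    using assms by (auto simp: mem_box_cart)
  then have "flat_fun 0 (x $ i - a $ i) * flat_fun 0 (b $ i - x $ i) = 0"
    by (auto simp: flat_fun_def)
  then show ?thesis
    unfolding box_bump_def by (intro prod_zero) auto
qed

lemma C_k_box_bump: "C_k k (box_bump a b) UNIV"
proof -
  have lin: "C_k k (\<lambda>x::real^'n. x $ i) UNIV" for i
    by (rule C_k_linear[OF bounded_linear_vec_nth])
  show ?thesis
    unfolding box_bump_def[abs_def]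
    by (intro C_k_prod C_k_mult C_k_compose_real[OF C_k_flat_fun] C_k_diff lin C_k_const)
qed

lemma test_functionsI:
  "(\<And>k. C_k k \<phi> UNIV) \<Longrightarrow> compact K \<Longrightarrow> K \<subseteq> \<Omega> \<Longrightarrow> (\<And>x. x \<notin> K \<Longrightarrow> \<phi> x = 0) \<Longrightarrow> \<phi> \<in> test_functions \<Omega>"
  unfolding test_functions_def smooth_on_def by blast

lemma test_functions_C_k: "\<phi> \<in> test_functions \<Omega> \<Longrightarrow> C_k k \<phi> UNIV"
  by (simp add: test_functions_def smooth_on_def)

lemma test_functions_support:
  assumes "\<phi> \<in> test_functions \<Omega>"
  obtains K where "compact K" "K \<subseteq> \<Omega>" "\<And>x. x \<notin> K \<Longrightarrow> \<phi> x = 0"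
  using assms unfolding test_functions_def by blast

lemma test_functions_0: "(\<lambda>_. 0) \<in> test_functions \<Omega>"
  by (rule test_functionsI[of _ "{}"]) (auto intro: C_k_const simp del: C_k.simps)

lemma test_functions_add:
  assumes "\<phi> \<in> test_functions \<Omega>" "\<psi> \<in> test_functions \<Omega>"
  shows "(\<lambda>x. \<phi> x + \<psi> x) \<in> test_functions \<Omega>"
proof -
  obtain K where K: "compact K" "K \<subseteq> \<Omega>" "\<And>x. x \<notin> K \<Longrightarrow> \<phi> x = 0"
    using assms(1) by (rule test_functions_support) blast
  obtain L where L: "compact L" "L \<subseteq> \<Omega>" "\<And>x. x \<notin> L \<Longrightarrow> \<psi> x = 0"
    using assms(2) by (rule test_functions_support) blast
  show ?thesis
  proof (rule test_functionsI)
    show "C_k k (\<lambda>x. \<phi> x + \<psi> x) UNIV" for k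
      by (intro C_k_add assms[THEN test_functions_C_k])
    show "compact (K \<union> L)" "K \<union> L \<subseteq> \<Omega>"
      using K L by auto
    show "\<phi> x + \<psi> x = 0" if "x \<notin> K \<union> L" for x
      using K(3) L(3) that by auto
  qed
qed

lemma test_functions_mult:
  assumes "\<phi> \<in> test_functions \<Omega>" "\<And>k. C_k k c UNIV"
  shows "(\<lambda>x. c x * \<phi> x) \<in> test_functions \<Omega>"
proof -
  obtain K where K: "compact K" "K \<subseteq> \<Omega>" "\<And>x. x \<notin> K \<Longrightarrow> \<phi> x = 0"
    using assms(1) by (rule test_functions_support) blast
  show ?thesis
  proof (rule test_functionsI)
    show "C_k k (\<lambda>x. c x * \<phi> x) UNIV" for k
      by (intro C_k_mult assms(2) test_functions_C_k[OF assms(1)])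
  qed (use K in auto)
qed

section \<open>The fundamental lemma of the calculus of variations\<close>

text \<open>By Lindelof, \<open>U\<close> is a countable union of open boxes whose closures lie in
  \<open>U\<close>. If s_m is the sum of the first m bumps, then 1 - exp(-m s_m) is smooth, lies
  between 0 and 1, is supported in finitely many closed boxes, and tends to 1 wherever some bump is
  positive.\<close>

lemma open_approx_test_functions:
  fixes U :: "(real^'n) set"
  assumes "open U" "U \<subseteq> \<Omega>"
  obtains \<phi> where "\<And>m::nat. \<phi> m \<in> test_functions \<Omega>" "\<And>m x. \<bar>\<phi> m x\<bar> \<le> 1"
    "\<And>x. (\<lambda>m. \<phi> m x) \<longlonglongrightarrow> indicator U x"
proof -
  define F where "F = {box a b | a b :: real^'n. cbox a b \<subseteq> U}"
  obtain F' where F': "F' \<subseteq> F" "countable F'" "\<Union>F' = \<Union>F"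
    using Lindelof[of F] by (auto simp: F_def)
  have "\<Union>F = U"
  proof
    show "\<Union>F \<subseteq> U" using box_subset_cbox by (fastforce simp: F_def)
    show "U \<subseteq> \<Union>F"
    proof
      fix x assume "x \<in> U"
      then obtain a b where "x \<in> box a b" "cbox a b \<subseteq> U"
        using assms(1) open_contains_cbox[of U x] by metis
      then show "x \<in> \<Union>F" by (auto simp: F_def)
    qed
  qed
  have "box 1 (0::real^'n) = {}" "cbox 1 (0::real^'n) = {}"
    by (auto simp: interval_eq_empty_cart)
  then have "{} \<in> F"
    unfolding F_def by (metis (mono_tags, lifting) empty_subsetI mem_Collect_eq)
  \<comment> \<open>The empty box keeps the enumerated family nonempty even when \<open>U\<close> is
    empty.\<close>
  define G where "G = from_nat_into (insert {} F')"
  have range_G: "range G = insert {} F'"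
    unfolding G_def by (rule range_from_nat_into) (use F' in auto)
  have "G i \<in> F" for i
    using range_G F'(1) \<open>{} \<in> F\<close> rangeI[of G i] by auto
  then have "\<forall>i. \<exists>a b. G i = box a b \<and> cbox a b \<subseteq> U"
    unfolding F_def by simp
  then obtain a b where ab: "\<And>i. G i = box (a i) (b i)" "\<And>i. cbox (a i) (b i) \<subseteq> U"
    by metis
  have U: "U = (\<Union>i. box (a i) (b i))"
    using range_G \<open>\<Union>F = U\<close> F'(3) ab(1) by auto
  define s where "s m x = (\<Sum>i<m. box_bump (a i) (b i) x)" for m x
  define \<phi> where "\<phi> m x = 1 - exp (- (real m * s m x))" for m x
  have s0: "0 \<le> s m x" for m x
    by (auto simp: s_def intro!: sum_nonneg box_bump_nonneg)
  have s_out: "s m x = 0" if "\<And>i. i < m \<Longrightarrow> x \<notin> box (a i) (b i)" for m x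
    using that by (simp add: s_def box_bump_eq_0)
  have "\<phi> m \<in> test_functions \<Omega>" for m
  proof (rule test_functionsI)
    show "C_k k (\<phi> m) UNIV" for k
      unfolding \<phi>_def[abs_def] s_def
      by (intro C_k_diff C_k_const C_k_compose_real[OF C_k_exp] C_k_uminus C_k_mult C_k_sum C_k_box_bump)
    show "compact (\<Union>i<m. cbox (a i) (b i))" by auto
    show "(\<Union>i<m. cbox (a i) (b i)) \<subseteq> \<Omega>" using ab(2) assms(2) by blast
    show "\<phi> m x = 0" if "x \<notin> (\<Union>i<m. cbox (a i) (b i))" for x
    proof -
      have "s m x = 0"
        using that by (intro s_out) (auto dest: subsetD[OF box_subset_cbox])
      then show ?thesis by (simp add: \<phi>_def)
    qed
  qed
  moreover have "\<bar>\<phi> m x\<bar> \<le> 1" for m x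
    using s0[of m x] by (simp add: \<phi>_def)
  moreover have "(\<lambda>m. \<phi> m x) \<longlonglongrightarrow> indicator U x" for x
  proof (cases "x \<in> U")
    case True
    then obtain i where i: "x \<in> box (a i) (b i)" using U by auto
    define c where "c = box_bump (a i) (b i) x"
    have c: "c > 0" using i by (simp add: c_def box_bump_pos)
    have ge: "c \<le> s m x" if "m > i" for m
      unfolding c_def s_def using that by (intro member_le_sum) (auto intro: box_bump_nonneg)
    have "(\<lambda>m. exp (- c) ^ m) \<longlonglongrightarrow> 0"
      using c by (intro LIMSEQ_power_zero) simp
    then have "(\<lambda>m. exp (- (c * real m))) \<longlonglongrightarrow> 0"
      by (simp add: mult.commute flip: exp_of_nat_mult)
    then have "(\<lambda>m. exp (- (real m * s m x))) \<longlonglongrightarrow> 0"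
    proof (rule tendsto_sandwich[OF _ _ tendsto_const, rotated -1])
      show "\<forall>\<^sub>F m in sequentially. exp (- (real m * s m x)) \<le> exp (- (c * real m))"
        using eventually_gt_at_top[of i]
        by eventually_elim (use ge in \<open>auto simp: mult.commute intro!: mult_left_mono\<close>)
    qed auto
    then have "(\<lambda>m. 1 - exp (- (real m * s m x))) \<longlonglongrightarrow> 1 - 0"
      by (intro tendsto_intros)
    then show ?thesis using True by (simp add: \<phi>_def)
  next
    case False
    then have "s m x = 0" for m using U by (intro s_out) auto
    then show ?thesis using False by (simp add: \<phi>_def)
  qed
  ultimately show ?thesis using that by blast
qed

text \<open>The vanishing integral passes from test functions to open sets, by decreasing
  intersections to G_delta sets, hence to all measurable sets modulo null sets, and in the end to
  the sets where \<open>h\<close> is positive or negative.\<close>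

lemma lebesgue_on_open_ae_eq_0:
  fixes h :: "real^'n \<Rightarrow> real"
  assumes op: "open \<Omega>" and h: "integrable (lebesgue_on \<Omega>) h"
    and zero: "\<And>\<phi>. \<phi> \<in> test_functions \<Omega> \<Longrightarrow> (LINT x|lebesgue_on \<Omega>. h x * \<phi> x) = 0"
  shows "AE x in lebesgue_on \<Omega>. h x = 0"
proof -
  let ?M = "lebesgue_on \<Omega>"
  have hm[measurable]: "h \<in> borel_measurable ?M" using h by auto
  have sets: "\<Omega> \<in> sets lebesgue" using op by auto
  have meas_ind: "(\<lambda>x. h x * indicator A x) \<in> borel_measurable ?M" if "A \<in> sets lebesgue" for A
  proof -
    have "indicator A \<in> borel_measurable ?M"
      using that by (intro measurable_restrict_space1) simp
    then show ?thesis by measurable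
  qed
  have open_zero: "(LINT x|?M. h x * indicator U x) = 0" if "open U" "U \<subseteq> \<Omega>" for U
  proof -
    obtain \<phi> where \<phi>: "\<And>m::nat. \<phi> m \<in> test_functions \<Omega>" "\<And>m x. \<bar>\<phi> m x\<bar> \<le> 1"
      "\<And>x. (\<lambda>m. \<phi> m x) \<longlonglongrightarrow> indicator U x"
      using open_approx_test_functions[OF \<open>open U\<close> \<open>U \<subseteq> \<Omega>\<close>] by blast
    have "(\<lambda>m. LINT x|?M. h x * \<phi> m x) \<longlonglongrightarrow> (LINT x|?M. h x * indicator U x)"
    proof (rule integral_dominated_convergence[where w="\<lambda>x. \<bar>h x\<bar>"])
      show "(\<lambda>x. h x * indicator U x) \<in> borel_measurable ?M"
        using that by (intro meas_ind) auto
      show "(\<lambda>x. h x * \<phi> m x) \<in> borel_measurable ?M" for m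
      proof -
        have "\<phi> m \<in> borel_measurable ?M"
          by (rule measurable_restrict_space1, rule measurable_completion)
             (simp add: borel_measurable_continuous_onI[OF C_k_imp_continuous[OF test_functions_C_k[OF \<phi>(1)]]])
        then show ?thesis by measurable
      qed
      show "AE x in ?M. (\<lambda>m. h x * \<phi> m x) \<longlonglongrightarrow> h x * indicator U x"
        by (intro AE_I2 tendsto_intros \<phi>)
      show "AE x in ?M. norm (h x * \<phi> m x) \<le> \<bar>h x\<bar>" for m
        using \<phi>(2) by (intro AE_I2) (simp add: abs_mult mult_left_le)
    qed (use h in auto)
    then show ?thesis
      unfolding zero[OF \<phi>(1)] by (simp add: LIMSEQ_const_iff)
  qed
  have meas_zero: "(LINT x|?M. h x * indicator A x) = 0" if A: "A \<in> sets lebesgue" "A \<subseteq> \<Omega>" for A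
  proof -
    obtain C T where C: "gdelta C" "T \<in> null_sets lebesgue" "A \<union> T = C" "disjnt A T"
      using lebesgue_set_almost_gdelta[OF A(1)] by metis
    obtain F :: "nat \<Rightarrow> _" where F: "C = \<Inter>(F ` UNIV)" "\<And>i. open (F i)"
      using C(1) by (auto elim!: gdelta.cases)
    \<comment> \<open>Finite intersections make the open sets decrease to the part of the G_delta
      set in \<Omega>, which differs from \<open>A\<close> by a null set.\<close>
    define V where "V m = \<Omega> \<inter> (\<Inter>i\<le>m. F i)" for m
    have V: "open (V m)" "V m \<subseteq> \<Omega>" for m
      using op F(2) by (auto simp: V_def intro!: open_Int open_INT)
    have ind: "(\<lambda>m. indicator (V m) x :: real) \<longlonglongrightarrow> indicator (\<Omega> \<inter> C) x" for x
    proof (cases "x \<in> \<Omega> \<inter> C")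
      case True
      then show ?thesis by (auto simp: V_def F)
    next
      case False
      show ?thesis
      proof (cases "x \<in> \<Omega>")
        case True
        then obtain i where "x \<notin> F i" using False F(1) by auto
        have "\<forall>\<^sub>F m in sequentially. indicator (V m) x = (0::real)"
          using eventually_ge_at_top[of i]
          by eventually_elim (use \<open>x \<notin> F i\<close> in \<open>auto simp: V_def indicator_def\<close>)
        then show ?thesis using False by (auto intro: tendsto_eventually)
      qed (auto simp: V_def)
    qed
    have "(\<lambda>m. LINT x|?M. h x * indicator (V m) x) \<longlonglongrightarrow> (LINT x|?M. h x * indicator (\<Omega> \<inter> C) x)"
    proof (rule integral_dominated_convergence[where w="\<lambda>x. \<bar>h x\<bar>"])
      show "(\<lambda>x. h x * indicator (V m) x) \<in> borel_measurable ?M" for m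
        using V by (intro meas_ind) auto
      have "\<Omega> \<inter> C \<in> sets lebesgue"
        using sets A C(2) unfolding C(3)[symmetric] by (auto simp: null_sets_def)
      then show "(\<lambda>x. h x * indicator (\<Omega> \<inter> C) x) \<in> borel_measurable ?M"
        by (rule meas_ind)
      show "AE x in ?M. (\<lambda>m. h x * indicator (V m) x) \<longlonglongrightarrow> h x * indicator (\<Omega> \<inter> C) x"
        by (intro AE_I2 tendsto_intros ind)
      show "AE x in ?M. norm (h x * indicator (V m) x) \<le> \<bar>h x\<bar>" for m
        by (intro AE_I2) (simp add: indicator_def)
    qed (use h in auto)
    then have "(LINT x|?M. h x * indicator (\<Omega> \<inter> C) x) = 0"
      unfolding open_zero[OF V] by (simp add: LIMSEQ_const_iff)
    moreover have "(LINT x|?M. h x * indicator (\<Omega> \<inter> C) x) = (LINT x|?M. h x * indicator A x)"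
    proof (rule integral_cong_AE)
      have "\<Omega> \<inter> C \<in> sets lebesgue"
        using sets A C(2) unfolding C(3)[symmetric] by (auto simp: null_sets_def)
      then show "(\<lambda>x. h x * indicator (\<Omega> \<inter> C) x) \<in> borel_measurable ?M"
        by (rule meas_ind)
      show "(\<lambda>x. h x * indicator A x) \<in> borel_measurable ?M"
        using A by (intro meas_ind)
      have "AE x in lebesgue. x \<notin> T" using C(2) by (rule AE_not_in)
      then have "AE x in ?M. x \<notin> T"
        using sets by (simp add: AE_restrict_space_iff) (auto elim: eventually_mono)
      then show "AE x in ?M. h x * indicator (\<Omega> \<inter> C) x = h x * indicator A x"
        using AE_space by eventually_elim (use C(3) A in \<open>auto simp: indicator_def\<close>)
    qed
    ultimately show ?thesis by simp
  qed
  have half: "AE x in ?M. g x * indicator {x\<in>\<Omega>. 0 < g x} x = 0"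
    if g: "integrable ?M g" "\<And>A. A \<in> sets lebesgue \<Longrightarrow> A \<subseteq> \<Omega> \<Longrightarrow> (LINT x|?M. g x * indicator A x) = 0" for g :: "real^'n \<Rightarrow> real"
  proof -
    let ?A = "{x\<in>\<Omega>. 0 < g x}"
    have [measurable]: "g \<in> borel_measurable ?M" using g by auto
    have "{x \<in> space ?M. 0 < g x} \<in> sets ?M" by measurable
    then have A: "?A \<in> sets lebesgue"
      using sets by (auto simp: sets_restrict_space_iff)
    then have iA: "?A \<in> sets ?M" using sets by (auto simp: sets_restrict_space_iff)
    have "integrable ?M (\<lambda>x. g x * indicator ?A x)"
      using integrable_real_mult_indicator[OF iA g(1)] by (simp add: mult.commute)
    moreover have "AE x in ?M. 0 \<le> g x * indicator ?A x"
      by (intro AE_I2) (auto simp: indicator_def)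
    ultimately show ?thesis
      using integral_nonneg_eq_0_iff_AE[of ?M "\<lambda>x. g x * indicator ?A x"] g(2)[OF A] by auto
  qed
  have "AE x in ?M. h x * indicator {x\<in>\<Omega>. 0 < h x} x = 0"
    using h meas_zero by (rule half)
  moreover have "AE x in ?M. (- h x) * indicator {x\<in>\<Omega>. 0 < - h x} x = 0"
    using h meas_zero by (intro half) auto
  ultimately show ?thesis
    using AE_space
  proof eventually_elim
    case (elim x)
    then show ?case by (auto simp: indicator_def split: if_splits)
  qed
qed

section \<open>Convolutions\<close>

text \<open>The box of integration is fixed, so that all derivatives fall on \<open>h\<close> and
  \<open>w\<close> need only be continuous. Either factor of a convolution can be put in the place
  of \<open>h\<close>: the mollifier, to see smoothness, or the function, to see the
  gradient.\<close>

lemma convolution_has_derivative: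
  fixes w h :: "real^'n \<Rightarrow> real"
  assumes w: "continuous_on UNIV w" and h: "C_k (Suc k) h UNIV"
  shows "((\<lambda>x. integral (cbox a b) (\<lambda>z. w z * h (x - z))) has_derivative
      (\<lambda>v. integral (cbox a b) (\<lambda>z. w z * frechet_derivative h (at (x - z)) v))) (at x)"
proof -
  have [continuous_intros]: "continuous_on A (\<lambda>y. h (f y))" "continuous_on A (\<lambda>y. grad h (f y))"
    if "continuous_on A f" for f :: "'z::topological_space \<Rightarrow> real^'n" and A
    by (rule continuous_on_compose2[OF C_k_imp_continuous[OF h] that subset_UNIV],
        rule continuous_on_compose2[OF continuous_grad[OF h] that subset_UNIV])
  have [continuous_intros]: "continuous_on A (\<lambda>y. w (f y))"
    if "continuous_on A f" for f :: "'z::topological_space \<Rightarrow> real^'n" and A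
    by (rule continuous_on_compose2[OF w that subset_UNIV])
  define fx where "fx x z = w z *\<^sub>R blinfun_inner_right (grad h (x - z))" for x z
  have fx: "((\<lambda>x. w z * h (x - z)) has_derivative blinfun_apply (fx x z)) (at x within UNIV)" for x z
  proof -
    have "((\<lambda>x. x - z) has_derivative (\<lambda>v. v)) (at x)"
      by (auto intro!: derivative_eq_intros)
    from diff_chain_at[OF this has_derivative_grad[OF C_k_differentiable[OF h]]]
    have "((\<lambda>x. h (x - z)) has_derivative (\<lambda>v. grad h (x - z) \<bullet> v)) (at x)"
      by (simp add: o_def)
    from has_derivative_mult_right[OF this, of "w z"]
    have "((\<lambda>x. w z * h (x - z)) has_derivative (\<lambda>v. w z * (grad h (x - z) \<bullet> v))) (at x)" .
    moreover have "blinfun_apply (fx x z) = (\<lambda>v. w z * (grad h (x - z) \<bullet> v))"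
      by (rule ext) (simp add: fx_def blinfun.scaleR_left)
    ultimately show ?thesis by simp
  qed
  have cont: "continuous_on (UNIV \<times> cbox a b) (\<lambda>(x, z). fx x z)"
    unfolding fx_def split_beta
    by (intro continuous_intros bounded_linear.continuous_on[OF bounded_linear_blinfun_inner_right])
  have "((\<lambda>x. integral (cbox a b) (\<lambda>z. w z * h (x - z))) has_derivative
      blinfun_apply (integral (cbox a b) (fx x))) (at x within UNIV)"
    by (rule leibniz_rule[OF fx _ cont])
       (auto intro!: integrable_continuous continuous_intros)
  moreover have "blinfun_apply (integral (cbox a b) (fx x))
      = (\<lambda>v. integral (cbox a b) (\<lambda>z. w z * frechet_derivative h (at (x - z)) v))"
  proof
    fix v
    have "fx x integrable_on cbox a b"
      unfolding fx_def by (intro integrable_continuous continuous_intros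
          bounded_linear.continuous_on[OF bounded_linear_blinfun_inner_right])
    then have "blinfun_apply (integral (cbox a b) (fx x)) v = integral (cbox a b) (\<lambda>z. fx x z v)"
      by (rule blinfun_apply_integral)
    also have "\<dots> = integral (cbox a b) (\<lambda>z. w z * frechet_derivative h (at (x - z)) v)"
      by (simp add: fx_def blinfun.scaleR_left frechet_eq_grad[OF C_k_differentiable[OF h]])
    finally show "blinfun_apply (integral (cbox a b) (fx x)) v
      = integral (cbox a b) (\<lambda>z. w z * frechet_derivative h (at (x - z)) v)" .
  qed
  ultimately show ?thesis by simp
qed

lemma C_k_convolution:
  fixes w h :: "real^'n \<Rightarrow> real"
  assumes w: "continuous_on UNIV w"
  shows "C_k k h UNIV \<Longrightarrow> C_k k (\<lambda>x. integral (cbox a b) (\<lambda>z. w z * h (x - z))) UNIV"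
proof (induction k arbitrary: h)
  case 0
  then have h: "continuous_on UNIV h" by simp
  show ?case
    by (simp, rule integral_continuous_on_param, unfold split_beta,
        intro continuous_intros continuous_on_compose2[OF h _ subset_UNIV]
          continuous_on_compose2[OF w _ subset_UNIV])
next
  case (Suc k)
  show ?case
    by (rule C_k_SucI[OF convolution_has_derivative[OF w Suc.prems]])
       (rule Suc.IH[OF C_k_Suc_derivative[OF Suc.prems]])
qed

lemma lborel_distr_reflect: "distr lborel borel (\<lambda>y. x - y) = (lborel :: 'a::euclidean_space measure)"
  by (subst lborel_affine[of "-1" x]) (auto simp: density_1)

lemma lborel_integral_reflect:
  fixes f :: "'a::euclidean_space \<Rightarrow> real"
  assumes "f \<in> borel_measurable borel"
  shows "(LINT y|lborel. f (x - y)) = (LINT y|lborel. f y)"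
proof -
  have "(LINT y|lborel. f y) = (LINT y|distr lborel borel (\<lambda>y. x - y). f y)"
    by (simp add: lborel_distr_reflect)
  also have "\<dots> = (LINT y|lborel. f (x - y))"
    using assms by (subst integral_distr) auto
  finally show ?thesis by simp
qed

lemma integral_cbox_eq_lborel:
  fixes f :: "'a::euclidean_space \<Rightarrow> real"
  assumes f: "continuous_on UNIV f" and "\<And>x. x \<notin> cbox a b \<Longrightarrow> f x = 0"
  shows "integral (cbox a b) f = (LINT x|lborel. f x)"
proof -
  have "set_integrable lborel (cbox a b) f"
    unfolding set_integrable_def
    by (rule borel_integrable_compact) (use f in \<open>auto intro: continuous_on_subset\<close>)
  then have "integral (cbox a b) f = (LINT x:cbox a b|lborel. f x)"
    by (rule set_borel_integral_eq_integral(2)[symmetric])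
  also have "\<dots> = (LINT x|lborel. f x)"
    unfolding set_lebesgue_integral_def
    by (rule Bochner_Integration.integral_cong) (use assms(2) in \<open>auto simp: indicator_def\<close>)
  finally show ?thesis .
qed

lemma compact_support_cbox:
  fixes K :: "(real^'n) set"
  assumes "compact K" "0 \<le> r"
  obtains a b where "\<And>x y. y \<in> K \<Longrightarrow> norm (x - y) \<le> r \<Longrightarrow> x \<in> cbox a b"
proof -
  have comp: "compact {x + y | x y. x \<in> K \<and> y \<in> cball 0 r}"
    by (intro compact_sums assms compact_cball)
  obtain a where a: "{x + y | x y. x \<in> K \<and> y \<in> cball 0 r} \<subseteq> cbox (- a) a"
    by (rule bounded_subset_cbox_symmetric[OF compact_imp_bounded[OF comp]])
  have "x \<in> cbox (- a) a" if "y \<in> K" "norm (x - y) \<le> r" for x y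
  proof -
    have "y + (x - y) \<in> {x + y | x y. x \<in> K \<and> y \<in> cball 0 r}"
      using that by (intro CollectI exI[of _ y] exI[of _ "x - y"]) auto
    then show ?thesis using a by auto
  qed
  then show ?thesis using that by blast
qed

text \<open>Near \<open>x = 0\<close> the convolution of \<open>1\<close> with a compactly supported \<open>h\<close> is constant.\<close>

lemma lborel_integral_grad_eq_0:
  fixes h :: "real^'n \<Rightarrow> real"
  assumes h: "C_k (Suc 0) h UNIV" and K: "compact K" "\<And>x. x \<notin> K \<Longrightarrow> h x = 0"
  shows "(LINT x|lborel. grad h x $ i) = 0"
proof -
  have K': "compact (uminus ` K)"
    using K(1) by (intro compact_continuous_image continuous_intros) auto
  \<comment> \<open>Reflection and radius 1: the box then contains every z with x - z in
    \<open>K\<close>, for all x in the unit ball at once, so that the convolution can be compared at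
    nearby points.\<close>
  obtain a b where ab: "\<And>x y. y \<in> uminus ` K \<Longrightarrow> norm (x - y) \<le> 1 \<Longrightarrow> x \<in> cbox a b"
    using compact_support_cbox[OF K', of 1] by auto
  have cont: "continuous_on UNIV h" by (rule C_k_imp_continuous[OF h])
  have contd: "continuous_on UNIV (\<lambda>x. grad h x $ i)"
    by (intro continuous_intros continuous_grad[OF h])
  have out: "x - z \<notin> K" if "norm x \<le> 1" "z \<notin> cbox a b" for x z
  proof
    assume "x - z \<in> K"
    then have "- (x - z) \<in> uminus ` K" by (rule imageI)
    then show False
      using ab[of "- (x - z)" z] that by simp
  qed
  have const: "integral (cbox a b) (\<lambda>z. 1 * h (x - z)) = (LINT z|lborel. h z)" if "norm x \<le> 1" for x
  proof -
    have "integral (cbox a b) (\<lambda>z. 1 * h (x - z)) = (LINT z|lborel. 1 * h (x - z))"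
      by (rule integral_cbox_eq_lborel)
         (use out[OF that] K(2) in \<open>auto intro!: continuous_intros continuous_on_compose2[OF cont _ subset_UNIV]\<close>)
    also have "\<dots> = (LINT z|lborel. h z)"
      using lborel_integral_reflect[OF borel_measurable_continuous_onI[OF cont], of x] by simp
    finally show ?thesis .
  qed
  let ?F = "\<lambda>x. integral (cbox a b) (\<lambda>z. 1 * h (x - z))"
  have "(?F has_derivative (\<lambda>v. integral (cbox a b) (\<lambda>z. 1 * frechet_derivative h (at (0 - z)) v))) (at 0)"
    by (rule convolution_has_derivative[OF continuous_on_const h])
  moreover have "(?F has_derivative (\<lambda>v. 0)) (at 0)"
    by (rule has_derivative_transform_within_open[where s="ball 0 1", OF has_derivative_const])
       (use const in auto)
  ultimately have "(\<lambda>v. integral (cbox a b) (\<lambda>z. 1 * frechet_derivative h (at (0 - z)) v)) = (\<lambda>v. 0)"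
    by (rule has_derivative_unique)
  then have "integral (cbox a b) (\<lambda>z. 1 * frechet_derivative h (at (0 - z)) (axis i 1)) = 0"
    by (rule fun_cong)
  then have "integral (cbox a b) (\<lambda>z. grad h (0 - z) $ i) = 0"
    by (simp add: grad_def)
  also have "integral (cbox a b) (\<lambda>z. grad h (0 - z) $ i) = (LINT z|lborel. grad h (0 - z) $ i)"
  proof (rule integral_cbox_eq_lborel)
    show "continuous_on UNIV (\<lambda>z. grad h (0 - z) $ i)"
      by (rule continuous_on_compose2[OF contd]) (auto intro!: continuous_intros)
    show "grad h (0 - z) $ i = 0" if "z \<notin> cbox a b" for z
      using grad_eq_0_outside[of K h "0 - z", OF compact_imp_closed[OF K(1)] K(2)] out[of 0 z] that
      by simp
  qed
  also have "\<dots> = (LINT z|lborel. grad h z $ i)"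
    by (rule lborel_integral_reflect[OF borel_measurable_continuous_onI[OF contd]])
  finally show ?thesis .
qed

section \<open>Mollification\<close>

lemma mollifier_approx:
  fixes \<rho> f :: "real^'n \<Rightarrow> real"
  assumes \<rho>: "continuous_on UNIV \<rho>" "\<And>z. 0 \<le> \<rho> z" "integral (cbox a b) \<rho> = 1"
    and f: "continuous_on UNIV f" and e: "\<And>z. z \<in> cbox a b \<Longrightarrow> \<bar>f (x - z) - f x\<bar> \<le> e"
  shows "\<bar>integral (cbox a b) (\<lambda>z. \<rho> z * f (x - z)) - f x\<bar> \<le> e"
proof -
  have [continuous_intros]: "continuous_on A \<rho>" "continuous_on A (\<lambda>z. f (x - z))" for A
    by (rule continuous_on_subset[OF \<rho>(1) subset_UNIV],
        intro continuous_on_compose2[OF f _ subset_UNIV] continuous_intros)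
  have "integral (cbox a b) (\<lambda>z. \<rho> z * f (x - z)) - f x
      = integral (cbox a b) (\<lambda>z. \<rho> z * f (x - z)) - integral (cbox a b) (\<lambda>z. \<rho> z * f x)"
    using \<rho>(3) by simp
  also have "\<dots> = integral (cbox a b) (\<lambda>z. \<rho> z * f (x - z) - \<rho> z * f x)"
    by (rule Henstock_Kurzweil_Integration.integral_diff[symmetric])
       (auto intro!: integrable_continuous continuous_intros)
  also have "norm \<dots> \<le> integral (cbox a b) (\<lambda>z. \<rho> z * e)"
  proof (rule integral_norm_bound_integral)
    fix z assume "z \<in> cbox a b"
    then show "norm (\<rho> z * f (x - z) - \<rho> z * f x) \<le> \<rho> z * e"
      using e[of z] \<rho>(2)[of z] by (simp add: abs_mult mult_left_mono flip: right_diff_distrib)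
  qed (auto intro!: integrable_continuous continuous_intros)
  also have "\<dots> = e" using \<rho>(3) by simp
  finally show ?thesis by simp
qed

lemma cube_mollifier:
  fixes r :: real
  assumes "0 < r"
  obtains \<rho> :: "real^'n \<Rightarrow> real" where "\<And>k. C_k k \<rho> UNIV" "\<And>z. 0 \<le> \<rho> z"
    "integral (cbox (\<chi> i. - r) (\<chi> i. r)) \<rho> = 1" "\<And>z. z \<notin> cbox (\<chi> i. - r) (\<chi> i. r) \<Longrightarrow> \<rho> z = 0"
proof -
  let ?a = "(\<chi> i. - r) :: real^'n" and ?b = "(\<chi> i. r) :: real^'n"
  have ne: "0 \<in> box ?a ?b"
    using assms by (simp add: mem_box_cart)
  have cont: "continuous_on A (box_bump ?a ?b)" for A
    using C_k_imp_continuous[OF C_k_box_bump[of 0 ?a ?b]] by (rule continuous_on_subset) simp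
  have "integral (cbox ?a ?b) (box_bump ?a ?b) \<noteq> 0"
    using integral_cbox_eq_0_iff[OF cont, of ?a ?b] ne box_bump_nonneg[of ?a ?b] box_bump_pos[OF ne]
      box_subset_cbox by fastforce
  then have I: "integral (cbox ?a ?b) (box_bump ?a ?b) > 0"
    using Henstock_Kurzweil_Integration.integral_nonneg[OF integrable_continuous[OF cont], of ?a ?b]
      box_bump_nonneg[of ?a ?b] by (metis less_eq_real_def)
  show ?thesis
  proof (rule that)
    let ?\<rho> = "\<lambda>z. box_bump ?a ?b z / integral (cbox ?a ?b) (box_bump ?a ?b)"
    show "C_k k ?\<rho> UNIV" for k
      unfolding divide_inverse by (intro C_k_mult C_k_box_bump C_k_const)
    show "0 \<le> ?\<rho> z" for z
      using I box_bump_nonneg[of ?a ?b z] by simp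
    show "integral (cbox ?a ?b) ?\<rho> = 1"
      using I by simp
    show "?\<rho> z = 0" if "z \<notin> cbox ?a ?b" for z
      using that box_bump_eq_0[of z ?a ?b] box_subset_cbox[of ?a ?b] by auto
  qed
qed

lemma norm_le_in_cube:
  assumes "z \<in> cbox (\<chi> i. - r) ((\<chi> i. r) :: real^'n)"
  shows "norm z \<le> real CARD('n) * r"
proof -
  have "norm z \<le> (\<Sum>i\<in>UNIV. \<bar>z $ i\<bar>)" by (rule norm_le_l1_cart)
  also have "\<dots> \<le> (\<Sum>i\<in>(UNIV::'n set). r)"
    by (rule sum_mono) (use assms in \<open>auto simp: mem_box_cart abs_le_iff minus_le_iff\<close>)
  finally show ?thesis by simp
qed

text \<open>With the derivatives on the mollifier the convolution is smooth; with the derivative on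
  \<open>g\<close> its gradient is the mollified gradient of \<open>g\<close>. Both estimates then
  follow from the uniform continuity of (g, grad g).\<close>

lemma test_function_C1_approx:
  fixes g :: "real^'n \<Rightarrow> real"
  assumes \<Omega>: "open \<Omega>" "bounded \<Omega>" and g: "C_k (Suc 0) g UNIV"
    and K: "compact K" "K \<subseteq> \<Omega>" "\<And>x. x \<notin> K \<Longrightarrow> g x = 0" and e: "0 < e"
  obtains \<phi> where "\<phi> \<in> test_functions \<Omega>" "\<And>x. x \<in> \<Omega> \<Longrightarrow> \<bar>\<phi> x - g x\<bar> \<le> e"
    "\<And>x i. x \<in> \<Omega> \<Longrightarrow> \<bar>grad \<phi> x $ i - grad g x $ i\<bar> \<le> e"
proof -
  have cg: "continuous_on UNIV g" and cdg: "continuous_on UNIV (grad g)"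
    using C_k_imp_continuous[OF g] continuous_grad[OF g] by auto
  obtain d where d: "d > 0" "(\<Union>x\<in>K. cball x d) \<subseteq> \<Omega>"
    using compact_subset_open_imp_cball_epsilon_subset[OF K(1) \<Omega>(1) K(2)] by metis
  obtain R where R: "\<And>x. x \<in> \<Omega> \<Longrightarrow> norm x \<le> R"
    using \<Omega>(2) unfolding bounded_iff by auto
  have uc: "uniformly_continuous_on (cball 0 (R + d)) (\<lambda>x. (g x, grad g x))"
    by (intro compact_uniformly_continuous continuous_on_Pair continuous_on_subset[OF cg]
        continuous_on_subset[OF cdg] compact_cball) auto
  then obtain s where s: "s > 0" "\<And>x y. x \<in> cball 0 (R + d) \<Longrightarrow> y \<in> cball 0 (R + d) \<Longrightarrow> dist y x < s \<Longrightarrow>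
      dist (g y, grad g y) (g x, grad g x) < e"
    using e unfolding uniformly_continuous_on_def by metis
  define n where "n = real CARD('n)"
  have n: "n > 0" by (simp add: n_def)
  \<comment> \<open>Vectors in the cube of half side r have norm at most n r. This is at most d,
    which keeps the support inside \<Omega>, and less than s, which belongs to \<open>e\<close> in
    the uniform continuity of (g, grad g).\<close>
  define r where "r = min d (s / 2) / n"
  have r: "r > 0" and rn: "n * r = min d (s / 2)" using d s n by (auto simp: r_def)
  let ?a = "(\<chi> i. - r) :: real^'n" and ?b = "(\<chi> i. r) :: real^'n"
  obtain \<rho> :: "real^'n \<Rightarrow> real" where \<rho>: "\<And>k. C_k k \<rho> UNIV" "\<And>z. 0 \<le> \<rho> z"
    "integral (cbox ?a ?b) \<rho> = 1" "\<And>z. z \<notin> cbox ?a ?b \<Longrightarrow> \<rho> z = 0"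
    using cube_mollifier[OF r] by blast
  have c\<rho>: "continuous_on UNIV \<rho>" using \<rho>(1)[of 0] by simp
  have small: "norm z \<le> d \<and> norm z < s" if "z \<in> cbox ?a ?b" for z
    using norm_le_in_cube[OF that] rn s(1) by (auto simp: n_def min_def split: if_splits)
  have near: "dist (g (x - z), grad g (x - z)) (g x, grad g x) < e" if "x \<in> \<Omega>" "z \<in> cbox ?a ?b" for x z
  proof (rule s(2))
    show "x \<in> cball 0 (R + d)" using R[OF that(1)] d(1) by simp
    show "x - z \<in> cball 0 (R + d)"
      using R[OF that(1)] small[OF that(2)] norm_triangle_ineq4[of x z] by simp
    show "dist (x - z) x < s" using small[OF that(2)] by (simp add: dist_norm)
  qed
  define p where "p x = integral (cbox ?a ?b) (\<lambda>z. \<rho> z * g (x - z))" for x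
  obtain a b where ab: "\<And>x y. y \<in> K \<Longrightarrow> norm (x - y) \<le> 0 \<Longrightarrow> x \<in> cbox a b"
    using compact_support_cbox[OF K(1), of 0] by auto
  have p_eq: "p x = integral (cbox a b) (\<lambda>y. g y * \<rho> (x - y))" for x
  proof -
    have "p x = (LINT z|lborel. \<rho> z * g (x - z))"
      unfolding p_def
      by (rule integral_cbox_eq_lborel)
         (use \<rho>(4) in \<open>auto intro!: continuous_intros continuous_on_compose2[OF cg _ subset_UNIV] c\<rho>\<close>)
    also have "\<dots> = (LINT y|lborel. g y * \<rho> (x - y))"
    proof -
      have "continuous_on UNIV (\<lambda>y. g y * \<rho> (x - y))"
        by (auto intro!: continuous_intros continuous_on_compose2[OF c\<rho> _ subset_UNIV] cg)
      from lborel_integral_reflect[OF borel_measurable_continuous_onI[OF this], of x]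
      show ?thesis by (simp add: mult.commute)
    qed
    also have "\<dots> = integral (cbox a b) (\<lambda>y. g y * \<rho> (x - y))"
      by (rule integral_cbox_eq_lborel[symmetric])
         (use ab K(3) in \<open>auto intro!: continuous_intros continuous_on_compose2[OF c\<rho> _ subset_UNIV] cg\<close>)
    finally show ?thesis .
  qed
  have test: "p \<in> test_functions \<Omega>"
  proof (rule test_functionsI)
    show "C_k k p UNIV" for k
      unfolding p_eq[abs_def] by (rule C_k_convolution[OF cg \<rho>(1)])
    let ?L = "{x + y | x y. x \<in> K \<and> y \<in> cball 0 d}"
    show "compact ?L" by (intro compact_sums K compact_cball)
    show "?L \<subseteq> \<Omega>"
    proof clarify
      fix x y assume "x \<in> K" "y \<in> cball (0::real^'n) d"
      then have "x + y \<in> (\<Union>x\<in>K. cball x d)"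
        by (intro UN_I[of x]) (auto simp: dist_norm)
      then show "x + y \<in> \<Omega>" using d(2) by blast
    qed
    show "p x = 0" if x: "x \<notin> ?L" for x
    proof -
      have "g (x - z) = 0" if "z \<in> cbox ?a ?b" for z
      proof (rule K(3), rule notI)
        assume "x - z \<in> K"
        moreover have "z \<in> cball 0 d" using small[OF that] by simp
        ultimately have "(x - z) + z \<in> ?L" by blast
        then show False using x by simp
      qed
      then show ?thesis
        unfolding p_def using Henstock_Kurzweil_Integration.integral_cong[of "cbox ?a ?b" "\<lambda>z. \<rho> z * g (x - z)" "\<lambda>_. 0"]
        by simp
    qed
  qed
  have "\<bar>p x - g x\<bar> \<le> e" if "x \<in> \<Omega>" for x
    unfolding p_def
  proof (rule mollifier_approx[OF c\<rho> \<rho>(2,3) cg])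
    fix z assume "z \<in> cbox ?a ?b"
    then show "\<bar>g (x - z) - g x\<bar> \<le> e"
      using near[OF that, of z] dist_fst_le[of "(g (x - z), grad g (x - z))" "(g x, grad g x)"]
      by (simp add: dist_real_def)
  qed
  moreover have "\<bar>grad p x $ i - grad g x $ i\<bar> \<le> e" if "x \<in> \<Omega>" for x i
  proof -
    have "frechet_derivative p (at x) = (\<lambda>v. integral (cbox ?a ?b) (\<lambda>z. \<rho> z * frechet_derivative g (at (x - z)) v))"
      using frechet_derivative_at[OF convolution_has_derivative[OF c\<rho> g, of ?a ?b x]]
      unfolding p_def[abs_def] by simp
    then have "grad p x $ i = integral (cbox ?a ?b) (\<lambda>z. \<rho> z * (grad g (x - z) $ i))"
      by (simp add: grad_def)
    also have "\<bar>\<dots> - grad g x $ i\<bar> \<le> e"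
    proof (rule mollifier_approx[OF c\<rho> \<rho>(2,3)])
      show "continuous_on UNIV (\<lambda>x. grad g x $ i)" by (intro continuous_intros cdg)
      fix z assume "z \<in> cbox ?a ?b"
      then show "\<bar>grad g (x - z) $ i - grad g x $ i\<bar> \<le> e"
        using near[OF that, of z] dist_snd_le[of "(g (x - z), grad g (x - z))" "(g x, grad g x)"]
          component_le_norm_cart[of "grad g (x - z) - grad g x" i]
        by (simp add: dist_norm)
    qed
    finally show ?thesis .
  qed
  ultimately show ?thesis using that test by blast
qed

section \<open>The space \<open>H^1_0\<close> as a space of jets\<close>

text \<open>A function \<open>f\<close> of \<open>H^1_0\<close> is represented by the field \<open>x \<mapsto> (f x, grad f x)\<close>; the norm of the
  representing field is the \<open>H^1\<close>-norm of \<open>f\<close>.\<close>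

definition jet :: "(real^'n \<Rightarrow> real) \<Rightarrow> real^'n \<Rightarrow> real \<times> (real^'n)" where
  "jet f x = (f x, grad f x)"

definition W0 :: "(real^'n) set \<Rightarrow> (real^'n \<Rightarrow> real \<times> (real^'n)) set" where
  "W0 \<Omega> = L2_closure (lebesgue_on \<Omega>) (jet ` test_functions \<Omega>)"

lemma norm_prod_sq: "(norm p)\<^sup>2 = (norm (fst p))\<^sup>2 + (norm (snd p))\<^sup>2"
  by (simp add: norm_prod_def)

lemma continuous_jet: "C_k (Suc k) f UNIV \<Longrightarrow> continuous_on UNIV (jet f)"
  unfolding jet_def[abs_def]
  by (intro continuous_on_Pair continuous_grad C_k_imp_continuous)

locale bounded_open =
  fixes \<Omega> :: "(real^'n) set"
  assumes open_\<Omega>: "open \<Omega>" and bounded_\<Omega>: "bounded \<Omega>"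
begin

abbreviation "M \<equiv> lebesgue_on \<Omega>"

lemma \<Omega>_sets [simp, intro]: "\<Omega> \<in> sets lebesgue"
  using open_\<Omega> by auto

lemma finite_measure_M: "finite_measure M"
  using bounded_\<Omega> \<Omega>_sets by (intro finite_measure_lebesgue_on lmeasurable_open open_\<Omega>)

lemma continuous_measurable_M:
  fixes f :: "real^'n \<Rightarrow> 'b::euclidean_space"
  assumes "continuous_on UNIV f"
  shows "f \<in> borel_measurable M"
  using borel_measurable_continuous_onI[OF assms]
  by (intro measurable_restrict_space1 measurable_completion) simp

lemma continuous_bounded_on_\<Omega>:
  fixes f :: "real^'n \<Rightarrow> 'b::euclidean_space"
  assumes "continuous_on UNIV f"
  obtains C where "0 \<le> C" "\<And>x. x \<in> \<Omega> \<Longrightarrow> norm (f x) \<le> C"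
proof -
  have "compact (f ` closure \<Omega>)"
    using bounded_\<Omega> by (intro compact_continuous_image continuous_on_subset[OF assms]) auto
  then obtain C where C: "\<And>y. y \<in> f ` closure \<Omega> \<Longrightarrow> norm y \<le> C"
    using compact_imp_bounded bounded_iff by metis
  have "norm (f x) \<le> max C 0" if "x \<in> \<Omega>" for x
    using C[OF imageI[OF subsetD[OF closure_subset that]]] by simp
  then show ?thesis using that[of "max C 0"] by simp
qed

lemma continuous_L2:
  fixes f :: "real^'n \<Rightarrow> 'b::euclidean_space"
  assumes "continuous_on UNIV f"
  shows "f \<in> L2 M"
proof -
  obtain C where C: "0 \<le> C" "\<And>x. x \<in> \<Omega> \<Longrightarrow> norm (f x) \<le> C"
    using continuous_bounded_on_\<Omega>[OF assms] by blast
  interpret finite_measure M by (rule finite_measure_M)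
  have one: "(\<lambda>_. 1::real) \<in> L2 M"
    by (simp add: L2_def)
  show ?thesis
    by (rule L2I_bound[where C=C, OF continuous_measurable_M[OF assms] one]) (use C(2) in simp)
qed

lemma L2_integrable:
  fixes f :: "real^'n \<Rightarrow> 'b::euclidean_space"
  assumes "f \<in> L2 M"
  shows "integrable M f"
proof -
  have "(\<lambda>_. 1::real) \<in> L2 M" by (rule continuous_L2) simp
  from integrable_norm_mult[OF assms this] show ?thesis
    using L2D(1)[OF assms] by (simp add: integrable_norm_iff)
qed

lemma jet_test_L2: "jet ` test_functions \<Omega> \<subseteq> L2 M"
  by (auto intro!: continuous_L2 continuous_jet[OF test_functions_C_k] simp del: C_k.simps)

lemma W0_L2: "j \<in> W0 \<Omega> \<Longrightarrow> j \<in> L2 M"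
  unfolding W0_def by (rule L2_closure_L2)

lemma jet_test_W0: "\<phi> \<in> test_functions \<Omega> \<Longrightarrow> jet \<phi> \<in> W0 \<Omega>"
  unfolding W0_def using L2_closure_incl[OF jet_test_L2] by blast

lemma subspace_jet_test: "subspace (jet ` test_functions \<Omega>)"
proof (rule subspaceI)
  have "jet (\<lambda>_::real^'n. 0) = 0"
    by (simp add: fun_eq_iff jet_def prod_eq_iff grad_def vec_eq_iff)
  then show "0 \<in> jet ` test_functions \<Omega>"
    using test_functions_0 by (metis image_eqI)
next
  fix p r assume "p \<in> jet ` test_functions \<Omega>" "r \<in> jet ` test_functions \<Omega>"
  then obtain \<phi> \<psi> where *: "\<phi> \<in> test_functions \<Omega>" "\<psi> \<in> test_functions \<Omega>" "p = jet \<phi>" "r = jet \<psi>"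
    by blast
  have "p + r = jet (\<lambda>x. \<phi> x + \<psi> x)"
    using C_k_differentiable[OF test_functions_C_k[OF *(1)]] C_k_differentiable[OF test_functions_C_k[OF *(2)]]
    by (simp add: * fun_eq_iff jet_def grad_add)
  then show "p + r \<in> jet ` test_functions \<Omega>"
    using test_functions_add[OF *(1,2)] by blast
next
  fix c p assume "p \<in> jet ` test_functions \<Omega>"
  then obtain \<phi> where *: "\<phi> \<in> test_functions \<Omega>" "p = jet \<phi>" by blast
  have "c *\<^sub>R p = jet (\<lambda>x. c * \<phi> x)"
    using C_k_differentiable[OF test_functions_C_k[OF *(1)]]
    by (simp add: * fun_eq_iff jet_def grad_cmult)
  then show "c *\<^sub>R p \<in> jet ` test_functions \<Omega>"
    using test_functions_mult[OF *(1) C_k_const] by blast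
qed

lemma subspace_W0: "subspace (W0 \<Omega>)"
  unfolding W0_def by (rule subspace_L2_closure[OF jet_test_L2 subspace_jet_test])

lemma W0_closed:
  "j \<in> L2 M \<Longrightarrow> (\<And>m. J m \<in> W0 \<Omega>) \<Longrightarrow> (\<lambda>m. sqn M (J m - j)) \<longlonglongrightarrow> 0 \<Longrightarrow> j \<in> W0 \<Omega>"
  unfolding W0_def by (rule L2_closure_closed[OF jet_test_L2])

lemma sqn_le_sup:
  fixes f :: "real^'n \<Rightarrow> 'b::euclidean_space"
  assumes "f \<in> L2 M" "\<And>x. x \<in> \<Omega> \<Longrightarrow> norm (f x) \<le> C"
  shows "sqn M f \<le> C\<^sup>2 * measure M \<Omega>"
proof -
  have one: "(\<lambda>_. 1::real) \<in> L2 M" by (rule continuous_L2) simp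
  have "sqn M f \<le> C\<^sup>2 * sqn M (\<lambda>_. 1::real)"
    by (rule sqn_le_bound[OF assms(1) one]) (use assms(2) in simp)
  then show ?thesis by (simp add: sqn_def)
qed

section \<open>Multiplication by functions of class C^1\<close>

text \<open>The weight and the coefficients made from it are not smooth, so their products with test
  functions are not test functions. Mollification brings these products back into the
  closure.\<close>

lemma C1_compact_support_W0:
  assumes g: "C_k (Suc 0) g UNIV" and K: "compact K" "K \<subseteq> \<Omega>" "\<And>x. x \<notin> K \<Longrightarrow> g x = 0"
  shows "jet g \<in> W0 \<Omega>"
  unfolding W0_def
proof (subst L2_closure_iff)
  show jg: "jet g \<in> L2 M" by (rule continuous_L2[OF continuous_jet[OF g]])
  show "\<forall>e>0. \<exists>j\<in>jet ` test_functions \<Omega>. sqn M (j - jet g) < e"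
  proof (intro allI impI)
    fix e :: real assume e: "0 < e"
    define n where "n = real CARD('n)"
    define m where "m = measure M \<Omega> + 1"
    have m: "0 < m" by (simp add: m_def add_nonneg_pos)
    \<comment> \<open>The jets differ by at most (1 + n) d in norm, one d for the value and one for
      each partial derivative, and m exceeds the volume of \<Omega>.\<close>
    define d where "d = sqrt (e / m) / (1 + n)"
    have n: "0 < 1 + n" by (simp add: n_def add_pos_nonneg)
    have d: "0 < d" using e m n by (simp add: d_def)
    obtain \<phi> where \<phi>: "\<phi> \<in> test_functions \<Omega>" "\<And>x. x \<in> \<Omega> \<Longrightarrow> \<bar>\<phi> x - g x\<bar> \<le> d"
      "\<And>x i. x \<in> \<Omega> \<Longrightarrow> \<bar>grad \<phi> x $ i - grad g x $ i\<bar> \<le> d"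
      using test_function_C1_approx[OF open_\<Omega> bounded_\<Omega> g K d] by blast
    have j\<phi>: "jet \<phi> \<in> L2 M" using \<phi>(1) jet_test_L2 by blast
    have "norm ((jet \<phi> - jet g) x) \<le> sqrt (e / m)" if x: "x \<in> \<Omega>" for x
    proof -
      have "norm ((jet \<phi> - jet g) x) \<le> norm (\<phi> x - g x) + norm (grad \<phi> x - grad g x)"
        using norm_Pair_le[of "\<phi> x - g x" "grad \<phi> x - grad g x"] by (simp add: jet_def)
      also have "\<dots> \<le> d + (\<Sum>i\<in>(UNIV::'n set). d)"
        using \<phi>(2)[OF x] \<phi>(3)[OF x]
        by (intro add_mono order_trans[OF norm_le_l1_cart] sum_mono) auto
      also have "\<dots> = (1 + n) * d"
        by (simp add: n_def algebra_simps)
      also have "\<dots> = sqrt (e / m)"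
        using n by (simp add: d_def)
      finally show ?thesis .
    qed
    then have "sqn M (jet \<phi> - jet g) \<le> (sqrt (e / m))\<^sup>2 * measure M \<Omega>"
      by (rule sqn_le_sup[OF L2_diff[OF j\<phi> jg]])
    also have "\<dots> < e"
      using e m by (simp add: m_def field_simps)
    finally show "\<exists>j\<in>jet ` test_functions \<Omega>. sqn M (j - jet g) < e"
      using \<phi>(1) by blast
  qed
qed

text \<open>The Leibniz rule: applied to the jet of a differentiable f, this gives the jet of c
  f.\<close>

definition mult_jet :: "(real^'n \<Rightarrow> real) \<Rightarrow> real^'n \<Rightarrow> real \<times> (real^'n) \<Rightarrow> real \<times> (real^'n)" where
  "mult_jet c x p = (c x * fst p, c x *\<^sub>R snd p + fst p *\<^sub>R grad c x)"

lemma bounded_op_mult_jet: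
  assumes c: "C_k (Suc 0) c UNIV"
  shows "bounded_op M (mult_jet c)"
proof (rule bounded_op_continuous[OF _ _ bounded_\<Omega> \<Omega>_sets])
  show "linear (mult_jet c x)" for x
    by (rule linearI) (auto simp: mult_jet_def algebra_simps)
  have "continuous_on UNIV (\<lambda>p::(real^'n) \<times> real \<times> (real^'n). c (fst p))"
    "continuous_on UNIV (\<lambda>p::(real^'n) \<times> real \<times> (real^'n). grad c (fst p))"
    by (rule continuous_on_compose2[OF C_k_imp_continuous[OF c] _ subset_UNIV], intro continuous_intros,
        rule continuous_on_compose2[OF continuous_grad[OF c] _ subset_UNIV], intro continuous_intros)
  then show "continuous_on UNIV (\<lambda>(x, p). mult_jet c x p)"
    unfolding mult_jet_def split_beta by (intro continuous_intros)
qed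

lemma mult_jet_W0:
  assumes c: "C_k (Suc 0) c UNIV" and j: "j \<in> W0 \<Omega>"
  shows "(\<lambda>x. mult_jet c x (j x)) \<in> W0 \<Omega>"
  unfolding W0_def
proof (rule bounded_op_closure[OF bounded_op_mult_jet[OF c] jet_test_L2 jet_test_L2 _ j[unfolded W0_def]])
  fix f assume "f \<in> jet ` test_functions \<Omega>"
  then obtain \<phi> where \<phi>: "\<phi> \<in> test_functions \<Omega>" "f = jet \<phi>" by blast
  obtain K where K: "compact K" "K \<subseteq> \<Omega>" "\<And>x. x \<notin> K \<Longrightarrow> \<phi> x = 0"
    using \<phi>(1) by (rule test_functions_support) blast
  have "(\<lambda>x. mult_jet c x (f x)) = jet (\<lambda>x. c x * \<phi> x)"
    using C_k_differentiable[OF test_functions_C_k[OF \<phi>(1)]] C_k_differentiable[OF c]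
    by (simp add: \<phi>(2) fun_eq_iff jet_def mult_jet_def grad_mult)
  also have "\<dots> \<in> W0 \<Omega>"
    by (rule C1_compact_support_W0[OF C_k_mult[OF c test_functions_C_k[OF \<phi>(1)]] K(1,2)])
       (simp add: K(3))
  finally show "(\<lambda>x. mult_jet c x (f x)) \<in> L2_closure M (jet ` test_functions \<Omega>)"
    by (simp add: W0_def)
qed

section \<open>Integration by parts for scalar jets\<close>

lemma integral_M_eq_lborel:
  fixes f :: "real^'n \<Rightarrow> real"
  assumes "f \<in> borel_measurable borel" "\<And>x. x \<notin> \<Omega> \<Longrightarrow> f x = 0"
  shows "(LINT x|M. f x) = (LINT x|lborel. f x)"
proof -
  have "(LINT x|M. f x) = (LINT x|lebesgue. indicator \<Omega> x *\<^sub>R f x)"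
    by (rule integral_restrict_space) simp
  also have "\<dots> = (LINT x|lebesgue. f x)"
    by (rule Bochner_Integration.integral_cong) (use assms(2) in \<open>auto simp: indicator_def\<close>)
  also have "\<dots> = (LINT x|lborel. f x)"
    by (rule integral_completion) (use assms(1) in simp)
  finally show ?thesis .
qed

lemma integral_test_grad_eq_0:
  assumes "\<psi> \<in> test_functions \<Omega>"
  shows "(LINT x|M. grad \<psi> x $ i) = 0"
proof -
  obtain K where K: "compact K" "K \<subseteq> \<Omega>" "\<And>x. x \<notin> K \<Longrightarrow> \<psi> x = 0"
    using assms by (rule test_functions_support) blast
  have C: "C_k (Suc 0) \<psi> UNIV" by (rule test_functions_C_k[OF assms])
  have "(LINT x|M. grad \<psi> x $ i) = (LINT x|lborel. grad \<psi> x $ i)"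
  proof (rule integral_M_eq_lborel)
    show "(\<lambda>x. grad \<psi> x $ i) \<in> borel_measurable borel"
      by (intro borel_measurable_continuous_onI continuous_intros continuous_grad[OF C])
    show "grad \<psi> x $ i = 0" if "x \<notin> \<Omega>" for x
    proof -
      have "x \<notin> K" using K(2) that by blast
      then show ?thesis
        using grad_eq_0_outside[of K \<psi> x, OF compact_imp_closed[OF K(1)] K(3)] by simp
    qed
  qed
  also have "\<dots> = 0" by (rule lborel_integral_grad_eq_0[OF C K(1,3)])
  finally show ?thesis .
qed

text \<open>On jets of functions f and g this is the i-th partial derivative of f g. Its integral
  vanishes for test functions and therefore, by density, on all of \<open>W0\<close>.\<close>

definition ibp_form :: "'n \<Rightarrow> real^'n \<Rightarrow> real \<times> (real^'n) \<Rightarrow> real \<times> (real^'n) \<Rightarrow> real" where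
  "ibp_form i x p r = fst p * snd r $ i + snd p $ i * fst r"

lemma bounded_ibp_form: "bounded_form M (ibp_form i)"
proof (rule bounded_form_continuous[OF _ _ bounded_\<Omega> \<Omega>_sets])
  show "bilinear (ibp_form i x)" for x
    unfolding bilinear_def by (auto intro!: linearI simp: ibp_form_def algebra_simps)
  show "continuous_on UNIV (\<lambda>(x, p, r). ibp_form i x p r)"
    unfolding ibp_form_def split_beta by (intro continuous_intros)
qed

lemma ibp_form_zero:
  assumes "j \<in> W0 \<Omega>" "l \<in> W0 \<Omega>"
  shows "bform M (ibp_form i) j l = 0"
proof (rule bform_zero_closure[OF bounded_ibp_form jet_test_L2 jet_test_L2 _ assms[unfolded W0_def]])
  fix f g assume "f \<in> jet ` test_functions \<Omega>" "g \<in> jet ` test_functions \<Omega>"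
  then obtain \<phi> \<psi> where *: "\<phi> \<in> test_functions \<Omega>" "\<psi> \<in> test_functions \<Omega>" "f = jet \<phi>" "g = jet \<psi>"
    by blast
  have "ibp_form i x (f x) (g x) = grad (\<lambda>x. \<phi> x * \<psi> x) x $ i" for x
    using C_k_differentiable[OF test_functions_C_k[OF *(1)]] C_k_differentiable[OF test_functions_C_k[OF *(2)]]
    by (simp add: * ibp_form_def jet_def grad_mult)
  then show "bform M (ibp_form i) f g = 0"
    using integral_test_grad_eq_0[OF test_functions_mult[OF *(2) test_functions_C_k[OF *(1)]], of i]
    by (simp add: bform_def)
qed

lemma L2_real_mult_integrable:
  fixes f g :: "real^'n \<Rightarrow> real"
  assumes "f \<in> L2 M" "g \<in> L2 M"
  shows "integrable M (\<lambda>x. f x * g x)"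
proof (rule Bochner_Integration.integrable_bound[OF integrable_norm_mult[OF assms]])
  have [measurable]: "f \<in> borel_measurable M" "g \<in> borel_measurable M"
    using assms by (auto dest: L2D(1))
  show "(\<lambda>x. f x * g x) \<in> borel_measurable M" by measurable
qed (simp add: abs_mult)

lemma L2_fst:
  fixes j :: "real^'n \<Rightarrow> 'b::euclidean_space \<times> 'c::euclidean_space"
  assumes "j \<in> L2 M"
  shows "(\<lambda>x. fst (j x)) \<in> L2 M"
proof (rule L2I_bound[where C=1, OF _ assms])
  show "(\<lambda>x. fst (j x)) \<in> borel_measurable M"
    using L2D(1)[OF assms] unfolding borel_prod[symmetric] by measurable
qed (metis mult_1 norm_fst_le prod.collapse)

lemma L2_snd:
  fixes j :: "real^'n \<Rightarrow> 'b::euclidean_space \<times> 'c::euclidean_space"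
  assumes "j \<in> L2 M"
  shows "(\<lambda>x. snd (j x)) \<in> L2 M"
proof (rule L2I_bound[where C=1, OF _ assms])
  show "(\<lambda>x. snd (j x)) \<in> borel_measurable M"
    using L2D(1)[OF assms] unfolding borel_prod[symmetric] by measurable
qed (metis mult_1 norm_snd_le prod.collapse)

lemma L2_Pair:
  fixes f :: "real^'n \<Rightarrow> 'b::euclidean_space" and g :: "real^'n \<Rightarrow> 'c::euclidean_space"
  assumes "f \<in> L2 M" "g \<in> L2 M"
  shows "(\<lambda>x. (f x, g x)) \<in> L2 M"
proof -
  have [measurable]: "f \<in> borel_measurable M" "g \<in> borel_measurable M"
    using assms by (auto dest: L2D(1))
  have "(\<lambda>x. (f x, g x)) \<in> borel_measurable M"
    unfolding borel_prod[symmetric] by measurable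
  moreover have "integrable M (\<lambda>x. (norm (f x, g x))\<^sup>2)"
    using L2D(2)[OF assms(1)] L2D(2)[OF assms(2)] by (simp add: norm_prod_sq)
  ultimately show ?thesis by (simp add: L2_def)
qed

lemma L2_nth:
  fixes f :: "real^'n \<Rightarrow> 'b::euclidean_space^'m"
  assumes "f \<in> L2 M"
  shows "(\<lambda>x. f x $ i) \<in> L2 M"
proof (rule L2I_bound[where C=1, OF _ assms])
  show "(\<lambda>x. f x $ i) \<in> borel_measurable M"
    using measurable_compose[OF L2D(1)[OF assms] borel_measurable_continuous_onI[of "\<lambda>v. v $ i"]]
    by (simp add: continuous_on_component)
qed (simp add: Finite_Cartesian_Product.norm_nth_le)

section \<open>Comparison of \<open>W0\<close> with \<open>H1_0\<close>\<close>

lemma square_integrable_iff: "square_integrable \<Omega> f \<longleftrightarrow> f \<in> L2 M"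
  for f :: "real^'n \<Rightarrow> 'b::euclidean_space"
  by (simp add: square_integrable_def L2_def)

lemma ae_eq_0_test:
  fixes h :: "real^'n \<Rightarrow> real"
  shows "integrable M h \<Longrightarrow> (\<And>\<phi>. \<phi> \<in> test_functions \<Omega> \<Longrightarrow> (LINT x|M. h x * \<phi> x) = 0)
    \<Longrightarrow> AE x in M. h x = 0"
  by (rule lebesgue_on_open_ae_eq_0[OF open_\<Omega>])

lemma test_L2: "\<phi> \<in> test_functions \<Omega> \<Longrightarrow> \<phi> \<in> L2 M"
  by (rule continuous_L2[OF C_k_imp_continuous[OF test_functions_C_k]])

lemma has_weak_grad_weak_grad: "has_weak_grad \<Omega> f g \<Longrightarrow> has_weak_grad \<Omega> f (weak_grad \<Omega> f)"
  unfolding weak_grad_def by (rule someI[of "has_weak_grad \<Omega> f"])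

lemma weak_grad_unique:
  assumes "has_weak_grad \<Omega> f g" "has_weak_grad \<Omega> f g'"
  shows "AE x in M. g x = g' x"
proof -
  have g: "g \<in> L2 M" "g' \<in> L2 M"
    using assms by (auto simp: has_weak_grad_def square_integrable_iff)
  have "AE x in M. g x $ i - g' x $ i = 0" for i
  proof (rule ae_eq_0_test)
    show "integrable M (\<lambda>x. g x $ i - g' x $ i)"
      by (intro Bochner_Integration.integrable_diff L2_integrable L2_nth g)
    fix \<phi> assume \<phi>: "\<phi> \<in> test_functions \<Omega>"
    have "(LINT x|M. g x $ i * \<phi> x) = (LINT x|M. g' x $ i * \<phi> x)"
      using assms \<phi> by (auto simp: has_weak_grad_def)
    then show "(LINT x|M. (g x $ i - g' x $ i) * \<phi> x) = 0"
      using L2_real_mult_integrable[OF L2_nth[OF g(1)] test_L2[OF \<phi>], of i]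
        L2_real_mult_integrable[OF L2_nth[OF g(2)] test_L2[OF \<phi>], of i]
      by (simp add: left_diff_distrib)
  qed
  then have "AE x in M. \<forall>i. g x $ i - g' x $ i = 0"
    by (subst AE_all_countable) auto
  then show ?thesis
    by eventually_elim (simp add: vec_eq_iff)
qed

text \<open>Together with \<open>W0_H1_0\<close> this identifies two descriptions of the same space.
  The gradient picked by \<open>weak_grad\<close> is one representative among many; by
  \<open>weak_grad_unique\<close> any other gives the same jet almost everywhere.\<close>

lemma H1_0_jet:
  assumes "f \<in> H1_0 \<Omega>"
  shows "(\<lambda>x. (f x, weak_grad \<Omega> f x)) \<in> W0 \<Omega>"
proof -
  have "has_weak_grad \<Omega> f (weak_grad \<Omega> f)"
    using assms has_weak_grad_weak_grad unfolding H1_0_def by blast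
  then have L2: "(\<lambda>x. (f x, weak_grad \<Omega> f x)) \<in> L2 M"
    by (intro L2_Pair) (auto simp: has_weak_grad_def square_integrable_iff)
  obtain \<phi> where \<phi>: "\<And>m. \<phi> m \<in> test_functions \<Omega>"
    "(\<lambda>m::nat. LINT x|M. (\<phi> m x - f x)\<^sup>2 + (norm (grad (\<phi> m) x - weak_grad \<Omega> f x))\<^sup>2) \<longlonglongrightarrow> 0"
    using assms unfolding H1_0_def by blast
  have "(\<lambda>m. sqn M (jet (\<phi> m) - (\<lambda>x. (f x, weak_grad \<Omega> f x)))) \<longlonglongrightarrow> 0"
    using \<phi>(2) by (simp add: sqn_def jet_def norm_prod_sq)
  then show ?thesis
    unfolding W0_def using \<phi>(1) by (intro L2_closureI[OF L2 imageI])
qed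

lemma W0_has_weak_grad:
  assumes j: "j \<in> W0 \<Omega>"
  shows "has_weak_grad \<Omega> (\<lambda>x. fst (j x)) (\<lambda>x. snd (j x))"
  unfolding has_weak_grad_def square_integrable_iff
proof (intro conjI ballI allI L2_fst L2_snd W0_L2 j)
  fix \<phi> i assume \<phi>: "\<phi> \<in> test_functions \<Omega>"
  note f = L2_fst[OF W0_L2[OF j]] and g = L2_nth[OF L2_snd[OF W0_L2[OF j]], of i]
  have grad: "(\<lambda>x. grad \<phi> x $ i) \<in> L2 M"
    by (intro continuous_L2 continuous_intros continuous_grad[OF test_functions_C_k[OF \<phi>, of "Suc 0"]])
  have "0 = (LINT x|M. fst (j x) * grad \<phi> x $ i + snd (j x) $ i * \<phi> x)"
    using ibp_form_zero[OF j jet_test_W0[OF \<phi>], of i] by (simp add: bform_def ibp_form_def jet_def)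
  also have "\<dots> = (LINT x|M. fst (j x) * grad \<phi> x $ i) + (LINT x|M. snd (j x) $ i * \<phi> x)"
    by (intro Bochner_Integration.integral_add L2_real_mult_integrable f g grad test_L2 \<phi>)
  finally show "(LINT x|M. fst (j x) * grad \<phi> x $ i) = - (LINT x|M. snd (j x) $ i * \<phi> x)"
    by simp
qed

lemma W0_weak_grad_ae:
  assumes j: "j \<in> W0 \<Omega>"
  shows "AE x in M. weak_grad \<Omega> (\<lambda>x. fst (j x)) x = snd (j x)"
proof (rule weak_grad_unique[OF _ W0_has_weak_grad[OF j]])
  show "has_weak_grad \<Omega> (\<lambda>x. fst (j x)) (weak_grad \<Omega> (\<lambda>x. fst (j x)))"
    by (rule has_weak_grad_weak_grad[OF W0_has_weak_grad[OF j]])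
qed

lemma W0_H1_0:
  assumes j: "j \<in> W0 \<Omega>"
  shows "(\<lambda>x. fst (j x)) \<in> H1_0 \<Omega>"
  unfolding H1_0_def
proof (intro CollectI conjI)
  show "\<exists>g. has_weak_grad \<Omega> (\<lambda>x. fst (j x)) g"
    using W0_has_weak_grad[OF j] by blast
  obtain F where F: "\<And>m. F m \<in> jet ` test_functions \<Omega>" "(\<lambda>m. sqn M (F m - j)) \<longlonglongrightarrow> 0"
    using j unfolding W0_def by (rule L2_closureE) blast
  obtain \<phi> where \<phi>: "\<And>m. \<phi> m \<in> test_functions \<Omega>" "\<And>m. F m = jet (\<phi> m)"
    using F(1) unfolding image_iff by metis
  have eq: "(LINT x|M. (\<phi> m x - fst (j x))\<^sup>2 + (norm (grad (\<phi> m) x - weak_grad \<Omega> (\<lambda>x. fst (j x)) x))\<^sup>2)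
      = sqn M (F m - j)" for m
    unfolding sqn_def
  proof (rule integral_cong_AE)
    have "has_weak_grad \<Omega> (\<lambda>x. fst (j x)) (weak_grad \<Omega> (\<lambda>x. fst (j x)))"
      by (rule has_weak_grad_weak_grad[OF W0_has_weak_grad[OF j]])
    then have [measurable]: "weak_grad \<Omega> (\<lambda>x. fst (j x)) \<in> borel_measurable M" "(\<lambda>x. fst (j x)) \<in> borel_measurable M"
      by (auto simp: has_weak_grad_def square_integrable_def)
    have [measurable]: "\<phi> m \<in> borel_measurable M" "grad (\<phi> m) \<in> borel_measurable M"
      by (rule continuous_measurable_M[OF C_k_imp_continuous[OF test_functions_C_k[OF \<phi>(1)]]],
          rule continuous_measurable_M[OF continuous_grad[OF test_functions_C_k[OF \<phi>(1)]]])
    show "(\<lambda>x. (\<phi> m x - fst (j x))\<^sup>2 + (norm (grad (\<phi> m) x - weak_grad \<Omega> (\<lambda>x. fst (j x)) x))\<^sup>2)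
        \<in> borel_measurable M"
      by measurable
    have "F m - j \<in> L2 M"
      using F(1) jet_test_L2 W0_L2[OF j] by (intro L2_diff) auto
    from L2D(1)[OF this] show "(\<lambda>x. (norm ((F m - j) x))\<^sup>2) \<in> borel_measurable M"
      by measurable
    show "AE x in M. (\<phi> m x - fst (j x))\<^sup>2 + (norm (grad (\<phi> m) x - weak_grad \<Omega> (\<lambda>x. fst (j x)) x))\<^sup>2
        = (norm ((F m - j) x))\<^sup>2"
      using W0_weak_grad_ae[OF j]
      by eventually_elim (simp add: \<phi>(2) jet_def norm_prod_sq)
  qed
  show "\<exists>\<phi>. (\<forall>m. \<phi> m \<in> test_functions \<Omega>) \<and>
      (\<lambda>m::nat. LINT x|M. (\<phi> m x - fst (j x))\<^sup>2
         + (norm (grad (\<phi> m) x - weak_grad \<Omega> (\<lambda>x. fst (j x)) x))\<^sup>2) \<longlonglongrightarrow> 0"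
    by (rule exI[of _ \<phi>]) (simp add: eq F(2) \<phi>(1))
qed

end

section \<open>Rellich's theorem\<close>

lemma nn_integral_lborel_translate:
  fixes f :: "'a::euclidean_space \<Rightarrow> ennreal"
  assumes "f \<in> borel_measurable borel"
  shows "(\<integral>\<^sup>+x. f (c + x) \<partial>lborel) = (\<integral>\<^sup>+x. f x \<partial>lborel)"
proof -
  have "(\<integral>\<^sup>+x. f x \<partial>lborel) = (\<integral>\<^sup>+x. f x \<partial>distr lborel borel ((+) c))"
    by (simp add: lborel_distr_plus)
  also have "\<dots> = (\<integral>\<^sup>+x. f (c + x) \<partial>lborel)"
    using assms by (subst nn_integral_distr) auto
  finally show ?thesis by simp
qed

lemma nn_integral_unit_interval:
  fixes f :: "real \<Rightarrow> real"
  assumes "continuous_on UNIV f" "\<And>t. 0 \<le> f t"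
  shows "(\<integral>\<^sup>+t. ennreal (f t) * indicator {0..1} t \<partial>lborel) = ennreal (integral {0..1} f)"
proof -
  have "(f has_integral integral {0..1} f) {0..1}"
    by (intro integrable_integral integrable_continuous_interval continuous_on_subset[OF assms(1)]) simp
  then have "((\<lambda>t. if t \<in> {0..1} then f t else 0) has_integral integral {0..1} f) UNIV"
    by (subst has_integral_restrict_UNIV)
  moreover have "(\<lambda>t. if t \<in> {0..1} then f t else 0) = (\<lambda>t. indicator {0..1} t * f t)"
    by (auto simp: indicator_def)
  ultimately have "((\<lambda>t. indicator {0..1} t * f t) has_integral integral {0..1} f) UNIV"
    by simp
  then have "(\<integral>\<^sup>+t. ennreal (indicator {0..1} t * f t) \<partial>lborel) = ennreal (integral {0..1} f)"
    by (intro nn_integral_has_integral_lborel)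
       (use assms borel_measurable_continuous_onI[OF assms(1)] in auto)
  moreover have "ennreal (indicator {0..1} t * f t) = ennreal (f t) * indicator {0..1} t" for t
    by (simp add: indicator_def)
  ultimately show ?thesis by simp
qed

lemma integrable_on_unit_interval: "continuous_on UNIV f \<Longrightarrow> f integrable_on {0..1}"
  for f :: "real \<Rightarrow> real"
  by (rule integrable_continuous_interval[OF continuous_on_subset[OF _ subset_UNIV]])

lemma integral_unit_interval_sq_le:
  fixes g :: "real \<Rightarrow> real"
  assumes "continuous_on UNIV g"
  shows "(integral {0..1} g)\<^sup>2 \<le> integral {0..1} (\<lambda>t. (g t)\<^sup>2)"
proof -
  define c where "c = integral {0..1} g"
  note int = integrable_on_unit_interval
  have "0 \<le> integral {0..1} (\<lambda>t. (g t - c)\<^sup>2)"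
    by (intro Henstock_Kurzweil_Integration.integral_nonneg int continuous_intros assms) simp
  also have "(\<lambda>t. (g t - c)\<^sup>2) = (\<lambda>t. (g t)\<^sup>2 - 2 * c * g t + c\<^sup>2)"
    by (simp add: power2_eq_square algebra_simps)
  also have "integral {0..1} (\<lambda>t. (g t)\<^sup>2 - 2 * c * g t + c\<^sup>2) = integral {0..1} (\<lambda>t. (g t)\<^sup>2) - 2 * c * c + c\<^sup>2"
  proof (rule integral_unique)
    have "((\<lambda>t. 2 * c * g t) has_integral 2 * c * c) {0..1}"
      unfolding c_def by (intro has_integral_mult_right integrable_integral int assms)
    moreover have "((\<lambda>t. (g t)\<^sup>2) has_integral integral {0..1} (\<lambda>t. (g t)\<^sup>2)) {0..1}"
      by (intro integrable_integral int continuous_intros assms)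
    moreover have "((\<lambda>t::real. c\<^sup>2) has_integral c\<^sup>2) {0..1}"
      using has_integral_const_real[of "c\<^sup>2" 0 1] by simp
    ultimately show "((\<lambda>t. (g t)\<^sup>2 - 2 * c * g t + c\<^sup>2) has_integral
        integral {0..1} (\<lambda>t. (g t)\<^sup>2) - 2 * c * c + c\<^sup>2) {0..1}"
      by (intro has_integral_add has_integral_diff)
  qed
  finally show ?thesis
    by (simp add: c_def power2_eq_square)
qed

text \<open>The difference is the integral of a derivative along a segment, so its square is at most
  |z|^2 times the mean of |grad \<phi>|^2 over that segment. Tonelli and translation invariance then
  remove the segment.\<close>

lemma translation_estimate:
  fixes \<phi> :: "real^'n \<Rightarrow> real"
  assumes \<phi>: "C_k (Suc 0) \<phi> UNIV"
  shows "(\<integral>\<^sup>+x. ennreal ((\<phi> (x + z) - \<phi> x)\<^sup>2) \<partial>lborel)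
    \<le> ennreal ((norm z)\<^sup>2) * (\<integral>\<^sup>+x. ennreal ((norm (grad \<phi> x))\<^sup>2) \<partial>lborel)"
proof -
  have cg: "continuous_on UNIV (grad \<phi>)" by (rule continuous_grad[OF \<phi>])
  define G where "G x = (norm (grad \<phi> x))\<^sup>2" for x
  have cG: "continuous_on UNIV G" unfolding G_def by (intro continuous_intros cg)
  have pointwise: "ennreal ((\<phi> (x + z) - \<phi> x)\<^sup>2)
      \<le> ennreal ((norm z)\<^sup>2) * (\<integral>\<^sup>+t. ennreal (G (t *\<^sub>R z + x)) * indicator {0..1} t \<partial>lborel)" for x
  proof -
    define g where "g t = grad \<phi> (t *\<^sub>R z + x) \<bullet> z" for t
    have cg': "continuous_on UNIV g"
      unfolding g_def by (intro continuous_intros continuous_on_compose2[OF cg _ subset_UNIV])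
    have "((\<lambda>t. \<phi> (t *\<^sub>R z + x)) has_vector_derivative g t) (at t within {0..1})" for t
    proof -
      have "((\<lambda>t. t *\<^sub>R z + x) has_derivative (\<lambda>h. h *\<^sub>R z)) (at t)"
        by (auto intro!: derivative_eq_intros)
      from diff_chain_at[OF this has_derivative_grad[OF C_k_differentiable[OF \<phi>]]]
      have "((\<lambda>t. \<phi> (t *\<^sub>R z + x)) has_derivative (\<lambda>h. h *\<^sub>R g t)) (at t)"
        by (simp add: o_def g_def)
      then show ?thesis
        unfolding has_vector_derivative_def by (rule has_derivative_at_withinI)
    qed
    then have "(g has_integral \<phi> (1 *\<^sub>R z + x) - \<phi> (0 *\<^sub>R z + x)) {0..1}"
      by (intro fundamental_theorem_of_calculus) auto
    then have "(\<phi> (x + z) - \<phi> x)\<^sup>2 = (integral {0..1} g)\<^sup>2"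
      by (simp add: integral_unique add.commute)
    also have "\<dots> \<le> integral {0..1} (\<lambda>t. (g t)\<^sup>2)"
      by (rule integral_unit_interval_sq_le[OF cg'])
    also have "\<dots> \<le> integral {0..1} (\<lambda>t. (norm z)\<^sup>2 * G (t *\<^sub>R z + x))"
    proof (rule integral_le)
      show "(\<lambda>t. (g t)\<^sup>2) integrable_on {0..1}"
        by (intro integrable_on_unit_interval continuous_intros cg')
      show "(\<lambda>t. (norm z)\<^sup>2 * G (t *\<^sub>R z + x)) integrable_on {0..1}"
        by (intro integrable_on_unit_interval continuous_intros
            continuous_on_compose2[OF cG _ subset_UNIV])
      show "(g t)\<^sup>2 \<le> (norm z)\<^sup>2 * G (t *\<^sub>R z + x)" for t
        using power_mono[OF Cauchy_Schwarz_ineq2[of "grad \<phi> (t *\<^sub>R z + x)" z], of 2]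
        by (simp add: g_def G_def power_mult_distrib mult.commute)
    qed
    also have "\<dots> = (norm z)\<^sup>2 * integral {0..1} (\<lambda>t. G (t *\<^sub>R z + x))"
      by simp
    finally have "ennreal ((\<phi> (x + z) - \<phi> x)\<^sup>2)
        \<le> ennreal ((norm z)\<^sup>2 * integral {0..1} (\<lambda>t. G (t *\<^sub>R z + x)))"
      by (rule ennreal_leI)
    also have "\<dots> = ennreal ((norm z)\<^sup>2) * ennreal (integral {0..1} (\<lambda>t. G (t *\<^sub>R z + x)))"
      by (rule ennreal_mult') simp
    also have "ennreal (integral {0..1} (\<lambda>t. G (t *\<^sub>R z + x)))
        = (\<integral>\<^sup>+t. ennreal (G (t *\<^sub>R z + x)) * indicator {0..1} t \<partial>lborel)"
      by (rule nn_integral_unit_interval[symmetric])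
         (auto simp: G_def intro!: continuous_intros continuous_on_compose2[OF cg _ subset_UNIV])
    finally show ?thesis .
  qed
  have Gm[measurable]: "G \<in> borel_measurable borel"
    by (rule borel_measurable_continuous_onI[OF cG])
  have "(\<integral>\<^sup>+x. ennreal ((\<phi> (x + z) - \<phi> x)\<^sup>2) \<partial>lborel)
      \<le> (\<integral>\<^sup>+x. ennreal ((norm z)\<^sup>2) * (\<integral>\<^sup>+t. ennreal (G (t *\<^sub>R z + x)) * indicator {0..1} t \<partial>lborel) \<partial>lborel)"
    by (intro nn_integral_mono pointwise)
  also have "\<dots> = ennreal ((norm z)\<^sup>2) *
      (\<integral>\<^sup>+x. (\<integral>\<^sup>+t. ennreal (G (t *\<^sub>R z + x)) * indicator {0..1} t \<partial>lborel) \<partial>lborel)"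
    by (rule nn_integral_cmult) measurable
  also have "(\<integral>\<^sup>+x. (\<integral>\<^sup>+t. ennreal (G (t *\<^sub>R z + x)) * indicator {0..1} t \<partial>lborel) \<partial>lborel)
      = (\<integral>\<^sup>+t. (\<integral>\<^sup>+x. ennreal (G (t *\<^sub>R z + x)) * indicator {0..1::real} t \<partial>lborel) \<partial>lborel)"
    by (rule lborel_pair.Fubini') measurable
  also have "\<dots> = (\<integral>\<^sup>+t. (\<integral>\<^sup>+x. ennreal (G x) \<partial>lborel) * indicator {0..1::real} t \<partial>lborel)"
  proof (rule nn_integral_cong)
    fix t :: real
    have "(\<integral>\<^sup>+x. ennreal (G (t *\<^sub>R z + x)) * indicator {0..1::real} t \<partial>lborel)
        = (\<integral>\<^sup>+x. ennreal (G (t *\<^sub>R z + x)) \<partial>lborel) * indicator {0..1::real} t"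
      by (rule nn_integral_multc) measurable
    also have "(\<integral>\<^sup>+x. ennreal (G (t *\<^sub>R z + x)) \<partial>lborel) = (\<integral>\<^sup>+x. ennreal (G x) \<partial>lborel)"
      by (rule nn_integral_lborel_translate) measurable
    finally show "(\<integral>\<^sup>+x. ennreal (G (t *\<^sub>R z + x)) * indicator {0..1::real} t \<partial>lborel)
        = (\<integral>\<^sup>+x. ennreal (G x) \<partial>lborel) * indicator {0..1::real} t" .
  qed
  also have "\<dots> = (\<integral>\<^sup>+x. ennreal (G x) \<partial>lborel)"
    by (subst nn_integral_cmult_indicator) auto
  finally show ?thesis by (simp add: G_def)
qed

lemma variance_identity:
  fixes f :: "'a \<Rightarrow> real"
  assumes "finite_measure N" and f: "f \<in> L2 N"
  shows "(\<integral>\<^sup>+x. (\<integral>\<^sup>+y. ennreal ((f x - f y)\<^sup>2) \<partial>N) \<partial>N)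
    = ennreal (2 * (measure N (space N) * (LINT x|N. (f x)\<^sup>2) - (LINT x|N. f x)\<^sup>2))"
proof -
  interpret finite_measure N by fact
  define v where "v = measure N (space N)"
  define m1 where "m1 = (LINT x|N. f x)"
  define m2 where "m2 = (LINT x|N. (f x)\<^sup>2)"
  have one: "(\<lambda>_. 1::real) \<in> L2 N" by (simp add: L2_def)
  have fm[measurable]: "f \<in> borel_measurable N" by (rule L2D(1)[OF f])
  have i1: "integrable N f"
    using integrable_norm_mult[OF f one] integrable_norm_iff[OF fm] by simp
  have i2: "integrable N (\<lambda>x. (f x)\<^sup>2)" using L2D(2)[OF f] by simp
  have expand: "(\<lambda>y. (f x - f y)\<^sup>2) = (\<lambda>y. (f x)\<^sup>2 - 2 * f x * f y + (f y)\<^sup>2)" for x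
    by (simp add: power2_eq_square algebra_simps)
  have int: "integrable N (\<lambda>y. (f x - f y)\<^sup>2)" for x
    unfolding expand using i1 i2 by simp
  have inner: "(LINT y|N. (f x - f y)\<^sup>2) = v * (f x)\<^sup>2 - 2 * m1 * f x + m2" for x
    unfolding expand using i1 i2 by (simp add: v_def m1_def m2_def)
  have "(\<integral>\<^sup>+x. (\<integral>\<^sup>+y. ennreal ((f x - f y)\<^sup>2) \<partial>N) \<partial>N)
      = (\<integral>\<^sup>+x. ennreal (LINT y|N. (f x - f y)\<^sup>2) \<partial>N)"
    using nn_integral_eq_integral[OF int] by simp
  also have "\<dots> = (\<integral>\<^sup>+x. ennreal (v * (f x)\<^sup>2 - 2 * m1 * f x + m2) \<partial>N)"
    by (simp add: inner)
  also have "\<dots> = ennreal (LINT x|N. v * (f x)\<^sup>2 - 2 * m1 * f x + m2)"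
  proof (rule nn_integral_eq_integral)
    show "integrable N (\<lambda>x. v * (f x)\<^sup>2 - 2 * m1 * f x + m2)"
      using i1 i2 by simp
    show "AE x in N. 0 \<le> v * (f x)\<^sup>2 - 2 * m1 * f x + m2"
      unfolding inner[symmetric] by simp
  qed
  also have "(LINT x|N. v * (f x)\<^sup>2 - 2 * m1 * f x + m2) = v * m2 - 2 * m1 * m1 + m2 * v"
    using i1 i2 by (simp add: v_def m1_def m2_def)
  also have "\<dots> = 2 * (v * m2 - m1\<^sup>2)"
    by (simp add: power2_eq_square)
  finally show ?thesis by (simp add: v_def m1_def m2_def)
qed

section \<open>Lattice cells\<close>

text \<open>For h > 0 these are the half-open cubes of side h with corners in the lattice h Z^n. As
  joint level sets of floors they partition the space exactly, without common faces.\<close>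

definition cell :: "real \<Rightarrow> int^'n \<Rightarrow> (real^'n) set" where
  "cell h c = {x. \<forall>i. \<lfloor>x $ i / h\<rfloor> = c $ i}"

lemma cell_iff:
  "0 < h \<Longrightarrow> x \<in> cell h c \<longleftrightarrow> (\<forall>i. h * of_int (c $ i) \<le> x $ i \<and> x $ i < h * (of_int (c $ i) + 1))"
  by (simp add: cell_def floor_eq_iff field_simps)

lemma cell_unique: "x \<in> cell h c \<Longrightarrow> x \<in> cell h c' \<Longrightarrow> c = c'"
  by (simp add: cell_def vec_eq_iff)

lemma in_cell: "x \<in> cell h (\<chi> i. \<lfloor>x $ i / h\<rfloor>)"
  by (simp add: cell_def)

lemma cell_borel [measurable]:
  fixes c :: "int^'n"
  shows "cell h c \<in> sets borel"
proof -
  have eq: "cell h c = (\<Inter>i. {x. \<lfloor>x $ i / h\<rfloor> = c $ i})"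
    by (auto simp: cell_def)
  have "(\<lambda>x::real^'n. \<lfloor>x $ i / h\<rfloor>) \<in> borel \<rightarrow>\<^sub>M count_space UNIV" for i
    by (intro measurable_compose[OF _ measurable_real_floor] borel_measurable_divide borel_measurable_const
        borel_measurable_continuous_onI continuous_on_component continuous_on_id)
  then have "{x. \<lfloor>x $ i / h\<rfloor> = c $ i} \<in> sets borel" for i
    using measurable_sets[of "\<lambda>x::real^'n. \<lfloor>x $ i / h\<rfloor>" borel "count_space UNIV" "{c $ i}"]
    by (simp add: vimage_def)
  then show ?thesis unfolding eq by (intro sets.finite_INT) auto
qed

lemma emeasure_cell:
  fixes c :: "int^'n"
  assumes h: "0 < h"
  shows "emeasure lborel (cell h c) = ennreal (h ^ CARD('n))"
proof -
  let ?a = "(\<chi> i. h * of_int (c $ i)) :: real^'n" and ?b = "(\<chi> i. h * (of_int (c $ i) + 1)) :: real^'n"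
  have le: "\<And>i. i \<in> Basis \<Longrightarrow> ?a \<bullet> i \<le> ?b \<bullet> i"
    using h by (auto simp: Basis_vec_def inner_axis algebra_simps)
  have pr: "(\<Prod>i\<in>Basis. (?b - ?a) \<bullet> i) = h ^ CARD('n)"
  proof -
    have "(?b - ?a) \<bullet> i = h" if "i \<in> Basis" for i
      using that by (auto simp: Basis_vec_def inner_axis algebra_simps)
    then have "(\<Prod>i\<in>Basis. (?b - ?a) \<bullet> i) = (\<Prod>i\<in>(Basis::(real^'n) set). h)"
      by (intro prod.cong) auto
    then show ?thesis by simp
  qed
  have "emeasure lborel (box ?a ?b) \<le> emeasure lborel (cell h c)"
    by (rule emeasure_mono) (auto simp: cell_iff[OF h] mem_box_cart less_eq_real_def)
  moreover have "emeasure lborel (cell h c) \<le> emeasure lborel (cbox ?a ?b)"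
    by (rule emeasure_mono) (auto simp: cell_iff[OF h] mem_box_cart less_eq_real_def)
  ultimately show ?thesis
    using emeasure_lborel_box[OF le] emeasure_lborel_cbox[OF le] unfolding pr by simp
qed

lemma finite_cells:
  fixes S :: "(real^'n) set"
  assumes "bounded S" "0 < h"
  shows "finite {c :: int^'n. cell h c \<inter> S \<noteq> {}}"
proof -
  obtain R where R: "\<And>x. x \<in> S \<Longrightarrow> norm x \<le> R" using assms(1) unfolding bounded_iff by auto
  define m where "m = \<lceil>R / h\<rceil> + 1"
  have "{c :: int^'n. cell h c \<inter> S \<noteq> {}} \<subseteq> {c. \<forall>i. c $ i \<in> {-m..m}}"
  proof (intro subsetI CollectI allI)
    fix c :: "int^'n" and i assume "c \<in> {c. cell h c \<inter> S \<noteq> {}}"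
    then obtain x where x: "x \<in> cell h c" "x \<in> S" by blast
    have "\<bar>x $ i\<bar> \<le> R" using component_le_norm_cart[of x i] R[OF x(2)] by linarith
    then have "\<bar>x $ i / h\<bar> \<le> R / h" using assms(2) by (simp add: divide_right_mono)
    moreover have "c $ i = \<lfloor>x $ i / h\<rfloor>" using x(1) by (simp add: cell_def)
    ultimately show "c $ i \<in> {-m..m}"
      unfolding m_def atLeastAtMost_iff by linarith
  qed
  moreover have "finite {c :: int^'n. \<forall>i. c $ i \<in> {-m..m}}"
  proof -
    have "{c :: int^'n. \<forall>i. c $ i \<in> {-m..m}} \<subseteq> vec_lambda ` (UNIV \<rightarrow>\<^sub>E {-m..m})"
    proof
      fix c :: "int^'n" assume "c \<in> {c. \<forall>i. c $ i \<in> {-m..m}}"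
      then have "(\<lambda>i. c $ i) \<in> UNIV \<rightarrow>\<^sub>E {-m..m}" by auto
      then show "c \<in> vec_lambda ` (UNIV \<rightarrow>\<^sub>E {-m..m})"
        by (intro image_eqI[of _ _ "\<lambda>i. c $ i"]) (auto simp: vec_eq_iff)
    qed
    then show ?thesis by (rule finite_subset) (intro finite_imageI finite_PiE; simp)
  qed
  ultimately show ?thesis by (rule finite_subset)
qed

lemma ennreal_sum_le:
  fixes f :: "'i \<Rightarrow> real"
  shows "ennreal (\<Sum>i\<in>I. f i) \<le> (\<Sum>i\<in>I. ennreal (f i))"
proof -
  have "ennreal (\<Sum>i\<in>I. f i) \<le> ennreal (\<Sum>i\<in>I. max 0 (f i))"
    by (intro ennreal_leI sum_mono) simp
  also have "\<dots> = (\<Sum>i\<in>I. ennreal (max 0 (f i)))"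
    by (rule sum_ennreal[symmetric]) simp
  also have "\<dots> = (\<Sum>i\<in>I. ennreal (f i))"
    by (intro sum.cong) (auto simp: max_def ennreal_neg)
  finally show ?thesis .
qed

lemma norm_fst_le_norm: "norm (fst p) \<le> norm p"
  by (metis norm_fst_le prod.collapse)

lemma norm_snd_le_norm: "norm (snd p) \<le> norm p"
  by (metis norm_snd_le prod.collapse)

lemma integrable_compact_support:
  fixes f :: "'a::euclidean_space \<Rightarrow> real"
  assumes f: "continuous_on UNIV f" and K: "compact K" "\<And>x. x \<notin> K \<Longrightarrow> f x = 0"
  shows "integrable lborel f"
proof -
  have "integrable lborel (\<lambda>x. indicator K x *\<^sub>R f x)"
    by (rule borel_integrable_compact[OF K(1) continuous_on_subset[OF f subset_UNIV]])
  moreover have "(\<lambda>x. indicator K x *\<^sub>R f x) = f"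
    using K(2) by (auto simp: fun_eq_iff indicator_def)
  ultimately show ?thesis by simp
qed

text \<open>On each cell the variance of \<open>\<phi>\<close> is a double integral of squared differences, so that the sum
  over all cells is controlled by translations of length at most \<open>n h\<close>.\<close>

lemma cell_variance_le:
  fixes \<phi> :: "real^'n \<Rightarrow> real" and I :: "(int^'n) set"
  assumes h: "0 < h" and [measurable]: "\<phi> \<in> borel_measurable borel" and I: "finite I"
  shows "(\<Sum>c\<in>I. \<integral>\<^sup>+x. (\<integral>\<^sup>+y. ennreal ((\<phi> x - \<phi> y)\<^sup>2) * indicator (cell h c) y \<partial>lborel)
        * indicator (cell h c) x \<partial>lborel)
    \<le> (\<integral>\<^sup>+z. (\<integral>\<^sup>+x. ennreal ((\<phi> (x + z) - \<phi> x)\<^sup>2) \<partial>lborel)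
        * indicator (cbox (\<chi> i. - h) (\<chi> i. h)) z \<partial>lborel)"
proof -
  let ?Q = "cbox (\<chi> i. - h) (\<chi> i. h) :: (real^'n) set"
  let ?A = "\<lambda>c x. \<integral>\<^sup>+y. ennreal ((\<phi> x - \<phi> y)\<^sup>2) * indicator (cell h c) y \<partial>lborel"
  have "(\<Sum>c\<in>I. \<integral>\<^sup>+x. ?A c x * indicator (cell h c) x \<partial>lborel)
      = (\<integral>\<^sup>+x. (\<Sum>c\<in>I. ?A c x * indicator (cell h c) x) \<partial>lborel)"
    by (rule nn_integral_sum[symmetric]) measurable
  also have "\<dots> \<le> (\<integral>\<^sup>+x. (\<integral>\<^sup>+z. ennreal ((\<phi> (x + z) - \<phi> x)\<^sup>2) * indicator ?Q z \<partial>lborel) \<partial>lborel)"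
  proof (rule nn_integral_mono)
    fix x :: "real^'n"
    define c0 where "c0 = (\<chi> i. \<lfloor>x $ i / h\<rfloor>)"
    have c0: "x \<in> cell h c0" unfolding c0_def by (rule in_cell)
    have "(\<Sum>c\<in>I. ?A c x * indicator (cell h c) x) = (\<Sum>c\<in>I. if c = c0 then ?A c0 x else 0)"
      using c0 by (intro sum.cong) (auto simp: indicator_def dest: cell_unique)
    also have "\<dots> \<le> ?A c0 x"
      using I by simp
    also have "\<dots> \<le> (\<integral>\<^sup>+y. ennreal ((\<phi> y - \<phi> x)\<^sup>2) * indicator ?Q (y - x) \<partial>lborel)"
    proof (rule nn_integral_mono)
      fix y :: "real^'n"
      have "y - x \<in> ?Q" if y: "y \<in> cell h c0"
      proof -
        have "- h \<le> y $ i - x $ i \<and> y $ i - x $ i \<le> h" for i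
          using y c0 unfolding cell_iff[OF h] by (force simp: algebra_simps dest!: spec[of _ i])
        then show ?thesis by (simp add: mem_box_cart)
      qed
      then show "ennreal ((\<phi> x - \<phi> y)\<^sup>2) * indicator (cell h c0) y
          \<le> ennreal ((\<phi> y - \<phi> x)\<^sup>2) * indicator ?Q (y - x)"
        by (auto simp: indicator_def power2_commute)
    qed
    also have "\<dots> = (\<integral>\<^sup>+z. ennreal ((\<phi> (x + z) - \<phi> x)\<^sup>2) * indicator ?Q ((x + z) - x) \<partial>lborel)"
      by (rule nn_integral_lborel_translate[symmetric]) measurable
    finally show "(\<Sum>c\<in>I. ?A c x * indicator (cell h c) x)
        \<le> (\<integral>\<^sup>+z. ennreal ((\<phi> (x + z) - \<phi> x)\<^sup>2) * indicator ?Q z \<partial>lborel)"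
      by simp
  qed
  also have "\<dots> = (\<integral>\<^sup>+z. (\<integral>\<^sup>+x. ennreal ((\<phi> (x + z) - \<phi> x)\<^sup>2) * indicator ?Q z \<partial>lborel) \<partial>lborel)"
    by (rule lborel_pair.Fubini') measurable
  also have "\<dots> = (\<integral>\<^sup>+z. (\<integral>\<^sup>+x. ennreal ((\<phi> (x + z) - \<phi> x)\<^sup>2) \<partial>lborel) * indicator ?Q z \<partial>lborel)"
    by (intro nn_integral_cong nn_integral_multc) measurable
  finally show ?thesis .
qed

text \<open>Poincare's inequality on each cell, summed over the cells. Differences of two points of
  one cell lie in the cube of half side h, where |z| <= n h; the volume (2h)^n of that cube, divided
  by the volume h^n of a cell, gives the factor 2^n.\<close>

lemma cell_Poincare:
  fixes \<phi> :: "real^'n \<Rightarrow> real" and I :: "(int^'n) set"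
  assumes h: "0 < h" and \<phi>: "C_k (Suc 0) \<phi> UNIV" and K: "compact K" "\<And>x. x \<notin> K \<Longrightarrow> \<phi> x = 0"
    and I: "finite I" "K \<subseteq> (\<Union>c\<in>I. cell h c)"
  shows "(LINT x|lborel. (\<phi> x)\<^sup>2)
    \<le> 1 / h ^ CARD('n) * (\<Sum>c\<in>I. (LINT x|lborel. indicator (cell h c) x * \<phi> x)\<^sup>2)
      + 2 ^ CARD('n) * (real CARD('n) * h)\<^sup>2 * (LINT x|lborel. (norm (grad \<phi> x))\<^sup>2)"
proof -
  let ?Q = "cbox (\<chi> i. - h) (\<chi> i. h) :: (real^'n) set"
  define n where "n = CARD('n)"
  define v where "v = h ^ n"
  have v: "v > 0" using h by (simp add: v_def)
  have c\<phi>: "continuous_on UNIV \<phi>" by (rule C_k_imp_continuous[OF \<phi>])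
  have cg: "continuous_on UNIV (grad \<phi>)" by (rule continuous_grad[OF \<phi>])
  have m\<phi>[measurable]: "\<phi> \<in> borel_measurable borel" by (rule borel_measurable_continuous_onI[OF c\<phi>])
  have i1: "integrable lborel \<phi>" by (rule integrable_compact_support[OF c\<phi> K])
  have i2: "integrable lborel (\<lambda>x. (\<phi> x)\<^sup>2)"
    by (rule integrable_compact_support[OF _ K(1)]) (use K(2) in \<open>auto intro!: continuous_intros c\<phi>\<close>)
  define D where "D = (LINT x|lborel. (norm (grad \<phi> x))\<^sup>2)"
  have D0: "0 \<le> D" by (simp add: D_def)
  have iD: "integrable lborel (\<lambda>x. (norm (grad \<phi> x))\<^sup>2)"
    by (rule integrable_compact_support[OF _ K(1)])
       (use grad_eq_0_outside[OF compact_imp_closed[OF K(1)] K(2)] in \<open>auto intro!: continuous_intros cg\<close>)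
  have D: "(\<integral>\<^sup>+x. ennreal ((norm (grad \<phi> x))\<^sup>2) \<partial>lborel) = ennreal D"
    unfolding D_def by (rule nn_integral_eq_integral[OF iD]) simp
  define m1 where "m1 c = (LINT x|lborel. indicator (cell h c) x * \<phi> x)" for c :: "int^'n"
  define m2 where "m2 c = (LINT x|lborel. indicator (cell h c) x * (\<phi> x)\<^sup>2)" for c :: "int^'n"
  have var: "(\<integral>\<^sup>+x. (\<integral>\<^sup>+y. ennreal ((\<phi> x - \<phi> y)\<^sup>2) * indicator (cell h c) y \<partial>lborel)
        * indicator (cell h c) x \<partial>lborel) = ennreal (2 * (v * m2 c - (m1 c)\<^sup>2))" for c
  proof -
    let ?N = "restrict_space lborel (cell h c)"
    have s: "cell h c \<inter> space lborel \<in> sets lborel" by simp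
    have em: "emeasure ?N (space ?N) = ennreal v"
      using emeasure_cell[OF h, of c] by (simp add: emeasure_restrict_space space_restrict_space v_def n_def)
    have fin: "finite_measure ?N" by (rule finite_measureI) (simp only: em, simp)
    have mv: "measure ?N (space ?N) = v"
      using em v by (simp add: measure_def)
    have L2: "\<phi> \<in> L2 ?N"
    proof -
      have "\<phi> \<in> borel_measurable ?N" by (rule measurable_restrict_space1) simp
      moreover have "integrable ?N (\<lambda>x. (norm (\<phi> x))\<^sup>2)"
        using integrable_mult_indicator[OF _ i2, of "cell h c"] s by (simp add: integrable_restrict_space)
      ultimately show ?thesis by (simp add: L2_def)
    qed
    have "(\<integral>\<^sup>+x. (\<integral>\<^sup>+y. ennreal ((\<phi> x - \<phi> y)\<^sup>2) * indicator (cell h c) y \<partial>lborel)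
        * indicator (cell h c) x \<partial>lborel) = (\<integral>\<^sup>+x. (\<integral>\<^sup>+y. ennreal ((\<phi> x - \<phi> y)\<^sup>2) \<partial>?N) \<partial>?N)"
      by (simp add: nn_integral_restrict_space[OF s])
    also have "\<dots> = ennreal (2 * (v * (LINT x|?N. (\<phi> x)\<^sup>2) - (LINT x|?N. \<phi> x)\<^sup>2))"
      using variance_identity[OF fin L2] unfolding mv .
    also have "(LINT x|?N. (\<phi> x)\<^sup>2) = m2 c"
      unfolding m2_def using integral_restrict_space[OF s, of "\<lambda>x. (\<phi> x)\<^sup>2"] by simp
    also have "(LINT x|?N. \<phi> x) = m1 c"
      unfolding m1_def using integral_restrict_space[OF s, of \<phi>] by simp
    finally show ?thesis .
  qed
  \<comment> \<open>The volume of the cube of admissible translations, the second factor of the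
    final constant.\<close>
  have emQ: "emeasure lborel ?Q = ennreal ((2 * h) ^ n)"
  proof -
    have "\<And>i. i \<in> Basis \<Longrightarrow> ((\<chi> i. - h) :: real^'n) \<bullet> i \<le> (\<chi> i. h) \<bullet> i"
      using h by (auto simp: Basis_vec_def inner_axis)
    moreover have "(\<Prod>i\<in>Basis. (((\<chi> i. h) :: real^'n) - (\<chi> i. - h)) \<bullet> i) = (\<Prod>i\<in>(Basis::(real^'n) set). 2 * h)"
      by (intro prod.cong) (auto simp: Basis_vec_def inner_axis)
    ultimately show ?thesis
      by (subst emeasure_lborel_cbox) (auto simp: n_def)
  qed
  have "ennreal (\<Sum>c\<in>I. 2 * (v * m2 c - (m1 c)\<^sup>2)) \<le> (\<Sum>c\<in>I. ennreal (2 * (v * m2 c - (m1 c)\<^sup>2)))"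
    by (rule ennreal_sum_le)
  also have "\<dots> \<le> (\<integral>\<^sup>+z. (\<integral>\<^sup>+x. ennreal ((\<phi> (x + z) - \<phi> x)\<^sup>2) \<partial>lborel) * indicator ?Q z \<partial>lborel)"
    unfolding var[symmetric] by (rule cell_variance_le[OF h m\<phi> I(1)])
  also have "\<dots> \<le> (\<integral>\<^sup>+z. ennreal ((real n * h)\<^sup>2 * D) * indicator ?Q z \<partial>lborel)"
  proof (rule nn_integral_mono)
    fix z :: "real^'n"
    show "(\<integral>\<^sup>+x. ennreal ((\<phi> (x + z) - \<phi> x)\<^sup>2) \<partial>lborel) * indicator ?Q z
        \<le> ennreal ((real n * h)\<^sup>2 * D) * indicator ?Q z"
    proof (cases "z \<in> ?Q")
      case True
      have "(\<integral>\<^sup>+x. ennreal ((\<phi> (x + z) - \<phi> x)\<^sup>2) \<partial>lborel) \<le> ennreal ((norm z)\<^sup>2) * ennreal D"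
        using translation_estimate[OF \<phi>, of z] D by simp
      also have "\<dots> = ennreal ((norm z)\<^sup>2 * D)"
        by (rule ennreal_mult[symmetric]) (use D0 in auto)
      also have "\<dots> \<le> ennreal ((real n * h)\<^sup>2 * D)"
        using norm_le_in_cube[OF True] D0
        by (intro ennreal_leI mult_right_mono power_mono) (auto simp: n_def)
      finally show ?thesis using True by simp
    qed simp
  qed
  also have "\<dots> = ennreal ((real n * h)\<^sup>2 * D) * emeasure lborel ?Q"
    by (rule nn_integral_cmult_indicator) simp
  also have "\<dots> = ennreal ((real n * h)\<^sup>2 * D * (2 * h) ^ n)"
    unfolding emQ using D0 h by (intro ennreal_mult[symmetric]) auto
  finally have "(\<Sum>c\<in>I. 2 * (v * m2 c - (m1 c)\<^sup>2)) \<le> (real n * h)\<^sup>2 * D * (2 * h) ^ n"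
    using D0 h by (subst (asm) ennreal_le_iff) auto
  also have "\<dots> = v * (2 ^ n * (real n * h)\<^sup>2 * D)"
    by (simp add: v_def power_mult_distrib)
  also have "(\<Sum>c\<in>I. 2 * (v * m2 c - (m1 c)\<^sup>2)) = 2 * (v * (\<Sum>c\<in>I. m2 c) - (\<Sum>c\<in>I. (m1 c)\<^sup>2))"
    by (simp add: sum_subtractf sum_distrib_left right_diff_distrib)
  also have "(\<Sum>c\<in>I. m2 c) = (LINT x|lborel. (\<phi> x)\<^sup>2)"
  proof -
    have "(\<Sum>c\<in>I. m2 c) = (LINT x|lborel. (\<Sum>c\<in>I. indicator (cell h c) x * (\<phi> x)\<^sup>2))"
      unfolding m2_def
      by (rule Bochner_Integration.integral_sum[symmetric])
         (use integrable_mult_indicator[OF _ i2] in simp)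
    also have "\<dots> = (LINT x|lborel. (\<phi> x)\<^sup>2)"
    proof (rule Bochner_Integration.integral_cong[OF refl])
      fix x
      show "(\<Sum>c\<in>I. indicator (cell h c) x * (\<phi> x)\<^sup>2) = (\<phi> x)\<^sup>2"
      proof (cases "x \<in> K")
        case True
        then obtain c0 where c0: "c0 \<in> I" "x \<in> cell h c0" using I(2) by blast
        have "(\<Sum>c\<in>I. indicator (cell h c) x * (\<phi> x)\<^sup>2) = (\<Sum>c\<in>I. if c = c0 then (\<phi> x)\<^sup>2 else 0)"
          using c0(2) by (intro sum.cong) (auto simp: indicator_def dest: cell_unique)
        then show ?thesis using c0(1) I(1) by simp
      qed (use K(2) in simp)
    qed
    finally show ?thesis .
  qed
  finally have "2 * (v * (LINT x|lborel. (\<phi> x)\<^sup>2)) \<le> 2 * (\<Sum>c\<in>I. (m1 c)\<^sup>2) + v * (2 ^ n * (real n * h)\<^sup>2 * D)"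
    by simp
  moreover have "0 \<le> v * (2 ^ n * (real n * h)\<^sup>2 * D)"
    using v D0 by simp
  ultimately have "v * (LINT x|lborel. (\<phi> x)\<^sup>2) \<le> (\<Sum>c\<in>I. (m1 c)\<^sup>2) + v * (2 ^ n * (real n * h)\<^sup>2 * D)"
    by linarith
  then have "(LINT x|lborel. (\<phi> x)\<^sup>2) \<le> ((\<Sum>c\<in>I. (m1 c)\<^sup>2) + v * (2 ^ n * (real n * h)\<^sup>2 * D)) / v"
    using v by (simp add: field_simps)
  also have "\<dots> = 1 / v * (\<Sum>c\<in>I. (m1 c)\<^sup>2) + 2 ^ n * (real n * h)\<^sup>2 * D"
    using v by (simp add: field_simps)
  finally show ?thesis
    by (simp add: v_def n_def m1_def D_def)
qed

section \<open>The compact embedding\<close>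

context bounded_open
begin

lemma indicator_cell_L2: "(indicator (cell h c) :: real^'n \<Rightarrow> real) \<in> L2 M"
proof (rule L2I_bound[where C=1])
  show "(\<lambda>_. 1::real) \<in> L2 M" by (rule continuous_L2) simp
  show "(indicator (cell h c) :: real^'n \<Rightarrow> real) \<in> borel_measurable M"
    by (intro measurable_restrict_space1 measurable_completion) simp
qed (simp add: indicator_def)

lemma bounded_form_fst_mult: "bounded_form M (\<lambda>x (p :: real \<times> (real^'n)) (r :: real). fst p * r)"
proof (rule bounded_form_continuous[OF _ _ bounded_\<Omega> \<Omega>_sets])
  show "bilinear (\<lambda>(p :: real \<times> (real^'n)) (r :: real). fst p * r)" for x :: "real^'n"
    unfolding bilinear_def by (auto intro!: linearI simp: algebra_simps)
  show "continuous_on UNIV (\<lambda>(x :: real^'n, p :: real \<times> (real^'n), r :: real). fst p * r)"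
    unfolding split_beta by (intro continuous_intros)
qed

lemma sqn_tendsto:
  fixes J :: "nat \<Rightarrow> real^'n \<Rightarrow> 'b::euclidean_space"
  assumes "\<And>m. J m \<in> L2 M" "j \<in> L2 M" "(\<lambda>m. sqn M (J m - j)) \<longlonglongrightarrow> 0"
  shows "(\<lambda>m. sqn M (J m)) \<longlonglongrightarrow> sqn M j"
proof -
  have b: "bounded_form M (\<lambda>x (p::'b) r. p \<bullet> r)"
  proof (rule bounded_form_continuous[OF _ _ bounded_\<Omega> \<Omega>_sets])
    show "bilinear (\<lambda>(p::'b) r. p \<bullet> r)" for x :: "real^'n"
      unfolding bilinear_def by (auto intro!: linearI simp: inner_add_left inner_add_right)
    show "continuous_on UNIV (\<lambda>(x :: real^'n, p :: 'b, r). p \<bullet> r)"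
      unfolding split_beta by (intro continuous_intros)
  qed
  have "sqn M f = bform M (\<lambda>x (p::'b) r. p \<bullet> r) f f" for f
    by (simp add: sqn_def bform_def power2_norm_eq_inner)
  then show ?thesis
    using bform_tendsto[OF b assms assms] by simp
qed

lemma sqn_fst_tendsto:
  fixes J :: "nat \<Rightarrow> real^'n \<Rightarrow> 'b::euclidean_space \<times> 'c::euclidean_space"
  assumes "\<And>m. J m \<in> L2 M" "j \<in> L2 M" "(\<lambda>m. sqn M (J m - j)) \<longlonglongrightarrow> 0"
  shows "(\<lambda>m. sqn M (\<lambda>x. fst (J m x))) \<longlonglongrightarrow> sqn M (\<lambda>x. fst (j x))"
proof (rule sqn_tendsto)
  have "sqn M ((\<lambda>x. fst (J m x)) - (\<lambda>x. fst (j x))) \<le> 1\<^sup>2 * sqn M (J m - j)" for m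
  proof (rule sqn_le_bound)
    show "norm (((\<lambda>x. fst (J m x)) - (\<lambda>x. fst (j x))) x) \<le> 1 * norm ((J m - j) x)" for x
      using norm_fst_le_norm[of "(J m - j) x"] by simp
  qed (intro L2_diff L2_fst assms)+
  then show "(\<lambda>m. sqn M ((\<lambda>x. fst (J m x)) - (\<lambda>x. fst (j x)))) \<longlonglongrightarrow> 0"
    by (intro tendsto_0_le[OF assms(3) sqn_nonneg]) simp
qed (intro L2_fst assms)+

text \<open>All terms of the inequality are continuous on jets, so it suffices to prove it for test
  functions.\<close>

lemma W0_Poincare:
  assumes e: "0 < e"
  shows "\<exists>N C (I :: (int^'n) set). finite I \<and> 0 \<le> C \<and> (\<forall>j\<in>W0 \<Omega>. sqn M (\<lambda>x. fst (j x))
      \<le> C * (\<Sum>c\<in>I. (LINT x|M. fst (j x) * indicator (cell (inverse (real (Suc N))) c) x)\<^sup>2) + e * sqn M j)"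
proof -
  define n where "n = real CARD('n)"
  have n: "n > 0" by (simp add: n_def)
  define b where "b = 2 ^ CARD('n) * n\<^sup>2"
  have b: "b > 0" using n by (simp add: b_def)
  \<comment> \<open>Mesh sizes of the form 1 / (N + 1) keep the family of cell integrals countable,
    as extraction of a subsequence will require. With h < 1 one has b h^2 <= b h, which the second
    bound puts below e.\<close>
  obtain N where N: "inverse (real (Suc N)) < min 1 (e / b)"
    using reals_Archimedean[of "min 1 (e / b)"] e b by auto
  define h where "h = inverse (real (Suc N))"
  have h: "0 < h" "h < 1" "h < e / b" using N by (auto simp: h_def)
  have small: "2 ^ CARD('n) * (real CARD('n) * h)\<^sup>2 \<le> e"
  proof -
    have "2 ^ CARD('n) * (real CARD('n) * h)\<^sup>2 = b * (h * h)"
      by (simp add: b_def n_def power2_eq_square)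
    also have "\<dots> \<le> b * (h * 1)"
      using h b by (intro mult_left_mono) auto
    also have "\<dots> \<le> e" using h b by (simp add: field_simps)
    finally show ?thesis .
  qed
  define I where "I = {c :: int^'n. cell h c \<inter> \<Omega> \<noteq> {}}"
  have I: "finite I" unfolding I_def by (rule finite_cells[OF bounded_\<Omega> h(1)])
  have cover: "\<Omega> \<subseteq> (\<Union>c\<in>I. cell h c)"
    using in_cell by (fastforce simp: I_def)
  define C where "C = 1 / h ^ CARD('n)"
  have C: "0 \<le> C" using h by (simp add: C_def)
  let ?l = "\<lambda>j c. LINT x|M. fst (j x) * indicator (cell h c) x"
  have l_eq: "?l j c = bform M (\<lambda>x (p :: real \<times> (real^'n)) (r :: real). fst p * r) j (indicator (cell h c))" for j c
    by (simp add: bform_def)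
  have test: "sqn M (\<lambda>x. fst (jet \<phi> x)) \<le> C * (\<Sum>c\<in>I. (?l (jet \<phi>) c)\<^sup>2) + e * sqn M (jet \<phi>)"
    if \<phi>: "\<phi> \<in> test_functions \<Omega>" for \<phi>
  proof -
    obtain K where K: "compact K" "K \<subseteq> \<Omega>" "\<And>x. x \<notin> K \<Longrightarrow> \<phi> x = 0"
      using \<phi> by (rule test_functions_support) blast
    have C1: "C_k (Suc 0) \<phi> UNIV" by (rule test_functions_C_k[OF \<phi>])
    have [measurable]: "\<phi> \<in> borel_measurable borel"
      by (rule borel_measurable_continuous_onI[OF C_k_imp_continuous[OF C1]])
    have [measurable]: "grad \<phi> \<in> borel_measurable borel"
      by (rule borel_measurable_continuous_onI[OF continuous_grad[OF C1]])
    have out: "\<phi> x = 0" "grad \<phi> x = 0" if "x \<notin> \<Omega>" for x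
      using K(2) that K(3)[of x] grad_eq_0_outside[of K \<phi> x, OF compact_imp_closed[OF K(1)] K(3)] by auto
    have "sqn M (\<lambda>x. fst (jet \<phi> x)) = (LINT x|lborel. (\<phi> x)\<^sup>2)"
      unfolding sqn_def using out by (simp add: jet_def integral_M_eq_lborel)
    also have "\<dots> \<le> 1 / h ^ CARD('n) * (\<Sum>c\<in>I. (LINT x|lborel. indicator (cell h c) x * \<phi> x)\<^sup>2)
      + 2 ^ CARD('n) * (real CARD('n) * h)\<^sup>2 * (LINT x|lborel. (norm (grad \<phi> x))\<^sup>2)"
      by (rule cell_Poincare[OF h(1) C1 K(1,3) I]) (use cover K(2) in auto)
    also have "\<dots> \<le> 1 / h ^ CARD('n) * (\<Sum>c\<in>I. (LINT x|lborel. indicator (cell h c) x * \<phi> x)\<^sup>2)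
      + e * sqn M (jet \<phi>)"
    proof (intro add_left_mono mult_mono small)
      have "(LINT x|lborel. (norm (grad \<phi> x))\<^sup>2) = sqn M (\<lambda>x. snd (jet \<phi> x))"
        unfolding sqn_def using out by (simp add: jet_def integral_M_eq_lborel)
      also have "\<dots> \<le> 1\<^sup>2 * sqn M (jet \<phi>)"
      proof (rule sqn_le_bound)
        show "norm (snd (jet \<phi> x)) \<le> 1 * norm (jet \<phi> x)" for x
          using norm_snd_le_norm[of "jet \<phi> x"] by simp
      qed (use W0_L2[OF jet_test_W0[OF \<phi>]] L2_snd in auto)
      finally show "(LINT x|lborel. (norm (grad \<phi> x))\<^sup>2) \<le> sqn M (jet \<phi>)" by simp
    qed (use e in auto)
    finally have "sqn M (\<lambda>x. fst (jet \<phi> x))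
      \<le> C * (\<Sum>c\<in>I. (LINT x|lborel. indicator (cell h c) x * \<phi> x)\<^sup>2) + e * sqn M (jet \<phi>)"
      unfolding C_def .
    moreover have "(LINT x|lborel. indicator (cell h c) x * \<phi> x) = ?l (jet \<phi>) c" for c
      using out by (subst integral_M_eq_lborel) (auto simp: jet_def mult.commute)
    ultimately show ?thesis by simp
  qed
  have main: "sqn M (\<lambda>x. fst (j x)) \<le> C * (\<Sum>c\<in>I. (?l j c)\<^sup>2) + e * sqn M j" if j: "j \<in> W0 \<Omega>" for j
  proof -
    obtain F where F: "\<And>m. F m \<in> jet ` test_functions \<Omega>" "(\<lambda>m. sqn M (F m - j)) \<longlonglongrightarrow> 0"
      using j unfolding W0_def by (rule L2_closureE) blast
    have FL: "F m \<in> L2 M" for m using F(1) jet_test_L2 by blast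
    have jL: "j \<in> L2 M" by (rule W0_L2[OF j])
    show ?thesis
    proof (rule LIMSEQ_le)
      show "(\<lambda>m. sqn M (\<lambda>x. fst (F m x))) \<longlonglongrightarrow> sqn M (\<lambda>x. fst (j x))"
        by (rule sqn_fst_tendsto[OF FL jL F(2)])
      have "(\<lambda>m. ?l (F m) c) \<longlonglongrightarrow> ?l j c" for c
        unfolding l_eq
        by (rule bform_tendsto[OF bounded_form_fst_mult FL jL F(2) indicator_cell_L2 indicator_cell_L2])
           (simp add: sqn_def)
      then show "(\<lambda>m. C * (\<Sum>c\<in>I. (?l (F m) c)\<^sup>2) + e * sqn M (F m)) \<longlonglongrightarrow> C * (\<Sum>c\<in>I. (?l j c)\<^sup>2) + e * sqn M j"
        by (intro tendsto_intros sqn_tendsto FL jL F(2))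
      have "sqn M (\<lambda>x. fst (F m x)) \<le> C * (\<Sum>c\<in>I. (?l (F m) c)\<^sup>2) + e * sqn M (F m)" for m
      proof -
        obtain \<phi> where "\<phi> \<in> test_functions \<Omega>" "F m = jet \<phi>" using F(1)[of m] by auto
        then show ?thesis using test[of \<phi>] by simp
      qed
      then show "\<exists>N. \<forall>m\<ge>N. sqn M (\<lambda>x. fst (F m x)) \<le> C * (\<Sum>c\<in>I. (?l (F m) c)\<^sup>2) + e * sqn M (F m)"
        by blast
    qed
  qed
  show ?thesis
    using I C main unfolding h_def by (intro exI conjI ballI)
qed

text \<open>The integrals over all cells of all meshes are uniformly bounded, so some subsequence
  makes every one of them converge. \<open>W0_Poincare\<close> bounds the L2-distance of two members
  by finitely many differences of these integrals plus a small multiple of their bounded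
  H^1-distance.\<close>

theorem Rellich:
  fixes J :: "nat \<Rightarrow> real^'n \<Rightarrow> real \<times> (real^'n)"
  assumes J: "\<And>m. J m \<in> W0 \<Omega>" and B: "\<And>m. sqn M (J m) \<le> B"
  shows "\<exists>r::nat \<Rightarrow> nat. strict_mono r \<and>
    (\<forall>e>0. \<exists>N. \<forall>i\<ge>N. \<forall>k\<ge>N. sqn M (\<lambda>x. fst (J (r i) x) - fst (J (r k) x)) < e)"
proof -
  define l where "l m = (\<lambda>(N, c :: int^'n). LINT x|M. fst (J m x) * indicator (cell (inverse (real (Suc N))) c) x)" for m
  define R where "R = B + measure M \<Omega>"
  have one: "(\<lambda>_. 1::real) \<in> L2 M" by (rule continuous_L2) simp
  have JL: "J m \<in> L2 M" for m by (rule W0_L2[OF J])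
  have B0: "0 \<le> B" using B[of 0] sqn_nonneg[of M "J 0"] by linarith
  have "\<bar>l m p\<bar> \<le> R" for m p
  proof -
    obtain N c where p: "p = (N, c)" by (cases p)
    let ?f = "\<lambda>x. fst (J m x)"
    have "\<bar>l m p\<bar> \<le> (LINT x|M. \<bar>?f x * indicator (cell (inverse (real (Suc N))) c) x\<bar>)"
      unfolding l_def p split_conv by (rule integral_abs_bound)
    also have "\<dots> \<le> (LINT x|M. (norm (J m x))\<^sup>2 + 1)"
    proof (rule integral_mono)
      show "integrable M (\<lambda>x. \<bar>?f x * indicator (cell (inverse (real (Suc N))) c) x\<bar>)"
        by (intro integrable_abs L2_real_mult_integrable L2_fst JL indicator_cell_L2)
      show "integrable M (\<lambda>x. (norm (J m x))\<^sup>2 + 1)"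
        using L2D(2)[OF JL[of m]] L2D(2)[OF one] by simp
      fix x
      have "\<bar>?f x\<bar> \<le> norm (J m x)"
        using norm_fst_le_norm[of "J m x"] by simp
      moreover have "norm (J m x) \<le> (norm (J m x))\<^sup>2 + 1"
      proof -
        have "2 * norm (J m x) \<le> (norm (J m x))\<^sup>2 + 1"
          using sum_squares_bound[of "norm (J m x)" 1] by simp
        then show ?thesis using norm_ge_zero[of "J m x"] by linarith
      qed
      ultimately show "\<bar>?f x * indicator (cell (inverse (real (Suc N))) c) x\<bar> \<le> (norm (J m x))\<^sup>2 + 1"
        by (auto simp: indicator_def)
    qed
    also have "\<dots> = sqn M (J m) + measure M \<Omega>"
      using L2D(2)[OF JL[of m]] L2D(2)[OF one] by (simp add: sqn_def)
    also have "\<dots> \<le> R" using B by (simp add: R_def)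
    finally show ?thesis .
  qed
  then have "range l \<subseteq> (\<Pi>\<^sub>E p\<in>UNIV. {-R..R})"
    by (auto simp: abs_le_iff minus_le_iff)
  \<comment> \<open>Tychonoff gives compactness; since the index set is countable, the product is
    first countable and compactness yields convergent subsequences.\<close>
  moreover have "seq_compact (\<Pi>\<^sub>E p\<in>(UNIV :: (nat \<times> (int^'n)) set). {-R..R})"
  proof (rule compact_imp_seq_compact)
    have "compactin (product_topology (\<lambda>_. euclideanreal) UNIV) (\<Pi>\<^sub>E p\<in>(UNIV :: (nat \<times> (int^'n)) set). {-R..R})"
      by (simp add: compactin_PiE)
    then show "compact (\<Pi>\<^sub>E p\<in>(UNIV :: (nat \<times> (int^'n)) set). {-R..R})"
      by (simp only: euclidean_product_topology compactin_euclidean_iff)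
  qed
  ultimately obtain L r where r: "strict_mono r" "(l \<circ> r) \<longlonglongrightarrow> L"
    unfolding seq_compact_def by (metis range_subsetD)
  have lconv: "(\<lambda>m. l (r m) p) \<longlonglongrightarrow> L p" for p
  proof -
    have "continuous_on UNIV (\<lambda>f::(nat \<times> (int^'n)) \<Rightarrow> real. f p)"
      by (rule continuous_on_product_coordinates)
    from continuous_on_tendsto_compose[OF this r(2)] show ?thesis by (simp add: o_def)
  qed
  have "\<exists>N. \<forall>i\<ge>N. \<forall>k\<ge>N. sqn M (\<lambda>x. fst (J (r i) x) - fst (J (r k) x)) < e" if e: "0 < e" for e
  proof -
    \<comment> \<open>The squared H^1-distance of two members is at most 4 B; the added 1 keeps the
      denominator positive.\<close>
    define e' where "e' = e / 2 / (4 * B + 1)"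
    have e': "0 < e'" using e B0 by (simp add: e'_def)
    obtain N C and I :: "(int^'n) set" where P: "finite I" "0 \<le> C"
      "\<forall>j\<in>W0 \<Omega>. sqn M (\<lambda>x. fst (j x))
        \<le> C * (\<Sum>c\<in>I. (LINT x|M. fst (j x) * indicator (cell (inverse (real (Suc N))) c) x)\<^sup>2) + e' * sqn M j"
      using W0_Poincare[OF e'] by (elim exE conjE)
    have est: "sqn M (\<lambda>x. fst (J i x) - fst (J k x)) \<le> C * (\<Sum>c\<in>I. (l i (N, c) - l k (N, c))\<^sup>2) + e / 2" for i k
    proof -
      have leq: "(LINT x|M. fst ((J i - J k) x) * indicator (cell (inverse (real (Suc N))) c) x)
          = l i (N, c) - l k (N, c)" for c
        unfolding l_def split_conv
        using L2_real_mult_integrable[OF L2_fst[OF JL[of i]] indicator_cell_L2[of "inverse (real (Suc N))" c]]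
          L2_real_mult_integrable[OF L2_fst[OF JL[of k]] indicator_cell_L2[of "inverse (real (Suc N))" c]]
        by (simp add: left_diff_distrib)
      have "sqn M (\<lambda>x. fst ((J i - J k) x))
          \<le> C * (\<Sum>c\<in>I. (LINT x|M. fst ((J i - J k) x) * indicator (cell (inverse (real (Suc N))) c) x)\<^sup>2)
            + e' * sqn M (J i - J k)"
        by (rule P(3)[rule_format, OF subspace_diff[OF subspace_W0 J J]])
      then have "sqn M (\<lambda>x. fst (J i x) - fst (J k x))
          \<le> C * (\<Sum>c\<in>I. (l i (N, c) - l k (N, c))\<^sup>2) + e' * sqn M (J i - J k)"
        by (simp only: leq) simp
      also have "e' * sqn M (J i - J k) \<le> e' * (4 * B + 1)"
      proof (rule mult_left_mono)
        have "sqn M (J i - J k) = sqn M (J i + (- 1) *\<^sub>R J k)"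
          by (simp add: sqn_def)
        also have "\<dots> \<le> 2 * sqn M (J i) + 2 * sqn M ((- 1) *\<^sub>R J k)"
          by (intro sqn_add_le JL L2_scaleR)
        also have "\<dots> \<le> 4 * B + 1"
          using B[of i] B[of k] unfolding sqn_scaleR by simp
        finally show "sqn M (J i - J k) \<le> 4 * B + 1" .
      qed (use e' in simp)
      also have "e' * (4 * B + 1) = e / 2"
      proof -
        have "4 * B + 1 \<noteq> 0" using B0 by simp
        then show ?thesis
          unfolding e'_def by (rule nonzero_eq_divide_eq[THEN iffD1]) (rule refl)
      qed
      finally show ?thesis by simp
    qed
    have "\<exists>N0. \<forall>i\<ge>N0. \<forall>k\<ge>N0. C * (\<Sum>c\<in>I. (l (r i) (N, c) - l (r k) (N, c))\<^sup>2) < e / 2"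
    proof -
      have pos: "0 < 2 * (C + 1) * (real (card I) + 1)"
        using P(2) by simp
      define d where "d = sqrt (e / (2 * (C + 1) * (real (card I) + 1)))"
      have d: "0 < d"
        unfolding d_def by (intro real_sqrt_gt_zero divide_pos_pos e pos)
      have d2: "d\<^sup>2 = e / (2 * (C + 1) * (real (card I) + 1))"
        unfolding d_def by (intro real_sqrt_pow2 divide_nonneg_pos pos less_imp_le[OF e])
      have "\<exists>N0. \<forall>i\<ge>N0. \<forall>k\<ge>N0. norm (l (r i) (N, c) - l (r k) (N, c)) < d" for c
        using LIMSEQ_imp_Cauchy[OF lconv[of "(N, c)"]] d unfolding Cauchy_iff by blast
      then obtain N0 where N0: "\<And>c i k. i \<ge> N0 c \<Longrightarrow> k \<ge> N0 c \<Longrightarrow> norm (l (r i) (N, c) - l (r k) (N, c)) < d"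
        by metis
      have "C * (\<Sum>c\<in>I. (l (r i) (N, c) - l (r k) (N, c))\<^sup>2) < e / 2"
        if "i \<ge> Max (insert 0 (N0 ` I))" "k \<ge> Max (insert 0 (N0 ` I))" for i k
      proof -
        have "(l (r i) (N, c) - l (r k) (N, c))\<^sup>2 \<le> d\<^sup>2" if "c \<in> I" for c
        proof -
          have "N0 c \<le> Max (insert 0 (N0 ` I))" using P(1) that by (intro Max_ge) auto
          then have "norm (l (r i) (N, c) - l (r k) (N, c)) < d"
            using \<open>i \<ge> Max _\<close> \<open>k \<ge> Max _\<close> by (intro N0) auto
          then show ?thesis
            using d by (intro abs_le_square_iff[THEN iffD1]) auto
        qed
        then have "(\<Sum>c\<in>I. (l (r i) (N, c) - l (r k) (N, c))\<^sup>2) \<le> real (card I) * d\<^sup>2"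
          by (rule sum_bounded_above)
        then have "C * (\<Sum>c\<in>I. (l (r i) (N, c) - l (r k) (N, c))\<^sup>2) \<le> C * (real (card I) * d\<^sup>2)"
          using P(2) by (rule mult_left_mono)
        also have "\<dots> \<le> C * ((real (card I) + 1) * d\<^sup>2)"
          using P(2) by (intro mult_left_mono mult_right_mono) auto
        also have "\<dots> < (C + 1) * ((real (card I) + 1) * d\<^sup>2)"
          using d by (intro mult_strict_right_mono mult_pos_pos) auto
        also have "\<dots> = e / 2"
          unfolding d2 using pos P(2) by (simp add: field_simps)
        finally show ?thesis .
      qed
      then show ?thesis by blast
    qed
    then obtain N0 where N0: "\<And>i k. i \<ge> N0 \<Longrightarrow> k \<ge> N0 \<Longrightarrow>
        C * (\<Sum>c\<in>I. (l (r i) (N, c) - l (r k) (N, c))\<^sup>2) < e / 2" by blast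
    have "sqn M (\<lambda>x. fst (J (r i) x) - fst (J (r k) x)) < e" if "i \<ge> N0" "k \<ge> N0" for i k
      using est[of "r i" "r k"] N0[OF that] by linarith
    then show ?thesis by blast
  qed
  then show ?thesis using r(1) by blast
qed

end

section \<open>Symmetric forms\<close>

text \<open>Only positive semidefiniteness on a carrier is asked for: fields that agree almost
  everywhere are not identified, and the form used for \<open>b\<close> sees the values of a jet but
  not its gradient.\<close>

locale sym_form =
  fixes V :: "'v::real_vector set" and b :: "'v \<Rightarrow> 'v \<Rightarrow> real"
  assumes subspace: "subspace V"
    and add_left: "x \<in> V \<Longrightarrow> y \<in> V \<Longrightarrow> z \<in> V \<Longrightarrow> b (x + y) z = b x z + b y z"
    and scale_left: "x \<in> V \<Longrightarrow> z \<in> V \<Longrightarrow> b (c *\<^sub>R x) z = c * b x z"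
    and sym: "x \<in> V \<Longrightarrow> y \<in> V \<Longrightarrow> b x y = b y x"
    and nonneg: "x \<in> V \<Longrightarrow> 0 \<le> b x x"
begin

lemmas mem_add = subspace_add[OF subspace]
  and mem_scale = subspace_scale[OF subspace]
  and mem_diff = subspace_diff[OF subspace]
  and mem_sum = subspace_sum[OF subspace]

lemma add_right: "x \<in> V \<Longrightarrow> y \<in> V \<Longrightarrow> z \<in> V \<Longrightarrow> b z (x + y) = b z x + b z y"
  using add_left[of x y z] sym[of z "x + y"] sym[of z x] sym[of z y] mem_add[of x y] by simp

lemma scale_right: "x \<in> V \<Longrightarrow> z \<in> V \<Longrightarrow> b z (c *\<^sub>R x) = c * b z x"
  using scale_left[of x z c] sym[of z "c *\<^sub>R x"] sym[of z x] mem_scale[of x c] by simp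

lemma diff_left: "x \<in> V \<Longrightarrow> y \<in> V \<Longrightarrow> z \<in> V \<Longrightarrow> b (x - y) z = b x z - b y z"
  using add_left[of "x - y" y z] mem_diff[of x y] by simp

lemma diff_right: "x \<in> V \<Longrightarrow> y \<in> V \<Longrightarrow> z \<in> V \<Longrightarrow> b z (x - y) = b z x - b z y"
  using add_right[of "x - y" y z] mem_diff[of x y] by simp

lemma zero_left: "z \<in> V \<Longrightarrow> b 0 z = 0"
  using scale_left[of z z 0] by simp

lemma sum_left:
  assumes "\<And>j. j \<in> J \<Longrightarrow> u j \<in> V" "z \<in> V"
  shows "b (\<Sum>j\<in>J. c j *\<^sub>R u j) z = (\<Sum>j\<in>J. c j * b (u j) z)"
  using assms(1)
proof (induction J rule: infinite_finite_induct)
  case (insert j J)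
  have "(\<Sum>j\<in>J. c j *\<^sub>R u j) \<in> V"
    using insert.prems by (intro mem_sum mem_scale) auto
  then show ?case
    using insert assms(2) by (simp add: add_left scale_left mem_scale)
qed (simp_all add: zero_left assms(2))

lemma sum_right:
  assumes "\<And>j. j \<in> J \<Longrightarrow> u j \<in> V" "z \<in> V"
  shows "b z (\<Sum>j\<in>J. c j *\<^sub>R u j) = (\<Sum>j\<in>J. c j * b z (u j))"
proof -
  have "(\<Sum>j\<in>J. c j *\<^sub>R u j) \<in> V"
    using assms by (intro mem_sum mem_scale) auto
  then have "b z (\<Sum>j\<in>J. c j *\<^sub>R u j) = (\<Sum>j\<in>J. c j * b (u j) z)"
    using sum_left[OF assms] sym[OF assms(2)] by simp
  also have "\<dots> = (\<Sum>j\<in>J. c j * b z (u j))"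
    by (intro sum.cong) (use assms sym in auto)
  finally show ?thesis .
qed

lemma square_add: "x \<in> V \<Longrightarrow> y \<in> V \<Longrightarrow> b (x + y) (x + y) = b x x + 2 * b x y + b y y"
  using mem_add[of x y] sym[of y x] by (simp add: add_left add_right)

lemma square_diff: "x \<in> V \<Longrightarrow> y \<in> V \<Longrightarrow> b (x - y) (x - y) = b x x - 2 * b x y + b y y"
  using mem_diff[of x y] sym[of y x] by (simp add: diff_left diff_right)

text \<open>Nonnegativity at t x + y and at t x - y. This version of the Cauchy-Schwarz inequality
  involves no division by a seminorm that might vanish.\<close>

lemma abs_le_young:
  assumes x: "x \<in> V" and y: "y \<in> V" and t: "0 < t"
  shows "2 * \<bar>b x y\<bar> \<le> t * b x x + b y y / t"
proof -
  have "0 \<le> b (t *\<^sub>R x + y) (t *\<^sub>R x + y)" "0 \<le> b (t *\<^sub>R x - y) (t *\<^sub>R x - y)"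
    using x y by (intro nonneg mem_add mem_diff mem_scale; simp)+
  then have "2 * \<bar>t * b x y\<bar> \<le> t * t * b x x + b y y"
    using x y by (simp add: square_add square_diff mem_scale scale_left scale_right)
  moreover have "t * (t * b x x + b y y / t) = t * t * b x x + b y y"
    using t by (simp add: distrib_left)
  ultimately have "t * (2 * \<bar>b x y\<bar>) \<le> t * (t * b x x + b y y / t)"
    using t by (simp add: abs_mult)
  then show ?thesis using t by simp
qed

text \<open>Only the seminorm \<open>sqrt (b x x)\<close> is available, hence convergence is expressed by
  \<open>b (f m - g) (f m - g)\<close>.\<close>

lemma tendsto_form:
  assumes f: "\<And>m. f m \<in> V" "g \<in> V" "(\<lambda>m. b (f m - g) (f m - g)) \<longlonglongrightarrow> 0" and y: "y \<in> V"
  shows "(\<lambda>m. b (f m) y) \<longlonglongrightarrow> b g y"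
proof (rule LIMSEQ_I)
  fix e :: real assume e: "0 < e"
  \<comment> \<open>With this parameter the contribution of \<open>y\<close> in Young's inequality
    is at most e, while the other contribution is below e for large m.\<close>
  define t where "t = (b y y + 1) / e"
  have t: "0 < t" using nonneg[OF y] e by (simp add: t_def add_nonneg_pos)
  have "\<forall>\<^sub>F m in sequentially. b (f m - g) (f m - g) < e / t"
    using e t by (intro order_tendstoD(2)[OF f(3)]) simp
  then obtain N where N: "\<And>m. m \<ge> N \<Longrightarrow> b (f m - g) (f m - g) < e / t"
    unfolding eventually_sequentially by blast
  have "norm (b (f m) y - b g y) < e" if "m \<ge> N" for m
  proof -
    have "2 * \<bar>b (f m - g) y\<bar> \<le> t * b (f m - g) (f m - g) + b y y / t"
      by (rule abs_le_young[OF mem_diff[OF f(1,2)] y t])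
    moreover have "t * b (f m - g) (f m - g) < e"
      using N[OF that] t by (simp add: field_simps)
    moreover have "b y y / t \<le> e"
      using nonneg[OF y] e t by (simp add: t_def field_simps)
    ultimately have "\<bar>b (f m - g) y\<bar> < e" by linarith
    then show ?thesis using f y by (simp add: diff_left)
  qed
  then show "\<exists>N. \<forall>m\<ge>N. norm (b (f m) y - b g y) < e" by blast
qed

lemma tendsto_square:
  assumes f: "\<And>m. f m \<in> V" "g \<in> V" "(\<lambda>m. b (f m - g) (f m - g)) \<longlonglongrightarrow> 0"
  shows "(\<lambda>m. b (f m) (f m)) \<longlonglongrightarrow> b g g"
proof -
  have "b (f m) (f m) = b (f m - g) (f m - g) + 2 * b (f m) g - b g g" for m
    using f(1)[of m] f(2) by (simp add: square_diff)
  moreover have "(\<lambda>m. b (f m - g) (f m - g) + 2 * b (f m) g - b g g) \<longlonglongrightarrow> 0 + 2 * b g g - b g g"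
    by (intro tendsto_intros f tendsto_form)
  ultimately show ?thesis by simp
qed

end

section \<open>Minimisation of the Rayleigh quotient\<close>

text \<open>The first-order condition at a minimum. At t = -A / (|C| + 1) the linear term outweighs
  the quadratic one, so the value is negative unless A = 0.\<close>

lemma quadratic_nonneg_linear_coeff:
  fixes A C :: real
  assumes "\<And>t. 0 \<le> 2 * t * A + t\<^sup>2 * C"
  shows "A = 0"
proof (rule ccontr)
  assume "A \<noteq> 0"
  define d where "d = \<bar>C\<bar> + 1"
  have d: "d > 0" "C \<le> d" by (auto simp: d_def)
  have "0 \<le> 2 * (- A / d) * A + (- A / d)\<^sup>2 * C" by (rule assms)
  also have "\<dots> \<le> 2 * (- A / d) * A + (- A / d)\<^sup>2 * d"
    by (intro add_left_mono mult_left_mono d) simp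
  also have "\<dots> = - (A\<^sup>2 / d)"
    using d by (simp add: field_simps power2_eq_square)
  also have "\<dots> < 0" using d \<open>A \<noteq> 0\<close> by simp
  finally show False by simp
qed

text \<open>The abstract form of a compact embedding of an energy space: \<open>b\<close> stands for
  the L2-product and \<open>q\<close> for the energy. Completeness refers to the norm of b + q, so
  one and the same limit must serve both forms.\<close>

locale compact_form_pair = b: sym_form V b + q: sym_form V q
  for V :: "'v::real_vector set" and b q +
  assumes compact: "\<And>f B. (\<And>m::nat. f m \<in> V) \<Longrightarrow> (\<And>m. b (f m) (f m) \<le> B) \<Longrightarrow> (\<And>m. q (f m) (f m) \<le> B)
      \<Longrightarrow> \<exists>r::nat \<Rightarrow> nat. strict_mono r \<and>
        (\<forall>e>0. \<exists>N. \<forall>i\<ge>N. \<forall>j\<ge>N. b (f (r i) - f (r j)) (f (r i) - f (r j)) < e)"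
    and complete: "\<And>f. (\<And>m::nat. f m \<in> V)
      \<Longrightarrow> (\<And>e. 0 < e \<Longrightarrow> \<exists>N. \<forall>i\<ge>N. \<forall>j\<ge>N. b (f i - f j) (f i - f j) < e)
      \<Longrightarrow> (\<And>e. 0 < e \<Longrightarrow> \<exists>N. \<forall>i\<ge>N. \<forall>j\<ge>N. q (f i - f j) (f i - f j) < e)
      \<Longrightarrow> \<exists>g\<in>V. (\<lambda>m. b (f m - g) (f m - g)) \<longlonglongrightarrow> 0 \<and> (\<lambda>m. q (f m - g) (f m - g)) \<longlonglongrightarrow> 0"
begin

text \<open>A minimising sequence is Cauchy for \<open>b\<close> along a subsequence, hence also for \<open>q\<close> by the
  parallelogram identity.\<close>

lemma constrained_minimiser:
  fixes I :: "'i set" and u :: "'i \<Rightarrow> 'v"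
  assumes u: "\<And>i. i \<in> I \<Longrightarrow> u i \<in> V"
    and w0: "w0 \<in> V" "\<And>i. i \<in> I \<Longrightarrow> b (u i) w0 = 0" "q w0 w0 < s * b w0 w0"
  shows "\<exists>g l. g \<in> V \<and> (\<forall>i\<in>I. b (u i) g = 0) \<and> b g g = 1 \<and> l < s \<and>
    (\<forall>v\<in>V. (\<forall>i\<in>I. b (u i) v = 0) \<longrightarrow> q g v = l * b g v)"
proof -
  define W where "W = {v \<in> V. \<forall>i\<in>I. b (u i) v = 0}"
  have WV: "v \<in> V" if "v \<in> W" for v using that by (simp add: W_def)
  have W_add: "x + y \<in> W" if "x \<in> W" "y \<in> W" for x y
    using that u by (auto simp: W_def b.mem_add b.add_right)
  have W_scale: "c *\<^sub>R x \<in> W" if "x \<in> W" for c x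
    using that u by (auto simp: W_def b.mem_scale b.scale_right)
  define S where "S = (\<lambda>w. q w w) ` {w \<in> W. b w w = 1}"
  have normalise: "\<exists>x\<in>W. b x x = 1 \<and> q x x = q w w / b w w" if w: "w \<in> W" and pos: "b w w > 0" for w
  proof (intro bexI conjI)
    let ?x = "(1 / sqrt (b w w)) *\<^sub>R w"
    show "?x \<in> W" by (rule W_scale[OF w])
    show "b ?x ?x = 1" "q ?x ?x = q w w / b w w"
      using WV[OF w] pos
      by (simp_all add: b.scale_left b.scale_right q.scale_left q.scale_right b.mem_scale)
  qed
  have w0W: "w0 \<in> W" using w0 by (simp add: W_def)
  have pos: "b w0 w0 > 0"
    using w0(3) q.nonneg[OF w0(1)] b.nonneg[OF w0(1)] by (cases "b w0 w0 = 0") auto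
  obtain x0 where x0: "x0 \<in> W" "b x0 x0 = 1" "q x0 x0 = q w0 w0 / b w0 w0"
    using normalise[OF w0W pos] by blast
  have S_ne: "S \<noteq> {}" using x0 by (auto simp: S_def)
  have S_bdd: "bdd_below S"
    by (rule bdd_belowI[of _ 0]) (auto simp: S_def WV q.nonneg)
  define l where "l = Inf S"
  have l0: "0 \<le> l"
    unfolding l_def by (rule cInf_greatest[OF S_ne]) (auto simp: S_def WV q.nonneg)
  have "q x0 x0 \<in> S"
    unfolding S_def using x0(1,2) by (intro imageI CollectI conjI)
  then have "l \<le> q x0 x0"
    unfolding l_def by (rule cInf_lower[OF _ S_bdd])
  also have "\<dots> < s" unfolding x0(3) using w0(3) pos by (simp add: pos_divide_less_eq)
  finally have ls: "l < s" .
  have lower: "l * b w w \<le> q w w" if w: "w \<in> W" for w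
  proof (cases "b w w = 0")
    case True
    then show ?thesis using q.nonneg[OF WV[OF w]] by simp
  next
    case False
    then have p: "b w w > 0" using b.nonneg[OF WV[OF w]] by simp
    obtain x where x: "x \<in> W" "b x x = 1" "q x x = q w w / b w w"
      using normalise[OF w p] by (elim bexE conjE)
    have "q x x \<in> S"
      unfolding S_def using x(1,2) by (intro imageI CollectI conjI)
    then have "l \<le> q x x"
      unfolding l_def by (rule cInf_lower[OF _ S_bdd])
    then show ?thesis unfolding x(3) using p by (simp add: pos_le_divide_eq)
  qed
  have "\<exists>w. w \<in> W \<and> b w w = 1 \<and> q w w < l + inverse (real (Suc m))" for m
  proof -
    have "Inf S < l + inverse (real (Suc m))" by (simp add: l_def)
    then obtain y where "y \<in> S" "y < l + inverse (real (Suc m))"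
      using cInf_less_iff[OF S_ne S_bdd] by blast
    then show ?thesis by (auto simp: S_def)
  qed
  then obtain w where w: "\<And>m. w m \<in> W" "\<And>m. b (w m) (w m) = 1"
    "\<And>m. q (w m) (w m) < l + inverse (real (Suc m))" by metis
  have wq: "q (w m) (w m) \<le> l + 1" for m
  proof -
    have "inverse (real (Suc m)) \<le> 1" by (simp add: field_simps)
    then show ?thesis using w(3)[of m] by linarith
  qed
  have wb: "b (w m) (w m) \<le> l + 1" for m using w(2) l0 by simp
  obtain r :: "nat \<Rightarrow> nat" where r: "strict_mono r"
    "\<And>e. 0 < e \<Longrightarrow> \<exists>N. \<forall>i\<ge>N. \<forall>j\<ge>N. b (w (r i) - w (r j)) (w (r i) - w (r j)) < e"
    using compact[of w "l + 1", OF WV[OF w(1)] wb wq] by (elim exE conjE) simp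
  define f where "f m = w (r m)" for m
  have f: "f m \<in> V" "f m \<in> W" "b (f m) (f m) = 1" for m
    using w WV by (auto simp: f_def)
  have fq: "q (f m) (f m) < l + inverse (real (Suc m))" for m
  proof -
    have "inverse (real (Suc (r m))) \<le> inverse (real (Suc m))"
      using seq_suble[OF r(1), of m] by (simp add: le_imp_inverse_le)
    then show ?thesis unfolding f_def using w(3)[of "r m"] by linarith
  qed
  have qlim: "(\<lambda>m. q (f m) (f m)) \<longlonglongrightarrow> l"
  proof (rule tendsto_sandwich[OF _ _ tendsto_const])
    have "l \<le> q (f m) (f m)" for m
      using lower[OF f(2)[of m]] f(3)[of m] by simp
    then show "\<forall>\<^sub>F m in sequentially. l \<le> q (f m) (f m)" by simp
    show "\<forall>\<^sub>F m in sequentially. q (f m) (f m) \<le> l + inverse (real (Suc m))"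
      by (rule always_eventually) (intro allI less_imp_le fq)
    show "(\<lambda>m. l + inverse (real (Suc m))) \<longlonglongrightarrow> l"
      using tendsto_add[OF tendsto_const LIMSEQ_inverse_real_of_nat, of l] by simp
  qed
  have para: "q (f i - f j) (f i - f j)
      \<le> 2 * (q (f i) (f i) - l) + 2 * (q (f j) (f j) - l) + l * b (f i - f j) (f i - f j)" for i j
  proof -
    have "l * b (f i + f j) (f i + f j) \<le> q (f i + f j) (f i + f j)"
      by (rule lower[OF W_add[OF f(2) f(2)]])
    moreover have "b (f i + f j) (f i + f j) = 4 - b (f i - f j) (f i - f j)"
      using f by (simp add: b.square_add b.square_diff)
    moreover have "q (f i + f j) (f i + f j) = 2 * q (f i) (f i) + 2 * q (f j) (f j) - q (f i - f j) (f i - f j)"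
      using f by (simp add: q.square_add q.square_diff)
    ultimately show ?thesis by (simp add: algebra_simps)
  qed
  have fb_cauchy: "\<exists>N. \<forall>i\<ge>N. \<forall>j\<ge>N. b (f i - f j) (f i - f j) < e" if "0 < e" for e
    using r(2)[OF that] by (simp add: f_def)
  have fq_cauchy: "\<exists>N. \<forall>i\<ge>N. \<forall>j\<ge>N. q (f i - f j) (f i - f j) < e" if e: "0 < e" for e
  proof -
    have "0 < e / (2 * (l + 1))" using e l0 by simp
    then obtain N1 where N1: "\<And>i j. i \<ge> N1 \<Longrightarrow> j \<ge> N1 \<Longrightarrow> b (f i - f j) (f i - f j) < e / (2 * (l + 1))"
      using fb_cauchy by metis
    have "\<forall>\<^sub>F m in sequentially. q (f m) (f m) < l + e / 8"
      using e by (intro order_tendstoD(2)[OF qlim]) simp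
    then obtain N2 where N2: "\<And>m. m \<ge> N2 \<Longrightarrow> q (f m) (f m) < l + e / 8"
      unfolding eventually_sequentially by blast
    have "q (f i - f j) (f i - f j) < e" if "i \<ge> max N1 N2" "j \<ge> max N1 N2" for i j
    proof -
      have "l * b (f i - f j) (f i - f j) \<le> (l + 1) * b (f i - f j) (f i - f j)"
        using b.nonneg[OF b.mem_diff[OF f(1) f(1)]] by (intro mult_right_mono) auto
      also have "\<dots> \<le> (l + 1) * (e / (2 * (l + 1)))"
        using N1[of i j] that l0 by (intro mult_left_mono) auto
      also have "\<dots> = e / 2" using l0 by (simp add: field_simps)
      finally show ?thesis
        using para[of i j] N2[of i] N2[of j] that by simp
    qed
    then show ?thesis by blast
  qed
  obtain g where g: "g \<in> V" "(\<lambda>m. b (f m - g) (f m - g)) \<longlonglongrightarrow> 0" "(\<lambda>m. q (f m - g) (f m - g)) \<longlonglongrightarrow> 0"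
    using complete[of f, OF f(1) fb_cauchy fq_cauchy] by blast
  have bg: "b g g = 1"
    using b.tendsto_square[OF f(1) g(1,2)] f(3) by (simp add: LIMSEQ_const_iff)
  have qg: "q g g = l"
    using q.tendsto_square[OF f(1) g(1,3)] qlim by (rule LIMSEQ_unique)
  have ortho: "b (u i) g = 0" if "i \<in> I" for i
  proof -
    have "b (f m) (u i) = 0" for m
      using f(2)[of m] that b.sym[OF u[OF that] f(1)[of m]] by (simp add: W_def)
    then have "b g (u i) = 0"
      using b.tendsto_form[OF f(1) g(1,2) u[OF that]] by (simp add: LIMSEQ_const_iff)
    then show ?thesis using b.sym[OF u[OF that] g(1)] by simp
  qed
  have gW: "g \<in> W" using g(1) ortho by (simp add: W_def)
  have EL: "q g v = l * b g v" if v: "v \<in> V" "\<And>i. i \<in> I \<Longrightarrow> b (u i) v = 0" for v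
  proof -
    have vW: "v \<in> W" using v by (simp add: W_def)
    \<comment> \<open>Because l is the infimum of the quotient and g attains it, q - l b is
      nonnegative at g + t v for every real t, and its term of order zero in t vanishes.\<close>
    have "0 \<le> 2 * t * (q g v - l * b g v) + t\<^sup>2 * (q v v - l * b v v)" for t
    proof -
      have "l * b (g + t *\<^sub>R v) (g + t *\<^sub>R v) \<le> q (g + t *\<^sub>R v) (g + t *\<^sub>R v)"
        by (rule lower[OF W_add[OF gW W_scale[OF vW]]])
      then show ?thesis
        using g(1) v(1) bg qg
        by (simp add: b.square_add q.square_add b.mem_scale b.scale_left b.scale_right
            q.scale_left q.scale_right algebra_simps power2_eq_square)
    qed
    then have "q g v - l * b g v = 0" by (rule quadratic_nonneg_linear_coeff)
    then show ?thesis by simp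
  qed
  show ?thesis
    using g(1) ortho bg ls EL by (intro exI[of _ g] exI[of _ l] conjI ballI impI) auto
qed

text \<open>If the bound failed, a minimiser g on the orthogonal complement would be a true
  eigenvector with eigenvalue l < \<sigma> (k + 1). The hypothesis \<open>mult\<close> expresses
  that the listed vectors exhaust each eigenspace; g is orthogonal to those for l, hence null,
  although it is normalised.\<close>

lemma Rayleigh_orthogonal_complement:
  fixes u :: "nat \<Rightarrow> 'v" and \<sigma> :: "nat \<Rightarrow> real"
  assumes u: "\<And>i. 1 \<le> i \<Longrightarrow> u i \<in> V"
    and ortho: "\<And>i j. 1 \<le> i \<Longrightarrow> 1 \<le> j \<Longrightarrow> b (u i) (u j) = (if i = j then 1 else 0)"
    and eigen: "\<And>i v. 1 \<le> i \<Longrightarrow> v \<in> V \<Longrightarrow> q (u i) v = \<sigma> i * b (u i) v"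
    and mono: "\<And>i j. 1 \<le> i \<Longrightarrow> i \<le> j \<Longrightarrow> \<sigma> i \<le> \<sigma> j"
    and mult: "\<And>g l. g \<in> V \<Longrightarrow> (\<And>v. v \<in> V \<Longrightarrow> q g v = l * b g v) \<Longrightarrow>
        (\<And>i. 1 \<le> i \<Longrightarrow> \<sigma> i = l \<Longrightarrow> b (u i) g = 0) \<Longrightarrow> b g g = 0"
    and w: "w \<in> V" "\<And>i. i \<in> {1..k} \<Longrightarrow> b (u i) w = 0"
  shows "\<sigma> (k + 1) * b w w \<le> q w w"
proof (rule ccontr)
  assume "\<not> \<sigma> (k + 1) * b w w \<le> q w w"
  then have less: "q w w < \<sigma> (k + 1) * b w w" by simp
  have uk: "u i \<in> V" if "i \<in> {1..k}" for i using u that by simp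
  have "\<exists>g l. g \<in> V \<and> (\<forall>i\<in>{1..k}. b (u i) g = 0) \<and> b g g = 1 \<and> l < \<sigma> (k + 1) \<and>
      (\<forall>v\<in>V. (\<forall>i\<in>{1..k}. b (u i) v = 0) \<longrightarrow> q g v = l * b g v)"
    by (rule constrained_minimiser[OF _ w(1) _ less]) (rule uk, assumption, rule w(2), assumption)
  then obtain g l where g: "g \<in> V" "\<forall>i\<in>{1..k}. b (u i) g = 0" "b g g = 1" "l < \<sigma> (k + 1)"
    "\<forall>v\<in>V. (\<forall>i\<in>{1..k}. b (u i) v = 0) \<longrightarrow> q g v = l * b g v"
    by (elim exE conjE)
  have "q g v = l * b g v" if v: "v \<in> V" for v
  proof -
    \<comment> \<open>The projection of v onto the first k eigenvectors. Both forms vanish on the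
      pair (g, p), which extends the Euler-Lagrange equation from the orthogonal complement to
      arbitrary v.\<close>
    define p where "p = (\<Sum>j\<in>{1..k}. b (u j) v *\<^sub>R u j)"
    have pV: "p \<in> V" unfolding p_def by (intro b.mem_sum b.mem_scale uk)
    have bp: "b (u i) p = b (u i) v" if "i \<in> {1..k}" for i
    proof -
      have "b (u i) p = (\<Sum>j\<in>{1..k}. b (u j) v * b (u i) (u j))"
        unfolding p_def by (rule b.sum_right[OF uk uk[OF that]])
      also have "\<dots> = (\<Sum>j\<in>{1..k}. if j = i then b (u i) v else 0)"
        by (intro sum.cong) (use ortho that in auto)
      finally show ?thesis using that by simp
    qed
    have "q g (v - p) = l * b g (v - p)"
      by (rule g(5)[rule_format, OF b.mem_diff[OF v pV]]) (simp add: b.diff_right v pV uk bp)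
    moreover have "q g p = 0"
    proof -
      have "q g p = (\<Sum>j\<in>{1..k}. b (u j) v * q g (u j))"
        unfolding p_def by (rule q.sum_right[OF uk g(1)])
      also have "\<dots> = 0"
        by (intro sum.neutral ballI) (use g q.sym[OF g(1) uk] eigen in auto)
      finally show ?thesis .
    qed
    moreover have "b g p = 0"
    proof -
      have "b g p = (\<Sum>j\<in>{1..k}. b (u j) v * b g (u j))"
        unfolding p_def by (rule b.sum_right[OF uk g(1)])
      also have "\<dots> = 0"
        by (intro sum.neutral ballI) (use g b.sym[OF g(1) uk] in auto)
      finally show ?thesis .
    qed
    ultimately show ?thesis using v pV g(1) by (simp add: q.diff_right b.diff_right)
  qed
  moreover have "b (u i) g = 0" if i: "1 \<le> i" "\<sigma> i = l" for i
  proof (rule g(2)[rule_format])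
    \<comment> \<open>By monotonicity every index with \<sigma> i = l < \<sigma> (k + 1) is among
      the first k, where orthogonality is known.\<close>
    have "\<not> k + 1 \<le> i" using mono[of "k + 1" i] g(4) i(2) by auto
    then show "i \<in> {1..k}" using i by simp
  qed
  ultimately have "b g g = 0" by (intro mult[OF g(1)])
  then show False using g(3) by simp
qed

end

section \<open>Yang's inequality for commutators\<close>

text \<open>The trial vectors are \<open>\<phi>\<^sub>i = X u\<^sub>i - \<Sum>\<^sub>j a\<^sub>i\<^sub>j u\<^sub>j\<close>.\<close>

lemma commutator_Yang_inequality:
  fixes V A :: "'v::real_vector set" and u :: "nat \<Rightarrow> 'v" and \<sigma> :: "nat \<Rightarrow> real" and X Z :: "'v \<Rightarrow> 'v"
  assumes b: "sym_form A b" and q: "sym_form V q" and VA: "V \<subseteq> A"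
    and K: "finite K" and u: "\<And>i. i \<in> K \<Longrightarrow> u i \<in> V"
    and ortho: "\<And>i j. i \<in> K \<Longrightarrow> j \<in> K \<Longrightarrow> b (u i) (u j) = (if i = j then 1 else 0)"
    and eigen: "\<And>i v. i \<in> K \<Longrightarrow> v \<in> V \<Longrightarrow> q (u i) v = \<sigma> i * b (u i) v"
    and Rayleigh: "\<And>w. w \<in> V \<Longrightarrow> (\<And>i. i \<in> K \<Longrightarrow> b (u i) w = 0) \<Longrightarrow> s * b w w \<le> q w w"
    and s: "\<And>i. i \<in> K \<Longrightarrow> \<sigma> i \<le> s"
    and X: "\<And>v. v \<in> V \<Longrightarrow> X v \<in> V" "linear X"
      "\<And>v w. v \<in> V \<Longrightarrow> w \<in> V \<Longrightarrow> b (X v) w = b v (X w)"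
    and Z: "\<And>i. i \<in> K \<Longrightarrow> Z (u i) \<in> A"
      "\<And>i j. i \<in> K \<Longrightarrow> j \<in> K \<Longrightarrow> b (Z (u i)) (u j) = - b (u i) (Z (u j))"
    and B: "0 < B"
  shows "(\<Sum>i\<in>K. (s - \<sigma> i)\<^sup>2 * (- 2 * b (Z (u i)) (X (u i))))
    \<le> B * (\<Sum>i\<in>K. (s - \<sigma> i)\<^sup>2 * (q (X (u i)) (X (u i)) - q (u i) (X (X (u i)))))
      + 1 / B * (\<Sum>i\<in>K. (s - \<sigma> i) * b (Z (u i)) (Z (u i)))"
proof -
  interpret b: sym_form A b by fact
  interpret q: sym_form V q by fact
  define D where "D i = s - \<sigma> i" for i
  have D0: "0 \<le> D i" if "i \<in> K" for i using s[OF that] by (simp add: D_def)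
  \<comment> \<open>Symmetry of \<open>X\<close> makes \<open>a\<close> symmetric and skewness of
    \<open>Z\<close> makes \<open>c\<close> antisymmetric; the final cancellation rests on
    this.\<close>
  define a where "a i j = b (X (u i)) (u j)" for i j
  define c where "c i j = b (Z (u i)) (u j)" for i j
  define \<phi> where "\<phi> i = X (u i) - (\<Sum>j\<in>K. a i j *\<^sub>R u j)" for i
  \<comment> \<open>Removing the projection leaves the product with \<open>\<phi> i\<close>
    unchanged, as this vector is orthogonal to all \<open>u j\<close>, but lowers the square of the
    norm by the sum of the (c_ij)^2. That gain pays for the mixed terms below.\<close>
  define Y where "Y i = Z (u i) - (\<Sum>j\<in>K. c i j *\<^sub>R u j)" for i
  define t where "t i = - 2 * b (Z (u i)) (X (u i))" for i
  define p where "p i = q (X (u i)) (X (u i)) - q (u i) (X (X (u i)))" for i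
  define z where "z i = b (Z (u i)) (Z (u i))" for i
  have uA: "u i \<in> A" if "i \<in> K" for i using u[OF that] VA by blast
  have XV: "X (u i) \<in> V" if "i \<in> K" for i using X(1)[OF u[OF that]] .
  have XA: "X (u i) \<in> A" if "i \<in> K" for i using XV[OF that] VA by blast
  have \<phi>V: "\<phi> i \<in> V" if "i \<in> K" for i
    unfolding \<phi>_def by (intro q.mem_diff XV that q.mem_sum q.mem_scale u)
  have \<phi>A: "\<phi> i \<in> A" if "i \<in> K" for i using \<phi>V[OF that] VA by blast
  have sumA: "(\<Sum>j\<in>K. d j *\<^sub>R u j) \<in> A" for d by (intro b.mem_sum b.mem_scale uA)
  have sumV: "(\<Sum>j\<in>K. d j *\<^sub>R u j) \<in> V" for d by (intro q.mem_sum q.mem_scale u)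
  have YA: "Y i \<in> A" if "i \<in> K" for i
    unfolding Y_def by (intro b.mem_diff Z(1) that sumA)
  have a_sym: "a i j = a j i" if "i \<in> K" "j \<in> K" for i j
    unfolding a_def using X(3)[OF u[OF that(1)] u[OF that(2)]] b.sym[OF uA[OF that(1)] XA[OF that(2)]] by simp
  have c_anti: "c i j = - c j i" if "i \<in> K" "j \<in> K" for i j
    unfolding c_def using Z(2)[OF that] b.sym[OF uA[OF that(1)] Z(1)[OF that(2)]] by simp
  have coeff: "b (u i) (\<Sum>j\<in>K. d j *\<^sub>R u j) = d i" if "i \<in> K" for i d
  proof -
    have "b (u i) (\<Sum>j\<in>K. d j *\<^sub>R u j) = (\<Sum>j\<in>K. d j * b (u i) (u j))"
      by (rule b.sum_right[OF uA uA[OF that]])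
    also have "\<dots> = (\<Sum>j\<in>K. if j = i then d i else 0)"
      by (intro sum.cong) (use ortho that in auto)
    finally show ?thesis using that K by simp
  qed
  have \<phi>_ortho: "b (u j) (\<phi> i) = 0" if "i \<in> K" "j \<in> K" for i j
    unfolding \<phi>_def using that b.sym[OF uA[OF that(2)] XA[OF that(1)]]
    by (simp add: b.diff_right uA XA sumA coeff a_def)
  have sum_\<phi>: "b (\<Sum>j\<in>K. d j *\<^sub>R u j) (\<phi> i) = 0" if "i \<in> K" for i d
  proof -
    have "b (\<Sum>j\<in>K. d j *\<^sub>R u j) (\<phi> i) = (\<Sum>j\<in>K. d j * b (u j) (\<phi> i))"
      by (rule b.sum_left[OF uA \<phi>A[OF that]])
    also have "\<dots> = 0"
      by (intro sum.neutral ballI) (simp add: \<phi>_ortho that)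
    finally show ?thesis .
  qed
  have X\<phi>: "b (X (u i)) (\<phi> i) = b (\<phi> i) (\<phi> i)" if "i \<in> K" for i
  proof -
    have "b (\<phi> i) (\<phi> i) = b (X (u i) - (\<Sum>j\<in>K. a i j *\<^sub>R u j)) (\<phi> i)"
      by (simp add: \<phi>_def)
    then show ?thesis
      using b.diff_left[OF XA[OF that] sumA \<phi>A[OF that]] sum_\<phi>[OF that] by simp
  qed
  have q\<phi>: "q (\<phi> i) (\<phi> i) = q (X (u i)) (\<phi> i)" if "i \<in> K" for i
  proof -
    have "q (\<Sum>j\<in>K. a i j *\<^sub>R u j) (\<phi> i) = (\<Sum>j\<in>K. a i j * q (u j) (\<phi> i))"
      by (rule q.sum_left[OF u \<phi>V[OF that]])
    also have "\<dots> = 0"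
      by (intro sum.neutral ballI) (simp add: eigen \<phi>V that \<phi>_ortho)
    finally have "q (\<Sum>j\<in>K. a i j *\<^sub>R u j) (\<phi> i) = 0" .
    moreover have "q (\<phi> i) (\<phi> i) = q (X (u i) - (\<Sum>j\<in>K. a i j *\<^sub>R u j)) (\<phi> i)"
      by (simp add: \<phi>_def)
    ultimately show ?thesis
      using q.diff_left[OF XV[OF that] sumV \<phi>V[OF that]] by simp
  qed
  \<comment> \<open>The Rayleigh bound for the trial vector. Its energy and \<sigma>_i times its
    square are both expanded in the \<open>a i j\<close>; their difference is the double commutator
    \<open>p i\<close> plus terms antisymmetric in i and j.\<close>
  have main1: "D i * b (\<phi> i) (\<phi> i) \<le> p i + (\<Sum>j\<in>K. (\<sigma> i - \<sigma> j) * (a i j)\<^sup>2)" if i: "i \<in> K" for i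
  proof -
    have "q (X (u i)) (\<phi> i) = q (X (u i)) (X (u i)) - (\<Sum>j\<in>K. a i j * q (X (u i)) (u j))"
      unfolding \<phi>_def using q.diff_right[OF XV[OF i] sumV XV[OF i]] q.sum_right[OF u XV[OF i]] by simp
    also have "(\<Sum>j\<in>K. a i j * q (X (u i)) (u j)) = (\<Sum>j\<in>K. \<sigma> j * (a i j)\<^sup>2)"
    proof (rule sum.cong[OF refl])
      fix j assume j: "j \<in> K"
      have "q (X (u i)) (u j) = \<sigma> j * a i j"
        using q.sym[OF XV[OF i] u[OF j]] eigen[OF j XV[OF i]] b.sym[OF uA[OF j] XA[OF i]] by (simp add: a_def)
      then show "a i j * q (X (u i)) (u j) = \<sigma> j * (a i j)\<^sup>2" by (simp add: power2_eq_square)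
    qed
    finally have e1: "q (\<phi> i) (\<phi> i) = q (X (u i)) (X (u i)) - (\<Sum>j\<in>K. \<sigma> j * (a i j)\<^sup>2)"
      using q\<phi>[OF i] by simp
    have X\<phi>_eq: "X (\<phi> i) = X (X (u i)) - (\<Sum>j\<in>K. a i j *\<^sub>R X (u j))"
      unfolding \<phi>_def using X(2) by (simp add: linear_diff linear_sum linear_scale)
    have "\<sigma> i * b (\<phi> i) (\<phi> i) = q (u i) (X (\<phi> i))"
      using eigen[OF i X(1)[OF \<phi>V[OF i]]] X(3)[OF u[OF i] \<phi>V[OF i]] X\<phi>[OF i] by simp
    also have "\<dots> = q (u i) (X (X (u i))) - (\<Sum>j\<in>K. a i j * q (u i) (X (u j)))"
    proof -
      have "(\<Sum>j\<in>K. a i j *\<^sub>R X (u j)) \<in> V" by (intro q.mem_sum q.mem_scale XV)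
      then show ?thesis
        unfolding X\<phi>_eq using q.diff_right[OF X(1)[OF XV[OF i]] _ u[OF i]]
          q.sum_right[of K "\<lambda>j. X (u j)", OF XV u[OF i]] by simp
    qed
    also have "(\<Sum>j\<in>K. a i j * q (u i) (X (u j))) = (\<Sum>j\<in>K. \<sigma> i * (a i j)\<^sup>2)"
    proof (rule sum.cong[OF refl])
      fix j assume j: "j \<in> K"
      have "q (u i) (X (u j)) = \<sigma> i * a i j"
        using eigen[OF i XV[OF j]] X(3)[OF u[OF i] u[OF j]] by (simp add: a_def)
      then show "a i j * q (u i) (X (u j)) = \<sigma> i * (a i j)\<^sup>2" by (simp add: power2_eq_square)
    qed
    finally have e2: "\<sigma> i * b (\<phi> i) (\<phi> i) = q (u i) (X (X (u i))) - (\<Sum>j\<in>K. \<sigma> i * (a i j)\<^sup>2)" .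
    have "s * b (\<phi> i) (\<phi> i) \<le> q (\<phi> i) (\<phi> i)"
      by (rule Rayleigh[OF \<phi>V[OF i] \<phi>_ortho[OF i]])
    then have "D i * b (\<phi> i) (\<phi> i) \<le> q (\<phi> i) (\<phi> i) - \<sigma> i * b (\<phi> i) (\<phi> i)"
      by (simp add: D_def left_diff_distrib)
    also have "\<dots> = p i + (\<Sum>j\<in>K. (\<sigma> i - \<sigma> j) * (a i j)\<^sup>2)"
      unfolding e1 e2 p_def by (simp add: sum_subtractf left_diff_distrib)
    finally show ?thesis .
  qed
  have Yb: "b (Y i) (Y i) = z i - (\<Sum>j\<in>K. (c i j)\<^sup>2)" if i: "i \<in> K" for i
  proof -
    let ?S = "\<Sum>j\<in>K. c i j *\<^sub>R u j"
    have "b ?S ?S = (\<Sum>j\<in>K. c i j * b (u j) ?S)" by (rule b.sum_left[OF uA sumA])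
    also have "\<dots> = (\<Sum>j\<in>K. (c i j)\<^sup>2)"
      by (intro sum.cong) (simp_all add: coeff power2_eq_square)
    finally have 1: "b ?S ?S = (\<Sum>j\<in>K. (c i j)\<^sup>2)" .
    have "b (Z (u i)) ?S = (\<Sum>j\<in>K. c i j * c i j)"
      unfolding c_def by (rule b.sum_right[OF uA Z(1)[OF i]])
    then have 2: "b (Z (u i)) ?S = (\<Sum>j\<in>K. (c i j)\<^sup>2)" by (simp add: power2_eq_square)
    show ?thesis
      unfolding Y_def using b.square_diff[OF Z(1)[OF i] sumA] 1 2 by (simp add: z_def)
  qed
  have Y\<phi>: "- 2 * b (Y i) (\<phi> i) = t i + 2 * (\<Sum>j\<in>K. a i j * c i j)" if i: "i \<in> K" for i
  proof -
    have "b (Y i) (\<phi> i) = b (Z (u i)) (\<phi> i)"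
      unfolding Y_def using b.diff_left[OF Z(1)[OF i] sumA \<phi>A[OF i]] sum_\<phi>[OF i] by simp
    also have "\<dots> = b (Z (u i)) (X (u i)) - (\<Sum>j\<in>K. a i j * c i j)"
      unfolding \<phi>_def c_def using b.diff_right[OF XA[OF i] sumA Z(1)[OF i]]
        b.sum_right[OF uA Z(1)[OF i]] by simp
    finally show ?thesis by (simp add: t_def)
  qed
  \<comment> \<open>Collects all terms with two indices. A single entry has no sign; the sum over i
    and j has.\<close>
  define E where "E i j = B * (D i)\<^sup>2 * ((\<sigma> i - \<sigma> j) * (a i j)\<^sup>2) - D i / B * (c i j)\<^sup>2
      - 2 * (D i)\<^sup>2 * (a i j * c i j)" for i j
  have each: "(D i)\<^sup>2 * t i \<le> B * ((D i)\<^sup>2 * p i) + 1 / B * (D i * z i) + (\<Sum>j\<in>K. E i j)" if i: "i \<in> K" for i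
  proof -
    \<comment> \<open>Young's inequality with the weight B D_i adapted to the index. The later
      factor D_i / B produces the powers of D_i wanted in the sum.\<close>
    have "0 \<le> b ((B * D i) *\<^sub>R \<phi> i + Y i) ((B * D i) *\<^sub>R \<phi> i + Y i)"
      by (intro b.nonneg b.mem_add b.mem_scale \<phi>A YA i)
    also have "\<dots> = (B * D i)\<^sup>2 * b (\<phi> i) (\<phi> i) + 2 * (B * D i) * b (Y i) (\<phi> i) + b (Y i) (Y i)"
      using \<phi>A[OF i] YA[OF i] b.sym[OF YA[OF i] \<phi>A[OF i]]
      by (simp add: b.square_add b.mem_scale b.scale_left b.scale_right power2_eq_square)
    finally have "0 \<le> D i / B * ((B * D i)\<^sup>2 * b (\<phi> i) (\<phi> i) + 2 * (B * D i) * b (Y i) (\<phi> i) + b (Y i) (Y i))"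
      using D0[OF i] B by simp
    also have "\<dots> = B * (D i)\<^sup>2 * (D i * b (\<phi> i) (\<phi> i)) + (D i)\<^sup>2 * (2 * b (Y i) (\<phi> i)) + D i / B * b (Y i) (Y i)"
      using B by (simp add: field_simps power2_eq_square)
    also have "2 * b (Y i) (\<phi> i) = - (t i + 2 * (\<Sum>j\<in>K. a i j * c i j))"
      using Y\<phi>[OF i] by simp
    finally have "(D i)\<^sup>2 * t i \<le> B * (D i)\<^sup>2 * (D i * b (\<phi> i) (\<phi> i)) - 2 * (D i)\<^sup>2 * (\<Sum>j\<in>K. a i j * c i j)
        + D i / B * b (Y i) (Y i)"
      by (simp add: algebra_simps)
    also have "B * (D i)\<^sup>2 * (D i * b (\<phi> i) (\<phi> i)) \<le> B * (D i)\<^sup>2 * (p i + (\<Sum>j\<in>K. (\<sigma> i - \<sigma> j) * (a i j)\<^sup>2))"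
      using main1[OF i] B by (intro mult_left_mono) auto
    finally show ?thesis
      unfolding Yb[OF i] E_def sum_subtractf sum_distrib_left[symmetric] by (simp add: algebra_simps)
  qed
  have "(\<Sum>i\<in>K. \<Sum>j\<in>K. E i j) \<le> 0"
  proof -
    \<comment> \<open>Since \<sigma>_i - \<sigma>_j = D_j - D_i, symmetrising leaves minus a
      nonnegative multiple of the square of B (D_i - D_j) a_ij + c_ij.\<close>
    have pair: "E i j + E j i \<le> 0" if i: "i \<in> K" and j: "j \<in> K" for i j
    proof -
      have "E i j + E j i = - ((D i + D j) / B * (B * (D i - D j) * a i j + c i j)\<^sup>2)"
        unfolding E_def a_sym[OF j i] c_anti[OF j i] D_def using B
        by (simp add: field_simps power2_eq_square)
      also have "\<dots> \<le> 0"
        using D0[OF i] D0[OF j] B by simp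
      finally show ?thesis .
    qed
    have "2 * (\<Sum>i\<in>K. \<Sum>j\<in>K. E i j) = (\<Sum>i\<in>K. \<Sum>j\<in>K. E i j) + (\<Sum>i\<in>K. \<Sum>j\<in>K. E j i)"
      using sum.swap[of E K K] by simp
    also have "\<dots> = (\<Sum>i\<in>K. \<Sum>j\<in>K. E i j + E j i)"
      by (simp add: sum.distrib)
    also have "\<dots> \<le> 0"
      by (intro sum_nonpos pair)
    finally show ?thesis by simp
  qed
  moreover have "(\<Sum>i\<in>K. (D i)\<^sup>2 * t i)
      \<le> (\<Sum>i\<in>K. B * ((D i)\<^sup>2 * p i) + 1 / B * (D i * z i) + (\<Sum>j\<in>K. E i j))"
    by (intro sum_mono each)
  ultimately have "(\<Sum>i\<in>K. (D i)\<^sup>2 * t i) \<le> B * (\<Sum>i\<in>K. (D i)\<^sup>2 * p i) + 1 / B * (\<Sum>i\<in>K. D i * z i)"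
    by (simp add: sum.distrib sum_distrib_left)
  then show ?thesis by (simp add: D_def t_def p_def z_def)
qed

section \<open>The quadratic inequality\<close>

text \<open>After the shift by \<open>D\<close> the hypothesis is quadratic in x + D, with
  coefficients given by the first two moments of the shifted values; completing the square gives the
  claim. The point \<open>x\<close> is left free so that two consecutive eigenvalues can be
  inserted.\<close>

lemma Yang_quadratic:
  fixes \<sigma> :: "nat \<Rightarrow> real" and k :: nat
  assumes k: "1 \<le> k"
    and le: "(\<Sum>i=1..k. (x - \<sigma> i)\<^sup>2) \<le> A * (\<Sum>i=1..k. (x - \<sigma> i) * (\<sigma> i + D))"
  shows "(x + D - (1 + A / 2) * (1 / k * (\<Sum>i=1..k. \<sigma> i + D)))\<^sup>2
    \<le> (A / 2 * (1 / k * (\<Sum>i=1..k. \<sigma> i + D)))\<^sup>2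
      - (1 + A) * (1 / k * (\<Sum>j=1..k. (\<sigma> j - 1 / k * (\<Sum>i=1..k. \<sigma> i))\<^sup>2))"
proof -
  define v where "v i = \<sigma> i + D" for i
  define y where "y = x + D"
  define S where "S = (\<Sum>i=1..k. v i)"
  define Q where "Q = (\<Sum>i=1..k. (v i)\<^sup>2)"
  have k0: "real k > 0" using k by simp
  have mean: "1 / k * (\<Sum>i=1..k. \<sigma> i) = S / k - D"
    using k0 by (simp add: S_def v_def sum.distrib field_simps)
  have "(\<Sum>j=1..k. (\<sigma> j - 1 / k * (\<Sum>i=1..k. \<sigma> i))\<^sup>2) = (\<Sum>j=1..k. (v j)\<^sup>2 - 2 * (S / k) * v j + (S / k)\<^sup>2)"
    unfolding mean by (intro sum.cong) (simp_all add: v_def power2_eq_square algebra_simps)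
  also have "\<dots> = Q - 2 * (S / k) * S + k * (S / k)\<^sup>2"
    by (simp add: Q_def S_def sum.distrib sum_subtractf sum_distrib_left)
  also have "\<dots> = Q - S\<^sup>2 / k"
    using k0 by (simp add: power2_eq_square field_simps)
  finally have var: "(\<Sum>j=1..k. (\<sigma> j - 1 / k * (\<Sum>i=1..k. \<sigma> i))\<^sup>2) = Q - S\<^sup>2 / k" .
  have "(\<Sum>i=1..k. (x - \<sigma> i)\<^sup>2) = (\<Sum>i=1..k. y\<^sup>2 - 2 * y * v i + (v i)\<^sup>2)"
    by (intro sum.cong) (simp_all add: y_def v_def power2_eq_square algebra_simps)
  also have "\<dots> = k * y\<^sup>2 - 2 * y * S + Q"
    by (simp add: S_def Q_def sum.distrib sum_subtractf sum_distrib_left)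
  finally have lhs: "(\<Sum>i=1..k. (x - \<sigma> i)\<^sup>2) = k * y\<^sup>2 - 2 * y * S + Q" .
  have "(\<Sum>i=1..k. (x - \<sigma> i) * (\<sigma> i + D)) = (\<Sum>i=1..k. y * v i - (v i)\<^sup>2)"
    by (intro sum.cong) (simp_all add: y_def v_def power2_eq_square algebra_simps)
  also have "\<dots> = y * S - Q"
    by (simp add: S_def Q_def sum_subtractf sum_distrib_left)
  finally have "k * y\<^sup>2 - 2 * y * S + Q \<le> A * (y * S - Q)"
    using le lhs by simp
  then have "(k * y\<^sup>2 - 2 * y * S + Q) / k \<le> A * (y * S - Q) / k"
    using k0 by (intro divide_right_mono) auto
  then have *: "y\<^sup>2 - (2 + A) * y * (S / k) + (1 + A) * (Q / k) \<le> 0"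
    using k0 by (simp add: field_simps)
  have expand: "(y - (1 + A / 2) * m)\<^sup>2
      = (y\<^sup>2 - (2 + A) * y * m + (1 + A) * r) + ((A / 2 * m)\<^sup>2 - (1 + A) * (r - m\<^sup>2))" for m r :: real
    by (simp add: power2_eq_square algebra_simps)
  have "(y - (1 + A / 2) * (S / k))\<^sup>2
      = (y\<^sup>2 - (2 + A) * y * (S / k) + (1 + A) * (Q / k))
        + ((A / 2 * (S / k))\<^sup>2 - (1 + A) * (Q / k - (S / k)\<^sup>2))"
    by (rule expand)
  also have "\<dots> \<le> (A / 2 * (S / k))\<^sup>2 - (1 + A) * (Q / k - (S / k)\<^sup>2)"
    using * by simp
  also have "Q / k - (S / k)\<^sup>2 = 1 / k * (Q - S\<^sup>2 / k)"
    using k0 by (simp add: power2_eq_square field_simps)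
  finally show ?thesis
    unfolding var by (simp add: y_def S_def v_def)
qed

section \<open>Linear dependence\<close>

text \<open>Gaussian elimination of the last coordinate with pivot \<open>p0\<close>. The vectors
  form an indexed family, so repetitions among them are allowed.\<close>

lemma linear_dependence:
  fixes c :: "'p \<Rightarrow> nat \<Rightarrow> real"
  shows "finite P \<Longrightarrow> m < card P \<Longrightarrow> \<exists>d. (\<exists>p\<in>P. d p \<noteq> 0) \<and> (\<forall>j<m. (\<Sum>p\<in>P. d p * c p j) = 0)"
proof (induction m arbitrary: P c)
  case 0
  then have "P \<noteq> {}" by auto
  then show ?case by (intro exI[of _ "\<lambda>_. 1"]) auto
next
  case (Suc m)
  show ?case
  proof (cases "\<forall>p\<in>P. c p m = 0")
    case True
    obtain d where "\<exists>p\<in>P. d p \<noteq> 0" "\<forall>j<m. (\<Sum>p\<in>P. d p * c p j) = 0"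
      using Suc.IH[of P c] Suc.prems by auto
    with True show ?thesis by (intro exI[of _ d]) (auto simp: less_Suc_eq)
  next
    case False
    then obtain p0 where p0: "p0 \<in> P" "c p0 m \<noteq> 0" by blast
    define c' where "c' p j = c p j - c p m / c p0 m * c p0 j" for p j
    obtain d where d: "\<exists>p\<in>P - {p0}. d p \<noteq> 0" "\<forall>j<m. (\<Sum>p\<in>P - {p0}. d p * c' p j) = 0"
    proof -
      have "m < card (P - {p0})" "finite (P - {p0})"
        using Suc.prems p0(1) by (simp_all add: card_Diff_singleton)
      then show ?thesis using Suc.IH[of "P - {p0}" c'] that by blast
    qed
    define d' where "d' p = (if p = p0 then - (\<Sum>p\<in>P - {p0}. d p * (c p m / c p0 m)) else d p)" for p
    have "(\<Sum>p\<in>P. d' p * c p j) = (\<Sum>p\<in>P - {p0}. d p * c' p j)" for j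
    proof -
      have "(\<Sum>p\<in>P. d' p * c p j) = d' p0 * c p0 j + (\<Sum>p\<in>P - {p0}. d' p * c p j)"
        by (rule sum.remove[OF Suc.prems(1) p0(1)])
      also have "(\<Sum>p\<in>P - {p0}. d' p * c p j) = (\<Sum>p\<in>P - {p0}. d p * c p j)"
        by (intro sum.cong) (auto simp: d'_def)
      also have "d' p0 * c p0 j = - (\<Sum>p\<in>P - {p0}. d p * (c p m / c p0 m * c p0 j))"
        by (simp add: d'_def sum_distrib_right mult.assoc)
      finally show ?thesis
        by (simp add: c'_def right_diff_distrib sum_subtractf)
    qed
    moreover have "c' p m = 0" for p using p0(2) by (simp add: c'_def)
    ultimately have "\<forall>j<Suc m. (\<Sum>p\<in>P. d' p * c p j) = 0"
      using d(2) by (auto simp: less_Suc_eq)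
    moreover have "\<exists>p\<in>P. d' p \<noteq> 0" using d(1) by (auto simp: d'_def)
    ultimately show ?thesis by blast
  qed
qed

section \<open>Vector-valued jets\<close>

text \<open>Row a of the matrix is the gradient of the a-th component.\<close>

type_synonym 'n vjet = "(real^'n) \<times> (real^'n^'n)"

definition comp_jet :: "'n \<Rightarrow> 'n vjet \<Rightarrow> real \<times> (real^'n)" where
  "comp_jet a p = (fst p $ a, snd p $ a)"

definition emb_jet :: "'n \<Rightarrow> real \<times> (real^'n) \<Rightarrow> 'n vjet" where
  "emb_jet a p = (axis a (fst p), axis a (snd p))"

lemma linear_comp_jet: "linear (comp_jet a)"
  by (rule linearI) (auto simp: comp_jet_def)

lemma linear_emb_jet: "linear (emb_jet a)"
  by (rule linearI) (auto simp: emb_jet_def axis_def vec_eq_iff)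

lemma comp_emb_jet: "comp_jet a (emb_jet b p) = (if a = b then p else 0)"
  by (auto simp: comp_jet_def emb_jet_def axis_def prod_eq_iff)

lemma sum_emb_comp_jet: "(\<Sum>a\<in>UNIV. emb_jet a (comp_jet a p)) = p"
proof (rule prod_eqI)
  show "fst (\<Sum>a\<in>UNIV. emb_jet a (comp_jet a p)) = fst p"
    by (simp add: fst_sum vec_eq_iff emb_jet_def comp_jet_def axis_def sum_component if_distrib cong: if_cong)
  show "snd (\<Sum>a\<in>UNIV. emb_jet a (comp_jet a p)) = snd p"
    by (simp add: snd_sum vec_eq_iff[of "snd _"] emb_jet_def comp_jet_def axis_def sum_component
        if_distrib cong: if_cong) (simp add: vec_eq_iff)
qed

context bounded_open
begin

lemma bounded_op_const:
  fixes A :: "'b::euclidean_space \<Rightarrow> 'c::euclidean_space"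
  assumes "linear A"
  shows "bounded_op M (\<lambda>x. A)"
proof (rule bounded_op_continuous[OF _ _ bounded_\<Omega> \<Omega>_sets])
  have "continuous_on UNIV A"
    using assms by (intro linear_continuous_on) (simp add: linear_conv_bounded_linear)
  then show "continuous_on UNIV (\<lambda>(x::real^'n, p). A p)"
    unfolding split_beta by (rule continuous_on_compose2) (auto intro: continuous_intros)
qed (use assms in auto)

definition WV :: "(real^'n \<Rightarrow> 'n vjet) set" where
  "WV = {J. \<forall>a. (\<lambda>x. comp_jet a (J x)) \<in> W0 \<Omega>}"

lemma WV_comp: "J \<in> WV \<Longrightarrow> (\<lambda>x. comp_jet a (J x)) \<in> W0 \<Omega>"
  by (simp add: WV_def)

lemma sum_emb_comp_field: "(\<Sum>a\<in>UNIV. (\<lambda>x. emb_jet a (comp_jet a (J x)))) = J"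
  by (simp add: fun_eq_iff sum_fun_apply sum_emb_comp_jet)

lemma WV_L2: "WV \<subseteq> L2 M"
proof
  fix J assume "J \<in> WV"
  then have "(\<lambda>x. emb_jet a (comp_jet a (J x))) \<in> L2 M" for a
    by (intro bounded_op_L2[OF bounded_op_const[OF linear_emb_jet]] W0_L2 WV_comp)
  then have "(\<Sum>a\<in>UNIV. (\<lambda>x. emb_jet a (comp_jet a (J x)))) \<in> L2 M"
    by (intro L2_sum)
  then show "J \<in> L2 M" by (simp only: sum_emb_comp_field)
qed

lemma subspace_WV: "subspace WV"
proof (rule subspaceI)
  have "comp_jet a 0 = 0" for a :: 'n
    by (simp add: comp_jet_def prod_eq_iff)
  then show "0 \<in> WV"
    using subspace_0[OF subspace_W0] by (simp add: WV_def zero_fun_def)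
next
  fix J K assume *: "J \<in> WV" "K \<in> WV"
  have "(\<lambda>x. comp_jet a ((J + K) x)) = (\<lambda>x. comp_jet a (J x)) + (\<lambda>x. comp_jet a (K x))" for a
    by (simp add: fun_eq_iff comp_jet_def)
  then show "J + K \<in> WV"
    using subspace_add[OF subspace_W0 WV_comp[OF *(1)] WV_comp[OF *(2)]] by (simp add: WV_def)
next
  fix c J assume *: "J \<in> WV"
  have "(\<lambda>x. comp_jet a ((c *\<^sub>R J) x)) = c *\<^sub>R (\<lambda>x. comp_jet a (J x))" for a
    by (simp add: fun_eq_iff comp_jet_def)
  then show "c *\<^sub>R J \<in> WV"
    using subspace_scale[OF subspace_W0 WV_comp[OF *]] by (simp add: WV_def)
qed

lemma WV_closed:
  assumes J: "\<And>m. J m \<in> WV" and g: "g \<in> L2 M" and conv: "(\<lambda>m. sqn M (J m - g)) \<longlonglongrightarrow> 0"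
  shows "g \<in> WV"
  unfolding WV_def
proof (intro CollectI allI)
  fix a
  show "(\<lambda>x. comp_jet a (g x)) \<in> W0 \<Omega>"
  proof (rule W0_closed)
    show "(\<lambda>x. comp_jet a (g x)) \<in> L2 M"
      by (rule bounded_op_L2[OF bounded_op_const[OF linear_comp_jet] g])
    show "(\<lambda>x. comp_jet a (J m x)) \<in> W0 \<Omega>" for m by (rule WV_comp[OF J])
    have JL: "J m \<in> L2 M" for m using J WV_L2 by blast
    show "(\<lambda>m. sqn M ((\<lambda>x. comp_jet a (J m x)) - (\<lambda>x. comp_jet a (g x)))) \<longlonglongrightarrow> 0"
      by (rule bounded_op_tendsto[OF bounded_op_const[OF linear_comp_jet] JL g conv])
  qed
qed

lemma emb_WV:
  assumes "j \<in> W0 \<Omega>"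
  shows "(\<lambda>x. emb_jet a (j x)) \<in> WV"
proof -
  have "(\<lambda>x. 0) \<in> W0 \<Omega>"
    using subspace_0[OF subspace_W0] by (simp add: zero_fun_def)
  then have "(\<lambda>x. comp_jet c (emb_jet a (j x))) \<in> W0 \<Omega>" for c
    using assms by (cases "c = a") (simp_all add: comp_emb_jet)
  then show ?thesis by (simp add: WV_def)
qed

text \<open>Scalar compactness is applied to one component after another, each time thinning the
  subsequence; the components treated before stay Cauchy.\<close>

lemma Rellich_WV:
  fixes J :: "nat \<Rightarrow> real^'n \<Rightarrow> 'n vjet"
  assumes J: "\<And>m. J m \<in> WV" and B: "\<And>m. sqn M (J m) \<le> B"
  shows "\<exists>r::nat \<Rightarrow> nat. strict_mono r \<and>
    (\<forall>e>0. \<exists>N. \<forall>i\<ge>N. \<forall>k\<ge>N. sqn M (\<lambda>x. fst (J (r i) x) - fst (J (r k) x)) < e)"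
proof -
  let ?P = "\<lambda>S (r :: nat \<Rightarrow> nat). strict_mono r \<and> (\<forall>a\<in>S. \<forall>e>0. \<exists>N. \<forall>i\<ge>N. \<forall>k\<ge>N.
      sqn M (\<lambda>x. fst (J (r i) x) $ a - fst (J (r k) x) $ a) < e)"
  have JL: "J m \<in> L2 M" for m using J WV_L2 by blast
  have ex: "\<exists>r::nat \<Rightarrow> nat. ?P S r" if "finite S" for S :: "'n set"
    using that
  proof (induction S)
    case empty
    show ?case by (intro exI[of _ id]) (auto simp: strict_mono_def)
  next
    case (insert a S)
    then obtain r :: "nat \<Rightarrow> nat" where r: "?P S r" by blast
    have comp: "(\<lambda>x. comp_jet a (J (r m) x)) \<in> W0 \<Omega>" for m by (rule WV_comp[OF J])
    have bd: "sqn M (\<lambda>x. comp_jet a (J (r m) x)) \<le> B" for m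
    proof -
      have "sqn M (\<lambda>x. comp_jet a (J (r m) x)) \<le> 1\<^sup>2 * sqn M (J (r m))"
      proof (rule sqn_le_bound[OF W0_L2[OF comp] JL])
        fix x
        let ?p = "J (r m) x"
        have "(norm (comp_jet a ?p))\<^sup>2 \<le> (norm ?p)\<^sup>2"
          unfolding norm_prod_sq comp_jet_def fst_conv snd_conv
          by (intro add_mono power_mono Finite_Cartesian_Product.norm_nth_le) auto
        then show "norm (comp_jet a ?p) \<le> 1 * norm ?p"
          by (simp add: power2_le_iff_abs_le)
      qed
      then show ?thesis using B[of "r m"] by simp
    qed
    have "\<exists>r'::nat \<Rightarrow> nat. strict_mono r' \<and> (\<forall>e>0. \<exists>N. \<forall>i\<ge>N. \<forall>k\<ge>N.
        sqn M (\<lambda>x. fst (comp_jet a (J (r (r' i)) x)) - fst (comp_jet a (J (r (r' k)) x))) < e)"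
      by (rule Rellich[of "\<lambda>m x. comp_jet a (J (r m) x)" B, OF comp bd])
    then obtain r' :: "nat \<Rightarrow> nat" where r': "strict_mono r'" "\<forall>e>0. \<exists>N. \<forall>i\<ge>N. \<forall>k\<ge>N.
        sqn M (\<lambda>x. fst (comp_jet a (J (r (r' i)) x)) - fst (comp_jet a (J (r (r' k)) x))) < e"
      by (elim exE conjE)
    have "?P (insert a S) (\<lambda>i. r (r' i))"
    proof (intro conjI ballI allI impI)
      show "strict_mono (\<lambda>i. r (r' i))"
        using r r'(1) by (simp add: strict_mono_def)
      fix c and e :: real assume c: "c \<in> insert a S" and e: "0 < e"
      show "\<exists>N. \<forall>i\<ge>N. \<forall>k\<ge>N. sqn M (\<lambda>x. fst (J (r (r' i)) x) $ c - fst (J (r (r' k)) x) $ c) < e"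
      proof (cases "c = a")
        case True
        then show ?thesis using r'(2)[rule_format, OF e] by (simp add: comp_jet_def)
      next
        case False
        then obtain N where N: "\<forall>i\<ge>N. \<forall>k\<ge>N. sqn M (\<lambda>x. fst (J (r i) x) $ c - fst (J (r k) x) $ c) < e"
          using r c e by blast
        have "r' i \<ge> N" if "i \<ge> N" for i using seq_suble[OF r'(1), of i] that by simp
        then show ?thesis using N by blast
      qed
    qed
    then show ?case by blast
  qed
  have "\<exists>r::nat \<Rightarrow> nat. ?P (UNIV :: 'n set) r" by (rule ex) simp
  then obtain r :: "nat \<Rightarrow> nat" where P: "?P (UNIV :: 'n set) r" by (elim exE)
  have r: "strict_mono r" "\<And>a e. 0 < e \<Longrightarrow> \<exists>N. \<forall>i\<ge>N. \<forall>k\<ge>N.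
      sqn M (\<lambda>x. fst (J (r i) x) $ a - fst (J (r k) x) $ a) < e"
    using P by simp_all
  have split: "sqn M (\<lambda>x. fst (J i x) - fst (J k x)) = (\<Sum>a\<in>UNIV. sqn M (\<lambda>x. fst (J i x) $ a - fst (J k x) $ a))" for i k
  proof -
    have d: "(\<lambda>x. fst ((J i - J k) x)) \<in> L2 M" by (intro L2_fst L2_diff JL)
    have "sqn M (\<lambda>x. fst (J i x) - fst (J k x)) = (LINT x|M. (\<Sum>a\<in>UNIV. (norm (fst (J i x) $ a - fst (J k x) $ a))\<^sup>2))"
      unfolding sqn_def by (simp add: norm_vec_def L2_set_def sum_nonneg)
    also have "\<dots> = (\<Sum>a\<in>UNIV. sqn M (\<lambda>x. fst (J i x) $ a - fst (J k x) $ a))"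
      unfolding sqn_def
      by (rule Bochner_Integration.integral_sum) (use L2D(2)[OF L2_nth[OF d]] in simp)
    finally show ?thesis .
  qed
  have "\<exists>N. \<forall>i\<ge>N. \<forall>k\<ge>N. sqn M (\<lambda>x. fst (J (r i) x) - fst (J (r k) x)) < e" if e: "0 < e" for e
  proof -
    define n where "n = real CARD('n)"
    have n: "n > 0" by (simp add: n_def)
    have "\<forall>a. \<exists>N. \<forall>i\<ge>N. \<forall>k\<ge>N. sqn M (\<lambda>x. fst (J (r i) x) $ a - fst (J (r k) x) $ a) < e / n"
      using r(2)[OF divide_pos_pos[OF e n]] by simp
    then have "\<exists>N. \<forall>a. \<forall>i\<ge>N a. \<forall>k\<ge>N a. sqn M (\<lambda>x. fst (J (r i) x) $ a - fst (J (r k) x) $ a) < e / n"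
      by (rule choice)
    then obtain N where N: "\<forall>a. \<forall>i\<ge>N a. \<forall>k\<ge>N a. sqn M (\<lambda>x. fst (J (r i) x) $ a - fst (J (r k) x) $ a) < e / n"
      by (elim exE)
    have "sqn M (\<lambda>x. fst (J (r i) x) - fst (J (r k) x)) < e" if "i \<ge> Max (range N)" "k \<ge> Max (range N)" for i k
    proof -
      have "N a \<le> Max (range N)" for a by (intro Max_ge) auto
      then have "sqn M (\<lambda>x. fst (J (r i) x) $ a - fst (J (r k) x) $ a) < e / n" for a
        by (intro N[rule_format] order_trans[OF _ that(1)] order_trans[OF _ that(2)])
      then have "(\<Sum>a\<in>UNIV. sqn M (\<lambda>x. fst (J (r i) x) $ a - fst (J (r k) x) $ a)) < (\<Sum>a\<in>(UNIV::'n set). e / n)"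
        by (intro sum_strict_mono) auto
      also have "\<dots> = e" using n by (simp add: n_def)
      finally show ?thesis by (simp add: split)
    qed
    then show ?thesis by blast
  qed
  then show ?thesis using r(1) by blast
qed

end

section \<open>The weighted forms\<close>

lemma continuous_on_matrix_vector_mult [continuous_intros]:
  fixes F :: "'z::topological_space \<Rightarrow> real^'n^'m"
  assumes "continuous_on A F" "continuous_on A g"
  shows "continuous_on A (\<lambda>z. F z *v g z)"
  unfolding matrix_vector_mult_def
  by (intro continuous_on_vec_lambda continuous_intros assms)

lemma bform_cong_AE_left:
  assumes q: "bounded_form M q" and f: "f \<in> L2 M" "f' \<in> L2 M" and g: "g \<in> L2 M"
    and ae: "AE x in M. f x = f' x"
  shows "bform M q f g = bform M q f' g"
  unfolding bform_def
proof (rule integral_cong_AE)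
  show "(\<lambda>x. q x (f x) (g x)) \<in> borel_measurable M" "(\<lambda>x. q x (f' x) (g x)) \<in> borel_measurable M"
    using bform_integrable[OF q f(1) g] bform_integrable[OF q f(2) g] by auto
  show "AE x in M. q x (f x) (g x) = q x (f' x) (g x)"
    using ae by eventually_elim simp
qed

locale elliptic = bounded_open \<Omega> for \<Omega> :: "(real^'n) set" +
  fixes \<eta> :: "real^'n \<Rightarrow> real" and T :: "real^'n \<Rightarrow> real^'n^'n" and \<alpha> \<epsilon> \<delta> :: real
  assumes C2_\<eta>: "C_k (Suc (Suc 0)) \<eta> UNIV"
    and smooth_T: "\<And>k. C_k k T UNIV"
    and T_symmetric: "\<And>x. transpose (T x) = T x"
    and \<epsilon>_pos: "0 < \<epsilon>"
    and T_lower: "\<And>x v. x \<in> \<Omega> \<Longrightarrow> \<epsilon> * (v \<bullet> v) \<le> (T x *v v) \<bullet> v"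
    and T_upper: "\<And>x v. x \<in> \<Omega> \<Longrightarrow> (T x *v v) \<bullet> v \<le> \<delta> * (v \<bullet> v)"
    and \<alpha>_nonneg: "0 \<le> \<alpha>"
begin

definition \<omega> :: "real^'n \<Rightarrow> real" where
  "\<omega> x = exp (- \<eta> x)"

lemma \<omega>_pos: "0 < \<omega> x"
  by (simp add: \<omega>_def)

lemma C1_\<eta>: "C_k (Suc 0) \<eta> UNIV"
  by (rule C_k_Suc_imp[OF C2_\<eta>])

lemma C1_\<omega>: "C_k (Suc 0) \<omega> UNIV"
  unfolding \<omega>_def[abs_def] by (intro C_k_compose_real[OF C_k_exp] C_k_uminus C1_\<eta>)

lemma C1_exp_\<eta>: "C_k (Suc 0) (\<lambda>x. exp (\<eta> x)) UNIV"
  by (intro C_k_compose_real[OF C_k_exp] C1_\<eta>)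

lemma grad_\<omega>: "grad \<omega> x = - (\<omega> x *\<^sub>R grad \<eta> x)"
proof (rule grad_eqI)
  have "((\<lambda>x. exp (- \<eta> x)) has_derivative (\<lambda>v. (- (grad \<eta> x \<bullet> v)) * exp (- \<eta> x))) (at x)"
    by (intro has_derivative_exp has_derivative_minus has_derivative_grad C_k_differentiable[OF C1_\<eta>])
  then show "(\<omega> has_derivative (\<lambda>v. (- (\<omega> x *\<^sub>R grad \<eta> x)) \<bullet> v)) (at x)"
    by (simp add: \<omega>_def[abs_def] mult.commute)
qed

lemma grad_exp_\<eta>: "grad (\<lambda>x. exp (\<eta> x)) x = exp (\<eta> x) *\<^sub>R grad \<eta> x"
proof (rule grad_eqI)
  have "((\<lambda>x. exp (\<eta> x)) has_derivative (\<lambda>v. (grad \<eta> x \<bullet> v) * exp (\<eta> x))) (at x)"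
    by (intro has_derivative_exp has_derivative_grad C_k_differentiable[OF C1_\<eta>])
  then show "((\<lambda>x. exp (\<eta> x)) has_derivative (\<lambda>v. (exp (\<eta> x) *\<^sub>R grad \<eta> x) \<bullet> v)) (at x)"
    by (simp add: mult.commute)
qed

lemma continuous_coefficients [continuous_intros]:
  fixes f :: "'z::topological_space \<Rightarrow> real^'n"
  assumes "continuous_on A f"
  shows "continuous_on A (\<lambda>z. \<eta> (f z))" "continuous_on A (\<lambda>z. \<omega> (f z))"
    "continuous_on A (\<lambda>z. grad \<eta> (f z))" "continuous_on A (\<lambda>z. T (f z))"
  by (rule continuous_on_compose2[OF C_k_imp_continuous[OF C1_\<eta>] assms subset_UNIV],
      rule continuous_on_compose2[OF C_k_imp_continuous[OF C1_\<omega>] assms subset_UNIV],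
      rule continuous_on_compose2[OF continuous_grad[OF C1_\<eta>] assms subset_UNIV],
      rule continuous_on_compose2[OF C_k_imp_continuous[OF smooth_T[of 0]] assms subset_UNIV])

lemma T_inner_commute: "(T x *v v) \<bullet> w = v \<bullet> (T x *v w)"
proof -
  have "(T x *v v) \<bullet> w = (v v* T x) \<bullet> w"
    using T_symmetric[of x] transpose_matrix_vector[of "T x" v] by simp
  then show ?thesis by (simp add: dot_lmul_matrix)
qed

definition divf :: "real^'n \<Rightarrow> 'n vjet \<Rightarrow> real" where
  "divf x p = (\<Sum>a\<in>UNIV. snd p $ a $ a) - grad \<eta> x \<bullet> fst p"

definition bq :: "real^'n \<Rightarrow> 'n vjet \<Rightarrow> 'n vjet \<Rightarrow> real" where
  "bq x p r = \<omega> x * (fst p \<bullet> fst r)"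

text \<open>The integrand of the Dirichlet form of -(L + \<alpha> grad div_\<eta>). With respect to
  dm the operators grad and -div_\<eta> are adjoint, so testing the equation with a field that
  vanishes on the boundary moves one derivative onto that field.\<close>

definition qq :: "real^'n \<Rightarrow> 'n vjet \<Rightarrow> 'n vjet \<Rightarrow> real" where
  "qq x p r = \<omega> x * ((\<Sum>a\<in>UNIV. (T x *v (snd p $ a)) \<bullet> (snd r $ a)) + \<alpha> * (divf x p * divf x r))"

lemma divf_add: "divf x (p + r) = divf x p + divf x r"
  by (simp add: divf_def sum.distrib inner_add_right)

lemma divf_scale: "divf x (c *\<^sub>R p) = c * divf x p"
  by (simp add: divf_def sum_distrib_left right_diff_distrib)

lemma continuous_divf [continuous_intros]:
  fixes f :: "'z::topological_space \<Rightarrow> real^'n"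
  assumes "continuous_on A f" "continuous_on A g"
  shows "continuous_on A (\<lambda>z. divf (f z) (g z))"
  unfolding divf_def by (intro continuous_intros assms)

lemma bounded_bq: "bounded_form M bq"
proof (rule bounded_form_continuous[OF _ _ bounded_\<Omega> \<Omega>_sets])
  show "bilinear (bq x)" for x
    unfolding bilinear_def by (auto intro!: linearI simp: bq_def inner_add_left inner_add_right algebra_simps)
  show "continuous_on UNIV (\<lambda>(x, p, r). bq x p r)"
    unfolding bq_def split_beta by (intro continuous_intros)
qed

lemma bounded_qq: "bounded_form M qq"
proof (rule bounded_form_continuous[OF _ _ bounded_\<Omega> \<Omega>_sets])
  show "bilinear (qq x)" for x
    unfolding bilinear_def
    by (intro conjI allI linearI;
        simp add: qq_def divf_add divf_scale inner_add_left inner_add_right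
          matrix_vector_right_distrib matrix_vector_mult_scaleR sum.distrib sum_distrib_left algebra_simps)
  show "continuous_on UNIV (\<lambda>(x, p, r). qq x p r)"
    unfolding qq_def split_beta by (intro continuous_intros)
qed

abbreviation b :: "(real^'n \<Rightarrow> 'n vjet) \<Rightarrow> (real^'n \<Rightarrow> 'n vjet) \<Rightarrow> real" where
  "b \<equiv> bform M bq"

abbreviation q :: "(real^'n \<Rightarrow> 'n vjet) \<Rightarrow> (real^'n \<Rightarrow> 'n vjet) \<Rightarrow> real" where
  "q \<equiv> bform M qq"

lemma WV_L2': "J \<in> WV \<Longrightarrow> J \<in> L2 M"
  using WV_L2 by blast

lemma T_inner_sym: "(T x *v v) \<bullet> w = (T x *v w) \<bullet> v"
  using T_inner_commute[of x v w] inner_commute[of v "T x *v w"] by simp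

lemma qq_sym: "qq x p r = qq x r p"
proof -
  have "(\<Sum>a\<in>UNIV. (T x *v (snd p $ a)) \<bullet> (snd r $ a)) = (\<Sum>a\<in>UNIV. (T x *v (snd r $ a)) \<bullet> (snd p $ a))"
    by (intro sum.cong refl T_inner_sym)
  then show ?thesis by (simp add: qq_def mult.commute)
qed

lemma qq_nonneg: "x \<in> \<Omega> \<Longrightarrow> 0 \<le> qq x p p"
proof -
  assume x: "x \<in> \<Omega>"
  have "0 \<le> (T x *v v) \<bullet> v" for v
    using T_lower[OF x, of v] \<epsilon>_pos by (meson inner_ge_zero less_imp_le mult_nonneg_nonneg order_trans)
  then show ?thesis
    unfolding qq_def
    by (intro mult_nonneg_nonneg[OF less_imp_le[OF \<omega>_pos]] add_nonneg_nonneg sum_nonneg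
        mult_nonneg_nonneg[OF \<alpha>_nonneg zero_le_square])
qed

lemma sym_form_b: "sym_form (L2 M) b"
proof
  show "subspace (L2 M :: (real^'n \<Rightarrow> 'n vjet) set)" by (rule subspace_L2)
  show "0 \<le> b J J" for J
    unfolding bform_def bq_def by (intro Bochner_Integration.integral_nonneg) (simp add: \<omega>_pos less_imp_le)
  show "b J K = b K J" for J K
    by (simp add: bform_def bq_def inner_commute)
qed (simp_all add: bform_add_left[OF bounded_bq] bform_scale_left[OF bounded_bq])

lemma sym_form_q: "sym_form WV q"
proof
  show "subspace WV" by (rule subspace_WV)
  show "0 \<le> q J J" for J
    unfolding bform_def by (intro Bochner_Integration.integral_nonneg) (simp add: qq_nonneg)
  show "q J K = q K J" for J K
    unfolding bform_def by (subst qq_sym) simp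
qed (simp_all add: bform_add_left[OF bounded_qq] bform_scale_left[OF bounded_qq] WV_L2')

lemma sym_form_b_WV: "sym_form WV b"
proof -
  interpret b: sym_form "L2 M" b by (rule sym_form_b)
  show ?thesis
    by unfold_locales (auto intro: subspace_WV simp: b.add_left b.scale_left b.nonneg WV_L2' intro: b.sym)
qed

lemma \<omega>_lower:
  obtains c where "0 < c" "\<And>x. x \<in> \<Omega> \<Longrightarrow> c \<le> \<omega> x"
proof -
  have "continuous_on UNIV \<eta>" by (intro continuous_intros)
  then obtain C where C: "\<And>x. x \<in> \<Omega> \<Longrightarrow> norm (\<eta> x) \<le> C"
    by (rule continuous_bounded_on_\<Omega>) blast
  have "exp (- C) \<le> \<omega> x" if "x \<in> \<Omega>" for x
    using C[OF that] by (simp add: \<omega>_def)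
  then show ?thesis using that[of "exp (- C)"] by simp
qed

text \<open>On \<Omega> the weight has a positive lower bound. Hence \<open>b\<close> controls the
  values, and through the bound \<epsilon> for T the form \<open>q\<close> controls the
  gradients.\<close>

lemma coercive:
  obtains c where "0 < c" "\<And>J. J \<in> L2 M \<Longrightarrow> c * sqn M J \<le> b J J + q J J"
proof -
  obtain c0 where c0: "0 < c0" "\<And>x. x \<in> \<Omega> \<Longrightarrow> c0 \<le> \<omega> x"
    by (rule \<omega>_lower) blast
  define c where "c = c0 * min 1 \<epsilon>"
  have c: "0 < c" "c \<le> c0" "c \<le> c0 * \<epsilon>" using c0(1) \<epsilon>_pos by (auto simp: c_def)
  have bpt: "c * (norm (fst p))\<^sup>2 \<le> bq x p p" if "x \<in> \<Omega>" for x p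
    using c(2) c0(2)[OF that] unfolding bq_def power2_norm_eq_inner
    by (intro mult_right_mono) auto
  have qpt: "c * (norm (snd p))\<^sup>2 \<le> qq x p p" if x: "x \<in> \<Omega>" for x p
  proof -
    have "c * (norm (snd p))\<^sup>2 \<le> c0 * (\<epsilon> * (norm (snd p))\<^sup>2)"
      using mult_right_mono[OF c(3), of "(norm (snd p))\<^sup>2"] by (simp add: mult.assoc)
    also have "\<dots> \<le> \<omega> x * (\<epsilon> * (norm (snd p))\<^sup>2)"
      using c0(2)[OF x] \<epsilon>_pos by (intro mult_right_mono) auto
    also have "\<epsilon> * (norm (snd p))\<^sup>2 = (\<Sum>a\<in>UNIV. \<epsilon> * ((snd p $ a) \<bullet> (snd p $ a)))"
      by (simp only: power2_norm_eq_inner inner_vec_def[of "snd p" "snd p"] sum_distrib_left)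
    also have "\<omega> x * \<dots> \<le> qq x p p"
      unfolding qq_def
    proof (rule mult_left_mono)
      have "(\<Sum>a\<in>UNIV. \<epsilon> * ((snd p $ a) \<bullet> (snd p $ a))) \<le> (\<Sum>a\<in>UNIV. (T x *v (snd p $ a)) \<bullet> (snd p $ a))"
        by (intro sum_mono T_lower x)
      then show "(\<Sum>a\<in>UNIV. \<epsilon> * ((snd p $ a) \<bullet> (snd p $ a)))
          \<le> (\<Sum>a\<in>UNIV. (T x *v (snd p $ a)) \<bullet> (snd p $ a)) + \<alpha> * (divf x p * divf x p)"
        using mult_nonneg_nonneg[OF \<alpha>_nonneg zero_le_square[of "divf x p"]] by linarith
    qed (simp add: \<omega>_pos less_imp_le)
    finally show ?thesis .
  qed
  show ?thesis
  proof (rule that[OF c(1)])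
    fix J :: "real^'n \<Rightarrow> 'n vjet" assume J: "J \<in> L2 M"
    note ib = bform_integrable[OF bounded_bq J J] and iq = bform_integrable[OF bounded_qq J J]
    have "c * sqn M J = (LINT x|M. c * (norm (J x))\<^sup>2)" by (simp add: sqn_def)
    also have "\<dots> \<le> (LINT x|M. bq x (J x) (J x) + qq x (J x) (J x))"
    proof (rule integral_mono)
      show "c * (norm (J x))\<^sup>2 \<le> bq x (J x) (J x) + qq x (J x) (J x)" if "x \<in> space M" for x
        using bpt[of x "J x"] qpt[of x "J x"] that by (simp add: norm_prod_sq distrib_left)
    qed (use ib iq L2D(2)[OF J] in auto)
    also have "\<dots> = b J J + q J J"
      unfolding bform_def by (rule Bochner_Integration.integral_add[OF ib iq])
    finally show "c * sqn M J \<le> b J J + q J J" .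
  qed
qed

lemma form_le_sqn:
  assumes F: "bounded_form M F"
  obtains C where "0 \<le> C" "\<And>J. J \<in> L2 M \<Longrightarrow> bform M F J J \<le> C * sqn M J"
proof -
  obtain C where C: "C \<ge> 0" "\<And>f g. f \<in> L2 M \<Longrightarrow> g \<in> L2 M \<Longrightarrow>
      \<bar>bform M F f g\<bar> \<le> C * (sqrt (sqn M f) * sqrt (sqn M g))"
    by (rule bform_bound[OF F]) blast
  have "bform M F J J \<le> C * sqn M J" if "J \<in> L2 M" for J
    using C(2)[OF that that] by simp
  then show ?thesis using that C(1) by blast
qed

lemma b_le_fst:
  obtains C where "0 < C" "\<And>J. J \<in> L2 M \<Longrightarrow> b J J \<le> C * sqn M (\<lambda>x. fst (J x))"
proof -
  have "continuous_on UNIV \<omega>" by (intro continuous_intros)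
  then obtain C where C: "0 \<le> C" "\<And>x. x \<in> \<Omega> \<Longrightarrow> norm (\<omega> x) \<le> C"
    by (rule continuous_bounded_on_\<Omega>) blast
  have "b J J \<le> (C + 1) * sqn M (\<lambda>x. fst (J x))" if J: "J \<in> L2 M" for J
  proof -
    have "b J J \<le> (LINT x|M. (C + 1) * (norm (fst (J x)))\<^sup>2)"
      unfolding bform_def
    proof (rule integral_mono)
      show "integrable M (\<lambda>x. bq x (J x) (J x))" by (rule bform_integrable[OF bounded_bq J J])
      show "integrable M (\<lambda>x. (C + 1) * (norm (fst (J x)))\<^sup>2)"
        using L2D(2)[OF L2_fst[OF J]] by simp
      show "bq x (J x) (J x) \<le> (C + 1) * (norm (fst (J x)))\<^sup>2" if "x \<in> space M" for x
        unfolding bq_def power2_norm_eq_inner using C(2)[of x] that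
        by (intro mult_right_mono) auto
    qed
    then show ?thesis by (simp add: sqn_def)
  qed
  then show ?thesis using that[of "C + 1"] C(1) by simp
qed

text \<open>Compactness is Rellich's theorem, applicable because \<open>b\<close> is bounded by the
  values alone. Completeness is that of L2, because b + q is bounded above and below by multiples of
  the squared H^1-norm.\<close>

lemma compact_form_pair_WV: "compact_form_pair WV b q"
proof -
  obtain c where c: "0 < c" "\<And>J. J \<in> L2 M \<Longrightarrow> c * sqn M J \<le> b J J + q J J"
    by (rule coercive) blast
  obtain Cb where Cb: "0 < Cb" "\<And>J. J \<in> L2 M \<Longrightarrow> b J J \<le> Cb * sqn M (\<lambda>x. fst (J x))"
    by (rule b_le_fst) blast
  interpret b: sym_form WV b by (rule sym_form_b_WV)
  interpret q: sym_form WV q by (rule sym_form_q)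
  show ?thesis
  proof (unfold_locales, goal_cases)
    case (1 f B)
    have sq: "sqn M (f m) \<le> (B + B) / c" for m
    proof -
      have "c * sqn M (f m) \<le> B + B"
        using c(2)[OF WV_L2'[OF 1(1)], of m] 1(2)[of m] 1(3)[of m] by linarith
      then show ?thesis using c(1) by (simp add: pos_le_divide_eq mult.commute)
    qed
    have "\<exists>r::nat \<Rightarrow> nat. strict_mono r \<and>
      (\<forall>e>0. \<exists>N. \<forall>i\<ge>N. \<forall>k\<ge>N. sqn M (\<lambda>x. fst (f (r i) x) - fst (f (r k) x)) < e)"
      by (rule Rellich_WV[OF 1(1) sq])
    then obtain r :: "nat \<Rightarrow> nat" where r: "strict_mono r"
      "\<forall>e>0. \<exists>N. \<forall>i\<ge>N. \<forall>k\<ge>N. sqn M (\<lambda>x. fst (f (r i) x) - fst (f (r k) x)) < e"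
      by (elim exE conjE)
    have "\<exists>N. \<forall>i\<ge>N. \<forall>j\<ge>N. b (f (r i) - f (r j)) (f (r i) - f (r j)) < e" if e: "0 < e" for e
    proof -
      obtain N where N: "\<forall>i\<ge>N. \<forall>k\<ge>N. sqn M (\<lambda>x. fst (f (r i) x) - fst (f (r k) x)) < e / Cb"
        using r(2) divide_pos_pos[OF e Cb(1)] by (elim allE impE) auto
      have "b (f (r i) - f (r j)) (f (r i) - f (r j)) < e" if "i \<ge> N" "j \<ge> N" for i j
      proof -
        have "b (f (r i) - f (r j)) (f (r i) - f (r j)) \<le> Cb * sqn M (\<lambda>x. fst ((f (r i) - f (r j)) x))"
          by (rule Cb(2)[OF WV_L2'[OF b.mem_diff[OF 1(1) 1(1)]]])
        also have "\<dots> = Cb * sqn M (\<lambda>x. fst (f (r i) x) - fst (f (r j) x))" by simp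
        also have "\<dots> < e"
        proof -
          have "sqn M (\<lambda>x. fst (f (r i) x) - fst (f (r j) x)) < e / Cb"
            using N that by simp
          then show ?thesis using Cb(1) by (simp add: pos_less_divide_eq mult.commute)
        qed
        finally show ?thesis .
      qed
      then show ?thesis by (intro exI[of _ N]) simp
    qed
    then show ?case using r(1) by (intro exI[of _ r]) simp
  next
    case (2 f)
    have fL: "f m \<in> L2 M" for m using 2(1) WV_L2' by simp
    have cauchy: "\<exists>N. \<forall>i\<ge>N. \<forall>j\<ge>N. sqn M (f i - f j) < e" if e: "0 < e" for e
    proof -
      have e2: "0 < c * e / 2" using e c(1) by simp
      obtain N1 where N1: "\<forall>i\<ge>N1. \<forall>j\<ge>N1. b (f i - f j) (f i - f j) < c * e / 2"
        using 2(2)[OF e2] by (elim exE)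
      obtain N2 where N2: "\<forall>i\<ge>N2. \<forall>j\<ge>N2. q (f i - f j) (f i - f j) < c * e / 2"
        using 2(3)[OF e2] by (elim exE)
      have "sqn M (f i - f j) < e" if "i \<ge> max N1 N2" "j \<ge> max N1 N2" for i j
      proof -
        have "c * sqn M (f i - f j) \<le> b (f i - f j) (f i - f j) + q (f i - f j) (f i - f j)"
          by (rule c(2)[OF L2_diff[OF fL fL]])
        also have "\<dots> < c * e / 2 + c * e / 2"
          using N1 N2 that by (intro add_strict_mono) auto
        finally show ?thesis using c(1) by simp
      qed
      then show ?thesis by (intro exI[of _ "max N1 N2"]) simp
    qed
    obtain g where g: "g \<in> L2 M" "(\<lambda>m. sqn M (f m - g)) \<longlonglongrightarrow> 0"
      by (rule L2_complete[OF finite_measure_M fL cauchy]) auto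
    have gW: "g \<in> WV" by (rule WV_closed[OF 2(1) g])
    have lim: "(\<lambda>m. bform M F (f m - g) (f m - g)) \<longlonglongrightarrow> 0"
      if F: "bounded_form M F" and nonneg: "\<And>J. J \<in> WV \<Longrightarrow> 0 \<le> bform M F J J" for F
    proof -
      obtain C where C: "0 \<le> C" "\<And>J. J \<in> L2 M \<Longrightarrow> bform M F J J \<le> C * sqn M J"
        by (rule form_le_sqn[OF F]) blast
      show ?thesis
      proof (rule tendsto_0_le)
        show "(\<lambda>m. C * sqn M (f m - g)) \<longlonglongrightarrow> 0"
          using tendsto_mult_left[OF g(2), of C] by simp
        show "0 \<le> bform M F (f m - g) (f m - g)" for m
          by (rule nonneg[OF b.mem_diff[OF 2(1) gW]])
        show "bform M F (f m - g) (f m - g) \<le> C * sqn M (f m - g)" for m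
          by (rule C(2)[OF L2_diff[OF fL g(1)]])
      qed
    qed
    show ?case
      using gW lim[OF bounded_bq b.nonneg] lim[OF bounded_qq q.nonneg] by (intro bexI[of _ g] conjI)
  qed
qed

end

section \<open>The eigenvalue problem in weighted form\<close>

context elliptic
begin

text \<open>Built from the representative chosen by \<open>weak_grad\<close>, so a jet is recovered
  from its values only almost everywhere; see \<open>jetv_fst_ae\<close>.\<close>

definition jetv :: "(real^'n \<Rightarrow> real^'n) \<Rightarrow> real^'n \<Rightarrow> 'n vjet" where
  "jetv u x = (u x, \<chi> a. weak_grad \<Omega> (\<lambda>y. u y $ a) x)"

lemma weak_div_eta_eq: "weak_div_eta \<Omega> \<eta> u x = divf x (jetv u x)"
  by (simp add: weak_div_eta_def divf_def jetv_def)

lemma jetv_WV: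
  assumes "\<And>a. (\<lambda>x. u x $ a) \<in> H1_0 \<Omega>"
  shows "jetv u \<in> WV"
  using H1_0_jet[OF assms] by (simp add: WV_def comp_jet_def jetv_def)

lemma jetv_fst_ae:
  assumes J: "J \<in> WV"
  shows "AE x in M. jetv (\<lambda>x. fst (J x)) x = J x"
proof -
  have "AE x in M. weak_grad \<Omega> (\<lambda>y. fst (J y) $ a) x = snd (J x) $ a" for a
    using W0_weak_grad_ae[OF WV_comp[OF J, of a]] by (simp add: comp_jet_def)
  then have "AE x in M. \<forall>a. weak_grad \<Omega> (\<lambda>y. fst (J y) $ a) x = snd (J x) $ a"
    by (subst AE_all_countable) simp
  then show ?thesis
    by eventually_elim (simp add: jetv_def prod_eq_iff vec_eq_iff)
qed

text \<open>The (unweighted) distributional equation for the component \<open>a\<close>, as a form in the jets of the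
  solution and of the test function. Testing it with \<open>\<omega> \<phi>\<close> gives the weighted weak form.\<close>

definition eqn_form :: "'n \<Rightarrow> real \<Rightarrow> real^'n \<Rightarrow> 'n vjet \<Rightarrow> real \<times> (real^'n) \<Rightarrow> real" where
  "eqn_form a s x p r = (T x *v (snd p $ a)) \<bullet> snd r + (grad \<eta> x \<bullet> (T x *v (snd p $ a))) * fst r
    + \<alpha> * (divf x p * (snd r $ a)) - s * (fst p $ a * fst r)"

lemma bounded_form_combination:
  assumes bil: "\<And>x. bilinear (F x :: 'n vjet \<Rightarrow> real \<times> (real^'n) \<Rightarrow> real)"
    and cont: "continuous_on UNIV (\<lambda>(x, p, r). F x p r)"
  shows "bounded_form M F"
  by (rule bounded_form_continuous[OF bil cont bounded_\<Omega> \<Omega>_sets])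

lemma bounded_eqn_part1: "bounded_form M (\<lambda>x (p :: 'n vjet) (r :: real \<times> (real^'n)). (T x *v (snd p $ a)) \<bullet> snd r)"
proof (rule bounded_form_combination)
  show "bilinear ((\<lambda>x (p :: 'n vjet) (r :: real \<times> (real^'n)). (T x *v (snd p $ a)) \<bullet> snd r) x)" for x
    unfolding bilinear_def eqn_form_def
    by (intro conjI allI linearI; simp add: divf_add divf_scale inner_add_left inner_add_right
        matrix_vector_right_distrib matrix_vector_mult_scaleR algebra_simps)
  show "continuous_on UNIV (\<lambda>(x, p, r). (\<lambda>x (p :: 'n vjet) (r :: real \<times> (real^'n)). (T x *v (snd p $ a)) \<bullet> snd r) x p r)"
    unfolding split_beta eqn_form_def by (intro continuous_intros)
qed

lemma bounded_eqn_part2: "bounded_form M (\<lambda>x (p :: 'n vjet) (r :: real \<times> (real^'n)). (grad \<eta> x \<bullet> (T x *v (snd p $ a))) * fst r)"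
proof (rule bounded_form_combination)
  show "bilinear ((\<lambda>x (p :: 'n vjet) (r :: real \<times> (real^'n)). (grad \<eta> x \<bullet> (T x *v (snd p $ a))) * fst r) x)" for x
    unfolding bilinear_def eqn_form_def
    by (intro conjI allI linearI; simp add: divf_add divf_scale inner_add_left inner_add_right
        matrix_vector_right_distrib matrix_vector_mult_scaleR algebra_simps)
  show "continuous_on UNIV (\<lambda>(x, p, r). (\<lambda>x (p :: 'n vjet) (r :: real \<times> (real^'n)). (grad \<eta> x \<bullet> (T x *v (snd p $ a))) * fst r) x p r)"
    unfolding split_beta eqn_form_def by (intro continuous_intros)
qed

lemma bounded_eqn_part3: "bounded_form M (\<lambda>x (p :: 'n vjet) (r :: real \<times> (real^'n)). divf x p * (snd r $ a))"
proof (rule bounded_form_combination)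
  show "bilinear ((\<lambda>x (p :: 'n vjet) (r :: real \<times> (real^'n)). divf x p * (snd r $ a)) x)" for x
    unfolding bilinear_def eqn_form_def
    by (intro conjI allI linearI; simp add: divf_add divf_scale inner_add_left inner_add_right
        matrix_vector_right_distrib matrix_vector_mult_scaleR algebra_simps)
  show "continuous_on UNIV (\<lambda>(x, p, r). (\<lambda>x (p :: 'n vjet) (r :: real \<times> (real^'n)). divf x p * (snd r $ a)) x p r)"
    unfolding split_beta eqn_form_def by (intro continuous_intros)
qed

lemma bounded_eqn_part4: "bounded_form M (\<lambda>x (p :: 'n vjet) (r :: real \<times> (real^'n)). fst p $ a * fst r)"
proof (rule bounded_form_combination)
  show "bilinear ((\<lambda>x (p :: 'n vjet) (r :: real \<times> (real^'n)). fst p $ a * fst r) x)" for x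
    unfolding bilinear_def eqn_form_def
    by (intro conjI allI linearI; simp add: divf_add divf_scale inner_add_left inner_add_right
        matrix_vector_right_distrib matrix_vector_mult_scaleR algebra_simps)
  show "continuous_on UNIV (\<lambda>(x, p, r). (\<lambda>x (p :: 'n vjet) (r :: real \<times> (real^'n)). fst p $ a * fst r) x p r)"
    unfolding split_beta eqn_form_def by (intro continuous_intros)
qed

lemma bounded_eqn_form: "bounded_form M (eqn_form a s)"
proof (rule bounded_form_combination)
  show "bilinear (eqn_form a s x)" for x
    unfolding bilinear_def eqn_form_def
    by (intro conjI allI linearI; simp add: divf_add divf_scale inner_add_left inner_add_right
        matrix_vector_right_distrib matrix_vector_mult_scaleR algebra_simps)
  show "continuous_on UNIV (\<lambda>(x, p, r). eqn_form a s x p r)"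
    unfolding split_beta eqn_form_def by (intro continuous_intros)
qed

lemma eqn_form_split:
  assumes J: "J \<in> L2 M" and j: "j \<in> L2 M"
  shows "bform M (eqn_form a s) J j = (LINT x|M. (T x *v (snd (J x) $ a)) \<bullet> snd (j x))
    + (LINT x|M. (grad \<eta> x \<bullet> (T x *v (snd (J x) $ a))) * fst (j x))
    + \<alpha> * (LINT x|M. divf x (J x) * (snd (j x) $ a)) - s * (LINT x|M. fst (J x) $ a * fst (j x))"
  unfolding bform_def eqn_form_def
  using bform_integrable[OF bounded_eqn_part1 J j, of a] bform_integrable[OF bounded_eqn_part2 J j, of a]
    bform_integrable[OF bounded_eqn_part3 J j, of a] bform_integrable[OF bounded_eqn_part4 J j, of a]
  by simp

section \<open>From the distributional equation to the weighted weak form\<close>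

lemma eigen_equation_iff:
  assumes u: "jetv u \<in> L2 M" and \<phi>: "\<phi> \<in> test_functions \<Omega>"
  shows "L_op \<Omega> T \<eta> (\<lambda>x. u x $ a) \<phi> + \<alpha> * distr_partial \<Omega> a (weak_div_eta \<Omega> \<eta> u) \<phi>
      = - s * distr_of \<Omega> (\<lambda>x. u x $ a) \<phi>
    \<longleftrightarrow> bform M (eqn_form a s) (jetv u) (jet \<phi>) = 0"
proof -
  have j: "jet \<phi> \<in> L2 M" using jet_test_L2 \<phi> by blast
  show ?thesis
    unfolding eqn_form_split[OF u j]
    by (simp add: L_op_def distr_div_eta_def distr_div_def distr_of_def distr_partial_def
        weak_div_eta_eq[abs_def]) (auto simp add: jetv_def jet_def)
qed

text \<open>The gradient of the weight is -\<omega> grad \<eta>. It cancels the first-order term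
  with grad \<eta>, and it turns the a-th partial derivative of the test function into div_\<eta> of
  the field whose only component is the a-th.\<close>

lemma eqn_form_mult_jet:
  "eqn_form a s x p (mult_jet \<omega> x r) = qq x p (emb_jet a r) - s * bq x p (emb_jet a r)"
proof -
  have 1: "(\<Sum>c\<in>UNIV. (T x *v (snd p $ c)) \<bullet> (snd (emb_jet a r) $ c)) = (T x *v (snd p $ a)) \<bullet> snd r"
    by (simp add: emb_jet_def axis_def if_distrib cong: if_cong)
  have 2: "divf x (emb_jet a r) = snd r $ a - grad \<eta> x $ a * fst r"
  proof -
    have "(\<Sum>c\<in>UNIV. snd (emb_jet a r) $ c $ c) = (\<Sum>c\<in>UNIV. if c = a then snd r $ a else 0)"
      by (intro sum.cong) (auto simp: emb_jet_def axis_def)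
    then show ?thesis by (simp add: divf_def emb_jet_def inner_axis)
  qed
  have 3: "fst p \<bullet> fst (emb_jet a r) = fst p $ a * fst r"
    by (simp add: emb_jet_def inner_axis)
  show ?thesis
    unfolding eqn_form_def qq_def bq_def mult_jet_def grad_\<omega> fst_conv snd_conv 1 2 3
    by (simp add: inner_add_right inner_commute[of "grad \<eta> x"] algebra_simps)
qed

lemma bform_eqn_mult_jet:
  assumes J: "J \<in> L2 M" and l: "l \<in> W0 \<Omega>"
  shows "bform M (eqn_form a s) J (\<lambda>x. mult_jet \<omega> x (l x))
    = q J (\<lambda>x. emb_jet a (l x)) - s * b J (\<lambda>x. emb_jet a (l x))"
proof -
  have e: "(\<lambda>x. emb_jet a (l x)) \<in> L2 M" by (rule WV_L2'[OF emb_WV[OF l]])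
  show ?thesis
    unfolding bform_def eqn_form_mult_jet
    using bform_integrable[OF bounded_qq J e] bform_integrable[OF bounded_bq J e] by simp
qed

lemma eigenspace_WV:
  assumes "u \<in> eigenspace \<Omega> T \<eta> \<alpha> s"
  shows "jetv u \<in> WV"
  using assms by (intro jetv_WV) (simp add: eigenspace_def)

text \<open>The equation extends from test functions to \<open>W0\<close> by density, in particular
  to products with the weight; this settles fields with a single component. A general field is the
  sum of its components.\<close>

lemma eigenspace_form:
  assumes u: "u \<in> eigenspace \<Omega> T \<eta> \<alpha> s" and K: "K \<in> WV"
  shows "q (jetv u) K = s * b (jetv u) K"
proof -
  interpret q: sym_form WV q by (rule sym_form_q)
  interpret b: sym_form WV b by (rule sym_form_b_WV)
  have JW: "jetv u \<in> WV" by (rule eigenspace_WV[OF u])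
  have JL: "jetv u \<in> L2 M" by (rule WV_L2'[OF JW])
  have comp: "q (jetv u) (\<lambda>x. emb_jet a (l x)) = s * b (jetv u) (\<lambda>x. emb_jet a (l x))"
    if l: "l \<in> W0 \<Omega>" for a l
  proof -
    have "bform M (eqn_form a s) (jetv u) (\<lambda>x. mult_jet \<omega> x (l x)) = 0"
    proof (rule bform_zero_closure[OF bounded_eqn_form _ jet_test_L2])
      show "{jetv u} \<subseteq> L2 M" using JL by simp
      then show "jetv u \<in> L2_closure M {jetv u}" using L2_closure_incl by blast
      show "(\<lambda>x. mult_jet \<omega> x (l x)) \<in> L2_closure M (jet ` test_functions \<Omega>)"
        using mult_jet_W0[OF C1_\<omega> l] by (simp add: W0_def)
      fix f g assume f: "f \<in> {jetv u}" and "g \<in> jet ` test_functions \<Omega>"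
      then obtain \<phi> where \<phi>: "\<phi> \<in> test_functions \<Omega>" "g = jet \<phi>" by blast
      have "L_op \<Omega> T \<eta> (\<lambda>x. u x $ a) \<phi> + \<alpha> * distr_partial \<Omega> a (weak_div_eta \<Omega> \<eta> u) \<phi>
          = - s * distr_of \<Omega> (\<lambda>x. u x $ a) \<phi>"
        using u \<phi>(1) by (simp add: eigenspace_def)
      then show "bform M (eqn_form a s) f g = 0"
        using eigen_equation_iff[OF JL \<phi>(1)] f \<phi>(2) by simp
    qed
    then show ?thesis using bform_eqn_mult_jet[OF JL l] by simp
  qed
  have emb: "(\<lambda>x. emb_jet a (comp_jet a (K x))) \<in> WV" for a
    by (rule emb_WV[OF WV_comp[OF K]])
  have "q (jetv u) (\<Sum>a\<in>UNIV. 1 *\<^sub>R (\<lambda>x. emb_jet a (comp_jet a (K x))))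
      = (\<Sum>a\<in>UNIV. 1 * q (jetv u) (\<lambda>x. emb_jet a (comp_jet a (K x))))"
    by (rule q.sum_right[OF emb JW])
  moreover have "b (jetv u) (\<Sum>a\<in>UNIV. 1 *\<^sub>R (\<lambda>x. emb_jet a (comp_jet a (K x))))
      = (\<Sum>a\<in>UNIV. 1 * b (jetv u) (\<lambda>x. emb_jet a (comp_jet a (K x))))"
    by (rule b.sum_right[OF emb JW])
  ultimately show ?thesis
    by (simp add: sum_emb_comp_field comp[OF WV_comp[OF K]] sum_distrib_left)
qed

lemma eigenspace_converse:
  assumes J: "J \<in> WV" and eq: "\<And>K. K \<in> WV \<Longrightarrow> q J K = s * b J K"
  shows "(\<lambda>x. fst (J x)) \<in> eigenspace \<Omega> T \<eta> \<alpha> s"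
proof -
  let ?u = "\<lambda>x. fst (J x)"
  have H: "(\<lambda>x. ?u x $ a) \<in> H1_0 \<Omega>" for a
    using W0_H1_0[OF WV_comp[OF J, of a]] by (simp add: comp_jet_def)
  have JL: "J \<in> L2 M" by (rule WV_L2'[OF J])
  have uL: "jetv ?u \<in> L2 M" by (rule WV_L2'[OF jetv_WV[OF H]])
  have "bform M (eqn_form a s) (jetv ?u) (jet \<phi>) = 0" if \<phi>: "\<phi> \<in> test_functions \<Omega>" for a \<phi>
  proof -
    have j: "jet \<phi> \<in> W0 \<Omega>" by (rule jet_test_W0[OF \<phi>])
    \<comment> \<open>The test function divided by the weight: multiplication by
      \<open>\<omega>\<close> returns the jet of \<phi> itself.\<close>
    define l where "l = (\<lambda>x. mult_jet (\<lambda>x. exp (\<eta> x)) x (jet \<phi> x))"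
    have l: "l \<in> W0 \<Omega>" unfolding l_def by (rule mult_jet_W0[OF C1_exp_\<eta> j])
    have "(\<lambda>x. mult_jet \<omega> x (l x)) = jet \<phi>"
    proof
      fix x
      have "\<omega> x = inverse (exp (\<eta> x))" by (simp add: \<omega>_def exp_minus)
      then show "mult_jet \<omega> x (l x) = jet \<phi> x"
        by (simp add: l_def mult_jet_def grad_\<omega> grad_exp_\<eta> prod_eq_iff scaleR_add_right)
    qed
    then have "bform M (eqn_form a s) J (jet \<phi>) = q J (\<lambda>x. emb_jet a (l x)) - s * b J (\<lambda>x. emb_jet a (l x))"
      using bform_eqn_mult_jet[OF JL l, of a s] by simp
    also have "\<dots> = 0" using eq[OF emb_WV[OF l]] by simp
    finally show ?thesis
      using bform_cong_AE_left[OF bounded_eqn_form uL JL W0_L2[OF j] jetv_fst_ae[OF J]] by simp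
  qed
  then show ?thesis
    using H eigen_equation_iff[OF uL] by (simp add: eigenspace_def)
qed

lemma integral_weighted:
  assumes "f \<in> borel_measurable M"
  shows "(LINT x|weighted_measure \<Omega> \<eta>. f x) = (LINT x|M. \<omega> x * f x)"
proof -
  have "\<omega> \<in> borel_measurable M"
    by (rule continuous_measurable_M) (intro continuous_intros)
  moreover have "weighted_measure \<Omega> \<eta> = density M (\<lambda>x. ennreal (\<omega> x))"
    by (simp add: weighted_measure_def \<omega>_def)
  ultimately show ?thesis
    using integral_density[of f M \<omega>] assms \<omega>_pos by (simp add: less_imp_le)
qed

lemma b_jetv:
  assumes "jetv u \<in> L2 M" "jetv v \<in> L2 M"
  shows "(LINT x|weighted_measure \<Omega> \<eta>. u x \<bullet> v x) = b (jetv u) (jetv v)"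
proof -
  have "u \<in> borel_measurable M" "v \<in> borel_measurable M"
    using L2D(1)[OF L2_fst[OF assms(1)]] L2D(1)[OF L2_fst[OF assms(2)]] by (simp_all add: jetv_def)
  then have "(\<lambda>x. u x \<bullet> v x) \<in> borel_measurable M" by measurable
  then show ?thesis
    by (simp add: integral_weighted bform_def bq_def jetv_def)
qed

text \<open>An eigenfield orthogonal to all \<open>u\<^sub>i\<close> with the same eigenvalue would, together with them, be
  an orthogonal system exceeding the multiplicity.\<close>

lemma eigenvalue_multiplicity:
  fixes u :: "nat \<Rightarrow> real^'n \<Rightarrow> real^'n" and \<sigma> :: "nat \<Rightarrow> real"
  assumes u: "\<And>i. 1 \<le> i \<Longrightarrow> u i \<in> eigenspace \<Omega> T \<eta> \<alpha> (\<sigma> i)"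
    and ortho: "\<And>i j. 1 \<le> i \<Longrightarrow> 1 \<le> j \<Longrightarrow> b (jetv (u i)) (jetv (u j)) = (if i = j then 1 else 0)"
    and mult: "has_multiplicity \<Omega> T \<eta> \<alpha> l (card {i. 1 \<le> i \<and> \<sigma> i = l})"
    and fin: "finite {i. 1 \<le> i \<and> \<sigma> i = l}"
    and g: "g \<in> WV" "\<And>v. v \<in> WV \<Longrightarrow> q g v = l * b g v"
    and og: "\<And>i. 1 \<le> i \<Longrightarrow> \<sigma> i = l \<Longrightarrow> b (jetv (u i)) g = 0"
  shows "b g g = 0"
proof -
  interpret b: sym_form "L2 M" b by (rule sym_form_b)
  define I where "I = {i. 1 \<le> i \<and> \<sigma> i = l}"
  define m where "m = card I"
  \<comment> \<open>Index 0 is free, as eigenvalues are numbered from 1, and stands for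
    \<open>g\<close>. The resulting family has one member more than the multiplicity.\<close>
  define Jp where "Jp p = (if p = 0 then g else jetv (u p))" for p :: nat
  define P where "P = insert 0 I"
  have P: "finite P" "m < card P" using fin by (auto simp: P_def I_def m_def)
  have uW: "jetv (u i) \<in> WV" if "i \<in> I" for i
    using u[of i] that by (intro eigenspace_WV[of _ "\<sigma> i"]) (simp add: I_def)
  have JL: "Jp p \<in> L2 M" if "p \<in> P" for p
    using that uW g(1) by (auto simp: Jp_def P_def intro: WV_L2')
  have eig: "(\<lambda>x. fst (Jp p x)) \<in> eigenspace \<Omega> T \<eta> \<alpha> l" if "p \<in> P" for p
  proof (cases "p = 0")
    case True
    then show ?thesis using eigenspace_converse[OF g] by (simp add: Jp_def)
  next
    case False
    then have "p \<in> I" using that by (simp add: P_def)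
    then show ?thesis using u[of p] False by (simp add: Jp_def jetv_def I_def)
  qed
  have diag: "b (Jp p) (Jp r) = 0" if "p \<in> P" "r \<in> P" "p \<noteq> r" for p r
  proof (cases "p = 0")
    case True
    then have r: "r \<in> I" "r \<noteq> 0" using that by (auto simp: P_def)
    then show ?thesis using True og[of r] b.sym[OF WV_L2'[OF g(1)] WV_L2'[OF uW[OF r(1)]]]
      by (simp add: Jp_def I_def)
  next
    case False
    then have p: "p \<in> I" using that by (simp add: P_def)
    show ?thesis
    proof (cases "r = 0")
      case True
      then show ?thesis using og[of p] p False by (simp add: Jp_def I_def)
    next
      case False
      then have "r \<in> I" using that by (simp add: P_def)
      then show ?thesis using ortho[of p r] p that(3) \<open>p \<noteq> 0\<close> False by (simp add: Jp_def I_def)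
    qed
  qed
  obtain v where v: "\<forall>w\<in>eigenspace \<Omega> T \<eta> \<alpha> l. \<exists>c. AE x in M. w x = (\<Sum>j<m. c j *\<^sub>R v j x)"
    using mult unfolding has_multiplicity_def m_def I_def by (elim exE conjE)
  have "\<forall>p. \<exists>c. p \<in> P \<longrightarrow> (AE x in M. fst (Jp p x) = (\<Sum>j<m. c j *\<^sub>R v j x))"
    using v eig by simp
  then have "\<exists>c. \<forall>p. p \<in> P \<longrightarrow> (AE x in M. fst (Jp p x) = (\<Sum>j<m. c p j *\<^sub>R v j x))"
    by (rule choice)
  then obtain c where c: "\<forall>p. p \<in> P \<longrightarrow> (AE x in M. fst (Jp p x) = (\<Sum>j<m. c p j *\<^sub>R v j x))"
    by (elim exE)
  obtain d r where d: "r \<in> P" "d r \<noteq> 0" "\<forall>j<m. (\<Sum>p\<in>P. d p * c p j) = 0"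
    using linear_dependence[OF P, of c] by (elim exE conjE bexE)
  have "AE x in M. \<forall>p\<in>P. fst (Jp p x) = (\<Sum>j<m. c p j *\<^sub>R v j x)"
    using c P(1) by (intro AE_finite_allI) auto
  then have zero: "AE x in M. (\<Sum>p\<in>P. d p *\<^sub>R fst (Jp p x)) = 0"
  proof eventually_elim
    case (elim x)
    then have "(\<Sum>p\<in>P. d p *\<^sub>R fst (Jp p x)) = (\<Sum>p\<in>P. \<Sum>j<m. (d p * c p j) *\<^sub>R v j x)"
      by (simp add: scaleR_sum_right)
    also have "\<dots> = (\<Sum>j<m. (\<Sum>p\<in>P. d p * c p j) *\<^sub>R v j x)"
      by (subst sum.swap) (simp add: scaleR_sum_left)
    finally show ?case using d(3) by simp
  qed
  \<comment> \<open>Pairing the vanishing combination with a member whose coefficient is nonzero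
    isolates the square of that member. For r = 0 this is the claim; for r >= 1 it contradicts
    normalisation.\<close>
  have "b (\<Sum>p\<in>P. d p *\<^sub>R Jp p) (Jp r) = 0"
  proof -
    have "b (\<Sum>p\<in>P. d p *\<^sub>R Jp p) (Jp r) = (LINT x|M. 0)"
      unfolding bform_def
    proof (rule integral_cong_AE)
      have S: "(\<Sum>p\<in>P. d p *\<^sub>R Jp p) \<in> L2 M"
        by (intro b.mem_sum b.mem_scale JL)
      show "(\<lambda>x. bq x ((\<Sum>p\<in>P. d p *\<^sub>R Jp p) x) (Jp r x)) \<in> borel_measurable M"
        using bform_integrable[OF bounded_bq S JL[OF d(1)]] by simp
      show "AE x in M. bq x ((\<Sum>p\<in>P. d p *\<^sub>R Jp p) x) (Jp r x) = 0"
        using zero by eventually_elim (simp add: bq_def sum_fun_apply fst_sum)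
    qed simp
    then show ?thesis by simp
  qed
  moreover have "b (\<Sum>p\<in>P. d p *\<^sub>R Jp p) (Jp r) = (\<Sum>p\<in>P. d p * b (Jp p) (Jp r))"
    by (rule b.sum_left[OF JL JL[OF d(1)]])
  moreover have "(\<Sum>p\<in>P. d p * b (Jp p) (Jp r)) = (\<Sum>p\<in>P. if p = r then d r * b (Jp r) (Jp r) else 0)"
    by (intro sum.cong) (use diag d(1) in auto)
  ultimately have "d r * b (Jp r) (Jp r) = 0" using P(1) d(1) by simp
  then have br: "b (Jp r) (Jp r) = 0" using d(2) by simp
  show ?thesis
  proof (cases "r = 0")
    case True
    then show ?thesis using br by (simp add: Jp_def)
  next
    case False
    then have "1 \<le> r" using d(1) by simp
    then show ?thesis using br ortho[of r r] False by (simp add: Jp_def)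
  qed
qed

section \<open>The variational characterisation of the eigenvalues\<close>

lemma eigenvalue_sequence_mono:
  assumes "eigenvalue_sequence \<Omega> T \<eta> \<alpha> \<sigma>" "1 \<le> i" "i \<le> j"
  shows "\<sigma> i \<le> \<sigma> j"
  using assms(3)
proof (induction j rule: dec_induct)
  case (step j)
  have "\<sigma> j \<le> \<sigma> (Suc j)"
    using assms(1,2) step.hyps unfolding eigenvalue_sequence_def by simp
  with step.IH show ?case by simp
qed simp

lemma Rayleigh_WV:
  fixes u :: "nat \<Rightarrow> real^'n \<Rightarrow> real^'n" and \<sigma> :: "nat \<Rightarrow> real"
  assumes \<sigma>: "eigenvalue_sequence \<Omega> T \<eta> \<alpha> \<sigma>"
    and u: "\<And>i. 1 \<le> i \<Longrightarrow> u i \<in> eigenspace \<Omega> T \<eta> \<alpha> (\<sigma> i)"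
    and ortho: "\<And>i j. 1 \<le> i \<Longrightarrow> 1 \<le> j \<Longrightarrow> b (jetv (u i)) (jetv (u j)) = (if i = j then 1 else 0)"
    and w: "w \<in> WV" "\<And>i. i \<in> {1..k} \<Longrightarrow> b (jetv (u i)) w = 0"
  shows "\<sigma> (k + 1) * b w w \<le> q w w"
proof -
  interpret compact_form_pair WV b q by (rule compact_form_pair_WV)
  show ?thesis
  proof (rule Rayleigh_orthogonal_complement[where u="\<lambda>i. jetv (u i)"])
    show "jetv (u i) \<in> WV" if "1 \<le> i" for i by (rule eigenspace_WV[OF u[OF that]])
    show "q (jetv (u i)) v = \<sigma> i * b (jetv (u i)) v" if "1 \<le> i" "v \<in> WV" for i v
      by (rule eigenspace_form[OF u[OF that(1)] that(2)])
    show "\<sigma> i \<le> \<sigma> j" if "1 \<le> i" "i \<le> j" for i j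
      by (rule eigenvalue_sequence_mono[OF \<sigma> that])
    fix g l
    assume g: "g \<in> WV" "\<And>v. v \<in> WV \<Longrightarrow> q g v = l * b g v"
      and og: "\<And>i. 1 \<le> i \<Longrightarrow> \<sigma> i = l \<Longrightarrow> b (jetv (u i)) g = 0"
    \<comment> \<open>As \<sigma> tends to infinity, no value is taken infinitely often. This
      matters because \<open>card\<close> of an infinite set is 0, which would not be the true
      count.\<close>
    have fin: "finite {i. 1 \<le> i \<and> \<sigma> i = l}"
    proof -
      have "\<forall>\<^sub>F i in sequentially. l < \<sigma> i"
        using \<sigma> unfolding eigenvalue_sequence_def filterlim_at_top_dense by blast
      then obtain N where N: "\<And>i. i \<ge> N \<Longrightarrow> l < \<sigma> i"
        unfolding eventually_sequentially by blast
      have "{i. 1 \<le> i \<and> \<sigma> i = l} \<subseteq> {..<N}"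
        using N by (force simp: not_le[symmetric])
      then show ?thesis by (rule finite_subset) simp
    qed
    have hm: "has_multiplicity \<Omega> T \<eta> \<alpha> l (card {i. 1 \<le> i \<and> \<sigma> i = l})"
      using \<sigma> unfolding eigenvalue_sequence_def by blast
    show "b g g = 0"
      by (rule eigenvalue_multiplicity[OF u ortho hm fin g og])
  qed (use ortho w in auto)
qed

end

section \<open>Multiplication by coordinates and its commutator\<close>

lemma frechet_derivative_nth:
  fixes F :: "'a::euclidean_space \<Rightarrow> 'b::real_normed_vector^'m"
  assumes "F differentiable (at x)"
  shows "frechet_derivative (\<lambda>x. F x $ i) (at x) v = frechet_derivative F (at x) v $ i"
proof -
  have "((\<lambda>x. F x $ i) has_derivative (\<lambda>v. frechet_derivative F (at x) v $ i)) (at x)"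
    using assms by (intro bounded_linear.has_derivative[OF bounded_linear_vec_nth])
      (simp flip: frechet_derivative_works)
  from frechet_derivative_at[OF this] show ?thesis by (metis (no_types))
qed

lemma divergence_eq_grad:
  assumes "\<And>i. C_k (Suc 0) (\<lambda>x. F x $ i) UNIV"
  shows "divergence F x = (\<Sum>i\<in>UNIV. grad (\<lambda>x. F x $ i) x $ i)"
proof -
  have "F differentiable (at x)" by (rule C_k_differentiable[OF C_k_vec[OF assms]])
  then show ?thesis by (simp add: divergence_def grad_def frechet_derivative_nth)
qed

lemma matrix_vector_mult_nth: "(A *v v) $ i = (A $ i) \<bullet> v"
  by (simp add: matrix_vector_mult_def inner_vec_def)

lemma grad_nth: "grad (\<lambda>x. x $ h) x = axis h 1"
proof (rule grad_eqI)
  have "((\<lambda>x. x $ h) has_derivative (\<lambda>v. v $ h)) (at x)"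
    by (rule bounded_linear_imp_has_derivative[OF bounded_linear_vec_nth])
  then show "((\<lambda>x. x $ h) has_derivative (\<lambda>v. axis h 1 \<bullet> v)) (at x)"
    by (simp add: inner_axis')
qed

context elliptic
begin

text \<open>The Leibniz rule for multiplication by the coordinate x_h: the matrix added to the
  Jacobian is the tensor product of the field with e_h.\<close>

definition Xop :: "'n \<Rightarrow> real^'n \<Rightarrow> 'n vjet \<Rightarrow> 'n vjet" where
  "Xop h x p = (x $ h *\<^sub>R fst p, x $ h *\<^sub>R snd p + (\<chi> a. fst p $ a *\<^sub>R axis h 1))"

definition X :: "'n \<Rightarrow> (real^'n \<Rightarrow> 'n vjet) \<Rightarrow> real^'n \<Rightarrow> 'n vjet" where
  "X h J x = Xop h x (J x)"

lemma X_WV: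
  assumes "J \<in> WV"
  shows "X h J \<in> WV"
  unfolding WV_def
proof (intro CollectI allI)
  fix a
  have "comp_jet a (X h J x) = mult_jet (\<lambda>x. x $ h) x (comp_jet a (J x))" for x
    by (simp add: X_def Xop_def comp_jet_def mult_jet_def grad_nth)
  then show "(\<lambda>x. comp_jet a (X h J x)) \<in> W0 \<Omega>"
    using mult_jet_W0[OF C_k_linear[OF bounded_linear_vec_nth] WV_comp[OF assms]] by simp
qed

lemma linear_X: "linear (X h)"
  by (rule linearI) (auto simp: fun_eq_iff X_def Xop_def vec_eq_iff algebra_simps)

lemma b_X_sym: "b (X h J) K = b J (X h K)"
  by (simp add: bform_def bq_def X_def Xop_def mult.left_commute)

text \<open>With this vector field, \<open>div\<^sub>\<eta> (T e\<^sub>h)\<close> is its \<open>h\<close>-th component.\<close>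

definition Y :: "real^'n \<Rightarrow> real^'n" where
  "Y x = tr_nabla T x - T x *v grad \<eta> x"

text \<open>The second entry is a placeholder: Z_h u involves the weak gradient of u and need not be
  weakly differentiable itself. Only \<open>b\<close> is applied to such fields, and
  \<open>b\<close> reads the first entry alone.\<close>

definition Zop :: "'n \<Rightarrow> real^'n \<Rightarrow> 'n vjet \<Rightarrow> 'n vjet" where
  "Zop h x p = ((\<chi> a. (T x *v (snd p $ a)) $ h + 1/2 * (Y x $ h) * fst p $ a), 0)"

definition Z :: "'n \<Rightarrow> (real^'n \<Rightarrow> 'n vjet) \<Rightarrow> real^'n \<Rightarrow> 'n vjet" where
  "Z h J x = Zop h x (J x)"

lemma C_k_T_nth: "C_k k (\<lambda>x. T x $ i $ j) UNIV"
  by (rule C_k_bounded_linear[OF bounded_linear_vec_nth C_k_bounded_linear[OF bounded_linear_vec_nth smooth_T]])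

lemma tr_nabla_nth: "tr_nabla T x $ h = (\<Sum>j\<in>UNIV. grad (\<lambda>x. T x $ h $ j) x $ j)"
proof -
  have dT: "T differentiable (at x)" by (rule C_k_differentiable[OF smooth_T])
  have dTh: "(\<lambda>x. T x $ h) differentiable (at x)"
    by (rule C_k_differentiable[OF C_k_bounded_linear[OF bounded_linear_vec_nth smooth_T]])
  have "grad (\<lambda>x. T x $ h $ j) x $ j = (frechet_derivative T (at x) (axis j 1) *v axis j 1) $ h" for j
  proof -
    have "(frechet_derivative T (at x) (axis j 1) *v axis j 1) $ h = frechet_derivative T (at x) (axis j 1) $ h $ j"
      by (simp add: matrix_vector_mult_nth inner_axis)
    then show ?thesis
      by (simp add: grad_def frechet_derivative_nth[OF dTh] frechet_derivative_nth[OF dT])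
  qed
  then show ?thesis by (simp add: tr_nabla_def sum_component)
qed

lemma C1_mv:
  assumes "\<And>i. C_k (Suc 0) (\<lambda>x. F x $ i) UNIV"
  shows "C_k (Suc 0) (\<lambda>x. (T x *v F x) $ h) UNIV"
  unfolding matrix_vector_mult_def vec_lambda_beta
  by (intro C_k_sum C_k_mult C_k_T_nth assms)

lemma C1_grad_\<eta>: "C_k (Suc 0) (\<lambda>x. grad \<eta> x $ i) UNIV"
  by (rule grad_nth_C_k[OF C2_\<eta>])

lemma C1_Y: "C_k (Suc 0) (\<lambda>x. Y x $ h) UNIV"
  unfolding Y_def vector_minus_component tr_nabla_nth
  by (intro C_k_diff C_k_sum grad_nth_C_k C_k_T_nth C1_mv C1_grad_\<eta>)

lemma continuous_Y [continuous_intros]: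
  fixes f :: "'z::topological_space \<Rightarrow> real^'n"
  assumes "continuous_on A f"
  shows "continuous_on A (\<lambda>z. Y (f z))"
  by (rule continuous_on_compose2[OF C_k_imp_continuous[OF C_k_vec[OF C1_Y]] assms subset_UNIV])

lemma bounded_op_Zop: "bounded_op M (Zop h)"
proof (rule bounded_op_continuous[OF _ _ bounded_\<Omega> \<Omega>_sets])
  show "linear (Zop h x)" for x
    by (rule linearI) (auto simp: Zop_def vec_eq_iff matrix_vector_right_distrib
        matrix_vector_mult_scaleR algebra_simps)
  show "continuous_on UNIV (\<lambda>(x, p). Zop h x p)"
    unfolding Zop_def split_beta by (intro continuous_intros continuous_on_vec_lambda)
qed

lemma Z_L2: "J \<in> L2 M \<Longrightarrow> Z h J \<in> L2 M"
  unfolding Z_def[abs_def] by (rule bounded_op_L2[OF bounded_op_Zop])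

section \<open>Integration by parts\<close>

text \<open>The integrand is the divergence of C times the scalar product of the two fields. It is
  the sum over a and j of \<open>ibp_form j\<close> for the a-th components, one of them multiplied
  by C_j, and multiplication by a C^1 function preserves \<open>W0\<close>.\<close>

lemma integration_by_parts:
  fixes C :: "real^'n \<Rightarrow> real^'n"
  assumes C: "\<And>j. C_k (Suc 0) (\<lambda>x. C x $ j) UNIV" and J: "J \<in> WV" and K: "K \<in> WV"
  shows "integrable M (\<lambda>x. (\<Sum>a\<in>UNIV. fst (J x) $ a * (C x \<bullet> snd (K x) $ a) + fst (K x) $ a * (C x \<bullet> snd (J x) $ a))
        + (\<Sum>j\<in>UNIV. grad (\<lambda>x. C x $ j) x $ j) * (fst (J x) \<bullet> fst (K x)))" (is "integrable M ?f")
    and "(LINT x|M. (\<Sum>a\<in>UNIV. fst (J x) $ a * (C x \<bullet> snd (K x) $ a) + fst (K x) $ a * (C x \<bullet> snd (J x) $ a))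
        + (\<Sum>j\<in>UNIV. grad (\<lambda>x. C x $ j) x $ j) * (fst (J x) \<bullet> fst (K x))) = 0"
proof -
  define g where "g a j x = ibp_form j x (mult_jet (\<lambda>x. C x $ j) x (comp_jet a (J x))) (comp_jet a (K x))" for a j x
  have m: "(\<lambda>x. mult_jet (\<lambda>x. C x $ j) x (comp_jet a (J x))) \<in> W0 \<Omega>" for a j
    by (rule mult_jet_W0[OF C WV_comp[OF J]])
  have int: "integrable M (g a j)" for a j
    unfolding g_def by (rule bform_integrable[OF bounded_ibp_form W0_L2[OF m] W0_L2[OF WV_comp[OF K]]])
  have zero: "(LINT x|M. g a j x) = 0" for a j
    using ibp_form_zero[OF m WV_comp[OF K], of j j a a] by (simp add: bform_def g_def)
  have eq: "?f = (\<lambda>x. \<Sum>a\<in>UNIV. \<Sum>j\<in>UNIV. g a j x)"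
  proof
    fix x
    have "(\<Sum>j\<in>UNIV. g a j x) = fst (J x) $ a * (C x \<bullet> snd (K x) $ a) + fst (K x) $ a * (C x \<bullet> snd (J x) $ a)
        + (\<Sum>j\<in>UNIV. grad (\<lambda>x. C x $ j) x $ j) * (fst (J x) $ a * fst (K x) $ a)" for a
    proof -
      have "(\<Sum>j\<in>UNIV. g a j x) = (\<Sum>j\<in>UNIV. fst (J x) $ a * (C x $ j * snd (K x) $ a $ j)
          + fst (K x) $ a * (C x $ j * snd (J x) $ a $ j) + grad (\<lambda>x. C x $ j) x $ j * (fst (J x) $ a * fst (K x) $ a))"
        by (intro sum.cong) (simp_all add: g_def ibp_form_def mult_jet_def comp_jet_def algebra_simps)
      then show ?thesis
        by (simp add: sum.distrib sum_distrib_left sum_distrib_right inner_vec_def)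
    qed
    then show "?f x = (\<Sum>a\<in>UNIV. \<Sum>j\<in>UNIV. g a j x)"
      by (simp add: sum.distrib sum_distrib_left inner_vec_def[of "fst (J x)"])
  qed
  show "integrable M ?f"
    unfolding eq by (intro Bochner_Integration.integrable_sum int)
  show "(LINT x|M. ?f x) = 0"
    unfolding eq using int zero by (simp add: Bochner_Integration.integral_sum)
qed

lemma div_row: "(\<Sum>j\<in>UNIV. grad (\<lambda>x. (\<omega> x *\<^sub>R T x $ h) $ j) x $ j) = \<omega> x * Y x $ h"
proof -
  have "grad (\<lambda>x. (\<omega> x *\<^sub>R T x $ h) $ j) x $ j
      = \<omega> x * (grad (\<lambda>x. T x $ h $ j) x $ j - T x $ h $ j * grad \<eta> x $ j)" for j
    by (simp add: grad_mult[OF C_k_differentiable[OF C1_\<omega>] C_k_differentiable[OF C_k_T_nth]]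
        grad_\<omega> algebra_simps)
  then show ?thesis
    by (simp add: Y_def tr_nabla_nth matrix_vector_mult_nth inner_vec_def sum_subtractf right_diff_distrib
        sum_distrib_left)
qed

text \<open>Integration by parts along \<omega> times row h of T, whose divergence is \<omega> Y_h
  by \<open>div_row\<close>. The zeroth-order term Y_h / 2 of Z_h occurs once for each argument and
  together these two absorb that divergence.\<close>

lemma Z_skew:
  assumes J: "J \<in> WV" and K: "K \<in> WV"
  shows "b (Z h J) K = - b J (Z h K)"
proof -
  let ?C = "\<lambda>x. \<omega> x *\<^sub>R T x $ h"
  have C: "C_k (Suc 0) (\<lambda>x. ?C x $ j) UNIV" for j
    unfolding vector_scaleR_component real_scaleR_def by (intro C_k_mult C1_\<omega> C_k_T_nth)
  note JL = WV_L2'[OF J] and KL = WV_L2'[OF K]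
  have "bq x (Z h J x) (K x) + bq x (J x) (Z h K x)
      = (\<Sum>a\<in>UNIV. fst (J x) $ a * (?C x \<bullet> snd (K x) $ a) + fst (K x) $ a * (?C x \<bullet> snd (J x) $ a))
        + (\<Sum>j\<in>UNIV. grad (\<lambda>x. ?C x $ j) x $ j) * (fst (J x) \<bullet> fst (K x))" for x
    unfolding div_row
    by (simp add: bq_def Z_def Zop_def inner_vec_def[of "fst _"] inner_vec_def[of "vec_lambda _"]
        matrix_vector_mult_nth sum.distrib sum_distrib_left algebra_simps)
  then have "(LINT x|M. bq x (Z h J x) (K x) + bq x (J x) (Z h K x)) = 0"
    using integration_by_parts(2)[OF C J K] by simp
  moreover have "(LINT x|M. bq x (Z h J x) (K x) + bq x (J x) (Z h K x)) = b (Z h J) K + b J (Z h K)"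
    unfolding bform_def
    by (rule Bochner_Integration.integral_add[OF bform_integrable[OF bounded_bq Z_L2[OF JL] KL]
          bform_integrable[OF bounded_bq JL Z_L2[OF KL]]])
  ultimately show ?thesis by simp
qed

section \<open>The terms of the commutator inequality\<close>

definition Tu :: "'n \<Rightarrow> (real^'n \<Rightarrow> 'n vjet) \<Rightarrow> real" where
  "Tu h J = (LINT x|M. \<omega> x * (T x $ h $ h * (fst (J x) \<bullet> fst (J x))))"

lemma Tu_integrable:
  fixes J :: "real^'n \<Rightarrow> 'n vjet"
  assumes "J \<in> L2 M"
  shows "integrable M (\<lambda>x. \<omega> x * (T x $ h $ h * (fst (J x) \<bullet> fst (J x))))"
proof -
  have "bounded_form M (\<lambda>x (p :: 'n vjet) (r :: 'n vjet). \<omega> x * (T x $ h $ h * (fst p \<bullet> fst r)))"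
  proof (rule bounded_form_continuous[OF _ _ bounded_\<Omega> \<Omega>_sets])
    show "bilinear (\<lambda>(p :: 'n vjet) (r :: 'n vjet). \<omega> x * (T x $ h $ h * (fst p \<bullet> fst r)))" for x
      unfolding bilinear_def by (intro conjI allI linearI; simp add: inner_add_left inner_add_right algebra_simps)
    show "continuous_on UNIV (\<lambda>(x, p :: 'n vjet, r :: 'n vjet). \<omega> x * (T x $ h $ h * (fst p \<bullet> fst r)))"
      unfolding split_beta by (intro continuous_intros)
  qed
  from bform_integrable[OF this assms assms] show ?thesis .
qed

lemma T_diag: "T x $ h $ h = (T x *v axis h 1) \<bullet> axis h 1"
  by (simp add: inner_axis matrix_vector_mult_nth)

lemma Tu_bounds:
  assumes J: "J \<in> L2 M"
  shows "\<epsilon> * b J J \<le> Tu h J" "Tu h J \<le> \<delta> * b J J"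
proof -
  note ib = bform_integrable[OF bounded_bq J J]
  have ax: "axis h 1 \<bullet> (axis h 1 :: real^'n) = 1" by (simp add: inner_axis)
  have pt: "\<epsilon> * bq x p p \<le> \<omega> x * (T x $ h $ h * (fst p \<bullet> fst p))"
    "\<omega> x * (T x $ h $ h * (fst p \<bullet> fst p)) \<le> \<delta> * bq x p p" if x: "x \<in> \<Omega>" for x p
  proof -
    have "\<epsilon> \<le> T x $ h $ h" "T x $ h $ h \<le> \<delta>"
      using T_lower[OF x, of "axis h 1"] T_upper[OF x, of "axis h 1"] ax by (simp_all add: T_diag)
    then have "\<omega> x * (\<epsilon> * (fst p \<bullet> fst p)) \<le> \<omega> x * (T x $ h $ h * (fst p \<bullet> fst p))"
      "\<omega> x * (T x $ h $ h * (fst p \<bullet> fst p)) \<le> \<omega> x * (\<delta> * (fst p \<bullet> fst p))"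
      by (auto intro!: mult_left_mono mult_right_mono simp: \<omega>_pos less_imp_le)
    then show "\<epsilon> * bq x p p \<le> \<omega> x * (T x $ h $ h * (fst p \<bullet> fst p))"
      "\<omega> x * (T x $ h $ h * (fst p \<bullet> fst p)) \<le> \<delta> * bq x p p"
      by (simp_all add: bq_def mult.left_commute)
  qed
  have "(LINT x|M. \<epsilon> * bq x (J x) (J x)) \<le> Tu h J"
    unfolding Tu_def by (rule integral_mono) (use ib Tu_integrable[OF J] pt in auto)
  then show "\<epsilon> * b J J \<le> Tu h J" by (simp add: bform_def)
  have "Tu h J \<le> (LINT x|M. \<delta> * bq x (J x) (J x))"
    unfolding Tu_def by (rule integral_mono) (use ib Tu_integrable[OF J] pt in auto)
  then show "Tu h J \<le> \<delta> * b J J" by (simp add: bform_def)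
qed

lemma fst_Z_X: "fst (Zop h x (Xop h x p)) = x $ h *\<^sub>R fst (Zop h x p) + T x $ h $ h *\<^sub>R fst p"
  by (simp add: Zop_def Xop_def vec_eq_iff matrix_vector_right_distrib matrix_vector_mult_scaleR
      matrix_vector_mult_nth inner_axis algebra_simps)

text \<open>Skewness moves Z_h onto X_h u, the commutator with x_h splits off T_hh u, and symmetry
  of X_h returns the original product with the opposite sign.\<close>

lemma commutator_Z_X:
  assumes J: "J \<in> WV"
  shows "- 2 * b (Z h J) (X h J) = Tu h J"
proof -
  note JL = WV_L2'[OF J] and XL = WV_L2'[OF X_WV[OF J]]
  have "b J (Z h (X h J)) = (LINT x|M. bq x (Z h J x) (X h J x) + \<omega> x * (T x $ h $ h * (fst (J x) \<bullet> fst (J x))))"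
    unfolding bform_def
  proof (rule Bochner_Integration.integral_cong[OF refl])
    fix x
    have "fst (Xop h x p) = x $ h *\<^sub>R fst p" for p by (simp add: Xop_def)
    then show "bq x (J x) (Z h (X h J) x) = bq x (Z h J x) (X h J x) + \<omega> x * (T x $ h $ h * (fst (J x) \<bullet> fst (J x)))"
      unfolding bq_def Z_def X_def fst_Z_X
      by (simp add: inner_add_right inner_commute[of "fst (Zop h x (J x))"] algebra_simps)
  qed
  also have "\<dots> = b (Z h J) (X h J) + Tu h J"
    unfolding bform_def Tu_def
    by (rule Bochner_Integration.integral_add[OF bform_integrable[OF bounded_bq Z_L2[OF JL] XL] Tu_integrable[OF JL]])
  finally show ?thesis using Z_skew[OF J X_WV[OF J], of h] by simp
qed

definition u2 :: "'n \<Rightarrow> (real^'n \<Rightarrow> 'n vjet) \<Rightarrow> real" where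
  "u2 h J = (LINT x|M. \<omega> x * (fst (J x) $ h)\<^sup>2)"

lemma u2_integrable:
  fixes J :: "real^'n \<Rightarrow> 'n vjet"
  assumes "J \<in> L2 M"
  shows "integrable M (\<lambda>x. \<omega> x * (fst (J x) $ h)\<^sup>2)"
proof -
  have "bounded_form M (\<lambda>x (p :: 'n vjet) (r :: 'n vjet). \<omega> x * (fst p $ h * fst r $ h))"
  proof (rule bounded_form_continuous[OF _ _ bounded_\<Omega> \<Omega>_sets])
    show "bilinear (\<lambda>(p :: 'n vjet) (r :: 'n vjet). \<omega> x * (fst p $ h * fst r $ h))" for x
      unfolding bilinear_def by (intro conjI allI linearI; simp add: algebra_simps)
    show "continuous_on UNIV (\<lambda>(x, p :: 'n vjet, r :: 'n vjet). \<omega> x * (fst p $ h * fst r $ h))"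
      unfolding split_beta by (intro continuous_intros)
  qed
  from bform_integrable[OF this assms assms] show ?thesis by (simp add: power2_eq_square)
qed

lemma sum_u2:
  assumes J: "J \<in> L2 M"
  shows "(\<Sum>h\<in>UNIV. u2 h J) = b J J"
proof -
  have "(\<Sum>h\<in>UNIV. u2 h J) = (LINT x|M. (\<Sum>h\<in>UNIV. \<omega> x * (fst (J x) $ h)\<^sup>2))"
    unfolding u2_def by (rule Bochner_Integration.integral_sum[symmetric]) (rule u2_integrable[OF J])
  also have "\<dots> = b J J"
    by (simp add: bform_def bq_def inner_vec_def[of "fst _"] sum_distrib_left power2_eq_square)
  finally show ?thesis .
qed

text \<open>Multiplication by x_h sends p to x_h p + E, where E has zero value and the tensor
  product of the field with e_h as gradient; done twice it gives x_h^2 p + 2 x_h E. By symmetry of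
  the form everything cancels except the energy of E.\<close>

lemma qq_X_pointwise:
  "qq x (Xop h x p) (Xop h x p) - qq x p (Xop h x (Xop h x p))
    = \<omega> x * (T x $ h $ h * (fst p \<bullet> fst p)) + \<alpha> * (\<omega> x * (fst p $ h)\<^sup>2)"
proof -
  define E :: "'n vjet" where "E = (0, \<chi> a. fst p $ a *\<^sub>R axis h 1)"
  have bil: "bilinear (qq x)" using bounded_qq by (simp add: bounded_form_def)
  have X1: "Xop h x p = x $ h *\<^sub>R p + E" by (simp add: Xop_def E_def prod_eq_iff)
  have X2: "Xop h x (Xop h x p) = x $ h *\<^sub>R (x $ h *\<^sub>R p + E) + x $ h *\<^sub>R E"
    by (simp add: Xop_def E_def prod_eq_iff vec_eq_iff)
  have "qq x (Xop h x p) (Xop h x p) - qq x p (Xop h x (Xop h x p)) = qq x E E"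
    unfolding X2 unfolding X1
    using qq_sym[of x E p]
    by (simp add: bilinear_ladd[OF bil] bilinear_radd[OF bil] bilinear_lmul[OF bil] bilinear_rmul[OF bil]
        scaleR_add_right algebra_simps)
  also have "\<dots> = \<omega> x * (T x $ h $ h * (fst p \<bullet> fst p)) + \<alpha> * (\<omega> x * (fst p $ h)\<^sup>2)"
  proof -
    have "divf x E = fst p $ h"
    proof -
      have "(\<Sum>a\<in>UNIV. snd E $ a $ a) = (\<Sum>a\<in>UNIV. if a = h then fst p $ h else 0)"
        by (intro sum.cong) (auto simp: E_def axis_def)
      then show ?thesis by (simp add: divf_def E_def)
    qed
    moreover have "(\<Sum>a\<in>UNIV. (T x *v (snd E $ a)) \<bullet> (snd E $ a)) = T x $ h $ h * (fst p \<bullet> fst p)"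
      by (simp add: E_def matrix_vector_mult_scaleR T_diag inner_vec_def[of "fst p"] sum_distrib_left mult_ac)
    ultimately show ?thesis
      by (simp add: qq_def power2_eq_square algebra_simps)
  qed
  finally show ?thesis .
qed

lemma q_X_commutator:
  assumes J: "J \<in> WV"
  shows "q (X h J) (X h J) - q J (X h (X h J)) = Tu h J + \<alpha> * u2 h J"
proof -
  note JL = WV_L2'[OF J] and XL = WV_L2'[OF X_WV[OF J]] and XXL = WV_L2'[OF X_WV[OF X_WV[OF J]]]
  have "q (X h J) (X h J) - q J (X h (X h J)) = (LINT x|M. qq x (X h J x) (X h J x) - qq x (J x) (X h (X h J) x))"
    unfolding bform_def
    by (rule Bochner_Integration.integral_diff[symmetric, OF bform_integrable[OF bounded_qq XL XL]
          bform_integrable[OF bounded_qq JL XXL]])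
  also have "\<dots> = Tu h J + \<alpha> * u2 h J"
    unfolding X_def qq_X_pointwise Tu_def u2_def
    using Tu_integrable[OF JL] u2_integrable[OF JL] by simp
  finally show ?thesis .
qed

section \<open>The estimate of the sum over h of |Z_h u|^2\<close>

text \<open>Young's inequality for the scalar product defined by T, applied to v and T v with
  parameter \<delta>: the term with T(T v) is at most |T v|^2 by the upper bound on T and is
  absorbed on the left.\<close>

lemma T_norm_le:
  assumes x: "x \<in> \<Omega>"
  shows "(norm (T x *v v))\<^sup>2 \<le> \<delta> * ((T x *v v) \<bullet> v)"
proof -
  interpret t: sym_form UNIV "\<lambda>v w. (T x *v v) \<bullet> w"
  proof
    show "0 \<le> (T x *v v) \<bullet> v" for v
      using T_lower[OF x, of v] \<epsilon>_pos by (meson inner_ge_zero less_imp_le mult_nonneg_nonneg order_trans)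
  qed (auto simp: matrix_vector_right_distrib matrix_vector_mult_scaleR inner_add_left T_inner_sym)
  let ?w = "T x *v v"
  have "2 * (?w \<bullet> ?w) \<le> \<delta> * (?w \<bullet> v) + (?w \<bullet> ?w)" if "\<delta> > 0"
  proof -
    have "2 * \<bar>(T x *v v) \<bullet> ?w\<bar> \<le> \<delta> * (?w \<bullet> v) + ((T x *v ?w) \<bullet> ?w) / \<delta>"
      by (rule t.abs_le_young) (use that in auto)
    moreover have "((T x *v ?w) \<bullet> ?w) / \<delta> \<le> ?w \<bullet> ?w"
      using T_upper[OF x, of ?w] that by (simp add: pos_divide_le_eq mult.commute)
    ultimately show ?thesis by linarith
  qed
  moreover have "\<delta> > 0"
    using order_trans[OF T_lower[OF x] T_upper[OF x], of "axis undefined 1"] \<epsilon>_pos by (simp add: inner_axis)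
  ultimately show ?thesis by (simp add: power2_norm_eq_inner)
qed

definition TY :: "real^'n \<Rightarrow> real^'n" where
  "TY x = T x *v Y x"

lemma C1_TY: "C_k (Suc 0) (\<lambda>x. TY x $ j) UNIV"
  unfolding TY_def by (rule C1_mv[OF C1_Y])

lemma divergence_TY:
  "divergence (\<lambda>y. T y *v (T y *v grad \<eta> y - tr_nabla T y)) x = - (\<Sum>j\<in>UNIV. grad (\<lambda>x. TY x $ j) x $ j)"
proof -
  have eq: "(T y *v (T y *v grad \<eta> y - tr_nabla T y)) $ j = (-1) * TY y $ j" for y j
    by (simp add: TY_def Y_def matrix_vector_mult_diff_distrib)
  have "divergence (\<lambda>y. T y *v (T y *v grad \<eta> y - tr_nabla T y)) x
      = (\<Sum>j\<in>UNIV. grad (\<lambda>x. (-1) * TY x $ j) x $ j)"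
    by (subst divergence_eq_grad) (simp_all only: eq, intro C_k_mult C_k_const C1_TY)
  also have "\<dots> = (\<Sum>j\<in>UNIV. - grad (\<lambda>x. TY x $ j) x $ j)"
    using grad_cmult[OF C_k_differentiable[OF C1_TY], of "-1"] by simp
  finally show ?thesis by (simp add: sum_negf)
qed

text \<open>A real supremum dominates the members only of a set that is bounded above. Here the
  function is continuous on the whole space, as \<eta> is C^2 and T is smooth, and therefore bounded
  on the bounded set \<Omega>.\<close>

lemma C0_bound:
  assumes "x \<in> \<Omega>"
  shows "1/2 * divergence (\<lambda>y. T y *v (T y *v grad \<eta> y - tr_nabla T y)) x - 1/4 * (norm (T x *v grad \<eta> x))\<^sup>2
    \<le> C0_const \<Omega> T \<eta>"
  unfolding C0_const_def
proof (rule cSUP_upper[OF assms])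
  let ?P = "\<lambda>x. 1/2 * divergence (\<lambda>y. T y *v (T y *v grad \<eta> y - tr_nabla T y)) x - 1/4 * (norm (T x *v grad \<eta> x))\<^sup>2"
  have "continuous_on UNIV ?P"
    unfolding divergence_TY
    by (intro continuous_intros continuous_on_component continuous_grad[OF C1_TY])
  then obtain C where "\<And>x. x \<in> \<Omega> \<Longrightarrow> norm (?P x) \<le> C"
    by (rule continuous_bounded_on_\<Omega>) blast
  then show "bdd_above (?P ` \<Omega>)"
    by (intro bdd_aboveI2[where M=C]) (force simp: abs_le_iff)
qed

lemma T0_bound:
  assumes "x \<in> \<Omega>"
  shows "(norm (tr_nabla T x))\<^sup>2 \<le> (T0_const \<Omega> T)\<^sup>2"
proof (rule power_mono)
  have "continuous_on UNIV (tr_nabla T)"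
    by (rule C_k_imp_continuous[OF C_k_vec[of 0]]) (simp only: tr_nabla_nth, intro C_k_sum grad_nth_C_k C_k_T_nth)
  then obtain C where "\<And>x. x \<in> \<Omega> \<Longrightarrow> norm (tr_nabla T x) \<le> C"
    by (rule continuous_bounded_on_\<Omega>) blast
  then show "norm (tr_nabla T x) \<le> T0_const \<Omega> T"
    unfolding T0_const_def by (intro cSUP_upper[OF assms] bdd_aboveI2)
qed simp

text \<open>Expanding the squares of Z_h u gives a cross term, the product of T Y with half the
  gradient of |u|^2. Subtracting half the divergence of \<omega> |u|^2 T Y removes it at the price
  of a zeroth-order term, and the constants C_0 and T_0 bound what remains.\<close>

lemma Z_pointwise:
  assumes x: "x \<in> \<Omega>"
  shows "(\<Sum>h\<in>UNIV. bq x (Zop h x p) (Zop h x p))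
      - 1/2 * ((\<Sum>a\<in>UNIV. fst p $ a * ((\<omega> x *\<^sub>R TY x) \<bullet> snd p $ a) + fst p $ a * ((\<omega> x *\<^sub>R TY x) \<bullet> snd p $ a))
        + (\<Sum>j\<in>UNIV. grad (\<lambda>x. (\<omega> x *\<^sub>R TY x) $ j) x $ j) * (fst p \<bullet> fst p))
    \<le> \<delta> * (qq x p p - \<alpha> * (\<omega> x * (divf x p)\<^sup>2)) + (C0_const \<Omega> T \<eta> + (T0_const \<Omega> T)\<^sup>2 / 4) * bq x p p"
proof -
  define t where "t = tr_nabla T x"
  define e where "e = T x *v grad \<eta> x"
  define g where "g a = T x *v (snd p $ a)" for a
  define dTY where "dTY = (\<Sum>j\<in>UNIV. grad (\<lambda>x. TY x $ j) x $ j)"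
  have Yx: "Y x = t - e" by (simp add: Y_def t_def e_def)
  have TYg: "TY x \<bullet> snd p $ a = Y x \<bullet> g a" for a
    by (simp add: TY_def g_def T_inner_commute)
  have "grad (\<lambda>x. (\<omega> x *\<^sub>R TY x) $ j) x $ j = \<omega> x * (grad (\<lambda>x. TY x $ j) x $ j - TY x $ j * grad \<eta> x $ j)" for j
    by (simp add: grad_mult[OF C_k_differentiable[OF C1_\<omega>] C_k_differentiable[OF C1_TY]]
        grad_\<omega> algebra_simps)
  then have dC: "(\<Sum>j\<in>UNIV. grad (\<lambda>x. (\<omega> x *\<^sub>R TY x) $ j) x $ j) = \<omega> x * (dTY - Y x \<bullet> e)"
  proof -
    assume *: "\<And>j. grad (\<lambda>x. (\<omega> x *\<^sub>R TY x) $ j) x $ j = \<omega> x * (grad (\<lambda>x. TY x $ j) x $ j - TY x $ j * grad \<eta> x $ j)"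
    have "TY x \<bullet> grad \<eta> x = Y x \<bullet> e" by (simp add: TY_def e_def T_inner_commute)
    then show ?thesis
      unfolding * dTY_def by (simp add: sum_subtractf inner_vec_def[of "TY x"] flip: sum_distrib_left)
  qed
  have zz: "(\<Sum>h\<in>UNIV. bq x (Zop h x p) (Zop h x p))
      = \<omega> x * ((\<Sum>a\<in>UNIV. g a \<bullet> g a) + (\<Sum>a\<in>UNIV. fst p $ a * (Y x \<bullet> g a)) + 1/4 * (Y x \<bullet> Y x) * (fst p \<bullet> fst p))"
  proof -
    have "(\<Sum>h\<in>UNIV. bq x (Zop h x p) (Zop h x p))
        = \<omega> x * (\<Sum>h\<in>UNIV. \<Sum>a\<in>UNIV. (g a $ h + 1/2 * Y x $ h * fst p $ a)\<^sup>2)"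
      by (simp add: bq_def Zop_def g_def inner_vec_def[of "vec_lambda _"] power2_eq_square sum_distrib_left)
    also have "(\<Sum>h\<in>UNIV. \<Sum>a\<in>UNIV. (g a $ h + 1/2 * Y x $ h * fst p $ a)\<^sup>2)
        = (\<Sum>a\<in>UNIV. \<Sum>h\<in>UNIV. (g a $ h + 1/2 * Y x $ h * fst p $ a)\<^sup>2)"
      by (rule sum.swap)
    also have "\<dots> = (\<Sum>a\<in>UNIV. g a \<bullet> g a + fst p $ a * (Y x \<bullet> g a) + 1/4 * (Y x \<bullet> Y x) * (fst p $ a)\<^sup>2)"
    proof (rule sum.cong[OF refl])
      fix a
      have "(\<Sum>h\<in>UNIV. (g a $ h + 1/2 * Y x $ h * fst p $ a)\<^sup>2)
          = (\<Sum>h\<in>UNIV. g a $ h * g a $ h + fst p $ a * (Y x $ h * g a $ h) + 1/4 * (fst p $ a)\<^sup>2 * (Y x $ h * Y x $ h))"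
        by (intro sum.cong) (simp_all add: power2_eq_square algebra_simps)
      then show "(\<Sum>h\<in>UNIV. (g a $ h + 1/2 * Y x $ h * fst p $ a)\<^sup>2)
          = g a \<bullet> g a + fst p $ a * (Y x \<bullet> g a) + 1/4 * (Y x \<bullet> Y x) * (fst p $ a)\<^sup>2"
        by (simp add: sum.distrib inner_vec_def sum_distrib_left mult_ac)
    qed
    also have "\<dots> = (\<Sum>a\<in>UNIV. g a \<bullet> g a) + (\<Sum>a\<in>UNIV. fst p $ a * (Y x \<bullet> g a)) + 1/4 * (Y x \<bullet> Y x) * (fst p \<bullet> fst p)"
      by (simp add: sum.distrib inner_vec_def[of "fst p"] sum_distrib_left power2_eq_square)
    finally show ?thesis .
  qed
  have lhs: "(\<Sum>h\<in>UNIV. bq x (Zop h x p) (Zop h x p))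
      - 1/2 * ((\<Sum>a\<in>UNIV. fst p $ a * ((\<omega> x *\<^sub>R TY x) \<bullet> snd p $ a) + fst p $ a * ((\<omega> x *\<^sub>R TY x) \<bullet> snd p $ a))
        + (\<Sum>j\<in>UNIV. grad (\<lambda>x. (\<omega> x *\<^sub>R TY x) $ j) x $ j) * (fst p \<bullet> fst p))
      = \<omega> x * ((\<Sum>a\<in>UNIV. g a \<bullet> g a) + (1/4 * (Y x \<bullet> Y x) - 1/2 * (dTY - Y x \<bullet> e)) * (fst p \<bullet> fst p))"
    unfolding zz dC by (simp add: TYg sum.distrib sum_distrib_left algebra_simps)
  have coef: "1/4 * (Y x \<bullet> Y x) - 1/2 * (dTY - Y x \<bullet> e) \<le> C0_const \<Omega> T \<eta> + (T0_const \<Omega> T)\<^sup>2 / 4"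
  proof -
    \<comment> \<open>With Y = t - e the mixed products of t and e cancel. The part without t is the
      function whose supremum is C_0, and |t|^2 / 4 is bounded through T_0.\<close>
    have "1/4 * (Y x \<bullet> Y x) - 1/2 * (dTY - Y x \<bullet> e) = (1/2 * (- dTY) - 1/4 * (e \<bullet> e)) + (t \<bullet> t) / 4"
      unfolding Yx by (simp add: inner_diff_left inner_diff_right inner_commute algebra_simps)
    moreover have "1/2 * (- dTY) - 1/4 * (e \<bullet> e) \<le> C0_const \<Omega> T \<eta>"
      using C0_bound[OF x] by (simp add: divergence_TY dTY_def e_def power2_norm_eq_inner)
    moreover have "t \<bullet> t \<le> (T0_const \<Omega> T)\<^sup>2"
      using T0_bound[OF x] by (simp add: t_def power2_norm_eq_inner)
    ultimately show ?thesis by linarith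
  qed
  have "(\<Sum>a\<in>UNIV. g a \<bullet> g a) \<le> (\<Sum>a\<in>UNIV. \<delta> * (g a \<bullet> snd p $ a))"
    using T_norm_le[OF x] by (intro sum_mono) (simp add: g_def power2_norm_eq_inner)
  then have "(\<Sum>a\<in>UNIV. g a \<bullet> g a) \<le> \<delta> * (\<Sum>a\<in>UNIV. g a \<bullet> snd p $ a)"
    by (simp add: sum_distrib_left)
  then have "\<omega> x * ((\<Sum>a\<in>UNIV. g a \<bullet> g a) + (1/4 * (Y x \<bullet> Y x) - 1/2 * (dTY - Y x \<bullet> e)) * (fst p \<bullet> fst p))
      \<le> \<omega> x * (\<delta> * (\<Sum>a\<in>UNIV. g a \<bullet> snd p $ a) + (C0_const \<Omega> T \<eta> + (T0_const \<Omega> T)\<^sup>2 / 4) * (fst p \<bullet> fst p))"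
    using coef by (intro mult_left_mono add_mono mult_right_mono) (auto simp: \<omega>_pos less_imp_le)
  also have "\<dots> = \<delta> * (qq x p p - \<alpha> * (\<omega> x * (divf x p)\<^sup>2)) + (C0_const \<Omega> T \<eta> + (T0_const \<Omega> T)\<^sup>2 / 4) * bq x p p"
    by (simp add: qq_def bq_def g_def power2_eq_square algebra_simps)
  finally show ?thesis unfolding lhs .
qed

definition d2 :: "(real^'n \<Rightarrow> 'n vjet) \<Rightarrow> real" where
  "d2 J = (LINT x|M. \<omega> x * (divf x (J x))\<^sup>2)"

lemma d2_integrable:
  assumes "J \<in> L2 M"
  shows "integrable M (\<lambda>x. \<omega> x * (divf x (J x))\<^sup>2)"
proof -
  have "bounded_form M (\<lambda>x p r. \<omega> x * (divf x p * divf x r))"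
  proof (rule bounded_form_continuous[OF _ _ bounded_\<Omega> \<Omega>_sets])
    show "bilinear (\<lambda>p r. \<omega> x * (divf x p * divf x r))" for x
      unfolding bilinear_def by (intro conjI allI linearI; simp add: divf_add divf_scale algebra_simps)
    show "continuous_on UNIV (\<lambda>(x, p, r). \<omega> x * (divf x p * divf x r))"
      unfolding split_beta by (intro continuous_intros)
  qed
  from bform_integrable[OF this assms assms] show ?thesis by (simp add: power2_eq_square)
qed

lemma sum_Z_le:
  assumes J: "J \<in> WV"
  shows "(\<Sum>h\<in>UNIV. b (Z h J) (Z h J))
    \<le> \<delta> * (q J J - \<alpha> * d2 J) + (C0_const \<Omega> T \<eta> + (T0_const \<Omega> T)\<^sup>2 / 4) * b J J"
proof -
  let ?c = "C0_const \<Omega> T \<eta> + (T0_const \<Omega> T)\<^sup>2 / 4"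
  let ?C = "\<lambda>x. \<omega> x *\<^sub>R TY x"
  let ?f = "\<lambda>x. (\<Sum>a\<in>UNIV. fst (J x) $ a * (?C x \<bullet> snd (J x) $ a) + fst (J x) $ a * (?C x \<bullet> snd (J x) $ a))
        + (\<Sum>j\<in>UNIV. grad (\<lambda>x. ?C x $ j) x $ j) * (fst (J x) \<bullet> fst (J x))"
  have C: "C_k (Suc 0) (\<lambda>x. ?C x $ j) UNIV" for j
    unfolding vector_scaleR_component real_scaleR_def by (intro C_k_mult C1_\<omega> C1_TY)
  note JL = WV_L2'[OF J]
  note ip = integration_by_parts[OF C J J]
  have iz: "integrable M (\<lambda>x. bq x (Z h J x) (Z h J x))" for h
    by (rule bform_integrable[OF bounded_bq Z_L2[OF JL] Z_L2[OF JL]])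
  have isum: "integrable M (\<lambda>x. \<Sum>h\<in>UNIV. bq x (Z h J x) (Z h J x))"
    by (intro Bochner_Integration.integrable_sum iz)
  note ib = bform_integrable[OF bounded_bq JL JL] and iq = bform_integrable[OF bounded_qq JL JL]
    and id = d2_integrable[OF JL]
  have "(\<Sum>h\<in>UNIV. b (Z h J) (Z h J)) = (LINT x|M. (\<Sum>h\<in>UNIV. bq x (Z h J x) (Z h J x)))"
    unfolding bform_def by (rule Bochner_Integration.integral_sum[symmetric]) (rule iz)
  \<comment> \<open>The subtracted function has integral zero by integration by parts; its presence
    makes a pointwise estimate possible.\<close>
  also have "\<dots> = (LINT x|M. (\<Sum>h\<in>UNIV. bq x (Z h J x) (Z h J x)) - 1/2 * ?f x)"
    using Bochner_Integration.integral_diff[OF isum integrable_mult_right[OF ip(1), of "1/2"]] ip(2) by simp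
  also have "\<dots> \<le> (LINT x|M. \<delta> * (qq x (J x) (J x) - \<alpha> * (\<omega> x * (divf x (J x))\<^sup>2)) + ?c * bq x (J x) (J x))"
  proof (rule integral_mono)
    show "integrable M (\<lambda>x. (\<Sum>h\<in>UNIV. bq x (Z h J x) (Z h J x)) - 1/2 * ?f x)"
      by (intro Bochner_Integration.integrable_diff isum integrable_mult_right ip(1))
    show "integrable M (\<lambda>x. \<delta> * (qq x (J x) (J x) - \<alpha> * (\<omega> x * (divf x (J x))\<^sup>2)) + ?c * bq x (J x) (J x))"
      by (intro Bochner_Integration.integrable_add Bochner_Integration.integrable_diff integrable_mult_right ib iq id)
    fix x assume "x \<in> space M"
    then show "(\<Sum>h\<in>UNIV. bq x (Z h J x) (Z h J x)) - 1/2 * ?f x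
        \<le> \<delta> * (qq x (J x) (J x) - \<alpha> * (\<omega> x * (divf x (J x))\<^sup>2)) + ?c * bq x (J x) (J x)"
      unfolding Z_def by (intro Z_pointwise) simp
  qed
  also have "\<dots> = \<delta> * (q J J - \<alpha> * d2 J) + ?c * b J J"
    unfolding bform_def d2_def using ib iq id by simp
  finally show ?thesis .
qed

section \<open>Summation over the coordinate directions\<close>

text \<open>The constant \<open>D\<close> is left free and tied to the fields only by the bound
  \<open>D\<close>, so that one value can later be used for several numbers of eigenvalues.\<close>

lemma Yang_inequality:
  fixes u :: "nat \<Rightarrow> real^'n \<Rightarrow> real^'n" and \<sigma> :: "nat \<Rightarrow> real"
  assumes \<sigma>: "eigenvalue_sequence \<Omega> T \<eta> \<alpha> \<sigma>"
    and u: "\<And>i. 1 \<le> i \<Longrightarrow> u i \<in> eigenspace \<Omega> T \<eta> \<alpha> (\<sigma> i)"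
    and ortho: "\<And>i j. 1 \<le> i \<Longrightarrow> 1 \<le> j \<Longrightarrow> b (jetv (u i)) (jetv (u j)) = (if i = j then 1 else 0)"
    and D: "\<And>i. i \<in> {1..k} \<Longrightarrow> (\<Sum>h\<in>UNIV. b (Z h (jetv (u i))) (Z h (jetv (u i)))) \<le> \<delta> * (\<sigma> i + D)"
    and \<delta>: "0 < \<delta>"
  shows "(\<Sum>i=1..k. (\<sigma> (k+1) - \<sigma> i)\<^sup>2)
    \<le> 4 * \<delta> * (real CARD('n) * \<delta> + \<alpha>) / ((real CARD('n))\<^sup>2 * \<epsilon>\<^sup>2)
      * (\<Sum>i=1..k. (\<sigma> (k+1) - \<sigma> i) * (\<sigma> i + D))"
proof -
  define n where "n = real CARD('n)"
  have n: "0 < n" by (simp add: n_def)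
  \<comment> \<open>Bounds the double commutators summed over h for a normalised field: n \<delta>
    from the entries T_hh, and \<alpha> once, since the (u^h)^2 add up to |u|^2.\<close>
  define N where "N = n * \<delta> + \<alpha>"
  have N: "0 < N" using n \<delta> \<alpha>_nonneg by (simp add: N_def add_pos_nonneg)
  \<comment> \<open>From n \<epsilon> S <= B N S + \<delta> W / B one gets S <= \<delta> W / (B (n
    \<epsilon> - B N)). This value of B makes the denominator largest, and B N S is then half of the
    left-hand side.\<close>
  define B where "B = n * \<epsilon> / (2 * N)"
  have B: "0 < B" using n N \<epsilon>_pos by (simp add: B_def)
  define s where "s = \<sigma> (k + 1)"
  define S where "S = (\<Sum>i=1..k. (s - \<sigma> i)\<^sup>2)"
  define W where "W = (\<Sum>i=1..k. (s - \<sigma> i) * (\<sigma> i + D))"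
  let ?J = "\<lambda>i. jetv (u i)"
  have JW: "?J i \<in> WV" if "i \<in> {1..k}" for i using u that by (intro eigenspace_WV[of _ "\<sigma> i"]) simp
  have JL: "?J i \<in> L2 M" if "i \<in> {1..k}" for i by (rule WV_L2'[OF JW[OF that]])
  have nrm: "b (?J i) (?J i) = 1" if "i \<in> {1..k}" for i using ortho[of i i] that by simp
  have s: "\<sigma> i \<le> s" if "i \<in> {1..k}" for i
    unfolding s_def using that by (intro eigenvalue_sequence_mono[OF \<sigma>]) auto
  have each: "(\<Sum>i=1..k. (s - \<sigma> i)\<^sup>2 * Tu h (?J i))
      \<le> B * (\<Sum>i=1..k. (s - \<sigma> i)\<^sup>2 * (Tu h (?J i) + \<alpha> * u2 h (?J i)))
        + 1 / B * (\<Sum>i=1..k. (s - \<sigma> i) * b (Z h (?J i)) (Z h (?J i)))" for h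
  proof -
    have "(\<Sum>i\<in>{1..k}. (s - \<sigma> i)\<^sup>2 * (- 2 * b (Z h (?J i)) (X h (?J i))))
      \<le> B * (\<Sum>i\<in>{1..k}. (s - \<sigma> i)\<^sup>2 * (q (X h (?J i)) (X h (?J i)) - q (?J i) (X h (X h (?J i)))))
        + 1 / B * (\<Sum>i\<in>{1..k}. (s - \<sigma> i) * b (Z h (?J i)) (Z h (?J i)))"
    proof (rule commutator_Yang_inequality[OF sym_form_b sym_form_q WV_L2])
      show "q (?J i) v = \<sigma> i * b (?J i) v" if "i \<in> {1..k}" "v \<in> WV" for i v
        using that by (intro eigenspace_form u) auto
      show "s * b w w \<le> q w w" if "w \<in> WV" "\<And>i. i \<in> {1..k} \<Longrightarrow> b (?J i) w = 0" for w
        unfolding s_def by (rule Rayleigh_WV[OF \<sigma> u ortho that])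
      show "b (Z h (?J i)) (?J j) = - b (?J i) (Z h (?J j))" if "i \<in> {1..k}" "j \<in> {1..k}" for i j
        by (rule Z_skew[OF JW[OF that(1)] JW[OF that(2)]])
      show "b (?J i) (?J j) = (if i = j then 1 else 0)" if "i \<in> {1..k}" "j \<in> {1..k}" for i j
        using that by (intro ortho) auto
    qed (simp_all add: B JW s X_WV linear_X b_X_sym Z_L2 JL)
    moreover have "(\<Sum>i=1..k. (s - \<sigma> i)\<^sup>2 * (- 2 * b (Z h (?J i)) (X h (?J i)))) = (\<Sum>i=1..k. (s - \<sigma> i)\<^sup>2 * Tu h (?J i))"
      by (intro sum.cong refl) (simp only: commutator_Z_X[OF JW])
    moreover have "(\<Sum>i=1..k. (s - \<sigma> i)\<^sup>2 * (q (X h (?J i)) (X h (?J i)) - q (?J i) (X h (X h (?J i)))))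
        = (\<Sum>i=1..k. (s - \<sigma> i)\<^sup>2 * (Tu h (?J i) + \<alpha> * u2 h (?J i)))"
      by (intro sum.cong refl) (simp only: q_X_commutator[OF JW])
    ultimately show ?thesis by simp
  qed
  have S_le: "(\<Sum>h\<in>UNIV. \<Sum>i=1..k. (s - \<sigma> i)\<^sup>2 * (Tu h (?J i) + \<alpha> * u2 h (?J i))) \<le> N * S"
  proof -
    have "(\<Sum>h\<in>UNIV. \<Sum>i=1..k. (s - \<sigma> i)\<^sup>2 * (Tu h (?J i) + \<alpha> * u2 h (?J i)))
        = (\<Sum>i=1..k. (s - \<sigma> i)\<^sup>2 * (\<Sum>h\<in>UNIV. Tu h (?J i) + \<alpha> * u2 h (?J i)))"
      by (subst sum.swap) (simp add: sum_distrib_left)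
    also have "\<dots> \<le> (\<Sum>i=1..k. (s - \<sigma> i)\<^sup>2 * N)"
    proof (intro sum_mono mult_left_mono)
      fix i assume i: "i \<in> {1..k}"
      have "(\<Sum>h\<in>UNIV. Tu h (?J i) + \<alpha> * u2 h (?J i)) = (\<Sum>h\<in>UNIV. Tu h (?J i)) + \<alpha> * 1"
        using sum_u2[OF JL[OF i]] nrm[OF i] by (simp add: sum.distrib flip: sum_distrib_left)
      also have "(\<Sum>h\<in>UNIV. Tu h (?J i)) \<le> (\<Sum>h\<in>(UNIV::'n set). \<delta>)"
        using Tu_bounds(2)[OF JL[OF i]] nrm[OF i] by (intro sum_mono) simp
      finally show "(\<Sum>h\<in>UNIV. Tu h (?J i) + \<alpha> * u2 h (?J i)) \<le> N" by (simp add: N_def n_def)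
    qed simp
    also have "\<dots> = N * S" by (simp add: S_def sum_distrib_left mult.commute)
    finally show ?thesis .
  qed
  have W_le: "(\<Sum>h\<in>UNIV. \<Sum>i=1..k. (s - \<sigma> i) * b (Z h (?J i)) (Z h (?J i))) \<le> \<delta> * W"
  proof -
    have "(\<Sum>h\<in>UNIV. \<Sum>i=1..k. (s - \<sigma> i) * b (Z h (?J i)) (Z h (?J i)))
        = (\<Sum>i=1..k. (s - \<sigma> i) * (\<Sum>h\<in>UNIV. b (Z h (?J i)) (Z h (?J i))))"
      by (subst sum.swap) (simp add: sum_distrib_left)
    also have "\<dots> \<le> (\<Sum>i=1..k. (s - \<sigma> i) * (\<delta> * (\<sigma> i + D)))"
      by (intro sum_mono mult_left_mono D) (use s in auto)
    also have "\<dots> = \<delta> * W" by (simp add: W_def sum_distrib_left mult.left_commute)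
    finally show ?thesis .
  qed
  have "(\<Sum>h\<in>UNIV. \<Sum>i=1..k. (s - \<sigma> i)\<^sup>2 * Tu h (?J i))
      \<le> (\<Sum>h\<in>UNIV. B * (\<Sum>i=1..k. (s - \<sigma> i)\<^sup>2 * (Tu h (?J i) + \<alpha> * u2 h (?J i)))
        + 1 / B * (\<Sum>i=1..k. (s - \<sigma> i) * b (Z h (?J i)) (Z h (?J i))))"
    by (intro sum_mono each)
  also have "\<dots> = B * (\<Sum>h\<in>UNIV. \<Sum>i=1..k. (s - \<sigma> i)\<^sup>2 * (Tu h (?J i) + \<alpha> * u2 h (?J i)))
        + 1 / B * (\<Sum>h\<in>UNIV. \<Sum>i=1..k. (s - \<sigma> i) * b (Z h (?J i)) (Z h (?J i)))"
    by (simp add: sum.distrib sum_distrib_left)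
  also have "\<dots> \<le> B * (N * S) + 1 / B * (\<delta> * W)"
    using B by (intro add_mono mult_left_mono S_le W_le) auto
  finally have upper: "(\<Sum>h\<in>UNIV. \<Sum>i=1..k. (s - \<sigma> i)\<^sup>2 * Tu h (?J i)) \<le> B * (N * S) + 1 / B * (\<delta> * W)" .
  have "n * \<epsilon> * S = (\<Sum>h\<in>(UNIV::'n set). \<Sum>i=1..k. (s - \<sigma> i)\<^sup>2 * \<epsilon>)"
    by (simp add: n_def S_def sum_distrib_left mult_ac)
  also have "\<dots> \<le> (\<Sum>h\<in>UNIV. \<Sum>i=1..k. (s - \<sigma> i)\<^sup>2 * Tu h (?J i))"
  proof (intro sum_mono mult_left_mono)
    fix h i assume "i \<in> {1..k}"
    then show "\<epsilon> \<le> Tu h (?J i)" using Tu_bounds(1)[OF JL, of i h] nrm[of i] by simp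
  qed simp
  finally have "n * \<epsilon> * S \<le> B * (N * S) + 1 / B * (\<delta> * W)" using upper by linarith
  also have "B * (N * S) = n * \<epsilon> * S / 2" using N by (simp add: B_def)
  finally have "n * \<epsilon> * S / 2 \<le> 1 / B * (\<delta> * W)" by linarith
  then have "n * \<epsilon> * S / 2 \<le> 2 * N * \<delta> * W / (n * \<epsilon>)" by (simp add: B_def)
  then have "S \<le> 2 * N * \<delta> * W / (n * \<epsilon>) * 2 / (n * \<epsilon>)"
    using n \<epsilon>_pos by (simp add: pos_le_divide_eq mult_ac)
  also have "\<dots> = 4 * \<delta> * N / (n\<^sup>2 * \<epsilon>\<^sup>2) * W"
    by (simp add: power2_eq_square mult_ac)
  finally show ?thesis by (simp add: S_def W_def s_def N_def n_def)
qed

end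

theorem corollary1p1:
  fixes \<Omega> :: "(real^'n) set"
    and \<eta> :: "real^'n \<Rightarrow> real"
    and T :: "real^'n \<Rightarrow> real^'n^'n"
    and \<epsilon> \<delta> \<alpha> :: real
    and \<sigma> :: "nat \<Rightarrow> real"
    and u :: "nat \<Rightarrow> real^'n \<Rightarrow> real^'n"
    and k :: nat
  assumes "smooth_bounded_domain \<Omega>"
    and "C_k 2 \<eta> UNIV"
    and "sym_pos_def_tensor T"
    and "0 < \<epsilon>" and "0 < \<delta>"
    and "\<forall>x\<in>\<Omega>. \<forall>v. \<epsilon> * (v \<bullet> v) \<le> (T x *v v) \<bullet> v \<and> (T x *v v) \<bullet> v \<le> \<delta> * (v \<bullet> v)"
    and "0 \<le> \<alpha>"
    and "eigenvalue_sequence \<Omega> T \<eta> \<alpha> \<sigma>"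
    and "\<forall>i\<ge>1. u i \<in> eigenspace \<Omega> T \<eta> \<alpha> (\<sigma> i)"
    and "\<forall>i\<ge>1. \<forall>j\<ge>1. (LINT x|weighted_measure \<Omega> \<eta>. u i x \<bullet> u j x) = (if i = j then 1 else 0)"
    and "1 \<le> k"
  shows "let n = real CARD('n);
             D0 = D0_const \<Omega> T \<eta> \<alpha> \<delta> u k;
             R = (2 * \<delta> * (n * \<delta> + \<alpha>) / (\<epsilon>\<^sup>2 * n\<^sup>2) * (1 / k) * (\<Sum>i=1..k. \<sigma> i + D0))\<^sup>2
                 - (1 + 4 * \<delta> * (n * \<delta> + \<alpha>) / (\<epsilon>\<^sup>2 * n\<^sup>2)) * (1 / k)
                   * (\<Sum>j=1..k. (\<sigma> j - 1 / k * (\<Sum>i=1..k. \<sigma> i))\<^sup>2)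
         in (\<Sum>i=1..k. (\<sigma> (k+1) - \<sigma> i)\<^sup>2)
              \<le> 4 * \<delta> * (n * \<delta> + \<alpha>) / (n\<^sup>2 * \<epsilon>\<^sup>2) * (\<Sum>i=1..k. (\<sigma> (k+1) - \<sigma> i) * (\<sigma> i + D0))
          \<and> 0 \<le> R
          \<and> \<sigma> (k+1) + D0
              \<le> (1 + 2 * \<delta> * (n * \<delta> + \<alpha>) / (\<epsilon>\<^sup>2 * n\<^sup>2)) * (1 / k) * (\<Sum>i=1..k. \<sigma> i + D0) + sqrt R
          \<and> \<sigma> (k+1) - \<sigma> k \<le> 2 * sqrt R"
proof -
  have \<sigma>: "eigenvalue_sequence \<Omega> T \<eta> \<alpha> \<sigma>" by fact
  have u: "u i \<in> eigenspace \<Omega> T \<eta> \<alpha> (\<sigma> i)" if "1 \<le> i" for i using assms(9) that by blast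
  interpret elliptic \<Omega> \<eta> T \<alpha> \<epsilon> \<delta>
  proof
    show "open \<Omega>" "bounded \<Omega>" using assms(1) by (auto simp: smooth_bounded_domain_def)
    show "C_k (Suc (Suc 0)) \<eta> UNIV" using assms(2) by (simp only: numeral_2_eq_2)
    show "C_k k T UNIV" for k using assms(3) by (simp add: sym_pos_def_tensor_def smooth_on_imp_C_k)
    show "transpose (T x) = T x" for x using assms(3) by (simp add: sym_pos_def_tensor_def)
  qed (use assms(4,6,7) in auto)
  have uW: "jetv (u i) \<in> WV" if "1 \<le> i" for i by (rule eigenspace_WV[OF u[OF that]])
  have uL: "jetv (u i) \<in> L2 M" if "1 \<le> i" for i by (rule WV_L2'[OF uW[OF that]])
  have ortho: "b (jetv (u i)) (jetv (u j)) = (if i = j then 1 else 0)" if "1 \<le> i" "1 \<le> j" for i j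
    using b_jetv[OF uL[OF that(1)] uL[OF that(2)]] assms(10) that by simp
  define D where "D = D0_const \<Omega> T \<eta> \<alpha> \<delta> u k"
  define n where "n = real CARD('n)"
  define A where "A = 4 * \<delta> * (n * \<delta> + \<alpha>) / (\<epsilon>\<^sup>2 * n\<^sup>2)"
  have div_norm: "(LINT x|weighted_measure \<Omega> \<eta>. (weak_div_eta \<Omega> \<eta> (u i) x)\<^sup>2) = d2 (jetv (u i))" if "1 \<le> i" for i
  proof -
    have m: "(\<lambda>x. \<omega> x * (divf x (jetv (u i) x))\<^sup>2) \<in> borel_measurable M"
      using d2_integrable[OF uL[OF that]] by simp
    have "\<omega> \<in> borel_measurable M"
      by (rule continuous_measurable_M) (intro continuous_intros)
    \<comment> \<open>Measurability of the squared divergence is recovered from that of its product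
      with the positive weight.\<close>
    then have "(\<lambda>x. \<omega> x * (divf x (jetv (u i) x))\<^sup>2 / \<omega> x) \<in> borel_measurable M"
      using m by measurable
    moreover have "\<omega> x * c / \<omega> x = c" for x c using \<omega>_pos[of x] by simp
    ultimately show ?thesis
      unfolding weak_div_eta_eq d2_def by (subst integral_weighted) simp_all
  qed
  have Zb: "(\<Sum>h\<in>UNIV. b (Z h (jetv (u i))) (Z h (jetv (u i)))) \<le> \<delta> * (\<sigma> i + D)" if i: "i \<in> {1..k}" for i
  proof -
    let ?min = "Min ((\<lambda>j. LINT x|weighted_measure \<Omega> \<eta>. (weak_div_eta \<Omega> \<eta> (u j) x)\<^sup>2) ` {1..k})"
    have i1: "1 \<le> i" using i by simp
    have "?min \<le> (LINT x|weighted_measure \<Omega> \<eta>. (weak_div_eta \<Omega> \<eta> (u i) x)\<^sup>2)"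
      using i by (intro Min_le) auto
    then have min: "?min \<le> d2 (jetv (u i))" by (simp add: div_norm[OF i1])
    have "q (jetv (u i)) (jetv (u i)) = \<sigma> i"
      using eigenspace_form[OF u[OF i1] uW[OF i1]] ortho[OF i1 i1] by simp
    then have "(\<Sum>h\<in>UNIV. b (Z h (jetv (u i))) (Z h (jetv (u i))))
        \<le> \<delta> * (\<sigma> i - \<alpha> * d2 (jetv (u i))) + (C0_const \<Omega> T \<eta> + (T0_const \<Omega> T)\<^sup>2 / 4)"
      using sum_Z_le[OF uW[OF i1]] ortho[OF i1 i1] by simp
    \<comment> \<open>The divergence norm of the single field is replaced by the minimum, so that
      one constant serves all i <= k. Factoring out \<delta> then gives D_0.\<close>
    also have "\<dots> \<le> \<delta> * (\<sigma> i - \<alpha> * ?min) + (C0_const \<Omega> T \<eta> + (T0_const \<Omega> T)\<^sup>2 / 4)"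
      using min assms(5,7) by (intro add_right_mono mult_left_mono diff_left_mono) auto
    also have "\<dots> = \<delta> * (\<sigma> i + D)"
      using assms(5) by (simp add: D_def D0_const_def field_simps)
    finally show ?thesis .
  qed
  \<comment> \<open>All m <= k are covered with the constant \<open>D\<close> belonging to k,
    because the estimate of Z_h u holds for every index up to k with that constant.\<close>
  have main: "(\<Sum>i=1..m. (\<sigma> (m+1) - \<sigma> i)\<^sup>2) \<le> A * (\<Sum>i=1..m. (\<sigma> (m+1) - \<sigma> i) * (\<sigma> i + D))" if "m \<le> k" for m
    using Yang_inequality[OF \<sigma> u ortho Zb assms(5), of m] that
    by (simp add: A_def n_def mult.commute)
  obtain k' where k': "k = Suc k'" using assms(11) by (cases k) auto
  \<comment> \<open>The inequality for k - 1 eigenvalues has \<sigma>_k as its point. The additional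
    summand i = k is zero on both sides, so this is the inequality for k at that point; for k = 1
    the shorter sums are empty.\<close>
  have last: "(\<Sum>i=1..k. (\<sigma> k - \<sigma> i)\<^sup>2) \<le> A * (\<Sum>i=1..k. (\<sigma> k - \<sigma> i) * (\<sigma> i + D))"
    using main[of k'] by (simp add: k')
  define m where "m = 1 / k * (\<Sum>i=1..k. \<sigma> i + D)"
  define R where "R = (A / 2 * m)\<^sup>2 - (1 + A) * (1 / k * (\<Sum>j=1..k. (\<sigma> j - 1 / k * (\<Sum>i=1..k. \<sigma> i))\<^sup>2))"
  have y1: "(\<sigma> (k+1) + D - (1 + A / 2) * m)\<^sup>2 \<le> R"
    unfolding R_def m_def by (rule Yang_quadratic[OF assms(11) main[OF order_refl]])
  have y2: "(\<sigma> k + D - (1 + A / 2) * m)\<^sup>2 \<le> R"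
    unfolding R_def m_def by (rule Yang_quadratic[OF assms(11) last])
  \<comment> \<open>A square lies below the radicand, so that \<open>sqrt R\<close> is a genuine
    square root.\<close>
  have R0: "0 \<le> R" using y1 zero_le_power2 order_trans by blast
  have a1: "\<bar>\<sigma> (k+1) + D - (1 + A / 2) * m\<bar> \<le> sqrt R"
    using real_le_rsqrt[of "\<bar>\<sigma> (k+1) + D - (1 + A / 2) * m\<bar>" R] y1 by simp
  have a2: "\<bar>\<sigma> k + D - (1 + A / 2) * m\<bar> \<le> sqrt R"
    using real_le_rsqrt[of "\<bar>\<sigma> k + D - (1 + A / 2) * m\<bar>" R] y2 by simp
  have half: "A / 2 = 2 * \<delta> * (n * \<delta> + \<alpha>) / (\<epsilon>\<^sup>2 * n\<^sup>2)" by (simp add: A_def)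
  have A': "4 * \<delta> * (n * \<delta> + \<alpha>) / (n\<^sup>2 * \<epsilon>\<^sup>2) = A" by (simp add: A_def mult.commute)
  have R_eq: "(2 * \<delta> * (n * \<delta> + \<alpha>) / (\<epsilon>\<^sup>2 * n\<^sup>2) * (1 / k) * (\<Sum>i=1..k. \<sigma> i + D))\<^sup>2
      - (1 + 4 * \<delta> * (n * \<delta> + \<alpha>) / (\<epsilon>\<^sup>2 * n\<^sup>2)) * (1 / k)
        * (\<Sum>j=1..k. (\<sigma> j - 1 / k * (\<Sum>i=1..k. \<sigma> i))\<^sup>2) = R"
    unfolding half[symmetric] A_def[symmetric] R_def m_def by (simp only: mult.assoc)
  show ?thesis
    unfolding Let_def D_def[symmetric] n_def[symmetric] unfolding R_eq unfolding A' half[symmetric]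
  proof (intro conjI)
    show "(\<Sum>i=1..k. (\<sigma> (k+1) - \<sigma> i)\<^sup>2) \<le> A * (\<Sum>i=1..k. (\<sigma> (k+1) - \<sigma> i) * (\<sigma> i + D))"
      by (rule main[OF order_refl])
    show "0 \<le> R" by (rule R0)
    have "\<sigma> (k+1) + D \<le> (1 + A / 2) * m + sqrt R" using a1 by linarith
    then show "\<sigma> (k+1) + D \<le> (1 + A / 2) * (1 / k) * (\<Sum>i=1..k. \<sigma> i + D) + sqrt R"
      unfolding m_def by (simp only: mult.assoc)
    \<comment> \<open>After the shift by \<open>D\<close>, both eigenvalues lie within
      \<open>sqrt R\<close> of the same centre (1 + A/2) m.\<close>
    show "\<sigma> (k+1) - \<sigma> k \<le> 2 * sqrt R" using a1 a2 by linarith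
  qed
qed

end
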